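(* Let $A$ be a dilation and $X$ a ball quasi-Banach function space with an absolutely continuous quasi-norm satisfying Assumption (FS) with $p_-\in(0,\infty)$ and Assumption (A) with $\theta_0\in(0,\min\{p_-,1\})$ and $p_0\in(\theta_0,\infty)$. Let $d\in\mathbb Z_+$ with $d\ge\lfloor(1/\theta_0-1)\ln b/\ln\lambda_-\rfloor$, let $q\in[1,\infty)$ if $p_0\in(0,1)$ or $q\in[1,p_0')$ if $p_0\in[1,\infty)$, and let $$\varepsilon\in\left(\frac{\ln b}{\ln\lambda_-}\left[\frac2s+d\frac{\ln\lambda_+}{\ln b}\right],\infty\right)$$ for some $s\in(0,\theta_0)$. Then, for $f\in L^q_{\mathrm{loc}}(\mathbb R^n)$, $f\in\mathcal L^A_{X,q,d,\theta_0}(\mathbb R^n)$ if and only if $\|f\|_{\mathcal L^{A,\varepsilon}_{X,1,d,\theta_0}(\mathbb R^n)}<\infty$, where, writing $\beta:=\varepsilon\ln\lambda_-/\ln b$, $$\|f\|_{\mathcal L^{A,\varepsilon}_{X,1,d,\theta_0}(\mathbb R^n)}:=\sup\left\|\left\{\sum_{i=1}^m\left(\frac{\lambda_i}{\|\mathbf 1_{x_i+B_{l_i}}\|_X}\right)^{\theta_0}\mathbf 1_{x_i+B_{l_i}}\right\}^{1/\theta_0}\right\|_X^{-1}\sum_{j=1}^m\frac{\lambda_j|x_j+B_{l_j}|}{\|\mathbf 1_{x_j+B_{l_j}}\|_X}\int_{\mathbb R^n}\frac{b^{\beta l_j}|f(x)-P^d_{x_j+B_{l_j}}f(x)|}{b^{l_j(1+\beta)}+[\rho(x-x_j)]^{1+\beta}}\,dx,$$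 the supremum taken over all $m\in\mathbb N$, $\{x_j\}_{j=1}^m\subset\mathbb R^n$, $\{l_j\}_{j=1}^m\subset\mathbb Z$ and $\{\lambda_j\}_{j=1}^m\subset[0,\infty)$ with $\sum_{j=1}^m\lambda_j\ne0$. Moreover $\|f\|_{\mathcal L^A_{X,q,d,\theta_0}(\mathbb R^n)}\sim\|f\|_{\mathcal L^{A,\varepsilon}_{X,1,d,\theta_0}(\mathbb R^n)}$ with positive equivalence constants independent of $f$.
   Context: A real $n\times n$ matrix $A$ is a dilation if all its eigenvalues have modulus $>1$; $b:=|\det A|$; fix $\lambda_-,\lambda_+$ with $1<\lambda_-<\min|\lambda|\le\max|\lambda|<\lambda_+$, min and max over eigenvalues $\lambda$ of $A$. Fix an open ellipsoid $\Delta$ symmetric about $0$ with $|\Delta|=1$ and $r>1$ with $\Delta\subset r\Delta\subset A\Delta$; $B_k:=A^k\Delta$ (so $|B_k|=b^k$), $\mathcal B:=\{x+B_k:x\in\mathbb R^n,k\in\mathbb Z\}$; $\rho(x):=b^k$ if $x\in B_{k+1}\setminus B_k$, $\rho(0):=0$. $\mathcal M(f)(x):=\sup_{x\in B\in\mathcal B}|B|^{-1}\int_B|f|$, $\mathcal M^{(\alpha)}(f):=[\mathcal M(|f|^\alpha)]^{1/\alpha}$. Ball quasi-Banach function space: a quasi-normed space $X$ of measurable functions with quasi-norm defined on all measurable functions such that (i) $\|f\|_X=0\Rightarrow f=0$ a.e.; (ii) $|g|\le|f|$ a.e. $\Rightarrow\|g\|_X\le\|f\|_X$; (iii) $0\le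 f_m\uparrow f$ a.e. $\Rightarrow\|f_m\|_X\uparrow\|f\|_X$; (iv) $\mathbf 1_B\in X$ for $B\in\mathcal B$. Ball Banach function space: additionally the triangle inequality and, for each $B\in\mathcal B$, $\int_B|f|\le C_B\|f\|_X$. $X^p:=\{f:|f|^p\in X\}$, $\|f\|_{X^p}:=\||f|^p\|_X^{1/p}$; for ball Banach $Y$, $Y'$ = set of $f$ with $\|f\|_{Y'}:=\sup\{\|fg\|_{L^1}:\|g\|_Y=1\}<\infty$. Absolutely continuous quasi-norm: $\|f\mathbf 1_{E_j}\|_X\downarrow0$ for all $f\in X$ and measurable $E_j\downarrow\emptyset$. Assumption (FS) with $p_-$: for all $p\in(0,p_-)$, $u\in(1,\infty)$, $\|(\sum_k[\mathcal M(f_k)]^u)^{1/u}\|_{X^{1/p}}\le C\|(\sum_k|f_k|^u)^{1/u}\|_{X^{1/p}}$. Assumption (A) with $\theta_0,p_0$: $X^{1/\theta_0}$ is a ball Banach function space and $\mathcal M^{((p_0/\theta_0)')}$ is bounded on $(X^{1/\theta_0})'$. $P^d_Bg$ is the unique polynomial $P$ of degree $\le d$ with $\int_B(g-P)h=0$ for all polynomials $h$ of degree $\le d$. For $t\in[1,\infty)$, $\mathcal L^A_{X,t,d,\theta_0}(\mathbb R^n)$ is the set of $f\in L^t_{\mathrm{loc}}$ with $$\|f\|_{\mathcal L^A_{X,t,d,\theta_0}}:=\sup\left\|\left\{\sum_{i=1}^m\left[\frac{\lambda_i}{\|\mathbf 1_{B^{(i)}}\|_X}\right]^{\theta_0}\mathbf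 1_{B^{(i)}}\right\}^{1/\theta_0}\right\|_X^{-1}\sum_{j=1}^m\frac{\lambda_j|B^{(j)}|}{\|\mathbf 1_{B^{(j)}}\|_X}\left[\frac1{|B^{(j)}|}\int_{B^{(j)}}|f-P^d_{B^{(j)}}f|^t\right]^{1/t}<\infty$$ (sup over $m\in\mathbb N$, $B^{(j)}\in\mathcal B$, $\lambda_j\ge0$, $\sum_j\lambda_j\ne0$). *)

theory Defs
  imports "HOL-Analysis.Analysis"
begin

definition eigenvalue_of :: "real^'n^'n \<Rightarrow> complex \<Rightarrow> bool" where
  "eigenvalue_of A z \<longleftrightarrow>
     det ((\<chi> i j. complex_of_real (A $ i $ j) - (if i = j then z else 0)) :: complex^'n^'n) = 0"

definition dilation :: "real^'n^'n \<Rightarrow> bool" where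
  "dilation A \<longleftrightarrow> (\<forall>z. eigenvalue_of A z \<longrightarrow> cmod z > 1)"

definition bdet :: "real^'n^'n \<Rightarrow> real" where
  "bdet A = \<bar>det A\<bar>"

definition origin_ellipsoid :: "(real^'n) set \<Rightarrow> bool" where
  "origin_ellipsoid D \<longleftrightarrow> (\<exists>P::real^'n^'n. invertible P \<and> D = {x. norm (P *v x) < 1})"

definition matipow_map :: "real^'n^'n \<Rightarrow> int \<Rightarrow> real^'n \<Rightarrow> real^'n" where
  "matipow_map A k = (if 0 \<le> k then ((\<lambda>x. A *v x) ^^ nat k)
                      else ((\<lambda>x. matrix_inv A *v x) ^^ nat (- k)))"

definition Bk :: "real^'n^'n \<Rightarrow> (real^'n) set \<Rightarrow> int \<Rightarrow> (real^'n) set" where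
  "Bk A D k = matipow_map A k ` D"

definition dballs :: "real^'n^'n \<Rightarrow> (real^'n) set \<Rightarrow> (real^'n) set set" where
  "dballs A D = {(\<lambda>y. x + y) ` Bk A D k | x k. True}"

definition rho :: "real^'n^'n \<Rightarrow> (real^'n) set \<Rightarrow> real^'n \<Rightarrow> real" where
  "rho A D x = (if x = 0 then 0
                else bdet A powr real_of_int (THE k. x \<in> Bk A D (k + 1) - Bk A D k))"

definition epow :: "ennreal \<Rightarrow> real \<Rightarrow> ennreal" where
  "epow x p = (if x = \<infinity> then \<infinity> else ennreal (enn2real x powr p))"

definition maxf :: "real^'n^'n \<Rightarrow> (real^'n) set \<Rightarrow> (real^'n \<Rightarrow> ennreal) \<Rightarrow> real^'n \<Rightarrow> ennreal" where
  "maxf A D g x = (SUP B \<in> {B \<in> dballs A D. x \<in> B}.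
      (\<integral>\<^sup>+ y. g y * indicator B y \<partial>lebesgue) / emeasure lebesgue B)"

definition maxf_pow :: "real^'n^'n \<Rightarrow> (real^'n) set \<Rightarrow> real \<Rightarrow> (real^'n \<Rightarrow> ennreal) \<Rightarrow> real^'n \<Rightarrow> ennreal" where
  "maxf_pow A D a g x = epow (maxf A D (\<lambda>y. epow (g y) a) x) (1 / a)"

text \<open>A ball quasi-Banach function space X is represented by its quasi-norm on
  nonnegative measurable functions, N g = || g ||_X in [0,\<infinity>]; for a real function f,
  ||f||_X = N (\<lambda>x. ennreal |f x|), and X = {f. N |f| < \<infinity>}.\<close>
definition ball_qBfs :: "real^'n^'n \<Rightarrow> (real^'n) set \<Rightarrow> ((real^'n \<Rightarrow> ennreal) \<Rightarrow> ennreal) \<Rightarrow> bool" where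
  "ball_qBfs A D N \<longleftrightarrow>
     (\<exists>K\<ge>1. \<forall>g h. g \<in> borel_measurable lebesgue \<longrightarrow> h \<in> borel_measurable lebesgue \<longrightarrow>
          N (\<lambda>x. g x + h x) \<le> ennreal K * (N g + N h)) \<and>
     (\<forall>c::real. \<forall>g. c \<ge> 0 \<longrightarrow> g \<in> borel_measurable lebesgue \<longrightarrow>
          N (\<lambda>x. ennreal c * g x) = ennreal c * N g) \<and>
     (\<forall>g. g \<in> borel_measurable lebesgue \<longrightarrow> N g = 0 \<longrightarrow> (AE x in lebesgue. g x = 0)) \<and>
     (\<forall>g h. g \<in> borel_measurable lebesgue \<longrightarrow> h \<in> borel_measurable lebesgue \<longrightarrow>
          (AE x in lebesgue. g x \<le> h x) \<longrightarrow> N g \<le> N h) \<and>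
     (\<forall>gs g. (\<forall>m. gs m \<in> borel_measurable lebesgue) \<longrightarrow> g \<in> borel_measurable lebesgue \<longrightarrow>
          (AE x in lebesgue. incseq (\<lambda>m. gs m x) \<and> (\<lambda>m. gs m x) \<longlonglongrightarrow> g x) \<longrightarrow>
          (\<lambda>m. N (gs m)) \<longlonglongrightarrow> N g) \<and>
     (\<forall>B \<in> dballs A D. N (indicator B) < \<infinity>)"

definition ball_Bfs :: "real^'n^'n \<Rightarrow> (real^'n) set \<Rightarrow> ((real^'n \<Rightarrow> ennreal) \<Rightarrow> ennreal) \<Rightarrow> bool" where
  "ball_Bfs A D N \<longleftrightarrow> ball_qBfs A D N \<and>
     (\<forall>g h. g \<in> borel_measurable lebesgue \<longrightarrow> h \<in> borel_measurable lebesgue \<longrightarrow>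
          N (\<lambda>x. g x + h x) \<le> N g + N h) \<and>
     (\<forall>B \<in> dballs A D. \<exists>C::real. \<forall>g. g \<in> borel_measurable lebesgue \<longrightarrow>
          (\<integral>\<^sup>+ x. g x * indicator B x \<partial>lebesgue) \<le> ennreal C * N g)"

definition Xpow :: "((real^'n \<Rightarrow> ennreal) \<Rightarrow> ennreal) \<Rightarrow> real \<Rightarrow> (real^'n \<Rightarrow> ennreal) \<Rightarrow> ennreal" where
  "Xpow N p g = epow (N (\<lambda>x. epow (g x) p)) (1 / p)"

definition assoc_norm :: "((real^'n \<Rightarrow> ennreal) \<Rightarrow> ennreal) \<Rightarrow> (real^'n \<Rightarrow> ennreal) \<Rightarrow> ennreal" where
  "assoc_norm N h = (SUP g \<in> {g \<in> borel_measurable lebesgue. N g = 1}.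
                        \<integral>\<^sup>+ x. h x * g x \<partial>lebesgue)"

definition abs_cont_qnorm :: "((real^'n \<Rightarrow> ennreal) \<Rightarrow> ennreal) \<Rightarrow> bool" where
  "abs_cont_qnorm N \<longleftrightarrow>
     (\<forall>g E. g \<in> borel_measurable lebesgue \<longrightarrow> N g < \<infinity> \<longrightarrow>
        (\<forall>j. E j \<in> sets lebesgue) \<longrightarrow> decseq E \<longrightarrow> (\<Inter>j. E j) = {} \<longrightarrow>
        (\<lambda>j. N (\<lambda>x. g x * indicator (E j) x)) \<longlonglongrightarrow> 0)"

definition assumption_FS :: "real^'n^'n \<Rightarrow> (real^'n) set \<Rightarrow> ((real^'n \<Rightarrow> ennreal) \<Rightarrow> ennreal) \<Rightarrow> real \<Rightarrow> bool" where
  "assumption_FS A D N pm \<longleftrightarrow>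
     (\<forall>p u. 0 < p \<longrightarrow> p < pm \<longrightarrow> 1 < u \<longrightarrow>
       (\<exists>C::real. \<forall>f :: nat \<Rightarrow> real^'n \<Rightarrow> ennreal.
          (\<forall>k. f k \<in> borel_measurable lebesgue) \<longrightarrow>
          Xpow N (1 / p) (\<lambda>x. epow (\<Sum>k. epow (maxf A D (f k) x) u) (1 / u))
            \<le> ennreal C * Xpow N (1 / p) (\<lambda>x. epow (\<Sum>k. epow (f k x) u) (1 / u))))"

definition assumption_A :: "real^'n^'n \<Rightarrow> (real^'n) set \<Rightarrow> ((real^'n \<Rightarrow> ennreal) \<Rightarrow> ennreal) \<Rightarrow> real \<Rightarrow> real \<Rightarrow> bool" where
  "assumption_A A D N th p0 \<longleftrightarrow>
     ball_Bfs A D (Xpow N (1 / th)) \<and>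
     (\<exists>C::real. \<forall>h. h \<in> borel_measurable lebesgue \<longrightarrow>
        assoc_norm (Xpow N (1 / th)) (maxf_pow A D ((p0 / th) / (p0 / th - 1)) h)
          \<le> ennreal C * assoc_norm (Xpow N (1 / th)) h)"

definition multi_indices :: "nat \<Rightarrow> ('n::finite \<Rightarrow> nat) set" where
  "multi_indices d = {\<alpha>. (\<Sum>i\<in>UNIV. \<alpha> i) \<le> d}"

definition poly_le :: "nat \<Rightarrow> (real^'n \<Rightarrow> real) \<Rightarrow> bool" where
  "poly_le d P \<longleftrightarrow> (\<exists>c :: ('n \<Rightarrow> nat) \<Rightarrow> real.
      P = (\<lambda>x. \<Sum>\<alpha>\<in>multi_indices d. c \<alpha> * (\<Prod>i\<in>UNIV. (x $ i) ^ \<alpha> i)))"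

definition poly_proj :: "nat \<Rightarrow> (real^'n) set \<Rightarrow> (real^'n \<Rightarrow> real) \<Rightarrow> real^'n \<Rightarrow> real" where
  "poly_proj d B g = (THE P. poly_le d P \<and>
      (\<forall>h. poly_le d h \<longrightarrow> (LINT x:B|lebesgue. (g x - P x) * h x) = 0))"

definition Lloc :: "real \<Rightarrow> (real^'n \<Rightarrow> real) \<Rightarrow> bool" where
  "Lloc q f \<longleftrightarrow> f \<in> borel_measurable lebesgue \<and>
     (\<forall>K. compact K \<longrightarrow> (\<integral>\<^sup>+ x. ennreal (\<bar>f x\<bar> powr q) * indicator K x \<partial>lebesgue) < \<infinity>)"

definition ind_norm :: "((real^'n \<Rightarrow> ennreal) \<Rightarrow> ennreal) \<Rightarrow> (real^'n) set \<Rightarrow> real" where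
  "ind_norm N B = enn2real (N (indicator B))"

definition block_norm :: "((real^'n \<Rightarrow> ennreal) \<Rightarrow> ennreal) \<Rightarrow> real \<Rightarrow> nat \<Rightarrow> (nat \<Rightarrow> (real^'n) set)
    \<Rightarrow> (nat \<Rightarrow> real) \<Rightarrow> ennreal" where
  "block_norm N th m Bs lam = N (\<lambda>x. ennreal
      ((\<Sum>i<m. (lam i / ind_norm N (Bs i)) powr th * indicator (Bs i) x) powr (1 / th)))"

definition campanato :: "real^'n^'n \<Rightarrow> (real^'n) set \<Rightarrow> ((real^'n \<Rightarrow> ennreal) \<Rightarrow> ennreal)
    \<Rightarrow> real \<Rightarrow> nat \<Rightarrow> real \<Rightarrow> (real^'n \<Rightarrow> real) \<Rightarrow> ennreal" where
  "campanato A D N t d th f =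
     (SUP (m, Bs, lam) \<in> {(m, Bs, lam). (\<forall>j<m. Bs j \<in> dballs A D) \<and> (\<forall>j<m. 0 \<le> lam j)
                                       \<and> (\<Sum>j<m. lam j) \<noteq> 0}.
        inverse (block_norm N th m Bs lam) *
        (\<Sum>j<m. ennreal (lam j * measure lebesgue (Bs j) / ind_norm N (Bs j)) *
           epow ((\<integral>\<^sup>+ x. ennreal (\<bar>f x - poly_proj d (Bs j) f x\<bar> powr t) * indicator (Bs j) x \<partial>lebesgue)
                   / emeasure lebesgue (Bs j)) (1 / t)))"

definition campanato_eps :: "real^'n^'n \<Rightarrow> (real^'n) set \<Rightarrow> ((real^'n \<Rightarrow> ennreal) \<Rightarrow> ennreal)
    \<Rightarrow> real \<Rightarrow> real \<Rightarrow> nat \<Rightarrow> real \<Rightarrow> (real^'n \<Rightarrow> real) \<Rightarrow> ennreal" where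
  "campanato_eps A D N lm eps d th f =
     (let b = bdet A; \<beta> = eps * ln lm / ln b;
          ball = (\<lambda>(xc::real^'n) (l::int). (\<lambda>y. xc + y) ` Bk A D l) in
     (SUP (m, xs, ls, lam) \<in> {(m, xs, ls, lam). (\<forall>j<m. 0 \<le> lam j) \<and> (\<Sum>j<m. lam j) \<noteq> 0}.
        inverse (block_norm N th m (\<lambda>j. ball (xs j) (ls j)) lam) *
        (\<Sum>j<m. ennreal (lam j * measure lebesgue (ball (xs j) (ls j)) / ind_norm N (ball (xs j) (ls j))) *
           (\<integral>\<^sup>+ x. ennreal (b powr (\<beta> * real_of_int (ls j)) *
                 \<bar>f x - poly_proj d (ball (xs j) (ls j)) f x\<bar> /
                 (b powr (real_of_int (ls j) * (1 + \<beta>)) + rho A D (x - xs j) powr (1 + \<beta>))) \<partial>lebesgue))))"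

end

theory Submission
  imports Defs "HOL-Computational_Algebra.Fundamental_Theorem_Algebra"
begin


text \<open>Both seminorms are compared with the exponent-one seminorm
  \<open>campanato A D N 1 d th f\<close>, which sees f only through the mean oscillations
  \<open>osc f z k\<close> about its polynomial projections. Two of the four comparisons are direct.
  On the ball itself the kernel is at least 1/(2|B|), so exponent one is bounded by the kernel
  seminorm (\<open>campanato_le_eps\<close>); and averages increase with the exponent, up to a
  constant, so exponent one is bounded by exponent q (\<open>campanato_one_le\<close>).

  The two remaining comparisons share one mechanism. The quantity to be estimated is dominated by a
  sum of oscillations over a larger finite family of balls. The definition of the exponent-one
  seminorm, read for that family (\<open>campanato_sum\<close>), bounds the sum by the seminorm
  times the X-norm of a weighted sum of indicators. It remains to bound this X-norm by that of the
  original family.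

  Kernel seminorm (\<open>campanato_eps_le\<close>). Space is exhausted by the balls z + B_{l+k},
  and the difference of the projections on scales l and l+k telescopes. A polynomial of degree d
  grows at most like lp^d for each scale by which a ball is enlarged, because A^k is of size O(lp^k)
  (\<open>matpow_growth\<close>). Since lp^d < b^\<beta>, the kernel integral is at most a constant
  times the sum over j of b^(-j \<beta>) \<open>osc f z (l + int j)\<close>
  (\<open>ker_integral_le\<close>). The maximal function of the indicator of B_l is at least b^(-j)
  on B_{l+j}, so the Fefferman-Stein inequality with u = 2 replaces each large ball by the original
  one at the price of a factor b^(-2j) in the weights (\<open>FS_step\<close>), and \<beta> > 2/th
  leaves a convergent geometric series (\<open>eps_family\<close>).

  Exponent q (\<open>campanato_le_one\<close>) is a John-Nirenberg inequality in sparse form. A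
  stopping-time argument on nested cubes adapted to A bounds |f - Pf| on a ball, up to an error of
  small integral, by a sum of \<open>osc\<close> over selected cubes Q_t; pairwise disjoint subsets
  E_t of the cubes have measure comparable to the balls around them
  (\<open>sparse_domination\<close>). The L^q average of a truncation of |f - Pf| is written as a
  pairing with a function g normalized in L^{q'}, so that it is at most the sum of
  \<open>osc\<close> times the averages \<gamma>_t of g over Q_t (\<open>sparse_pairing\<close>).
  The Q_t form a laminar family, hence the sum of \<gamma>_t^{p0} |E_t| is O(|B|) because p0 < q'
  (\<open>laminar_averages_bound\<close>). In the X-norm of the new family the Fefferman-Stein
  inequality passes from balls to the sets E_t. The result is a sum of functions \<psi>_j living
  near B_j whose L^{p0/th} means are bounded, and duality with the maximal operator on the associate
  space of X^{1/th} replaces \<psi>_j by the indicator of B_j (\<open>dual_step\<close>, collected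
  in \<open>truncated_family_bound\<close>). The duality rests on recovering the norm of a ball
  Banach function space from its associate norm (\<open>lorentz_luxemburg\<close>), obtained by
  minimizing an L^2 distance instead of separating by a functional.\<close>

section \<open>Lebesgue measure under linear maps\<close>

text \<open>Both sides are multiplicative under composition, and a linear map factors into maps that
  kill a coordinate, scale the coordinates, swap two of them, or shear. For each of these the factor
  is compared with the determinant, on boxes where needed. The index type carries no order.\<close>

lemma lmeasurable_measure_linear_image:
  fixes f :: "real^'n \<Rightarrow> real^'n"
  assumes "linear f" "S \<in> lmeasurable"
  shows "f ` S \<in> lmeasurable \<and> measure lebesgue (f ` S) = \<bar>det (matrix f)\<bar> * measure lebesgue S"
proof -
  have suff: "\<forall>S\<in>lmeasurable. g ` S \<in> lmeasurable \<and> measure lebesgue (g ` S) = \<bar>det (matrix g)\<bar> * measure lebesgue S"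
    if "linear g" "\<And>a b. measure lebesgue (g ` cbox a b) = \<bar>det (matrix g)\<bar> * measure lebesgue (cbox a b)"
    for g :: "real^'n \<Rightarrow> real^'n"
    using measure_linear_sufficient[OF that(1), of _ "\<bar>det (matrix g)\<bar>"] that(2) by metis
  have "\<forall>S\<in>lmeasurable. f ` S \<in> lmeasurable \<and> measure lebesgue (f ` S) = \<bar>det (matrix f)\<bar> * measure lebesgue S"
  proof (rule induct_linear_elementary[OF assms(1)])
    fix g h :: "real^'n \<Rightarrow> real^'n"
    assume lin: "linear g" "linear h"
      and g: "\<forall>S\<in>lmeasurable. g ` S \<in> lmeasurable \<and> measure lebesgue (g ` S) = \<bar>det (matrix g)\<bar> * measure lebesgue S"
      and h: "\<forall>S\<in>lmeasurable. h ` S \<in> lmeasurable \<and> measure lebesgue (h ` S) = \<bar>det (matrix h)\<bar> * measure lebesgue S"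
    have "det (matrix (g \<circ> h)) = det (matrix g) * det (matrix h)"
      by (simp add: matrix_compose[OF lin(2,1)] det_mul)
    then show "\<forall>S\<in>lmeasurable. (g \<circ> h) ` S \<in> lmeasurable \<and> measure lebesgue ((g \<circ> h) ` S) = \<bar>det (matrix (g \<circ> h))\<bar> * measure lebesgue S"
      unfolding image_comp[symmetric] using g h by (simp add: abs_mult)
  next
    fix g :: "real^'n \<Rightarrow> real^'n" and i
    assume g: "linear g" "\<And>x. g x $ i = 0"
    have "negligible (g ` S)" for S
      by (rule negligible_subset[OF negligible_standard_hyperplane_cart[of i]]) (use g(2) in auto)
    moreover have "row i (matrix g) = 0" using g(2) by (simp add: row_def matrix_def vec_eq_iff)
    then have "det (matrix g) = 0" by (rule det_zero_row)
    ultimately show "\<forall>S\<in>lmeasurable. g ` S \<in> lmeasurable \<and> measure lebesgue (g ` S) = \<bar>det (matrix g)\<bar> * measure lebesgue S"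
      by (simp add: negligible_iff_measure)
  next
    fix c :: "'n \<Rightarrow> real"
    have "matrix (\<lambda>x::real^'n. \<chi> i. c i * x $ i) $ i $ j = (if i = j then c i else 0)" for i j
      by (simp add: matrix_def axis_def)
    then have "det (matrix (\<lambda>x::real^'n. \<chi> i. c i * x $ i)) = prod c UNIV"
      by (simp add: det_diagonal)
    then show "\<forall>S\<in>lmeasurable. (\<lambda>x. \<chi> i. c i * x $ i) ` S \<in> lmeasurable \<and>
        measure lebesgue ((\<lambda>x. \<chi> i. c i * x $ i) ` S) = \<bar>det (matrix (\<lambda>x. \<chi> i. c i * x $ i))\<bar> * measure lebesgue S"
      by (simp add: measurable_stretch measure_stretch)
  next
    fix m n :: 'n assume mn: "m \<noteq> n"
    let ?t = "Transposition.transpose m n" and ?g = "\<lambda>x::real^'n. \<chi> i. x $ Transposition.transpose m n i"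
    have t: "?t permutes UNIV" by (simp add: permutes_swap_id)
    have lin: "linear ?g" by (auto simp: linear_iff vec_eq_iff)
    have "matrix ?g = (\<chi> i. (mat 1 :: real^'n^'n) $ ?t i)"
      by (auto simp: matrix_def axis_def mat_def vec_eq_iff transpose_eq_iff)
    then have det: "\<bar>det (matrix ?g)\<bar> = 1"
      using det_permute_rows[OF t, of "mat 1 :: real^'n^'n"] by (simp add: sign_swap_id mn)
    have img: "?g ` cbox a b = cbox (?g a) (?g b)" for a b
    proof (intro equalityI subsetI)
      fix y assume "y \<in> cbox (?g a) (?g b)"
      then have "\<forall>i. a $ ?t i \<le> y $ i \<and> y $ i \<le> b $ ?t i" by (simp add: mem_box_cart)
      then have "?g y \<in> cbox a b" unfolding mem_box_cart by simp (metis transpose_involutory)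
      moreover have "y = ?g (?g y)" by (simp add: vec_eq_iff)
      ultimately show "y \<in> ?g ` cbox a b" by blast
    qed (auto simp: mem_box_cart)
    have "measure lebesgue (?g ` cbox a b) = measure lebesgue (cbox a b)" for a b
    proof (cases "cbox a b = {}")
      case False
      then have "cbox (?g a) (?g b) \<noteq> {}" unfolding img[symmetric] by simp
      moreover have "(\<Prod>i\<in>UNIV. b $ ?t i - a $ ?t i) = (\<Prod>i\<in>UNIV. b $ i - a $ i)"
        using prod.permute[OF t, of "\<lambda>i. b $ i - a $ i"] by (simp add: o_def)
      ultimately show ?thesis unfolding img using False by (simp add: content_cbox_cart)
    qed simp
    then show "\<forall>S\<in>lmeasurable. ?g ` S \<in> lmeasurable \<and> measure lebesgue (?g ` S) = \<bar>det (matrix ?g)\<bar> * measure lebesgue S"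
      using det by (intro suff lin) simp
  next
    fix m n :: 'n assume mn: "m \<noteq> n"
    let ?g = "\<lambda>x::real^'n. \<chi> i. if i = m then x $ m + x $ n else x $ i"
    have lin: "linear ?g" by (auto simp: linear_iff vec_eq_iff algebra_simps)
    have "matrix ?g = (\<chi> k. if k = m then row m (mat 1) + 1 *s row n (mat 1) else row k (mat 1 :: real^'n^'n))"
      using mn by (auto simp: matrix_def axis_def mat_def row_def vec_eq_iff)
    then have det: "det (matrix ?g) = 1"
      using det_row_operation[OF mn, of "mat 1" 1] by simp
    have "measure lebesgue (?g ` cbox a b) = measure lebesgue (cbox a b)" for a b
    proof (cases "cbox a b = {}")
      case False
      \<comment> \<open>Translating the box so that its lower n-th coordinate becomes 0 meets the
        sign condition of \<open>measure_shear_interval\<close>; translations change neither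
        measure.\<close>
      let ?v = "(\<chi> i. if i = n then - a $ n else 0) :: real^'n"
      have sh: "(+) ?v ` cbox a b = cbox (?v + a) (?v + b)" using cbox_translation[of ?v a b] by simp
      have "?g ` ((+) ?v ` cbox a b) = (+) (?g ?v) ` (?g ` cbox a b)"
        unfolding image_image by (rule image_cong[OF refl]) (rule linear_add[OF lin])
      then have "measure lebesgue (?g ` cbox a b) = measure lebesgue (?g ` cbox (?v + a) (?v + b))"
        unfolding sh by (simp add: measure_translation)
      also have "\<dots> = measure lebesgue (cbox (?v + a) (?v + b))"
        using False by (intro measure_shear_interval mn) (simp_all flip: sh)
      finally show ?thesis by (simp only: measure_translation flip: sh)
    qed simp
    then show "\<forall>S\<in>lmeasurable. ?g ` S \<in> lmeasurable \<and> measure lebesgue (?g ` S) = \<bar>det (matrix ?g)\<bar> * measure lebesgue S"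
      using det by (intro suff lin) simp
  qed
  with assms(2) show ?thesis by blast
qed


lemma nn_integral_lebesgue_on_eq:
  fixes u :: "'a::euclidean_space \<Rightarrow> real"
  assumes "set_integrable lebesgue S u"
  shows "(\<integral>\<^sup>+x. ennreal \<bar>u x\<bar> * indicator S x \<partial>lebesgue) = ennreal (LINT x:S|lebesgue. \<bar>u x\<bar>)"
proof -
  have "set_integrable lebesgue S (\<lambda>x. \<bar>u x\<bar>)"
    using set_integrable_abs[OF assms] .
  then have "(\<integral>\<^sup>+x. ennreal (indicator S x *\<^sub>R \<bar>u x\<bar>) \<partial>lebesgue) = ennreal (LINT x:S|lebesgue. \<bar>u x\<bar>)"
    unfolding set_integrable_def set_lebesgue_integral_def
    by (rule nn_integral_eq_integral) auto
  moreover have "ennreal (indicator S x *\<^sub>R \<bar>u x\<bar>) = ennreal \<bar>u x\<bar> * indicator S x" for x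
    by (auto simp: indicator_def)
  ultimately show ?thesis by simp
qed

section \<open>Dilated ellipsoids, their gauges and the quasi-norm\<close>

text \<open>The geometric data: an ellipsoid of volume 1 which A enlarges at least r-fold. This
  inclusion drives all lower bounds on expansion; the eigenvalues enter in
  \<open>aniso_poly\<close>, for upper bounds on growth.\<close>

locale aniso =
  fixes A :: "real^'n^'n" and D :: "(real^'n) set" and r :: real
  assumes ell: "origin_ellipsoid D" and vol: "emeasure lebesgue D = 1"
    and r1: "1 < r" and rD: "(\<lambda>x. r *\<^sub>R x) ` D \<subseteq> (\<lambda>x. A *v x) ` D"
begin

definition Pm where "Pm = (SOME Pm::real^'n^'n. invertible Pm \<and> D = {x. norm (Pm *v x) < 1})"

lemma Pm: "invertible Pm" "D = {x. norm (Pm *v x) < 1}"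
  using someI_ex[OF ell[unfolded origin_ellipsoid_def]] unfolding Pm_def by auto

lemma P_inj: "Pm *v x = 0 \<longleftrightarrow> x = 0"
proof -
  obtain Q where "Q ** Pm = mat 1" using Pm(1) unfolding invertible_def by blast
  then have "x = Q *v (Pm *v x)" by (simp add: matrix_vector_mul_assoc)
  then show ?thesis by (metis matrix_vector_mult_0_right)
qed

lemma D_iff: "x \<in> D \<longleftrightarrow> norm (Pm *v x) < 1"
  using Pm(2) by (metis (mono_tags, lifting) mem_Collect_eq)

lemma D_open: "open D"
proof -
  have "continuous_on UNIV (\<lambda>x. norm (Pm *v x))"
    by (rule continuous_on_norm[OF matrix_vector_mult_linear_continuous_on])
  then have "open {x. norm (Pm *v x) < 1}"
    using continuous_on_const by (rule open_Collect_less)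
  moreover have "D = {x. norm (Pm *v x) < 1}" by (rule Pm(2))
  ultimately show ?thesis by metis
qed

lemma norm_le_P: obtains K where "K > 0" "\<And>x. norm x \<le> K * norm (Pm *v x)"
proof -
  obtain Q where Q: "Q ** Pm = mat 1" using Pm(1) unfolding invertible_def by blast
  obtain K where K: "K > 0" "\<And>y. norm (Q *v y) \<le> norm y * K"
    using bounded_linear.pos_bounded[OF matrix_vector_mul_bounded_linear[of Q]] by auto
  have "norm x \<le> K * norm (Pm *v x)" for x
    using K(2)[of "Pm *v x"] Q by (simp add: matrix_vector_mul_assoc mult.commute)
  with K(1) that show thesis by blast
qed

lemma D_bounded: "bounded D"
proof -
  obtain K where K: "K > 0" "\<And>x. norm x \<le> K * norm (Pm *v x)" using norm_le_P by blast
  have "norm x \<le> K" if "x \<in> D" for x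
    using K(2)[of x] that K(1) mult_left_mono[of "norm (Pm *v x)" 1 K] by (auto simp: D_iff intro: order_trans)
  then show ?thesis unfolding bounded_iff by blast
qed

lemma D_sets: "D \<in> sets lebesgue" using D_open by auto

lemma D_lmeas: "D \<in> lmeasurable" using D_bounded D_open lmeasurable_open by blast

lemma measure_D: "measure lebesgue D = 1"
  using vol by (simp add: measure_def)

text \<open>Comparing the volumes in r D \<subseteq> A D gives r^n \<le> |det A|.\<close>

lemma b_gt1: "bdet A > 1"
proof -
  have lr: "linear (\<lambda>x::real^'n. r *\<^sub>R x)" by (simp add: linear_iff scaleR_right_distrib)
  have "matrix (\<lambda>x::real^'n. r *\<^sub>R x) = (\<chi> i j. if i = j then r else 0)"
    by (auto simp: matrix_def axis_def vec_eq_iff)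
  then have dr: "det (matrix (\<lambda>x::real^'n. r *\<^sub>R x)) = r ^ CARD('n)"
    by (simp add: det_diagonal)
  have "measure lebesgue ((\<lambda>x. r *\<^sub>R x) ` D) \<le> measure lebesgue ((\<lambda>x. A *v x) ` D)"
    using lmeasurable_measure_linear_image[OF lr D_lmeas] lmeasurable_measure_linear_image[of "(*v) A" D] D_lmeas
    by (intro measure_mono_fmeasurable rD fmeasurableD) auto
  also have "measure lebesgue ((\<lambda>x. A *v x) ` D) = bdet A"
    using lmeasurable_measure_linear_image[of "(*v) A" D] D_lmeas measure_D by (simp add: bdet_def)
  also have "measure lebesgue ((\<lambda>x. r *\<^sub>R x) ` D) = r ^ CARD('n)"
    using lmeasurable_measure_linear_image[OF lr D_lmeas] measure_D r1 by (simp add: dr)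
  finally have "r ^ CARD('n) \<le> bdet A" .
  moreover have "1 < r ^ CARD('n)" using r1 by (simp add: one_less_power)
  ultimately show ?thesis by simp
qed

lemma det_A: "det A \<noteq> 0" using b_gt1 unfolding bdet_def by auto

lemma A_inv: "invertible A" using det_A by (simp add: invertible_det_nz)

lemma matrix_inv_A: "A ** matrix_inv A = mat 1" "matrix_inv A ** A = mat 1"
  using someI_ex[OF A_inv[unfolded invertible_def]] unfolding matrix_inv_def by auto

lemma A_Ainv: "A *v (matrix_inv A *v x) = x" "matrix_inv A *v (A *v x) = x"
  using matrix_inv_A by (simp_all add: matrix_vector_mul_assoc)

definition pw where "pw k = matipow_map A k"

lemma pw_0 [simp]: "pw 0 x = x" by (simp add: pw_def matipow_map_def)

lemma pw_Suc: "pw (k + 1) x = A *v pw k x"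
proof (cases "0 \<le> k")
  case True
  then show ?thesis by (simp add: pw_def matipow_map_def nat_add_distrib)
next
  case False
  then obtain m where m: "k = - int (Suc m)" 
    by (metis add.commute int_cases not_less_iff_gr_or_eq of_nat_less_0_iff of_nat_Suc of_nat_0_le_iff minus_add_distrib)
  show ?thesis unfolding m by (auto simp: pw_def matipow_map_def A_Ainv nat_add_distrib)
qed

lemma pw_pred: "pw (k - 1) x = matrix_inv A *v pw k x"
  using pw_Suc[of "k - 1" x] by (simp add: A_Ainv)

lemma pw_add: "pw (j + k) x = pw j (pw k x)"
proof (induction j rule: int_induct[where k = 0])
  case base then show ?case by simp
next
  case (step1 i)
  have "pw (i + 1 + k) x = A *v pw (i + k) x" using pw_Suc[of "i + k" x] by (simp add: algebra_simps)
  then show ?case using step1 by (simp add: pw_Suc)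
next
  case (step2 i)
  have "pw (i - 1 + k) x = matrix_inv A *v pw (i + k) x" using pw_pred[of "i + k" x] by (simp add: algebra_simps)
  then show ?case using step2 by (simp add: pw_pred)
qed

lemma pw_inv [simp]: "pw (- k) (pw k x) = x" "pw k (pw (- k) x) = x"
  using pw_add[of "-k" k x] pw_add[of k "-k" x] by simp_all

lemma pw_matrix: obtains M where "\<And>x. pw k x = M *v x" "\<bar>det M\<bar> = bdet A powr real_of_int k"
proof -
  have "\<exists>M. (\<forall>x. pw k x = M *v x) \<and> \<bar>det M\<bar> = bdet A powr real_of_int k"
  proof (induction k rule: int_induct[where k = 0])
    case base then show ?case using b_gt1 by (intro exI[of _ "mat 1"]) (simp add: )
  next
    case (step1 i)
    then obtain M where M: "\<And>x. pw i x = M *v x" "\<bar>det M\<bar> = bdet A powr real_of_int i" by blast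
    show ?case using M b_gt1
      by (intro exI[of _ "A ** M"]) (simp add: pw_Suc matrix_vector_mul_assoc det_mul abs_mult powr_add bdet_def)
  next
    case (step2 i)
    then obtain M where M: "\<And>x. pw i x = M *v x" "\<bar>det M\<bar> = bdet A powr real_of_int i" by blast
    have "det (matrix_inv A) = 1 / det A"
      using matrix_inv_A det_A det_mul[of A "matrix_inv A"] by (simp add: field_simps)
    then show ?case using M b_gt1
      by (intro exI[of _ "matrix_inv A ** M"]) (simp add: pw_pred matrix_vector_mul_assoc det_mul abs_mult powr_diff bdet_def)
  qed
  with that show thesis by blast
qed

lemma pw_linear: "linear (pw k)"
proof -
  obtain M where "\<And>x. pw k x = M *v x" using pw_matrix by blast
  then have "pw k = (*v) M" by auto
  then show ?thesis by simp
qed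

lemma pw_simps: "pw k (x + y) = pw k x + pw k y" "pw k (x - y) = pw k x - pw k y"
  "pw k (c *\<^sub>R x) = c *\<^sub>R pw k x" "pw k 0 = 0" "pw k (- x) = - pw k x"
  using pw_linear[of k] by (simp_all add: linear_add linear_diff linear_cmul linear_0 linear_neg)

text \<open>The Minkowski gauge of B_k. At every fixed scale it is a genuine norm, so the triangle
  inequality holds with constant 1 and balls can be handled by their gauges instead of through
  \<open>rho\<close>.\<close>

definition G where "G k x = norm (Pm *v pw (- k) x)"

lemma Bk_eq: "Bk A D k = {x. G k x < 1}"
proof -
  have "Bk A D k = pw k ` D" by (simp add: Bk_def pw_def)
  also have "\<dots> = {x. pw (- k) x \<in> D}"
    by (auto simp: image_iff) (metis pw_inv(2))
  finally show ?thesis by (simp add: G_def D_iff)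
qed

lemma G_triangle: "G k (x + y) \<le> G k x + G k y"
  by (simp add: G_def pw_simps matrix_vector_right_distrib norm_triangle_ineq)

lemma G_scale: "G k (c *\<^sub>R x) = \<bar>c\<bar> * G k x"
  by (simp add: G_def pw_simps matrix_vector_mult_scaleR)

lemma G_neg: "G k (- x) = G k x" using G_scale[of k "-1" x] by simp
lemma G_nonneg [simp]: "0 \<le> G k x" by (simp add: G_def)
lemma G_0 [simp]: "G k 0 = 0" by (simp add: G_def pw_simps)
lemma G_minus: "G k (x - y) = G k (y - x)" using G_neg[of k "x - y"] by simp
lemma G_triangle3: "G k (x - z) \<le> G k (x - y) + G k (y - z)"
  using G_triangle[of k "x - y" "y - z"] by simp

lemma G_eq0: "G k x = 0 \<longleftrightarrow> x = 0"
proof -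
  have "pw (- k) x = 0 \<longleftrightarrow> x = 0" by (metis pw_inv(2) pw_simps(4))
  then show ?thesis unfolding G_def by (simp add: P_inj)
qed

lemma G_pw: "G k (pw j x) = G (k - j) x"
  unfolding G_def using pw_add[of "-k" j x] by simp

text \<open>The inclusion r D \<subseteq> A D transported by A^k says that r B_k lies in B_{k+1}.
  Since the balls are open, points are first scaled strictly inside B_k.\<close>

lemma G_step0: "r * G (k + 1) x \<le> G k x"
proof -
  have main: "G (k+1) (r *\<^sub>R y) < 1" if y: "G k y < 1" for y
  proof -
    have "pw (- k) y \<in> D" using y by (simp add: G_def D_iff)
    then obtain z where z: "z \<in> D" "r *\<^sub>R pw (-k) y = A *v z" using rD by blast
    then have "r *\<^sub>R y = pw k (A *v z)" by (metis pw_inv(2) pw_simps(3))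
    also have "\<dots> = pw (k + 1) z" using pw_add[of k 1 z] pw_Suc[of 0 z] by simp
    finally have "pw (- (k + 1)) (r *\<^sub>R y) = z" using pw_inv(1)[of "k + 1" z] by simp
    then show ?thesis using z(1) unfolding G_def D_iff by simp
  qed
  show ?thesis
  proof (rule field_le_epsilon)
    fix e :: real assume e: "e > 0"
    \<comment> \<open>Dividing by slightly more than the gauge lands in the open unit ball; the
      excess e tends to 0 afterwards.\<close>
    let ?c = "G k x + e"
    have c: "?c > 0" using e G_nonneg[of k x] by linarith
    have "G k ((1 / ?c) *\<^sub>R x) < 1" using c e by (simp add: G_scale)
    from main[OF this] have "r * G (k+1) x / ?c < 1" using c r1 by (simp add: G_scale)
    then show "r * G (k + 1) x \<le> ?c" using c by (simp add: divide_simps)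
  qed
qed

lemma G_step: "r ^ j * G (k + int j) x \<le> G k x"
proof (induction j)
  case (Suc j)
  have "r ^ Suc j * G (k + int (Suc j)) x = r ^ j * (r * G ((k + int j) + 1) x)"
    by (simp add: algebra_simps)
  also have "\<dots> \<le> r ^ j * G (k + int j) x" using r1 G_step0 by (intro mult_left_mono) auto
  finally show ?case using Suc by simp
qed simp

lemma G_antimono: assumes "j \<le> k" shows "G k x \<le> G j x"
proof -
  obtain m where m: "k = j + int m" using assms zle_iff_zadd by auto
  have "1 * G k x \<le> r ^ m * G k x" using r1 by (intro mult_right_mono) (auto intro: one_le_power)
  with G_step[of m j x] show ?thesis unfolding m by simp
qed

lemma Bk_mono: "j \<le> k \<Longrightarrow> Bk A D j \<subseteq> Bk A D k"
  unfolding Bk_eq using G_antimono order_le_less_trans by blast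

definition bl where "bl x k = (\<lambda>y. x + y) ` Bk A D k"

lemma bl_iff: "y \<in> bl x k \<longleftrightarrow> G k (y - x) < 1"
  unfolding bl_def Bk_eq by (auto simp: image_iff intro: exI[of _ "y - x"])

lemma dballs_eq: "dballs A D = {bl x k |x k. True}"
  by (simp add: dballs_def bl_def)

lemma bl_in_dballs [simp, intro]: "bl x k \<in> dballs A D" unfolding dballs_eq by auto

lemma bl_eq_image: "bl x k = (\<lambda>y. x + pw k y) ` D"
  unfolding bl_def Bk_def pw_def[symmetric] by (simp add: image_image)

lemma G_continuous: "continuous_on UNIV (G k)"
proof -
  have "continuous_on UNIV (pw (-k))" using pw_linear by (simp add: linear_continuous_on linear_conv_bounded_linear)
  then have "continuous_on UNIV (\<lambda>x. Pm *v pw (-k) x)"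
    by (intro continuous_on_compose2[OF matrix_vector_mult_linear_continuous_on[of UNIV Pm]]) auto
  then show ?thesis unfolding G_def by (intro continuous_on_norm)
qed

lemma bl_open: "open (bl x k)"
proof -
  have "bl x k = {y. G k (y - x) < 1}" using bl_iff by auto
  moreover have "continuous_on UNIV (\<lambda>y. G k (y - x))"
    by (intro continuous_on_compose2[OF G_continuous]) (auto intro!: continuous_intros)
  ultimately show ?thesis using open_Collect_less[of "\<lambda>y. G k (y-x)" "\<lambda>_. 1"] by simp
qed

lemma bl_sets [measurable, simp]: "bl x k \<in> sets lebesgue" using bl_open by auto

lemma bl_bounded: "bounded (bl x k)"
proof -
  have "bounded (pw k ` D)" using D_bounded pw_linear by (simp add: bounded_linear_image linear_conv_bounded_linear)
  then show ?thesis unfolding bl_def Bk_def pw_def[symmetric] by (simp add: bounded_translation)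
qed

lemma bl_lmeas: "bl x k \<in> lmeasurable" using bl_bounded bl_open lmeasurable_open by blast

lemma measure_bl: "measure lebesgue (bl x k) = bdet A powr real_of_int k"
proof -
  obtain M where M: "\<And>x. pw k x = M *v x" "\<bar>det M\<bar> = bdet A powr real_of_int k" using pw_matrix by blast
  have "measure lebesgue (bl x k) = measure lebesgue ((\<lambda>x. M *v x) ` D)"
    unfolding bl_def Bk_def pw_def[symmetric] by (simp add: measure_translation M(1) cong: image_cong)
  also have "\<dots> = \<bar>det M\<bar>"  using lmeasurable_measure_linear_image[of "(*v) M" D] D_lmeas measure_D by simp
  finally show ?thesis using M by simp
qed

lemma emeasure_bl: "emeasure lebesgue (bl x k) = ennreal (bdet A powr real_of_int k)"
  using measure_bl[of x k] bl_lmeas[of x k] by (simp add: emeasure_eq_measure2)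

lemma bl_center [simp]: "x \<in> bl x k" by (simp add: bl_iff)

lemma bl_mono: "j \<le> k \<Longrightarrow> bl x j \<subseteq> bl x k" unfolding bl_def using Bk_mono by blast

lemma G_exhaust: "\<exists>j::nat. G (k + int j) x < 1"
proof -
  obtain j where "G k x < r ^ j" using r1 real_arch_pow by blast
  with G_step[of j k x] have "r ^ j * G (k + int j) x < r ^ j * 1" by simp
  moreover have "0 < r ^ j" using r1 by simp
  ultimately have "G (k + int j) x < 1" by (simp only: mult_less_cancel_left_pos)
  then show ?thesis by blast
qed

text \<open>Each step down in scale multiplies the gauge by at least r, so a nonzero point leaves
  every sufficiently small ball.\<close>

lemma G_blowup: assumes "x \<noteq> 0" shows "\<exists>j::nat. G (k - int j) x \<ge> 1"
proof -
  have "G k x > 0" using assms G_eq0[of k x] by (metis G_nonneg less_eq_real_def)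
  then obtain j where j: "1 / G k x < r ^ j" using r1 real_arch_pow by blast
  then have "1 \<le> r ^ j * G k x" using \<open>G k x > 0\<close> by (simp add: divide_simps)
  also have "\<dots> \<le> G (k - int j) x" using G_step[of j "k - int j" x] by simp
  finally show ?thesis by blast
qed

lemma rho_eq: assumes "G k x \<ge> 1" "G (k + 1) x < 1"
  shows "rho A D x = bdet A powr real_of_int k"
proof -
  have "x \<noteq> 0" using assms(1) by auto
  moreover have "(THE k. x \<in> Bk A D (k + 1) - Bk A D k) = k"
  proof (rule the_equality)
    show "x \<in> Bk A D (k + 1) - Bk A D k" using assms by (simp add: Bk_eq)
    fix j assume "x \<in> Bk A D (j + 1) - Bk A D j"
    then have j: "G j x \<ge> 1" "G (j + 1) x < 1" by (simp_all add: Bk_eq)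
    show "j = k" using G_antimono[of "j+1" k x] G_antimono[of "k + 1" j x] j assms by force
  qed
  ultimately show ?thesis by (simp add: rho_def)
qed

text \<open>The gauge is at least 1 on small scales and below 1 on large ones, so the balls first
  capture x at some scale. With \<open>rho_eq\<close> this makes the definite description inside
  \<open>rho\<close> meaningful.\<close>

lemma rho_cases: assumes "x \<noteq> 0" obtains k where "G k x \<ge> 1" "G (k + 1) x < 1"
proof -
  obtain j where j: "G (0 - int j) x \<ge> 1" using G_blowup[OF assms, of 0] by auto
  obtain m where m: "G (- int j + int m) x < 1" using G_exhaust[of "- int j" x] by auto
  define i where "i = (LEAST i. G (- int j + int i) x < 1)"
  have i1: "G (- int j + int i) x < 1" unfolding i_def using m by (rule LeastI)
  have "i \<noteq> 0" using i1 j by (cases i) auto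
  then obtain i' where i': "i = Suc i'" using not0_implies_Suc by blast
  have "\<not> G (- int j + int i') x < 1" using not_less_Least[of i' "\<lambda>i. G (- int j + int i) x < 1"] i' unfolding i_def by auto
  then show thesis using i1 unfolding i' by (intro that[of "- int j + int i'"]) (auto simp: algebra_simps)
qed

lemma rho_lt: assumes "G k x < 1" shows "rho A D x \<le> bdet A powr real_of_int k"
proof (cases "x = 0")
  case True then show ?thesis by (simp add: rho_def)
next
  case False
  then obtain j where j: "G j x \<ge> 1" "G (j + 1) x < 1" using rho_cases by blast
  have "j \<le> k" using G_antimono[of k j x] j assms by force
  then show ?thesis using rho_eq[OF j] b_gt1 by (simp add: powr_mono)
qed

end


section \<open>Growth of matrix powers from eigenvalue bounds\<close>

text \<open>The polynomial p in the left shift S, applied to the sequence u and evaluated at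
  k.\<close>

definition shift_poly :: "complex poly \<Rightarrow> (nat \<Rightarrow> complex) \<Rightarrow> nat \<Rightarrow> complex" where
  "shift_poly p u k = (\<Sum>m\<le>degree p. coeff p m * u (k + m))"

lemma shift_poly_bound:
  assumes "degree p \<le> N" shows "shift_poly p u k = (\<Sum>m\<le>N. coeff p m * u (k + m))"
  unfolding shift_poly_def by (rule sum.mono_neutral_left) (use assms in \<open>auto simp: coeff_eq_0\<close>)

text \<open>The factor S - z commutes with q(S), so it can be applied to u first or to q(S)u last;
  \<open>orbit_growth\<close> needs both readings.\<close>

lemma shift_poly_linear_factor:
  "shift_poly ([:-z, 1:] * q) u k = shift_poly q (\<lambda>k. u (Suc k) - z * u k) k"
  "shift_poly ([:-z, 1:] * q) u k = shift_poly q u (Suc k) - z * shift_poly q u k"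
proof -
  have "degree ([:-z, 1:] * q) \<le> Suc (degree q)" by (rule order_trans[OF degree_mult_le]) simp
  then have "shift_poly ([:-z, 1:] * q) u k = (\<Sum>m\<le>Suc (degree q). coeff ([:-z, 1:] * q) m * u (k + m))"
    by (rule shift_poly_bound)
  also have "\<dots> = (\<Sum>m\<le>Suc (degree q). coeff (pCons 0 q) m * u (k + m)) - (\<Sum>m\<le>Suc (degree q). z * (coeff q m * u (k + m)))"
    unfolding sum_subtractf[symmetric] by (rule sum.cong) (auto simp: algebra_simps)
  also have "(\<Sum>m\<le>Suc (degree q). coeff (pCons 0 q) m * u (k + m)) = shift_poly q u (Suc k)"
    by (subst sum.atMost_Suc_shift) (simp add: shift_poly_def)
  also have "(\<Sum>m\<le>Suc (degree q). z * (coeff q m * u (k + m))) = z * shift_poly q u k"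
    by (simp add: sum_distrib_left[symmetric] shift_poly_bound[of q "Suc (degree q)"] del: sum.atMost_Suc)
  finally show 2: "shift_poly ([:-z, 1:] * q) u k = shift_poly q u (Suc k) - z * shift_poly q u k" .
  show "shift_poly ([:-z, 1:] * q) u k = shift_poly q (\<lambda>k. u (Suc k) - z * u k) k"
    unfolding 2 by (simp add: shift_poly_def sum_distrib_left sum_subtractf[symmetric] algebra_simps)
qed

lemma eigenvalue_ofI:
  fixes A :: "real^'n^'n"
  assumes "\<And>i. (\<Sum>j\<in>UNIV. complex_of_real (A $ i $ j) * w j) = z * w i" and "w i0 \<noteq> 0"
  shows "eigenvalue_of A z"
proof -
  let ?M = "(\<chi> i j. complex_of_real (A $ i $ j) - (if i = j then z else 0)) :: complex^'n^'n"
  let ?w = "(\<chi> i. w i) :: complex^'n"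
  have "?M *v ?w = 0"
    using assms(1)
    by (simp add: vec_eq_iff matrix_vector_mult_def left_diff_distrib sum_subtractf if_distrib[of "\<lambda>c. c * _"] cong: if_cong)
  moreover have "?w \<noteq> 0" using assms(2) by (auto simp: vec_eq_iff)
  ultimately have "\<not> (\<exists>B. B ** ?M = mat 1)" unfolding matrix_left_invertible_ker by blast
  then have "\<not> invertible ?M" unfolding invertible_def by blast
  then show ?thesis unfolding eigenvalue_of_def using invertible_det_nz by blast
qed

lemma orbit_growth:
  fixes A :: "real^'n^'n"
  assumes "p \<noteq> 0"
    and "\<And>k i. u (Suc k) i = (\<Sum>j\<in>UNIV. complex_of_real (A $ i $ j) * u k j)"
    and "\<And>k i. shift_poly p (\<lambda>k. u k i) k = 0"
    and "\<And>z. eigenvalue_of A z \<Longrightarrow> cmod z < lp"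
  shows "((\<exists>z. eigenvalue_of A z) \<longrightarrow> (\<exists>C. \<forall>k i. cmod (u k i) \<le> C * lp ^ k)) \<and> ((\<nexists>z. eigenvalue_of A z) \<longrightarrow> (\<forall>k i. u k i = 0))"
  using assms(1-3)
proof (induction "degree p" arbitrary: p u)
  case 0
  then obtain c where c: "p = [:c:]" using degree_eq_zeroE by metis
  then have "c \<noteq> 0" using 0 by auto
  then have "\<forall>k i. u k i = 0" using "0.prems"(3) c by (simp add: shift_poly_def)
  then show ?case by (auto intro!: exI[of _ 0])
next
  case (Suc n)
  then have "\<not> constant (poly p)" by (simp add: constant_degree)
  then obtain z where z: "poly p z = 0" using fundamental_theorem_of_algebra by blast
  then have "[:-z, 1:] dvd p" by (simp only: poly_eq_0_iff_dvd)
  then obtain q where q: "p = [:-z, 1:] * q" by (rule dvdE)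
  have q0: "q \<noteq> 0" using q Suc.prems(1) by auto
  have dq: "n = degree q" using Suc.hyps(2) q0 unfolding q by (subst (asm) degree_mult_eq) auto
  show ?case
  proof (cases "eigenvalue_of A z")
    case True
    \<comment> \<open>Apply S - z first: w is again an orbit of A, it is annihilated by q, and u
      (Suc k) = z u k + w k with |z| < lp.\<close>
    define w where "w k i = u (Suc k) i - z * u k i" for k i
    have w1: "w (Suc k) i = (\<Sum>j\<in>UNIV. complex_of_real (A $ i $ j) * w k j)" for k i
      unfolding w_def by (subst Suc.prems(2)[of "Suc k"], subst (2) Suc.prems(2)[of k])
        (simp add: sum_subtractf sum_distrib_left algebra_simps)
    have "shift_poly q (\<lambda>k. w k i) k = 0" for k i
      using Suc.prems(3)[of i k] unfolding q shift_poly_linear_factor(1) w_def by simp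
    from Suc.hyps(1)[OF dq q0 w1 this] True obtain C where C: "\<And>k i. cmod (w k i) \<le> C * lp ^ k" by metis
    have zl: "cmod z < lp" using assms(4) True by blast
    \<comment> \<open>The second entry makes |z| C' + C \<le> lp C', which is exactly what the
      induction step consumes; the first entry starts the induction.\<close>
    define C' where "C' = max (Max (range (\<lambda>i. cmod (u 0 i)))) (C / (lp - cmod z))"
    have "cmod (u k i) \<le> C' * lp ^ k" for k i
    proof (induction k arbitrary: i)
      case 0
      have "cmod (u 0 i) \<le> Max (range (\<lambda>i. cmod (u 0 i)))" by (intro Max_ge) auto
      then show ?case unfolding C'_def by (simp add: le_max_iff_disj)
    next
      case (Suc k)
      have lp: "0 < lp" using zl by (meson norm_ge_zero order_le_less_trans)
      have "C / (lp - cmod z) \<le> C'" unfolding C'_def by simp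
      then have c: "C \<le> C' * (lp - cmod z)" using zl pos_divide_le_eq[of "lp - cmod z" C C'] by simp
      have "cmod (u (Suc k) i) \<le> cmod z * cmod (u k i) + cmod (w k i)"
        using norm_triangle_ineq[of "z * u k i" "w k i"] by (simp add: w_def norm_mult)
      also have "\<dots> \<le> cmod z * (C' * lp ^ k) + C * lp ^ k"
        by (intro add_mono mult_left_mono Suc C) auto
      also have "\<dots> \<le> cmod z * (C' * lp ^ k) + C' * (lp - cmod z) * lp ^ k"
        using c lp by (intro add_left_mono mult_right_mono) auto
      also have "\<dots> = C' * lp ^ Suc k" by (simp add: algebra_simps)
      finally show ?case .
    qed
    with True show ?thesis by blast
  next
    case False
    \<comment> \<open>Apply q(S) first: each w k satisfies both A w = z w and w (Suc k) = z w k, so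
      it is zero because z is no eigenvalue. Hence q already annihilates u.\<close>
    define w where "w k i = shift_poly q (\<lambda>k. u k i) k" for k i
    have w1: "w (Suc k) i = z * w k i" for k i
      using Suc.prems(3)[of i k] unfolding q shift_poly_linear_factor(2) w_def by simp
    have w2: "w (Suc k) i = (\<Sum>j\<in>UNIV. complex_of_real (A $ i $ j) * w k j)" for k i
      unfolding w_def shift_poly_def
      by (simp add: Suc.prems(2) sum_distrib_left mult.assoc mult.left_commute) (rule sum.swap)
    have "w k i = 0" for k i
      using eigenvalue_ofI[of A "w k" z i] w1 w2 False by metis
    then have "\<And>k i. shift_poly q (\<lambda>k. u k i) k = 0" unfolding w_def .
    from Suc.hyps(1)[OF dq q0 Suc.prems(2) this] show ?thesis .
  qed
qed

text \<open>The n+1 vectors v, Av, ..., A^n v are linearly dependent. A repetition among them is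
  treated apart, since dependence is a notion for sets.\<close>

lemma matpow_annihilator:
  fixes A :: "real^'n^'n" and v :: "real^'n"
  obtains c :: "nat \<Rightarrow> real" where "\<exists>i\<le>CARD('n). c i \<noteq> 0"
    "(\<Sum>i\<le>CARD('n). c i *\<^sub>R (((*v) A ^^ i) v)) = 0"
proof (cases "inj_on (\<lambda>i. ((*v) A ^^ i) v) {..CARD('n)}")
  case False
  then obtain i j where ij: "i \<le> CARD('n)" "j \<le> CARD('n)" "i \<noteq> j" "((*v) A ^^ i) v = ((*v) A ^^ j) v"
    unfolding inj_on_def by auto
  have "(\<Sum>m\<le>CARD('n). (if m = i then 1 else if m = j then -1 else 0) *\<^sub>R (((*v) A ^^ m) v))
      = (\<Sum>m\<in>{i, j}. (if m = i then 1 else if m = j then -1 else 0) *\<^sub>R (((*v) A ^^ m) v))"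
    by (rule sum.mono_neutral_right) (use ij in auto)
  also have "\<dots> = 0" using ij by simp
  finally show ?thesis using ij by (intro that) auto
next
  case True
  let ?g = "\<lambda>i. ((*v) A ^^ i) v"
  let ?S = "?g ` {..CARD('n)}"
  have "card ?S = Suc CARD('n)" using card_image[OF True] by simp
  then have "dependent ?S" by (intro dependent_biggerset) auto
  then obtain u where u: "(\<Sum>w\<in>?S. u w *\<^sub>R w) = 0" "\<exists>w\<in>?S. u w \<noteq> 0"
    by (subst (asm) dependent_finite) auto
  from u(1) have "(\<Sum>i\<le>CARD('n). u (?g i) *\<^sub>R ?g i) = 0"
    by (subst (asm) sum.reindex[OF True]) simp
  with u(2) show ?thesis by (intro that[of "\<lambda>i. u (?g i)"]) auto
qed

lemma linear_funpow: "linear ((*v) (A::real^'n^'n) ^^ k)"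
proof (induction k)
  case (Suc k)
  then show ?case using linear_compose[OF Suc, of "(*v) A"] by (simp add: o_def)
qed (simp add: linear_id[unfolded id_def] id_def)

lemma matpow_growth_vec:
  fixes A :: "real^'n^'n" and v :: "real^'n"
  assumes "\<And>z. eigenvalue_of A z \<Longrightarrow> cmod z < lp"
  shows "((\<exists>z. eigenvalue_of A z) \<longrightarrow> (\<exists>C. \<forall>k i. \<bar>((*v) A ^^ k) v $ i\<bar> \<le> C * lp ^ k)) \<and>
    ((\<nexists>z. eigenvalue_of A z) \<longrightarrow> v = 0)"
proof -
  obtain c where c: "\<exists>i\<le>CARD('n). c i \<noteq> 0" "(\<Sum>i\<le>CARD('n). c i *\<^sub>R (((*v) A ^^ i) v)) = 0"
    using matpow_annihilator[of A v] by blast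
  define p where "p = Poly (map (\<lambda>i. complex_of_real (c i)) [0..<Suc (CARD('n))])"
  have cp: "coeff p i = (if i \<le> CARD('n) then complex_of_real (c i) else 0)" for i
    by (auto simp: p_def nth_default_def simp del: upt_Suc)
  have p0: "p \<noteq> 0" using c(1) cp by (metis coeff_0 of_real_eq_0_iff)
  have dp: "degree p \<le> CARD('n)" by (rule degree_le) (simp add: cp)
  let ?u = "\<lambda>k i. complex_of_real (((*v) A ^^ k) v $ i)"
  have u1: "?u (Suc k) i = (\<Sum>j\<in>UNIV. complex_of_real (A $ i $ j) * ?u k j)" for k i
    by (simp add: matrix_vector_mult_def)
  have lin: "linear ((*v) A ^^ k)" for k
    by (rule linear_funpow)
  have u2: "shift_poly p (\<lambda>k. ?u k i) k = 0" for k i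
  proof -
    have "0 = ((*v) A ^^ k) (\<Sum>i\<le>CARD('n). c i *\<^sub>R (((*v) A ^^ i) v))" using c(2) linear_0[OF lin] by simp
    also have "\<dots> = (\<Sum>m\<le>CARD('n). c m *\<^sub>R (((*v) A ^^ (k + m)) v))"
      by (simp add: linear_sum[OF lin] linear_cmul[OF lin] funpow_add)
    finally have eq: "0 = (\<Sum>m\<le>CARD('n). c m *\<^sub>R (((*v) A ^^ (k + m)) v))" .
    have "0 = (\<Sum>m\<le>CARD('n). c m * (((*v) A ^^ (k + m)) v) $ i)"
      using arg_cong[OF eq, of "\<lambda>v. v $ i"] by simp
    then have "complex_of_real 0 = complex_of_real (\<Sum>m\<le>CARD('n). c m * (((*v) A ^^ (k + m)) v) $ i)" by (rule arg_cong)
    then show ?thesis unfolding shift_poly_bound[OF dp] by (simp add: cp)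
  qed
  from orbit_growth[OF p0 u1 u2 assms]
  have *: "((\<exists>z. eigenvalue_of A z) \<longrightarrow> (\<exists>C. \<forall>k i. cmod (?u k i) \<le> C * lp ^ k)) \<and> ((\<nexists>z. eigenvalue_of A z) \<longrightarrow> (\<forall>k i. ?u k i = 0))" .
  have "v = 0" if "\<forall>k i. ?u k i = 0" using that[rule_format, of 0] by (simp add: vec_eq_iff)
  with * show ?thesis by (auto simp only: norm_of_real)
qed

text \<open>The orbits of the basis vectors are O(lp^k) componentwise; linearity then gives the
  operator bound.\<close>

lemma matpow_growth:
  fixes A :: "real^'n^'n"
  assumes "\<And>z. eigenvalue_of A z \<Longrightarrow> cmod z < lp"
  obtains C where "C > 0" "\<And>k x. norm (((*v) A ^^ k) x) \<le> C * lp ^ k * norm x"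
proof -
  have ex: "\<exists>z. eigenvalue_of A z"
    using matpow_growth_vec[OF assms, of A "axis undefined 1"] by (auto simp: axis_eq_0_iff)
  then have lp: "lp > 0" using assms by (meson norm_ge_zero order_le_less_trans)
  have "\<forall>j. \<exists>C. \<forall>k i. \<bar>((*v) A ^^ k) (axis j 1) $ i\<bar> \<le> C * lp ^ k"
    using ex matpow_growth_vec[OF assms] by blast
  then obtain C where C: "\<And>j k i. \<bar>((*v) A ^^ k) (axis j 1) $ i\<bar> \<le> C j * lp ^ k" by metis
  have C0: "C j \<ge> 0" for j using C[of 0 j undefined] by (smt (verit) power_0 mult_cancel_left1 mult.right_neutral)
  have lin: "linear ((*v) A ^^ k)" for k
    by (rule linear_funpow)
  let ?K = "real CARD('n) * (\<Sum>j\<in>UNIV. C j) + 1"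
  have "norm (((*v) A ^^ k) x) \<le> ?K * lp ^ k * norm x" for k x
  proof -
    have comp: "\<bar>((*v) A ^^ k) x $ i\<bar> \<le> (\<Sum>j\<in>UNIV. C j) * lp ^ k * norm x" for i
    proof -
      have x: "x = (\<Sum>j\<in>UNIV. x $ j *\<^sub>R axis j 1)"
        by (simp add: vec_eq_iff axis_def if_distrib cong: if_cong)
      have "((*v) A ^^ k) x = (\<Sum>j\<in>UNIV. x $ j *\<^sub>R ((*v) A ^^ k) (axis j 1))"
        by (subst x) (simp add: linear_cmul[OF lin] linear_sum[OF lin])
      then have "\<bar>((*v) A ^^ k) x $ i\<bar> = \<bar>\<Sum>j\<in>UNIV. x $ j * ((*v) A ^^ k) (axis j 1) $ i\<bar>" by simp
      also have "\<dots> \<le> (\<Sum>j\<in>UNIV. \<bar>x $ j\<bar> * \<bar>((*v) A ^^ k) (axis j 1) $ i\<bar>)"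
        by (rule order_trans[OF sum_abs]) (simp add: abs_mult)
      also have "\<dots> \<le> (\<Sum>j\<in>UNIV. norm x * (C j * lp ^ k))"
        by (intro sum_mono mult_mono C component_le_norm_cart) auto
      also have "\<dots> = (\<Sum>j\<in>UNIV. C j) * lp ^ k * norm x"
        by (simp add: sum_distrib_left sum_distrib_right algebra_simps)
      finally show ?thesis .
    qed
    have "norm (((*v) A ^^ k) x) \<le> (\<Sum>i\<in>UNIV. \<bar>((*v) A ^^ k) x $ i\<bar>)" by (rule norm_le_l1_cart)
    also have "\<dots> \<le> (\<Sum>i\<in>(UNIV::'n set). (\<Sum>j\<in>UNIV. C j) * lp ^ k * norm x)" by (intro sum_mono comp)
    also have "\<dots> = (real CARD('n) * (\<Sum>j\<in>UNIV. C j)) * (lp ^ k * norm x)" by simp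
    also have "\<dots> \<le> ?K * (lp ^ k * norm x)" using lp by (intro mult_right_mono) auto
    finally show ?thesis by (simp add: mult.assoc)
  qed
  moreover have "?K > 0" using C0 by (smt (verit) mult_nonneg_nonneg of_nat_0_le_iff sum_nonneg)
  ultimately show thesis using that by blast
qed

text \<open>Without eigenvalues the growth lemma, whose hypothesis is then vacuous, would force a
  basis vector to be 0.\<close>

lemma eigenvalue_exists: fixes A :: "real^'n^'n" obtains z where "eigenvalue_of A z"
proof -
  have "\<exists>z. eigenvalue_of A z"
  proof (rule ccontr)
    assume "\<nexists>z. eigenvalue_of A z"
    then show False using matpow_growth_vec[of A 1 "axis undefined 1"] by (auto simp: axis_eq_0_iff)
  qed
  with that show thesis by blast
qed


section \<open>Polynomials of bounded degree in several variables\<close>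

definition pmono :: "('n::finite \<Rightarrow> nat) \<Rightarrow> real^'n \<Rightarrow> real" where
  "pmono \<alpha> x = (\<Prod>i\<in>UNIV. (x $ i) ^ \<alpha> i)"

lemma finite_multi_indices [simp]: "finite (multi_indices d :: ('n::finite \<Rightarrow> nat) set)"
proof -
  have "(multi_indices d :: ('n \<Rightarrow> nat) set) \<subseteq> PiE UNIV (\<lambda>_. {..d})"
  proof
    fix \<alpha> :: "'n \<Rightarrow> nat" assume "\<alpha> \<in> multi_indices d"
    then have "sum \<alpha> UNIV \<le> d" by (simp add: multi_indices_def)
    moreover have "\<alpha> i \<le> sum \<alpha> UNIV" for i by (rule member_le_sum) auto
    ultimately show "\<alpha> \<in> PiE UNIV (\<lambda>_. {..d})" by (auto intro: order_trans)
  qed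
  then show ?thesis by (rule finite_subset) (auto intro: finite_PiE)
qed

lemma poly_le_iff: "poly_le d P \<longleftrightarrow> (\<exists>c. P = (\<lambda>x. \<Sum>\<alpha>\<in>multi_indices d. c \<alpha> * pmono \<alpha> x))"
  unfolding poly_le_def pmono_def ..

lemma poly_le_cmult: assumes "poly_le d P" shows "poly_le d (\<lambda>x. a * P x)"
proof -
  obtain c where c: "P = (\<lambda>x. \<Sum>\<alpha>\<in>multi_indices d. c \<alpha> * pmono \<alpha> x)" using assms poly_le_iff by blast
  show ?thesis unfolding c poly_le_iff by (intro exI[of _ "\<lambda>\<alpha>. a * c \<alpha>"]) (simp add: sum_distrib_left mult.assoc)
qed

lemma poly_le_add: assumes "poly_le d P" "poly_le d Q" shows "poly_le d (\<lambda>x. P x + Q x)"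
proof -
  obtain c where c: "P = (\<lambda>x. \<Sum>\<alpha>\<in>multi_indices d. c \<alpha> * pmono \<alpha> x)" using assms poly_le_iff by blast
  obtain e where e: "Q = (\<lambda>x. \<Sum>\<alpha>\<in>multi_indices d. e \<alpha> * pmono \<alpha> x)" using assms poly_le_iff by blast
  show ?thesis unfolding c e poly_le_iff
    by (intro exI[of _ "\<lambda>\<alpha>. c \<alpha> + e \<alpha>"]) (simp add: sum.distrib algebra_simps)
qed

lemma poly_le_diff: assumes "poly_le d P" "poly_le d Q" shows "poly_le d (\<lambda>x. P x - Q x)"
  using poly_le_add[OF assms(1) poly_le_cmult[OF assms(2), of "-1"]] by simp

lemma poly_le_zero: "poly_le d (\<lambda>x. 0)"
  unfolding poly_le_iff by (intro exI[of _ "\<lambda>_. 0"]) simp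

lemma poly_le_sum: assumes "\<And>i. i \<in> I \<Longrightarrow> poly_le d (P i)" shows "poly_le d (\<lambda>x. \<Sum>i\<in>I. P i x)"
  using assms by (induction I rule: infinite_finite_induct) (auto intro: poly_le_zero poly_le_add)

lemma poly_le_mono: assumes "\<alpha> \<in> multi_indices d" shows "poly_le d (pmono \<alpha>)"
  unfolding poly_le_iff
proof (intro exI[of _ "\<lambda>\<beta>. if \<beta> = \<alpha> then 1 else 0"] ext)
  fix x show "pmono \<alpha> x = (\<Sum>\<beta>\<in>multi_indices d. (if \<beta> = \<alpha> then 1 else 0) * pmono \<beta> x)"
    using assms by (simp add: if_distrib[of "\<lambda>a. a * _"] cong: if_cong)
qed

text \<open>Properties stable under adding one multiple of a monomial are proved without handling
  the coefficient family.\<close>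

lemma poly_le_induct [consumes 1, case_names zero pmono]:
  assumes "poly_le d P" and "Q (\<lambda>x. 0)"
    and "\<And>c \<alpha> P. \<alpha> \<in> multi_indices d \<Longrightarrow> Q P \<Longrightarrow> Q (\<lambda>x. c * pmono \<alpha> x + P x)"
  shows "Q P"
proof -
  obtain c where c: "P = (\<lambda>x. \<Sum>\<alpha>\<in>multi_indices d. c \<alpha> * pmono \<alpha> x)" using assms poly_le_iff by blast
  have "Q (\<lambda>x. \<Sum>\<alpha>\<in>F. c \<alpha> * pmono \<alpha> x)" if "finite F" "F \<subseteq> multi_indices d" for F
    using that by (induction F rule: finite_induct) (simp_all add: assms(2,3))
  from this[of "multi_indices d"] show ?thesis unfolding c by simp
qed

lemma poly_le_le: assumes "poly_le d P" "d \<le> e" shows "poly_le e P"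
  using assms(1)
proof (induction rule: poly_le_induct)
  case (pmono c \<alpha> P)
  then have "\<alpha> \<in> multi_indices e" using assms(2) by (auto simp: multi_indices_def)
  then show ?case by (intro poly_le_add poly_le_cmult poly_le_mono pmono)
qed (rule poly_le_zero)

lemma poly_le_const: "poly_le d (\<lambda>x::real^'n. c)"
proof -
  have "poly_le d (pmono (\<lambda>_::'n. 0))" by (rule poly_le_mono) (simp add: multi_indices_def)
  moreover have "pmono (\<lambda>_::'n. 0) = (\<lambda>x. 1)" by (auto simp: pmono_def)
  ultimately show ?thesis using poly_le_cmult[of d "\<lambda>x. 1" c] by simp
qed

lemma poly_le_coord: "poly_le 1 (\<lambda>x::real^'n. x $ i)"
proof -
  let ?\<alpha> = "\<lambda>j::'n. if j = i then 1 else 0 :: nat"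
  have "poly_le 1 (pmono ?\<alpha>)" by (rule poly_le_mono) (simp add: multi_indices_def)
  moreover have "pmono ?\<alpha> = (\<lambda>x. x $ i)"
  proof
    fix x :: "real^'n"
    have "pmono ?\<alpha> x = (\<Prod>j\<in>UNIV. if j = i then x $ j else 1)"
      unfolding pmono_def by (rule prod.cong) auto
    then show "pmono ?\<alpha> x = x $ i" by simp
  qed
  ultimately show ?thesis by simp
qed

lemma poly_le_mult: assumes "poly_le d P" "poly_le e Q" shows "poly_le (d + e) (\<lambda>x. P x * Q x)"
proof -
  obtain c where c: "P = (\<lambda>x. \<Sum>\<alpha>\<in>multi_indices d. c \<alpha> * pmono \<alpha> x)" using assms poly_le_iff by blast
  obtain c' where c': "Q = (\<lambda>x. \<Sum>\<alpha>\<in>multi_indices e. c' \<alpha> * pmono \<alpha> x)" using assms poly_le_iff by blast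
  have m: "pmono \<alpha> x * pmono \<beta> x = pmono (\<lambda>i. \<alpha> i + \<beta> i) x" for \<alpha> \<beta> and x :: "real^'n"
    by (simp add: pmono_def power_add prod.distrib)
  have "(\<lambda>x. P x * Q x) = (\<lambda>x. \<Sum>\<alpha>\<in>multi_indices d. \<Sum>\<beta>\<in>multi_indices e. (c \<alpha> * c' \<beta>) * pmono (\<lambda>i. \<alpha> i + \<beta> i) x)"
    unfolding c c' sum_product by (intro ext sum.cong refl) (simp add: m[symmetric])
  moreover have "poly_le (d + e) \<dots>"
    by (intro poly_le_sum poly_le_cmult poly_le_mono) (auto simp: multi_indices_def sum.distrib add_mono)
  ultimately show ?thesis by simp
qed

lemma poly_le_power: assumes "poly_le d P" shows "poly_le (d * m) (\<lambda>x. P x ^ m)"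
proof (induction m)
  case (Suc m) then show ?case using poly_le_mult[OF assms Suc] by (simp add: mult.commute)
qed (simp add: poly_le_const)

lemma poly_le_prod:
  assumes "\<And>i. i \<in> I \<Longrightarrow> poly_le (d i) (P i)" shows "poly_le (sum d I) (\<lambda>x. \<Prod>i\<in>I. P i x)"
  using assms by (induction I rule: infinite_finite_induct) (auto intro: poly_le_const poly_le_mult)

lemma poly_le_affine:
  assumes "poly_le d P" shows "poly_le d (\<lambda>x. P (v + M *v x))"
  using assms
proof (induction rule: poly_le_induct)
  case (pmono c \<alpha> P)
  have "poly_le 1 (\<lambda>x. v $ i + (\<Sum>j\<in>UNIV. M $ i $ j * x $ j))" for i
    by (intro poly_le_add poly_le_const poly_le_sum poly_le_cmult poly_le_coord)
  then have "poly_le (\<Sum>i\<in>UNIV. 1 * \<alpha> i) (\<lambda>x. \<Prod>i\<in>UNIV. (v $ i + (\<Sum>j\<in>UNIV. M $ i $ j * x $ j)) ^ \<alpha> i)"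
    by (intro poly_le_prod poly_le_power)
  moreover have "(\<Sum>i\<in>UNIV. 1 * \<alpha> i) \<le> d" using pmono(1) by (simp add: multi_indices_def)
  ultimately have "poly_le d (\<lambda>x. pmono \<alpha> (v + M *v x))"
    unfolding pmono_def matrix_vector_mult_def by (simp add: poly_le_le)
  then show ?case by (intro poly_le_add poly_le_cmult pmono)
qed (rule poly_le_zero)

lemma mono_bound:
  assumes "\<alpha> \<in> multi_indices d" shows "\<bar>pmono \<alpha> x\<bar> \<le> (1 + norm x) ^ d"
proof -
  have "\<bar>pmono \<alpha> x\<bar> = (\<Prod>i\<in>UNIV. \<bar>x $ i\<bar> ^ \<alpha> i)" by (simp add: pmono_def abs_prod power_abs)
  also have "\<dots> \<le> (\<Prod>i\<in>UNIV. (1 + norm x) ^ \<alpha> i)"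
    by (intro prod_mono conjI power_mono) (auto intro: order_trans[OF component_le_norm_cart])
  also have "\<dots> = (1 + norm x) ^ (\<Sum>i\<in>UNIV. \<alpha> i)" by (simp add: power_sum)
  also have "\<dots> \<le> (1 + norm x) ^ d" using assms by (intro power_increasing) (auto simp: multi_indices_def)
  finally show ?thesis .
qed

lemma poly_le_growth:
  assumes "poly_le d P" obtains C where "C \<ge> 0" "\<And>x. \<bar>P x\<bar> \<le> C * (1 + norm x) ^ d"
proof -
  have "\<exists>C\<ge>0. \<forall>x. \<bar>P x\<bar> \<le> C * (1 + norm x) ^ d"
    using assms
  proof (induction rule: poly_le_induct)
    case (pmono c \<alpha> P)
    then obtain C where C: "C \<ge> 0" "\<And>x. \<bar>P x\<bar> \<le> C * (1 + norm x) ^ d" by blast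
    have "\<bar>c * pmono \<alpha> x + P x\<bar> \<le> (\<bar>c\<bar> + C) * (1 + norm x) ^ d" for x
      using mono_bound[OF pmono(1), of x] C(2)[of x] abs_triangle_ineq[of "c * pmono \<alpha> x" "P x"]
        mult_left_mono[OF mono_bound[OF pmono(1), of x], of "\<bar>c\<bar>"]
      by (simp add: abs_mult algebra_simps)
    then show ?case using C(1) by (intro exI[of _ "\<bar>c\<bar> + C"]) auto
  qed (auto intro: exI[of _ 0])
  with that show thesis by blast
qed

lemma poly_le_continuous: assumes "poly_le d P" shows "continuous_on UNIV P"
  using assms
proof (induction rule: poly_le_induct)
  case (pmono c \<alpha> P)
  have "continuous_on UNIV (pmono \<alpha>)"
    unfolding pmono_def by (intro continuous_intros)
  then show ?case using pmono by (intro continuous_intros)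
qed (rule continuous_on_const)

text \<open>Restricted to the line through 0 and x, the polynomial is univariate and vanishes on an
  interval, hence has infinitely many roots.\<close>

lemma poly_le_eq_zero:
  assumes "poly_le d P" and "open S" "0 \<in> S" and "\<And>x. x \<in> S \<Longrightarrow> P x = 0"
  shows "P x = 0"
proof -
  obtain c where c: "P = (\<lambda>x. \<Sum>\<alpha>\<in>multi_indices d. c \<alpha> * pmono \<alpha> x)" using assms poly_le_iff by blast
  define p where "p = (\<Sum>\<alpha>\<in>multi_indices d. monom (c \<alpha> * pmono \<alpha> x) (\<Sum>i\<in>UNIV. \<alpha> i))"
  have p: "poly p t = P (t *\<^sub>R x)" for t
    by (simp add: p_def c poly_sum poly_monom pmono_def power_mult_distrib prod.distrib power_sum algebra_simps)
  have "continuous (at 0) (\<lambda>t::real. t *\<^sub>R x)" by (intro continuous_intros)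
  then have "((\<lambda>t::real. t *\<^sub>R x) \<longlongrightarrow> 0) (at 0)" by (simp add: continuous_at)
  from topological_tendstoD[OF this assms(2,3)] have "eventually (\<lambda>t::real. t *\<^sub>R x \<in> S) (at 0)" .
  then obtain e where e: "e > 0" "\<And>t::real. t \<noteq> 0 \<Longrightarrow> \<bar>t\<bar> < e \<Longrightarrow> t *\<^sub>R x \<in> S"
    unfolding eventually_at by (auto simp: dist_real_def)
  have "{0<..<e} \<subseteq> {t. poly p t = 0}" using e assms(4) by (auto simp: p)
  moreover have "infinite {0<..<e}" using e(1) by simp
  ultimately have "infinite {t. poly p t = 0}" using finite_subset by blast
  then have "p = 0" using poly_roots_finite by blast
  then show ?thesis using p[of 1] by simp
qed

lemma set_integrable_continuous:
  fixes F :: "'a::euclidean_space \<Rightarrow> real"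
  assumes "continuous_on UNIV F" "bounded S" "S \<in> sets lebesgue"
  shows "set_integrable lebesgue S F"
proof -
  obtain a where "S \<subseteq> cbox (-a) a" using bounded_subset_cbox_symmetric[OF assms(2)] by blast
  moreover have "set_integrable lebesgue (cbox (-a) a) F"
    using assms(1) by (intro absolutely_integrable_continuous) (auto intro: continuous_on_subset)
  ultimately show ?thesis using assms(3) set_integrable_subset by blast
qed

lemma set_integrable_sum:
  fixes f :: "'i \<Rightarrow> 'a \<Rightarrow> real"
  assumes "\<And>i. i \<in> I \<Longrightarrow> set_integrable M S (f i)"
  shows "set_integrable M S (\<lambda>x. \<Sum>i\<in>I. f i x)"
  using assms unfolding set_integrable_def scaleR_sum_right by (intro Bochner_Integration.integrable_sum) auto

lemma set_lebesgue_integral_sum: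
  fixes f :: "'i \<Rightarrow> 'a \<Rightarrow> real"
  assumes "\<And>i. i \<in> I \<Longrightarrow> set_integrable M S (f i)"
  shows "(LINT x:S|M. \<Sum>i\<in>I. f i x) = (\<Sum>i\<in>I. LINT x:S|M. f i x)"
  using assms unfolding set_integrable_def set_lebesgue_integral_def scaleR_sum_right
  by (intro Bochner_Integration.integral_sum) auto

text \<open>Gram-Schmidt in L^2(S), one function at a time. The orthonormal functions are kept as a
  set, so a linearly dependent input simply adds nothing.\<close>

lemma gram_schmidt:
  fixes S :: "(real^'n) set"
  assumes fin: "finite F" and F: "\<And>f. f \<in> F \<Longrightarrow> poly_le d f"
    and S: "open S" "0 \<in> S" "bounded S"
  shows "\<exists>E. finite E \<and> (\<forall>e\<in>E. poly_le d e) \<and>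
      (\<forall>e\<in>E. \<forall>e'\<in>E. (LINT x:S|lebesgue. e x * e' x) = (if e = e' then 1 else 0)) \<and>
      (\<forall>f\<in>F. \<exists>a. f = (\<lambda>x. \<Sum>e\<in>E. a e * e x))"
proof -
  have int: "set_integrable lebesgue S (\<lambda>x. f x * g x)" if "poly_le d f" "poly_le d g" for f g
    using that S by (intro set_integrable_continuous continuous_on_mult poly_le_continuous) auto
  show ?thesis
    using fin F
  proof (induction F rule: finite_induct)
    case empty then show ?case by (intro exI[of _ "{}"]) auto
  next
    case (insert f F)
    then obtain E where E: "finite E" "\<forall>e\<in>E. poly_le d e"
      "\<forall>e\<in>E. \<forall>e'\<in>E. (LINT x:S|lebesgue. e x * e' x) = (if e = e' then 1 else 0)"
      "\<forall>f\<in>F. \<exists>a. f = (\<lambda>x. \<Sum>e\<in>E. a e * e x)" by auto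
    define a where "a e = (LINT x:S|lebesgue. f x * e x)" for e
    \<comment> \<open>The component of f orthogonal to everything constructed so far.\<close>
    define g where "g x = f x - (\<Sum>e\<in>E. a e * e x)" for x
    have f: "poly_le d f" using insert.prems by simp
    have g: "poly_le d g" unfolding g_def using E f by (intro poly_le_diff poly_le_sum poly_le_cmult) auto
    have ge: "(LINT x:S|lebesgue. g x * e x) = 0" if e: "e \<in> E" for e
    proof -
      have i: "set_integrable lebesgue S (\<lambda>x. a e' * (e' x * e x))" if "e' \<in> E" for e'
        using int[of e' e] E that e by auto
      have "(LINT x:S|lebesgue. g x * e x) = (LINT x:S|lebesgue. f x * e x - (\<Sum>e'\<in>E. a e' * (e' x * e x)))"
        by (simp add: g_def left_diff_distrib sum_distrib_right mult.assoc)
      also have "\<dots> = a e - (LINT x:S|lebesgue. (\<Sum>e'\<in>E. a e' * (e' x * e x)))"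
      proof -
        have "set_integrable lebesgue S (\<lambda>x. \<Sum>e'\<in>E. a e' * (e' x * e x))" by (rule set_integrable_sum) (rule i)
        then show ?thesis using int[OF f, of e] E e by (subst set_integral_diff) (auto simp: a_def)
      qed
      also have "(LINT x:S|lebesgue. (\<Sum>e'\<in>E. a e' * (e' x * e x))) = (\<Sum>e'\<in>E. LINT x:S|lebesgue. a e' * (e' x * e x))"
        by (rule set_lebesgue_integral_sum) (rule i)
      also have "\<dots> = (\<Sum>e'\<in>E. if e' = e then a e' else 0)"
        by (rule sum.cong) (use E(3) e in auto)
      also have "\<dots> = a e" using E(1) e by simp
      finally show ?thesis by simp
    qed
    define G where "G = (LINT x:S|lebesgue. g x * g x)"
    show ?case
    proof (cases "g = (\<lambda>x. 0)")
      case True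
      then have "f = (\<lambda>x. \<Sum>e\<in>E. a e * e x)" unfolding g_def by (metis eq_iff_diff_eq_0)
      then show ?thesis using E by (intro exI[of _ E]) auto
    next
      case False
      \<comment> \<open>If g had norm 0, its nonvanishing set within S would be open and null, hence
        empty; a polynomial vanishing near 0 is zero.\<close>
      have "G \<noteq> 0"
      proof
        assume "G = 0"
        then have "AE x in lebesgue. indicator S x *\<^sub>R (g x * g x) = 0"
          unfolding G_def set_lebesgue_integral_def using int[OF g g]
          by (subst (asm) integral_nonneg_eq_0_iff_AE) (auto simp: set_integrable_def)
        then have ae: "AE x in lebesgue. x \<notin> {x \<in> S. g x \<noteq> 0}" by (rule eventually_mono) auto
        have "{x \<in> S. g x \<noteq> 0} = S \<inter> {x. g x \<noteq> 0}" by auto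
        moreover have "open {x. g x \<noteq> 0}"
          using poly_le_continuous[OF g] by (intro open_Collect_neq) auto
        ultimately have op: "open {x \<in> S. g x \<noteq> 0}" using S(1) by auto
        moreover from op have "negligible {x \<in> S. g x \<noteq> 0}"
          using ae by (subst negligible_iff_null_sets) (simp add: AE_iff_null_sets)
        ultimately have "{x \<in> S. g x \<noteq> 0} = {}" using open_not_negligible by blast
        then have "g x = 0" for x using poly_le_eq_zero[OF g S(1,2)] by blast
        then show False using False by auto
      qed
      moreover have "G \<ge> 0" unfolding G_def set_lebesgue_integral_def
        by (intro integral_nonneg_AE) auto
      ultimately have G: "G > 0" by simp
      define e0 where "e0 x = (1 / sqrt G) * g x" for x
      have e0: "poly_le d e0" unfolding e0_def using g by (rule poly_le_cmult)
      have e0e: "(LINT x:S|lebesgue. e0 x * e x) = 0" "(LINT x:S|lebesgue. e x * e0 x) = 0" if "e \<in> E" for e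
        using ge[OF that] by (simp_all add: e0_def mult.assoc mult.commute[of "e _"] del: times_divide_eq_left)
      have e0e0: "(LINT x:S|lebesgue. e0 x * e0 x) = 1"
      proof -
        have "(LINT x:S|lebesgue. e0 x * e0 x) = (LINT x:S|lebesgue. (1 / G) * (g x * g x))"
          using G by (simp add: e0_def divide_simps)
        also have "\<dots> = 1" using G unfolding set_integral_mult_right G_def[symmetric] by simp
        finally show ?thesis .
      qed
      have e0E: "e0 \<notin> E" using e0e(1) e0e0 by force
      have f_eq: "f = (\<lambda>x. \<Sum>e\<in>insert e0 E. (if e = e0 then sqrt G else a e) * e x)"
      proof
        fix x
        have "(\<Sum>e\<in>E. (if e = e0 then sqrt G else a e) * e x) = (\<Sum>e\<in>E. a e * e x)"
          by (rule sum.cong) (use e0E in auto)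
        then have "(\<Sum>e\<in>insert e0 E. (if e = e0 then sqrt G else a e) * e x) = sqrt G * e0 x + (\<Sum>e\<in>E. a e * e x)"
          using E(1) e0E by (simp only: sum.insert if_True simp_thms)
        also have "\<dots> = f x"
        proof -
          have "sqrt G * (1 / sqrt G * y) = y" for y using G by simp
          then show ?thesis unfolding e0_def g_def by (simp only: diff_add_cancel)
        qed
        finally show "f x = (\<Sum>e\<in>insert e0 E. (if e = e0 then sqrt G else a e) * e x)" by (rule sym)
      qed
      have old: "\<exists>a'. f' = (\<lambda>x. \<Sum>e\<in>insert e0 E. a' e * e x)" if "f' \<in> F" for f'
      proof -
        from bspec[OF E(4) that] obtain b where b: "f' = (\<lambda>x. \<Sum>e\<in>E. b e * e x)" by (rule exE)
        define b' where "b' e = (if e = e0 then 0 else b e)" for e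
        have eq: "(\<Sum>e\<in>E. b' e * e x) = (\<Sum>e\<in>E. b e * e x)" for x
        proof (rule sum.cong[OF refl])
          fix e assume "e \<in> E"
          then have "e \<noteq> e0" using e0E by blast
          then show "b' e * e x = b e * e x" unfolding b'_def by (simp only: if_False)
        qed
        have "b' e0 = 0" unfolding b'_def by simp
        then have "(\<Sum>e\<in>insert e0 E. b' e * e x) = (\<Sum>e\<in>E. b e * e x)" for x
          unfolding sum.insert[OF E(1) e0E] eq by (simp only: mult_zero_left add_0)
        then have "f' = (\<lambda>x. \<Sum>e\<in>insert e0 E. b' e * e x)" unfolding b by (simp only:)
        then show ?thesis by (rule exI[of _ b'])
      qed
      show ?thesis
      proof (intro exI[of _ "insert e0 E"] conjI ballI)
        show "finite (insert e0 E)" using E(1) by simp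
        show "poly_le d e" if "e \<in> insert e0 E" for e using that e0 E(2) by blast
        show "(LINT x:S|lebesgue. e x * e' x) = (if e = e' then 1 else 0)" if "e \<in> insert e0 E" "e' \<in> insert e0 E" for e e'
        proof (cases "e = e0")
          case True
          then show ?thesis using that(2) e0e(1)[of e'] e0e0 e0E by (cases "e' = e0") (simp_all only: if_True if_False, auto)
        next
          case False
          then show ?thesis using that e0e(2)[of e] E(3) e0E by (cases "e' = e0") auto
        qed
        show "\<exists>a'. f' = (\<lambda>x. \<Sum>e\<in>insert e0 E. a' e * e x)" if "f' \<in> insert f F" for f'
        proof (cases "f' = f")
          case True show ?thesis unfolding True using f_eq by (rule exI[of _ "\<lambda>e. if e = e0 then sqrt G else a e"])
        next
          case False then show ?thesis using that by (intro old) blast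
        qed
      qed
    qed
  qed
qed


section \<open>Change of variables to the unit ellipsoid\<close>

context aniso begin

lemma pw_measurable [measurable]: "pw k \<in> borel_measurable borel"
proof -
  have "continuous_on UNIV (pw k)" using pw_linear by (simp add: linear_continuous_on linear_conv_bounded_linear)
  then show ?thesis by (rule borel_measurable_continuous_onI)
qed

text \<open>Lebesgue measure is determined by its values on boxes, and the preimage of a box under y
  \<mapsto> x0 + A^k y has volume b^(-k) times that of the box.\<close>

lemma lborel_pw:
  "lborel = density (distr lborel borel (\<lambda>y. x0 + pw k y)) (\<lambda>_. ennreal (bdet A powr real_of_int k))"
proof (rule lborel_eqI)
  fix l u :: "real^'n" assume lu: "\<And>b. b \<in> Basis \<Longrightarrow> l \<bullet> b \<le> u \<bullet> b"
  let ?b = "bdet A powr real_of_int k"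
  obtain M where M: "\<And>x. pw (-k) x = M *v x" "\<bar>det M\<bar> = bdet A powr real_of_int (-k)" using pw_matrix by blast
  have pre: "(\<lambda>y. x0 + pw k y) -` box l u = ((*v) M) ` ((\<lambda>x. x - x0) ` box l u)"
  proof (intro equalityI subsetI)
    fix y assume "y \<in> (\<lambda>y. x0 + pw k y) -` box l u"
    then have "x0 + pw k y \<in> box l u" by simp
    moreover have "y = M *v ((x0 + pw k y) - x0)" unfolding M(1)[symmetric] by simp
    ultimately show "y \<in> ((*v) M) ` ((\<lambda>x. x - x0) ` box l u)" by blast
  next
    fix y assume "y \<in> ((*v) M) ` ((\<lambda>x. x - x0) ` box l u)"
    then obtain x where "x \<in> box l u" "y = pw (-k) (x - x0)" unfolding M(1) by blast
    then show "y \<in> (\<lambda>y. x0 + pw k y) -` box l u" by simp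
  qed
  have lm: "(\<lambda>x. x - x0) ` box l u \<in> lmeasurable" by (intro measurable_translation_subtract) auto
  have lm2: "(*v) M ` (\<lambda>x. x - x0) ` box l u \<in> lmeasurable"
    and me: "measure lebesgue ((*v) M ` (\<lambda>x. x - x0) ` box l u) = bdet A powr real_of_int (-k) * measure lebesgue (box l u)"
    using lmeasurable_measure_linear_image[OF _ lm, of "(*v) M"] M(2) by (simp_all add: measure_translation_subtract)
  have borel: "(\<lambda>y. x0 + pw k y) -` box l u \<in> sets borel"
    using measurable_sets[of "\<lambda>y. x0 + pw k y" borel borel "box l u"] by simp
  have "emeasure (density (distr lborel borel (\<lambda>y. x0 + pw k y)) (\<lambda>_. ennreal ?b)) (box l u)
      = ennreal ?b * emeasure lborel ((\<lambda>y. x0 + pw k y) -` box l u)"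
    by (subst emeasure_density_const) (simp_all add: emeasure_distr)
  also have "emeasure lborel ((\<lambda>y. x0 + pw k y) -` box l u) = emeasure lebesgue ((\<lambda>y. x0 + pw k y) -` box l u)"
    using borel by simp
  also have "\<dots> = ennreal (bdet A powr real_of_int (-k) * measure lebesgue (box l u))"
    using lm2 me unfolding pre by (simp add: emeasure_eq_measure2)
  also have "ennreal ?b * \<dots> = ennreal (measure lebesgue (box l u))"
    using b_gt1 by (simp add: ennreal_mult[symmetric] powr_minus field_simps)
  also have "\<dots> = ennreal (\<Prod>b\<in>Basis. (u - l) \<bullet> b)"
  proof -
    have "ennreal (measure lebesgue (box l u)) = emeasure lebesgue (box l u)"
      by (simp add: emeasure_eq_measure2)
    then show ?thesis using emeasure_lborel_box[of l u] lu by simp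
  qed
  finally show "emeasure (density (distr lborel borel (\<lambda>y. x0 + pw k y)) (\<lambda>_. ennreal ?b)) (box l u) = (\<Prod>b\<in>Basis. (u - l) \<bullet> b)" .
qed simp

lemma set_integral_bl_transform:
  assumes F: "continuous_on UNIV (F :: real^'n \<Rightarrow> real)"
  shows "(LINT x:bl x0 k|lebesgue. F (pw (-k) (x - x0))) = bdet A powr real_of_int k * (LINT y:D|lebesgue. F y)"
proof -
  have [measurable]: "F \<in> borel_measurable borel" using F by (rule borel_measurable_continuous_onI)
  have [measurable]: "D \<in> sets borel" "bl x0 k \<in> sets borel" using D_open bl_open by auto
  let ?h = "\<lambda>x. indicator (bl x0 k) x *\<^sub>R F (pw (-k) (x - x0))"
  have "(LINT x:bl x0 k|lebesgue. F (pw (-k) (x - x0))) = integral\<^sup>L lborel ?h"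
    unfolding set_lebesgue_integral_def by (rule integral_completion) measurable
  also have "\<dots> = integral\<^sup>L (density (distr lborel borel (\<lambda>y. x0 + pw k y)) (\<lambda>_. ennreal (bdet A powr real_of_int k))) ?h"
    using lborel_pw[of x0 k] by simp
  also have "\<dots> = (LINT x|distr lborel borel (\<lambda>y. x0 + pw k y). bdet A powr real_of_int k * ?h x)"
    by (subst integral_density) simp_all
  also have "\<dots> = (LINT y|lborel. bdet A powr real_of_int k * ?h (x0 + pw k y))"
    by (subst integral_distr) simp_all
  also have "\<dots> = (LINT y|lborel. bdet A powr real_of_int k * (indicator D y *\<^sub>R F y))"
  proof (rule Bochner_Integration.integral_cong[OF refl])
    fix y
    have "x0 + pw k y \<in> bl x0 k \<longleftrightarrow> y \<in> D" unfolding bl_iff by (simp add: G_def D_iff)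
    then show "bdet A powr real_of_int k * ?h (x0 + pw k y) = bdet A powr real_of_int k * (indicator D y *\<^sub>R F y)"
      by (simp add: indicator_def)
  qed
  also have "\<dots> = bdet A powr real_of_int k * integral\<^sup>L lborel (\<lambda>y. indicator D y *\<^sub>R F y)" by simp
  also have "integral\<^sup>L lborel (\<lambda>y. indicator D y *\<^sub>R F y) = (LINT y:D|lebesgue. F y)"
    unfolding set_lebesgue_integral_def by (rule integral_completion[symmetric]) measurable
  finally show ?thesis .
qed

end

section \<open>Polynomial projections and their bounds on enlarged balls\<close>

locale aniso_poly = aniso A D r for A :: "real^'n^'n" and D r +
  fixes lp :: real and d :: nat
  assumes lp: "\<And>z. eigenvalue_of A z \<Longrightarrow> cmod z < lp" and lp1: "1 < lp"
begin

lemma onb_exists: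
  "\<exists>E. finite E \<and> (\<forall>e\<in>E. poly_le d (e :: real^'n \<Rightarrow> real)) \<and>
      (\<forall>e\<in>E. \<forall>e'\<in>E. (LINT x:D|lebesgue. e x * e' x) = (if e = e' then 1 else 0)) \<and>
      (\<forall>P x. poly_le d P \<longrightarrow> P x = (\<Sum>e\<in>E. (LINT x:D|lebesgue. P x * e x) * e x))"
proof -
  have z: "0 \<in> D" by (simp add: D_iff)
  have F: "poly_le d f" if "f \<in> pmono ` multi_indices d" for f :: "real^'n \<Rightarrow> real"
    using that poly_le_mono by blast
  have fin: "finite ((pmono :: _ \<Rightarrow> real^'n \<Rightarrow> real) ` multi_indices d)" by simp
  from gram_schmidt[OF fin F D_open z D_bounded] obtain E where E0: "finite E \<and> (\<forall>e\<in>E. poly_le d (e :: real^'n \<Rightarrow> real)) \<and>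
      (\<forall>e\<in>E. \<forall>e'\<in>E. (LINT x:D|lebesgue. e x * e' x) = (if e = e' then 1 else 0)) \<and>
      (\<forall>f\<in>pmono ` multi_indices d. \<exists>a. f = (\<lambda>x. \<Sum>e\<in>E. a e * e x))" by (rule exE)
  have E: "finite E" "\<And>e. e \<in> E \<Longrightarrow> poly_le d e"
    "\<And>e e'. e \<in> E \<Longrightarrow> e' \<in> E \<Longrightarrow> (LINT x:D|lebesgue. e x * e' x) = (if e = e' then 1 else 0)"
    "\<And>f. f \<in> pmono ` multi_indices d \<Longrightarrow> \<exists>a. f = (\<lambda>x. \<Sum>e\<in>E. a e * e x)"
    subgoal using E0 by (elim conjE)
    subgoal using E0 by (elim conjE) (erule (1) bspec)
    subgoal using E0 by (elim conjE) (drule (1) bspec, drule (1) bspec, assumption)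
    subgoal using E0 by (elim conjE) (drule (1) bspec, assumption)
    done
  have rep: "P x = (\<Sum>e\<in>E. (LINT x:D|lebesgue. P x * e x) * e x)" if P: "poly_le d P" for P x
  proof -
    have "\<exists>a. P = (\<lambda>x. \<Sum>e\<in>E. a e * e x)" using P
    proof (induction rule: poly_le_induct)
      case zero show ?case by (rule exI[of _ "\<lambda>_. 0"]) simp
    next
      case (pmono c \<alpha> P)
      from pmono(2) obtain a where a: "P = (\<lambda>x. \<Sum>e\<in>E. a e * e x)" by (rule exE)
      from E(4)[of "pmono \<alpha>"] pmono(1) obtain a' where a': "pmono \<alpha> = (\<lambda>x. \<Sum>e\<in>E. a' e * e x)" by auto
      show ?case unfolding a a'
        by (rule exI[of _ "\<lambda>e. c * a' e + a e"]) (simp add: sum_distrib_left sum.distrib algebra_simps)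
    qed
    then obtain a where a: "P = (\<lambda>x. \<Sum>e\<in>E. a e * e x)" by (rule exE)
    have "(LINT x:D|lebesgue. P x * e x) = a e" if e: "e \<in> E" for e
    proof -
      have i: "set_integrable lebesgue D (\<lambda>x. a e' * (e' x * e x))" if "e' \<in> E" for e'
        using E(2) e that D_bounded D_sets
        by (intro set_integrable_continuous continuous_on_mult poly_le_continuous continuous_on_const) auto
      have "(LINT x:D|lebesgue. P x * e x) = (LINT x:D|lebesgue. \<Sum>e'\<in>E. a e' * (e' x * e x))"
        unfolding a by (simp add: sum_distrib_right mult.assoc)
      also have "\<dots> = (\<Sum>e'\<in>E. LINT x:D|lebesgue. a e' * (e' x * e x))"
        by (rule set_lebesgue_integral_sum) (rule i)
      also have "\<dots> = (\<Sum>e'\<in>E. if e' = e then a e' else 0)"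
        by (rule sum.cong) (use E(3) e in auto)
      also have "\<dots> = a e" using E(1) e by simp
      finally show ?thesis .
    qed
    then show ?thesis by (subst a) (intro sum.cong refl, simp)
  qed
  show ?thesis
  proof (intro exI[of _ E] conjI ballI allI impI)
    show "finite E" by (rule E(1))
    show "poly_le d e" if "e \<in> E" for e by (rule E(2)[OF that])
    show "(LINT x:D|lebesgue. e x * e' x) = (if e = e' then 1 else 0)" if "e \<in> E" "e' \<in> E" for e e'
      by (rule E(3)[OF that])
    show "P x = (\<Sum>e\<in>E. (LINT x:D|lebesgue. P x * e x) * e x)" if "poly_le d P" for P x by (rule rep[OF that])
  qed
qed

text \<open>One fixed orthonormal basis of the polynomials of degree at most d in L^2(D). All
  projections are expressed by it, so constants derived from it do not depend on the ball.\<close>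

definition onb :: "(real^'n \<Rightarrow> real) set" where
  "onb = (SOME E. finite E \<and> (\<forall>e\<in>E. poly_le d (e :: real^'n \<Rightarrow> real)) \<and>
      (\<forall>e\<in>E. \<forall>e'\<in>E. (LINT x:D|lebesgue. e x * e' x) = (if e = e' then 1 else 0)) \<and>
      (\<forall>P x. poly_le d P \<longrightarrow> P x = (\<Sum>e\<in>E. (LINT x:D|lebesgue. P x * e x) * e x)))"

lemma onb: "finite onb" "\<And>e. e \<in> onb \<Longrightarrow> poly_le d e"
  "\<And>e e'. e \<in> onb \<Longrightarrow> e' \<in> onb \<Longrightarrow> (LINT x:D|lebesgue. e x * e' x) = (if e = e' then 1 else 0)"
  "\<And>P x. poly_le d P \<Longrightarrow> P x = (\<Sum>e\<in>onb. (LINT x:D|lebesgue. P x * e x) * e x)"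
proof -
  note s = someI_ex[OF onb_exists, folded onb_def]
  from s show "finite onb" by (elim conjE)
  from s show "\<And>e. e \<in> onb \<Longrightarrow> poly_le d e" by (elim conjE) (erule bspec)
  from s show "\<And>e e'. e \<in> onb \<Longrightarrow> e' \<in> onb \<Longrightarrow> (LINT x:D|lebesgue. e x * e' x) = (if e = e' then 1 else 0)"
    by (elim conjE) (drule (1) bspec, drule (1) bspec, assumption)
  from s show "\<And>P x. poly_le d P \<Longrightarrow> P x = (\<Sum>e\<in>onb. (LINT x:D|lebesgue. P x * e x) * e x)"
    by (elim conjE) (drule spec, drule spec, erule mp)
qed

text \<open>The basis carried from D to the ball x0 + B_k. It stays orthogonal, with squared norm
  b^k.\<close>

definition eb where "eb x0 k e x = e (pw (-k) (x - x0))" for e :: "real^'n \<Rightarrow> real"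

lemma poly_le_pw: "poly_le d P \<Longrightarrow> poly_le d (\<lambda>x. P (v + pw k x))"
proof -
  assume P: "poly_le d P"
  obtain M where "\<And>x. pw k x = M *v x" using pw_matrix by blast
  then show ?thesis using poly_le_affine[OF P, of v M] by simp
qed

lemma eb_poly: "e \<in> onb \<Longrightarrow> poly_le d (eb x0 k e)"
  using poly_le_pw[OF onb(2), of e "- pw (-k) x0" "-k"] unfolding eb_def[abs_def] by (simp add: pw_simps)

lemma bl_integrable: "continuous_on UNIV (F :: real^'n \<Rightarrow> real) \<Longrightarrow> set_integrable lebesgue (bl x0 k) F"
  by (rule set_integrable_continuous) (auto intro: bl_bounded)

lemma eb_orth:
  assumes "e \<in> onb" "e' \<in> onb"
  shows "(LINT x:bl x0 k|lebesgue. eb x0 k e x * eb x0 k e' x) = (if e = e' then bdet A powr real_of_int k else 0)"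
proof -
  have "continuous_on UNIV (\<lambda>x. e x * e' x)"
    by (rule continuous_on_mult[OF poly_le_continuous[OF onb(2)[OF assms(1)]] poly_le_continuous[OF onb(2)[OF assms(2)]]])
  from set_integral_bl_transform[OF this, of x0 k] show ?thesis
    unfolding eb_def by (simp add: onb(3)[OF assms])
qed

lemma eb_repr:
  assumes "poly_le d P"
  shows "P x = (\<Sum>e\<in>onb. bdet A powr real_of_int (-k) * (LINT y:bl x0 k|lebesgue. P y * eb x0 k e y) * eb x0 k e x)"
proof -
  have P': "poly_le d (\<lambda>y. P (x0 + pw k y))" by (rule poly_le_pw[OF assms])
  have c: "(LINT y:D|lebesgue. P (x0 + pw k y) * e y) = bdet A powr real_of_int (-k) * (LINT y:bl x0 k|lebesgue. P y * eb x0 k e y)" if "e \<in> onb" for e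
  proof -
    have "continuous_on UNIV (\<lambda>y. P (x0 + pw k y) * e y)"
      by (rule continuous_on_mult[OF poly_le_continuous[OF P'] poly_le_continuous[OF onb(2)[OF that]]])
    from set_integral_bl_transform[OF this, of x0 k]
    have "(LINT x:bl x0 k|lebesgue. P x * eb x0 k e x) = bdet A powr real_of_int k * (LINT y:D|lebesgue. P (x0 + pw k y) * e y)"
      unfolding eb_def by simp
    then show ?thesis using b_gt1 by (simp add: powr_minus)
  qed
  have "P x = P (x0 + pw k (pw (-k) (x - x0)))" by simp
  also have "\<dots> = (\<Sum>e\<in>onb. (LINT y:D|lebesgue. P (x0 + pw k y) * e y) * e (pw (-k) (x - x0)))"
    by (rule onb(4)[OF P'])
  also have "\<dots> = (\<Sum>e\<in>onb. bdet A powr real_of_int (-k) * (LINT y:bl x0 k|lebesgue. P y * eb x0 k e y) * eb x0 k e x)"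
    by (intro sum.cong refl) (simp add: c eb_def)
  finally show ?thesis .
qed

text \<open>A point of x0 + B_{k+j} has the form x0 + A^{k+j} y with y in D, so rescaling by A^(-k)
  leaves A^j y, which is O(lp^j).\<close>

lemma pw_growth: obtains C where "C \<ge> 1" "\<And>x0 k j x. x \<in> bl x0 (k + int j) \<Longrightarrow> norm (pw (-k) (x - x0)) \<le> C * lp ^ j"
proof -
  obtain C1 where C1: "C1 > 0" "\<And>k x. norm (((*v) A ^^ k) x) \<le> C1 * lp ^ k * norm x"
    using matpow_growth[OF lp] by blast
  obtain C2 where C2: "\<And>x. x \<in> D \<Longrightarrow> norm x \<le> C2" using D_bounded unfolding bounded_iff by blast
  have "norm (pw (-k) (x - x0)) \<le> (1 + C1 * \<bar>C2\<bar>) * lp ^ j" if "x \<in> bl x0 (k + int j)" for x0 k j x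
  proof -
    obtain y where y: "y \<in> D" "x = x0 + pw (k + int j) y" using \<open>x \<in> _\<close> unfolding bl_eq_image by blast
    have "pw (-k) (x - x0) = pw (int j) y" using pw_add[of "-k" "k + int j" y] y by simp
    also have "\<dots> = ((*v) A ^^ j) y" by (simp add: pw_def matipow_map_def)
    finally have "norm (pw (-k) (x - x0)) \<le> C1 * lp ^ j * norm y" using C1(2) by simp
    also have "\<dots> \<le> C1 * lp ^ j * \<bar>C2\<bar>" using C1(1) C2[OF y(1)] lp1 by (intro mult_left_mono) auto
    also have "\<dots> \<le> (1 + C1 * \<bar>C2\<bar>) * lp ^ j" using lp1 by (simp add: algebra_simps)
    finally show ?thesis .
  qed
  moreover have "1 \<le> 1 + C1 * \<bar>C2\<bar>" using C1(1) by simp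
  ultimately show thesis using that by blast
qed

text \<open>A polynomial of degree d at a point of norm O(lp^j) is O(lp^(dj)). This is where every
  factor \<open>lp ^ (d * j)\<close> below originates.\<close>

lemma eb_bound: obtains C where "C \<ge> 1"
  "\<And>x0 k j x e. e \<in> onb \<Longrightarrow> x \<in> bl x0 (k + int j) \<Longrightarrow> \<bar>eb x0 k e x\<bar> \<le> C * lp ^ (d * j)"
proof -
  obtain C where C: "C \<ge> 1" "\<And>x0 k j x. x \<in> bl x0 (k + int j) \<Longrightarrow> norm (pw (-k) (x - x0)) \<le> C * lp ^ j"
    using pw_growth by blast
  have "\<forall>e\<in>onb. \<exists>K\<ge>0. \<forall>x. \<bar>e x\<bar> \<le> K * (1 + norm x) ^ d"
    using poly_le_growth onb(2) by metis
  then obtain K where K: "\<And>e. e \<in> onb \<Longrightarrow> K e \<ge> 0" "\<And>e x. e \<in> onb \<Longrightarrow> \<bar>e x\<bar> \<le> K e * (1 + norm x) ^ d"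
    by metis
  let ?C = "1 + sum K onb * (2 * C) ^ d"
  have "\<bar>eb x0 k e x\<bar> \<le> ?C * lp ^ (d * j)" if e: "e \<in> onb" and x: "x \<in> bl x0 (k + int j)" for x0 k j x e
  proof -
    have l: "1 \<le> lp ^ j" using lp1 by simp
    have l1: "1 \<le> C * lp ^ j" using mult_mono[OF C(1) l] C(1) by simp
    have s: "0 \<le> sum K onb" using K(1) by (rule sum_nonneg)
    have "\<bar>eb x0 k e x\<bar> \<le> K e * (1 + norm (pw (-k) (x - x0))) ^ d" unfolding eb_def by (rule K(2)[OF e])
    also have "\<dots> \<le> sum K onb * (2 * C * lp ^ j) ^ d"
      using C(2)[OF x] C(1) l1 s by (intro mult_mono power_mono member_le_sum e K(1) onb(1)) auto
    also have "\<dots> = sum K onb * (2 * C) ^ d * lp ^ (d * j)"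
      by (simp add: power_mult_distrib power_mult[symmetric] mult.commute)
    also have "\<dots> \<le> ?C * lp ^ (d * j)" using lp1 by (intro mult_right_mono) auto
    finally show ?thesis .
  qed
  moreover have "?C \<ge> 1" using K(1) C(1) by (simp add: sum_nonneg)
  ultimately show thesis using that by blast
qed

lemma integrable_times_bounded:
  fixes f h :: "real^'n \<Rightarrow> real"
  assumes "set_integrable lebesgue S f" "h \<in> borel_measurable borel" "S \<in> sets lebesgue" "\<And>x. x \<in> S \<Longrightarrow> \<bar>h x\<bar> \<le> K"
  shows "set_integrable lebesgue S (\<lambda>x. f x * h x)"
proof (rule set_integrable_bound[where f = "\<lambda>x. K * f x"])
  show "set_integrable lebesgue S (\<lambda>x. K * f x)" using assms(1) by auto
  have "(\<lambda>x. indicator S x *\<^sub>R f x) \<in> borel_measurable lebesgue"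
    using assms(1) unfolding set_integrable_def by (rule borel_measurable_integrable)
  moreover have "h \<in> borel_measurable lebesgue" using assms(2) by (intro measurable_completion) simp
  ultimately have "(\<lambda>x. (indicator S x *\<^sub>R f x) * h x) \<in> borel_measurable lebesgue" by (rule borel_measurable_times)
  then show "set_borel_measurable lebesgue S (\<lambda>x. f x * h x)" unfolding set_borel_measurable_def by (simp add: mult.assoc)
  show "AE x in lebesgue. x \<in> S \<longrightarrow> norm (f x * h x) \<le> norm (K * f x)"
  proof (intro AE_I2 impI)
    fix x assume "x \<in> S"
    then have "\<bar>h x\<bar> \<le> \<bar>K\<bar>" using assms(4)[of x] by linarith
    then show "norm (f x * h x) \<le> norm (K * f x)" using mult_right_mono[of "\<bar>h x\<bar>" "\<bar>K\<bar>" "\<bar>f x\<bar>"] by (simp add: abs_mult mult.commute)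
  qed
qed

lemma integrable_times_poly:
  assumes "set_integrable lebesgue (bl x0 k) f" "poly_le d h"
  shows "set_integrable lebesgue (bl x0 k) (\<lambda>x. f x * h x)"
proof -
  obtain C where C: "\<And>x. \<bar>h x\<bar> \<le> C * (1 + norm x) ^ d" "C \<ge> 0" using poly_le_growth[OF assms(2)] by metis
  obtain R where R: "\<And>x. x \<in> bl x0 k \<Longrightarrow> norm x \<le> R" using bl_bounded unfolding bounded_iff by blast
  have "\<bar>h x\<bar> \<le> C * (1 + R) ^ d" if "x \<in> bl x0 k" for x
    using C(1)[of x] R[OF that] C(2) by (meson add_left_mono mult_left_mono norm_ge_zero order_trans power_mono add_nonneg_nonneg zero_le_one)
  then show ?thesis using assms poly_le_continuous
    by (intro integrable_times_bounded[where K = "C * (1 + R) ^ d"]) (auto intro: borel_measurable_continuous_onI)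
qed

abbreviation proj :: "real^'n \<Rightarrow> int \<Rightarrow> (real^'n \<Rightarrow> real) \<Rightarrow> real^'n \<Rightarrow> real" where
  "proj x0 k f \<equiv> poly_proj d (bl x0 k) f"

text \<open>The orthogonal expansion in the basis \<open>eb\<close> satisfies the moment conditions.
  Any other solution has the same moments against the basis, so \<open>eb_repr\<close> applied to
  the difference identifies the two and evaluates the description in
  \<open>poly_proj\<close>.\<close>

lemma proj_exists:
  assumes f: "set_integrable lebesgue (bl x0 k) f"
  shows "poly_le d (proj x0 k f) \<and> (\<forall>h. poly_le d h \<longrightarrow> (LINT x:bl x0 k|lebesgue. (f x - proj x0 k f x) * h x) = 0)"
proof -
  let ?B = "bl x0 k" and ?c = "bdet A powr real_of_int (-k)"
  define Q where "Q x = (\<Sum>e\<in>onb. (?c * (LINT y:?B|lebesgue. f y * eb x0 k e y)) * eb x0 k e x)" for x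
  have Q: "poly_le d Q" unfolding Q_def by (intro poly_le_sum poly_le_cmult eb_poly)
  have ip: "set_integrable lebesgue ?B P" if "poly_le d P" for P
    by (rule bl_integrable) (rule poly_le_continuous[OF that])
  have ipp: "set_integrable lebesgue ?B (\<lambda>x. P x * R x)" if "poly_le d P" "poly_le d R" for P R
    by (rule integrable_times_poly[OF ip]) (rule that)+
  have intd: "(LINT x:?B|lebesgue. (f x - P x) * h x) = (LINT x:?B|lebesgue. f x * h x) - (LINT x:?B|lebesgue. P x * h x)"
    if "poly_le d P" "poly_le d h" for P h
    unfolding left_diff_distrib by (intro set_integral_diff integrable_times_poly f ip that)
  have orth_e: "(LINT x:?B|lebesgue. (f x - Q x) * eb x0 k e x) = 0" if e: "e \<in> onb" for e
  proof -
    let ?a = "\<lambda>e'. ?c * (LINT y:?B|lebesgue. f y * eb x0 k e' y)"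
    have "(LINT x:?B|lebesgue. Q x * eb x0 k e x) = (LINT x:?B|lebesgue. \<Sum>e'\<in>onb. ?a e' * (eb x0 k e' x * eb x0 k e x))"
      by (simp add: Q_def sum_distrib_right mult.assoc)
    also have "\<dots> = (\<Sum>e'\<in>onb. LINT x:?B|lebesgue. ?a e' * (eb x0 k e' x * eb x0 k e x))"
      by (intro set_lebesgue_integral_sum set_integrable_mult_right ipp eb_poly e)
    also have "\<dots> = (\<Sum>e'\<in>onb. if e' = e then (LINT y:?B|lebesgue. f y * eb x0 k e' y) else 0)"
    proof (rule sum.cong[OF refl])
      fix e' assume e': "e' \<in> onb"
      have "?c * bdet A powr real_of_int k = 1" using b_gt1 by (simp add: powr_minus)
      then have "?a e' * bdet A powr real_of_int k = (LINT y:?B|lebesgue. f y * eb x0 k e' y)"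
        by (simp only: mult.assoc mult.left_commute[of ?c] mult.right_neutral mult.commute[of _ "bdet A powr real_of_int k"]) simp
      then show "(LINT x:?B|lebesgue. ?a e' * (eb x0 k e' x * eb x0 k e x)) = (if e' = e then (LINT y:?B|lebesgue. f y * eb x0 k e' y) else 0)"
        unfolding set_integral_mult_right eb_orth[OF e' e] by auto
    qed
    also have "\<dots> = (LINT y:?B|lebesgue. f y * eb x0 k e y)" using onb(1) e by simp
    finally show ?thesis by (simp add: intd[OF Q eb_poly[OF e]])
  qed
  have orth: "(LINT x:?B|lebesgue. (f x - Q x) * h x) = 0" if h: "poly_le d h" for h
  proof -
    let ?a = "\<lambda>e. ?c * (LINT y:?B|lebesgue. h y * eb x0 k e y)"
    have fQ: "set_integrable lebesgue ?B (\<lambda>x. f x - Q x)" by (intro set_integral_diff f ip Q)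
    have hx: "h x = (\<Sum>e\<in>onb. ?a e * eb x0 k e x)" for x by (rule eb_repr[OF h])
    have "(LINT x:?B|lebesgue. (f x - Q x) * h x) = (LINT x:?B|lebesgue. \<Sum>e\<in>onb. ?a e * ((f x - Q x) * eb x0 k e x))"
      by (subst hx) (simp add: sum_distrib_left algebra_simps)
    also have "\<dots> = (\<Sum>e\<in>onb. LINT x:?B|lebesgue. ?a e * ((f x - Q x) * eb x0 k e x))"
      by (intro set_lebesgue_integral_sum set_integrable_mult_right integrable_times_poly fQ eb_poly)
    also have "\<dots> = 0" by (simp add: orth_e)
    finally show ?thesis .
  qed
  have "(THE P. poly_le d P \<and> (\<forall>h. poly_le d h \<longrightarrow> (LINT x:?B|lebesgue. (f x - P x) * h x) = 0)) = Q"
  proof (rule the_equality)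
    show "poly_le d Q \<and> (\<forall>h. poly_le d h \<longrightarrow> (LINT x:?B|lebesgue. (f x - Q x) * h x) = 0)" using Q orth by blast
    fix P assume P: "poly_le d P \<and> (\<forall>h. poly_le d h \<longrightarrow> (LINT x:?B|lebesgue. (f x - P x) * h x) = 0)"
    have R: "poly_le d (\<lambda>x. P x - Q x)" using P Q by (intro poly_le_diff) auto
    have z: "(LINT x:?B|lebesgue. (P x - Q x) * eb x0 k e x) = 0" if e: "e \<in> onb" for e
    proof -
      have "(LINT x:?B|lebesgue. P x * eb x0 k e x) = (LINT x:?B|lebesgue. f x * eb x0 k e x)"
        using intd[of P "eb x0 k e"] P eb_poly[OF e] by auto
      moreover have "(LINT x:?B|lebesgue. Q x * eb x0 k e x) = (LINT x:?B|lebesgue. f x * eb x0 k e x)"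
        using intd[OF Q eb_poly[OF e]] orth_e[OF e] by auto
      moreover have "(LINT x:?B|lebesgue. (P x - Q x) * eb x0 k e x) = (LINT x:?B|lebesgue. P x * eb x0 k e x) - (LINT x:?B|lebesgue. Q x * eb x0 k e x)"
        unfolding left_diff_distrib using P Q eb_poly[OF e] by (intro set_integral_diff ipp) auto
      ultimately show ?thesis by simp
    qed
    have "P x - Q x = 0" for x
      using eb_repr[OF R, of x k x0] z by simp
    then show "P = Q" by auto
  qed
  then have "proj x0 k f = Q" unfolding poly_proj_def .
  with Q orth show ?thesis by simp
qed

lemmas proj_poly = proj_exists[THEN conjunct1]

text \<open>A polynomial is recovered from its moments on x0 + B_k, and each moment is at most a
  constant times an L^1 norm there. Both claims are put under one constant, so that it can be chosen
  once and for all.\<close>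

lemma proj_bound_ex: "\<exists>C\<ge>1. (\<forall>x0 k j x f Q. set_integrable lebesgue (bl x0 k) f \<longrightarrow> poly_le d Q \<longrightarrow> x \<in> bl x0 (k + int j) \<longrightarrow>
     \<bar>proj x0 k f x - Q x\<bar> \<le> C * lp ^ (d * j) * (bdet A powr real_of_int (-k) * (LINT y:bl x0 k|lebesgue. \<bar>f y - Q y\<bar>))) \<and>
   (\<forall>x0 k j x Q. poly_le d Q \<longrightarrow> x \<in> bl x0 (k + int j) \<longrightarrow>
     \<bar>Q x\<bar> \<le> C * lp ^ (d * j) * (bdet A powr real_of_int (-k) * (LINT y:bl x0 k|lebesgue. \<bar>Q y\<bar>)))"
proof -
  obtain C where C: "C \<ge> 1" "\<And>x0 k j x e. e \<in> onb \<Longrightarrow> x \<in> bl x0 (k + int j) \<Longrightarrow> \<bar>eb x0 k e x\<bar> \<le> C * lp ^ (d * j)"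
    using eb_bound by blast
  let ?C = "1 + real (card onb) * C * C"
  have C1: "?C \<ge> 1" using C(1) by simp
  \<comment> \<open>Only equality of the moments of R and g is used. The two claims are the
    instances R = Pf - Q, g = f - Q and R = g = Q.\<close>
  have main: "\<bar>R x\<bar> \<le> ?C * lp ^ (d * j) * (bdet A powr real_of_int (-k) * (LINT y:bl x0 k|lebesgue. \<bar>g y\<bar>))"
    if R: "poly_le d R" and g: "set_integrable lebesgue (bl x0 k) g" and x: "x \<in> bl x0 (k + int j)"
      and eq: "\<And>e. e \<in> onb \<Longrightarrow> (LINT y:bl x0 k|lebesgue. R y * eb x0 k e y) = (LINT y:bl x0 k|lebesgue. g y * eb x0 k e y)"
    for R g x0 k j x
  proof -
    let ?I = "LINT y:bl x0 k|lebesgue. \<bar>g y\<bar>" and ?c = "bdet A powr real_of_int (-k)"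
    have I0: "?I \<ge> 0" unfolding set_lebesgue_integral_def by (intro integral_nonneg_AE) auto
    have b: "\<bar>LINT y:bl x0 k|lebesgue. g y * eb x0 k e y\<bar> \<le> C * ?I" if e: "e \<in> onb" for e
    proof -
      have ge: "set_integrable lebesgue (bl x0 k) (\<lambda>y. g y * eb x0 k e y)" by (intro integrable_times_poly g eb_poly e)
      have "\<bar>LINT y:bl x0 k|lebesgue. g y * eb x0 k e y\<bar> \<le> (LINT y:bl x0 k|lebesgue. \<bar>g y * eb x0 k e y\<bar>)"
        using set_integral_norm_bound[OF ge] by simp
      also have "\<dots> \<le> (LINT y:bl x0 k|lebesgue. C * \<bar>g y\<bar>)"
      proof (rule set_integral_mono)
        show "set_integrable lebesgue (bl x0 k) (\<lambda>y. \<bar>g y * eb x0 k e y\<bar>)" using ge by (rule set_integrable_abs)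
        show "set_integrable lebesgue (bl x0 k) (\<lambda>y. C * \<bar>g y\<bar>)" using set_integrable_abs[OF g] by auto
        fix y assume "y \<in> bl x0 k"
        then have "\<bar>eb x0 k e y\<bar> \<le> C" using C(2)[OF e, of y x0 k 0] by simp
        then show "\<bar>g y * eb x0 k e y\<bar> \<le> C * \<bar>g y\<bar>" using mult_right_mono[of "\<bar>eb x0 k e y\<bar>" C "\<bar>g y\<bar>"] by (simp add: abs_mult mult.commute)
      qed
      finally show ?thesis by simp
    qed
    have "\<bar>R x\<bar> = \<bar>\<Sum>e\<in>onb. ?c * (LINT y:bl x0 k|lebesgue. R y * eb x0 k e y) * eb x0 k e x\<bar>"
      using eb_repr[OF R] by simp
    also have "\<dots> \<le> (\<Sum>e\<in>onb. \<bar>?c * (LINT y:bl x0 k|lebesgue. R y * eb x0 k e y) * eb x0 k e x\<bar>)" by (rule sum_abs)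
    also have "\<dots> \<le> (\<Sum>e\<in>onb. ?c * (C * ?I) * (C * lp ^ (d * j)))"
    proof (rule sum_mono)
      fix e assume e: "e \<in> onb"
      have "\<bar>?c * (LINT y:bl x0 k|lebesgue. R y * eb x0 k e y) * eb x0 k e x\<bar> = ?c * \<bar>LINT y:bl x0 k|lebesgue. g y * eb x0 k e y\<bar> * \<bar>eb x0 k e x\<bar>"
        by (simp add: eq[OF e] abs_mult)
      also have "\<dots> \<le> ?c * (C * ?I) * (C * lp ^ (d * j))"
        using b[OF e] C(2)[OF e x] C(1) I0 by (intro mult_mono mult_nonneg_nonneg) auto
      finally show "\<bar>?c * (LINT y:bl x0 k|lebesgue. R y * eb x0 k e y) * eb x0 k e x\<bar> \<le> ?c * (C * ?I) * (C * lp ^ (d * j))" .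
    qed
    also have "\<dots> = real (card onb) * C * C * (lp ^ (d * j) * (?c * ?I))" by simp
    also have "\<dots> \<le> ?C * (lp ^ (d * j) * (?c * ?I))" using I0 lp1 by (intro mult_right_mono mult_nonneg_nonneg) auto
    finally show ?thesis by (simp add: mult.assoc)
  qed
  show ?thesis
  proof (intro exI[of _ ?C] conjI C1 allI impI)
    fix x0 k j x and f Q :: "real^'n \<Rightarrow> real"
    assume f: "set_integrable lebesgue (bl x0 k) f" and Q: "poly_le d Q" and x: "x \<in> bl x0 (k + int j)"
    let ?B = "bl x0 k" and ?P = "proj x0 k f"
    note P = proj_exists[OF f]
    have iQ: "set_integrable lebesgue ?B Q" and iP: "set_integrable lebesgue ?B ?P"
      using poly_le_continuous Q P by (auto intro: bl_integrable)
    show "\<bar>?P x - Q x\<bar> \<le> ?C * lp ^ (d * j) * (bdet A powr real_of_int (-k) * (LINT y:?B|lebesgue. \<bar>f y - Q y\<bar>))"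
    proof (rule main[OF _ _ x])
      show "poly_le d (\<lambda>x. ?P x - Q x)" using P Q by (intro poly_le_diff) auto
      show "set_integrable lebesgue ?B (\<lambda>y. f y - Q y)" by (intro set_integral_diff f iQ)
      fix e assume e: "e \<in> onb"
      note i = integrable_times_poly[OF _ eb_poly[OF e]]
      have "(LINT y:?B|lebesgue. (f y - ?P y) * eb x0 k e y) = 0" using P eb_poly[OF e] by blast
      moreover have "(LINT y:?B|lebesgue. (f y - ?P y) * eb x0 k e y) = (LINT y:?B|lebesgue. f y * eb x0 k e y) - (LINT y:?B|lebesgue. ?P y * eb x0 k e y)"
        unfolding left_diff_distrib by (intro set_integral_diff i f iP)
      moreover have "(LINT y:?B|lebesgue. (f y - Q y) * eb x0 k e y) = (LINT y:?B|lebesgue. f y * eb x0 k e y) - (LINT y:?B|lebesgue. Q y * eb x0 k e y)"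
        unfolding left_diff_distrib by (intro set_integral_diff i f iQ)
      moreover have "(LINT y:?B|lebesgue. (?P y - Q y) * eb x0 k e y) = (LINT y:?B|lebesgue. ?P y * eb x0 k e y) - (LINT y:?B|lebesgue. Q y * eb x0 k e y)"
        unfolding left_diff_distrib by (intro set_integral_diff i iP iQ)
      ultimately show "(LINT y:?B|lebesgue. (?P y - Q y) * eb x0 k e y) = (LINT y:?B|lebesgue. (f y - Q y) * eb x0 k e y)" by simp
    qed
  next
    fix x0 k j x and Q :: "real^'n \<Rightarrow> real" assume Q: "poly_le d Q" and x: "x \<in> bl x0 (k + int j)"
    show "\<bar>Q x\<bar> \<le> ?C * lp ^ (d * j) * (bdet A powr real_of_int (-k) * (LINT y:bl x0 k|lebesgue. \<bar>Q y\<bar>))"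
      by (rule main[OF Q bl_integrable[OF poly_le_continuous[OF Q]] x]) simp
  qed
qed

end


section \<open>Continuous approximation in L^1\<close>

lemma L1_continuous_approx:
  fixes f :: "'a::euclidean_space \<Rightarrow> real"
  assumes f: "set_integrable lebesgue S f" and S: "S \<in> lmeasurable" and e: "e > 0"
  obtains g where "continuous_on UNIV g" "(LINT x:S|lebesgue. \<bar>f x - g x\<bar>) < e"
proof -
  \<comment> \<open>Clipping at a fixed height makes the pointwise approximants uniformly bounded,
    so dominated convergence applies on the set S of finite measure. First the height is chosen,
    then the approximant.\<close>
  define clip :: "real \<Rightarrow> real \<Rightarrow> real" where "clip M y = max (- M) (min M y)" for M y
  have S': "S \<in> sets lebesgue" using S by (simp add: fmeasurableD)
  let ?f = "\<lambda>x. indicator S x *\<^sub>R f x"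
  have fi: "integrable lebesgue ?f" using f unfolding set_integrable_def .
  then have fm: "?f \<in> borel_measurable lebesgue" by auto
  have Sm: "indicator S \<in> borel_measurable lebesgue" using S' by auto
  have Si: "integrable lebesgue (indicator S :: _ \<Rightarrow> real)"
    using S unfolding fmeasurable_def by (intro integrable_real_indicator) auto
  obtain Z g where Z: "negligible Z" "\<And>n. continuous_on UNIV (g n)"
    "\<And>x. x \<notin> Z \<Longrightarrow> (\<lambda>n. g n x) \<longlonglongrightarrow> ?f x"
    using lebesgue_measurable_imp_measurable_on_real[OF fm, of UNIV] unfolding measurable_on_def by auto
  have cm: "continuous_on UNIV (clip M)" for M unfolding clip_def by (intro continuous_intros)
  then have cmm: "clip M \<in> borel_measurable borel" for M by (rule borel_measurable_continuous_onI)
  have gm: "g n \<in> borel_measurable lebesgue" for n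
    using borel_measurable_continuous_onI[OF Z(2)] by (intro measurable_completion) simp
  have cl: "\<bar>clip M y\<bar> \<le> M" if "M \<ge> 0" for M y using that by (auto simp: clip_def)
  have clf: "(\<lambda>x. clip M (?f x)) \<in> borel_measurable lebesgue" for M
    using measurable_compose[OF fm cmm] by simp
  have "(\<lambda>M. LINT x|lebesgue. \<bar>?f x - clip (real M) (?f x)\<bar>) \<longlonglongrightarrow> (LINT x::'a|lebesgue. 0)"
  proof (rule integral_dominated_convergence[where w = "\<lambda>x. 2 * \<bar>?f x\<bar>"])
    show "integrable lebesgue (\<lambda>x. 2 * \<bar>?f x\<bar>)" using fi by auto
    show "AE x in lebesgue. (\<lambda>M. \<bar>?f x - clip (real M) (?f x)\<bar>) \<longlonglongrightarrow> 0"
    proof (rule AE_I2)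
      fix x
      obtain M0 :: nat where M0: "\<bar>?f x\<bar> \<le> real M0" using real_arch_simple by blast
      have "eventually (\<lambda>M. \<bar>?f x - clip (real M) (?f x)\<bar> = 0) sequentially"
        using eventually_ge_at_top[of M0]
      proof eventually_elim
        case (elim M) then show ?case using M0 by (auto simp: clip_def)
      qed
      then show "(\<lambda>M. \<bar>?f x - clip (real M) (?f x)\<bar>) \<longlonglongrightarrow> 0" by (rule tendsto_eventually)
    qed
    show "AE x in lebesgue. norm \<bar>?f x - clip (real M) (?f x)\<bar> \<le> 2 * \<bar>?f x\<bar>" for M
      by (intro AE_I2) (auto simp: clip_def)
  qed (use fm clf in auto)
  then have "eventually (\<lambda>M. (LINT x|lebesgue. \<bar>?f x - clip (real M) (?f x)\<bar>) < e / 2) sequentially"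
    using e by (intro order_tendstoD) auto
  then obtain M where M: "(LINT x|lebesgue. \<bar>?f x - clip (real M) (?f x)\<bar>) < e / 2"
    by (auto simp: eventually_sequentially)
  let ?h = "\<lambda>n x. indicator S x * \<bar>clip (real M) (?f x) - clip (real M) (g n x)\<bar>"
  have hm: "?h n \<in> borel_measurable lebesgue" for n
    using Sm clf measurable_compose[OF gm cmm] by (intro borel_measurable_times borel_measurable_abs borel_measurable_diff) auto
  have hb: "norm (?h n x) \<le> 2 * real M * indicator S x" for n x
    using cl[of "real M" "?f x"] cl[of "real M" "g n x"] by (auto simp: indicator_def)
  have hi: "integrable lebesgue (?h n)" for n
    by (rule Bochner_Integration.integrable_bound[where f = "\<lambda>x. 2 * real M * indicator S x"])
      (use Si hm hb in \<open>auto intro!: AE_I2\<close>)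
  have "(\<lambda>n. LINT x|lebesgue. ?h n x) \<longlonglongrightarrow> (LINT x::'a|lebesgue. 0)"
  proof (rule integral_dominated_convergence[where w = "\<lambda>x. 2 * real M * indicator S x"])
    show "integrable lebesgue (\<lambda>x. 2 * real M * indicator S x)" using Si by auto
    have "AE x in lebesgue. x \<notin> Z" using Z(1) by (simp add: AE_not_in negligible_iff_null_sets)
    then show "AE x in lebesgue. (\<lambda>n. ?h n x) \<longlonglongrightarrow> 0"
    proof eventually_elim
      case (elim x)
      have "(\<lambda>n. clip (real M) (g n x)) \<longlonglongrightarrow> clip (real M) (?f x)"
        unfolding clip_def by (intro tendsto_intros Z(3) elim)
      then have "(\<lambda>n. ?h n x) \<longlonglongrightarrow> indicator S x * \<bar>clip (real M) (?f x) - clip (real M) (?f x)\<bar>"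
        by (intro tendsto_intros)
      then show ?case by simp
    qed
    show "AE x in lebesgue. norm (?h n x) \<le> 2 * real M * indicator S x" for n
      using hb by (intro AE_I2)
  qed (use hm in auto)
  then have "eventually (\<lambda>n. (LINT x|lebesgue. ?h n x) < e / 2) sequentially"
    using e by (intro order_tendstoD) auto
  then obtain n where n: "(LINT x|lebesgue. ?h n x) < e / 2" by (auto simp: eventually_sequentially)
  let ?g = "\<lambda>x. clip (real M) (g n x)"
  have "(LINT x:S|lebesgue. \<bar>f x - ?g x\<bar>) \<le> (LINT x|lebesgue. \<bar>?f x - clip (real M) (?f x)\<bar> + ?h n x)"
    unfolding set_lebesgue_integral_def
  proof (rule integral_mono_AE')
    have a: "integrable lebesgue (\<lambda>x. clip (real M) (?f x))"
      by (rule Bochner_Integration.integrable_bound[OF fi clf]) (auto intro!: AE_I2 simp: clip_def)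
    show "integrable lebesgue (\<lambda>x. \<bar>?f x - clip (real M) (?f x)\<bar> + ?h n x)"
      using fi a hi by (intro Bochner_Integration.integrable_add integrable_abs Bochner_Integration.integrable_diff)
    show "AE x in lebesgue. indicator S x *\<^sub>R \<bar>f x - ?g x\<bar> \<le> \<bar>?f x - clip (real M) (?f x)\<bar> + ?h n x"
    proof (rule AE_I2)
      fix x show "indicator S x *\<^sub>R \<bar>f x - ?g x\<bar> \<le> \<bar>?f x - clip (real M) (?f x)\<bar> + ?h n x"
        using abs_triangle_ineq[of "f x - clip (real M) (f x)" "clip (real M) (f x) - ?g x"] by (cases "x \<in> S") auto
    qed
  qed (auto intro!: AE_I2)
  also have "\<dots> = (LINT x|lebesgue. \<bar>?f x - clip (real M) (?f x)\<bar>) + (LINT x|lebesgue. ?h n x)"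
  proof (rule Bochner_Integration.integral_add)
    have a: "integrable lebesgue (\<lambda>x. clip (real M) (?f x))"
      by (rule Bochner_Integration.integrable_bound[OF fi clf]) (auto intro!: AE_I2 simp: clip_def)
    show "integrable lebesgue (\<lambda>x. \<bar>?f x - clip (real M) (?f x)\<bar>)"
      using fi a by (intro integrable_abs Bochner_Integration.integrable_diff)
  qed (rule hi)
  also have "\<dots> < e" using M n by simp
  finally have "(LINT x:S|lebesgue. \<bar>f x - ?g x\<bar>) < e" .
  moreover have "continuous_on UNIV ?g"
    by (rule continuous_on_compose2[OF cm Z(2)]) auto
  ultimately show thesis using that by blast
qed

section \<open>Nested cubes adapted to the dilation\<close>

context aniso_poly begin

definition floorvec :: "real^'n \<Rightarrow> int^'n" where "floorvec v = (\<chi> i. \<lfloor>v $ i\<rfloor>)"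
definition ofintvec :: "int^'n \<Rightarrow> real^'n" where "ofintvec m = (\<chi> i. of_int (m $ i))"

text \<open>The mesh \<delta> is so small that a coordinate box of that size has gauge at most 1/8.
  The number a of scales between generations is so large that one generation at least halves gauges
  and that a ball a scales smaller moves coordinates by less than \<delta>/4. The numbers 1/8 and
  1/4 leave room for two rounding errors.\<close>

lemma grid_constants: "\<exists>\<delta> a. \<delta> > 0 \<and> 2 \<le> r ^ a \<and> a > 0 \<and> (\<forall>y. (\<forall>i. \<bar>y $ i\<bar> \<le> \<delta>) \<longrightarrow> G 0 y \<le> 1/8) \<and>
     (\<forall>y. G (- int a) y < 1 \<longrightarrow> (\<forall>i. \<bar>y $ i\<bar> < \<delta> / 4))"
proof -
  obtain K where K: "K > 0" "\<And>y. norm (Pm *v y) \<le> norm y * K"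
    using bounded_linear.pos_bounded[OF matrix_vector_mul_bounded_linear[of Pm]] by auto
  obtain K' where K': "K' > 0" "\<And>x. norm x \<le> K' * norm (Pm *v x)" using norm_le_P by blast
  define \<delta> where "\<delta> = 1 / (8 * K * real CARD('n))"
  have d: "\<delta> > 0" using K(1) by (simp add: \<delta>_def)
  obtain a where a: "max 2 (4 * K' / \<delta>) < r ^ a" using r1 real_arch_pow by blast
  have 1: "G 0 y \<le> 1/8" if "\<forall>i. \<bar>y $ i\<bar> \<le> \<delta>" for y
  proof -
    have "norm y \<le> (\<Sum>i\<in>UNIV. \<bar>y $ i\<bar>)" by (rule norm_le_l1_cart)
    also have "\<dots> \<le> (\<Sum>i\<in>(UNIV::'n set). \<delta>)" using that by (intro sum_mono) auto
    finally have "norm y * K \<le> real CARD('n) * \<delta> * K" using K(1) by (intro mult_right_mono) auto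
    then show ?thesis using K(2)[of y] K(1) by (simp add: G_def \<delta>_def)
  qed
  have 2: "\<bar>y $ i\<bar> < \<delta> / 4" if "G (- int a) y < 1" for y i
  proof -
    have "r ^ a * G 0 y < 1" using G_step[of a "- int a" y] that by simp
    then have "4 * K' / \<delta> * G 0 y \<le> r ^ a * G 0 y" using a by (intro mult_right_mono) auto
    with \<open>r ^ a * G 0 y < 1\<close> have "4 * K' / \<delta> * G 0 y < 1" by simp
    then have "K' * G 0 y < \<delta> / 4" using d by (simp add: field_simps)
    then show ?thesis using K'(2)[of y] component_le_norm_cart[of y i] by (simp add: G_def)
  qed
  have "2 \<le> r ^ a" using a by simp
  moreover have "a > 0" using a by (cases a) auto
  ultimately show ?thesis using d 1 2 by (intro exI[of _ \<delta>] exI[of _ a]) blast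
qed

definition gd :: real where "gd = (SOME \<delta>. \<exists>a. \<delta> > 0 \<and> 2 \<le> r ^ a \<and> a > 0 \<and> (\<forall>y. (\<forall>i. \<bar>y $ i\<bar> \<le> \<delta>) \<longrightarrow> G 0 y \<le> 1/8) \<and>
     (\<forall>y. G (- int a) y < 1 \<longrightarrow> (\<forall>i. \<bar>y $ i\<bar> < \<delta> / 4)))"
definition ga :: nat where "ga = (SOME a. gd > 0 \<and> 2 \<le> r ^ a \<and> a > 0 \<and> (\<forall>y. (\<forall>i. \<bar>y $ i\<bar> \<le> gd) \<longrightarrow> G 0 y \<le> 1/8) \<and>
     (\<forall>y. G (- int a) y < 1 \<longrightarrow> (\<forall>i. \<bar>y $ i\<bar> < gd / 4)))"

lemma grid: "gd > 0" "2 \<le> r ^ ga" "ga > 0" "\<And>y. (\<And>i. \<bar>y $ i\<bar> \<le> gd) \<Longrightarrow> G 0 y \<le> 1/8"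
  "\<And>y i. G (- int ga) y < 1 \<Longrightarrow> \<bar>y $ i\<bar> < gd / 4"
  using someI_ex[OF someI_ex[OF grid_constants, folded gd_def], folded ga_def] by auto

abbreviation half :: "real^'n" where "half \<equiv> (\<chi> i. gd / 2)"

definition lev :: "int \<Rightarrow> nat \<Rightarrow> int" where "lev k0 i = k0 - int (i * ga)"

text \<open>Rounds x down to the lattice o' + A^k (gd Z^n).\<close>

definition snap :: "real^'n \<Rightarrow> int \<Rightarrow> real^'n \<Rightarrow> real^'n" where
  "snap o' k x = o' + pw k (gd *\<^sub>R ofintvec (floorvec ((1 / gd) *\<^sub>R pw (-k) (x - o'))))"

lemma snap_close: "G k (x - snap o' k x) \<le> 1/8"
proof -
  let ?y = "pw (-k) (x - o')"
  have "G k (x - snap o' k x) = G 0 (?y - gd *\<^sub>R ofintvec (floorvec ((1 / gd) *\<^sub>R ?y)))"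
  proof -
    have "x - snap o' k x = pw k (?y - gd *\<^sub>R ofintvec (floorvec ((1 / gd) *\<^sub>R ?y)))"
      unfolding snap_def pw_simps(2) by (simp add: algebra_simps)
    then show ?thesis by (simp add: G_pw)
  qed
  also have "\<dots> \<le> 1/8"
  proof (rule grid(4))
    fix i
    have "of_int \<lfloor>?y $ i / gd\<rfloor> * gd \<le> ?y $ i"
      by (rule pos_le_divide_eq[THEN iffD1, OF grid(1) of_int_floor_le])
    then have "0 \<le> ?y $ i - gd * of_int \<lfloor>?y $ i / gd\<rfloor>" by (simp add: mult.commute)
    moreover have "?y $ i / gd \<le> of_int \<lfloor>?y $ i / gd\<rfloor> + 1" by linarith
    then have "?y $ i - gd * of_int \<lfloor>?y $ i / gd\<rfloor> \<le> gd" using grid(1) by (simp add: pos_divide_le_eq algebra_simps)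
    ultimately show "\<bar>(?y - gd *\<^sub>R ofintvec (floorvec ((1 / gd) *\<^sub>R ?y))) $ i\<bar> \<le> gd"
      by (simp add: ofintvec_def floorvec_def)
  qed
  finally show ?thesis .
qed

text \<open>A lattice cell has c as its corner and \<open>c + pw k half\<close> as its middle;
  points closer than gd/2 to the middle in each coordinate round to c.\<close>

lemma snap_eq:
  assumes c: "c = snap o' k u" and x: "\<And>i. \<bar>pw (-k) (x - (c + pw k half)) $ i\<bar> < gd / 2"
  shows "snap o' k x = c"
proof -
  define m where "m = floorvec ((1 / gd) *\<^sub>R pw (-k) (u - o'))"
  have cm: "c = o' + pw k (gd *\<^sub>R ofintvec m)" unfolding c snap_def m_def ..
  have "floorvec ((1 / gd) *\<^sub>R pw (-k) (x - o')) = m"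
  proof -
    have eq: "pw (-k) (x - o') = pw (-k) (x - (c + pw k half)) + gd *\<^sub>R ofintvec m + half"
      unfolding cm by (simp add: pw_simps(1,2) algebra_simps)
    have "\<lfloor>pw (-k) (x - o') $ i / gd\<rfloor> = m $ i" for i
    proof (rule floor_unique)
      let ?w = "pw (-k) (x - (c + pw k half)) $ i"
      have v: "pw (-k) (x - o') $ i = ?w + gd * of_int (m $ i) + gd / 2" unfolding eq by (simp add: ofintvec_def)
      have w: "- (gd/2) < ?w" "?w < gd / 2" using x[of i] by linarith+
      show "of_int (m $ i) \<le> pw (-k) (x - o') $ i / gd"
        unfolding v using w(1) grid(1) by (simp add: field_simps)
      show "pw (-k) (x - o') $ i / gd < of_int (m $ i) + 1"
        unfolding v using w(2) grid(1) by (simp add: field_simps)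
    qed
    then show ?thesis by (simp add: floorvec_def vec_eq_iff)
  qed
  then show ?thesis unfolding snap_def[of o' k x] cm by simp
qed

lemma snap_measurable [measurable]: "snap o' k \<in> borel_measurable borel"
proof -
  have ov: "ofintvec (floorvec v) = (\<Sum>i\<in>UNIV. of_int \<lfloor>v $ i\<rfloor> *\<^sub>R axis i 1)" for v
    by (simp add: ofintvec_def floorvec_def vec_eq_iff axis_def if_distrib cong: if_cong)
  have [measurable]: "(\<lambda>v::real^'n. v $ i) \<in> borel_measurable borel" for i
    by (intro borel_measurable_continuous_onI continuous_intros)
  show ?thesis unfolding snap_def ov by measurable
qed

fun cpt :: "real^'n \<Rightarrow> int \<Rightarrow> nat \<Rightarrow> nat \<Rightarrow> real^'n \<Rightarrow> real^'n" where
  "cpt o' k0 L 0 x = snap o' (lev k0 L) x"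
| "cpt o' k0 L (Suc n) x = snap o' (lev k0 (L - Suc n)) (cpt o' k0 L n x)"

text \<open>The centre of the generation-i cube containing x: x is rounded to the finest lattice,
  generation L, and the result is then rounded generation by generation. Since a coarser centre is
  computed from the next finer one, the cubes are nested by construction
  (\<open>ctr_determined\<close>). The number of generations is finite.\<close>

definition ctr :: "real^'n \<Rightarrow> int \<Rightarrow> nat \<Rightarrow> nat \<Rightarrow> real^'n \<Rightarrow> real^'n" where
  "ctr o' k0 L i x = cpt o' k0 L (L - i) x"

lemma ctr_top: "ctr o' k0 L L x = snap o' (lev k0 L) x" by (simp add: ctr_def)

lemma ctr_step: "i < L \<Longrightarrow> ctr o' k0 L i x = snap o' (lev k0 i) (ctr o' k0 L (Suc i) x)"
proof -
  assume "i < L"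
  then have "L - i = Suc (L - Suc i)" "L - Suc (L - Suc i) = i" by auto
  then show ?thesis unfolding ctr_def by simp
qed

lemma ctr_measurable [measurable]: "ctr o' k0 L i \<in> borel_measurable borel"
proof -
  have "cpt o' k0 L n \<in> borel_measurable borel" for n
    by (induction n) (simp_all add: measurable_compose[OF _ snap_measurable])
  then show ?thesis unfolding ctr_def[abs_def] by simp
qed

lemma ctr_range: "i \<le> L \<Longrightarrow> ctr o' k0 L i x \<in> range (snap o' (lev k0 i))"
  using ctr_top ctr_step by (cases "i = L") (auto simp: less_le)

lemma G_lev_step: "G (lev k0 i) x \<le> G (lev k0 (Suc i)) x / r ^ ga"
proof -
  have "lev k0 i = lev k0 (Suc i) + int ga" by (simp add: lev_def)
  then have "r ^ ga * G (lev k0 i) x \<le> G (lev k0 (Suc i)) x" using G_step[of ga "lev k0 (Suc i)" x] by simp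
  then show ?thesis using r1 by (simp add: field_simps)
qed

lemma G_lev_step2: "G (lev k0 i) x \<le> G (lev k0 (Suc i)) x / 2"
proof -
  have "G (lev k0 (Suc i)) x / r ^ ga \<le> G (lev k0 (Suc i)) x / 2"
    using grid(2) by (intro divide_left_mono) auto
  with G_lev_step[of k0 i x] show ?thesis by (rule order_trans)
qed

text \<open>Passing to the coarser generation halves the accumulated distance 1/4, and the new
  rounding adds 1/8.\<close>

lemma ctr_close: "i \<le> L \<Longrightarrow> G (lev k0 i) (x - ctr o' k0 L i x) \<le> 1/4"
proof (induction i rule: inc_induct)
  case base
  show ?case using snap_close[of "lev k0 L" x o'] unfolding ctr_top by simp
next
  case (step i)
  let ?c = "ctr o' k0 L (Suc i) x"
  have "G (lev k0 i) (x - ctr o' k0 L i x) \<le> G (lev k0 i) (x - ?c) + G (lev k0 i) (?c - ctr o' k0 L i x)"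
    by (rule G_triangle3)
  also have "G (lev k0 i) (x - ?c) \<le> 1/8" using G_lev_step2[of k0 i "x - ?c"] step.IH by simp
  also have "G (lev k0 i) (?c - ctr o' k0 L i x) \<le> 1/8"
    using snap_close[of "lev k0 i" ?c o'] ctr_step[OF step.hyps(2)[unfolded less_eq_Suc_le, THEN Suc_le_lessD]] by simp
  finally show ?case by simp
qed

definition cube :: "real^'n \<Rightarrow> int \<Rightarrow> nat \<Rightarrow> nat \<Rightarrow> real^'n \<Rightarrow> (real^'n) set" where
  "cube o' k0 L i c = {x. ctr o' k0 L i x = c}"

lemma cube_sets [simp]: "cube o' k0 L i c \<in> sets lebesgue"
proof -
  have "ctr o' k0 L i -` {c} \<inter> space borel \<in> sets borel" by measurable
  then have "cube o' k0 L i c \<in> sets borel" by (simp add: cube_def vimage_def)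
  then show ?thesis by simp
qed

lemma cube_subset_bl: assumes "i \<le> L" shows "cube o' k0 L i c \<subseteq> bl c (lev k0 i)"
proof
  fix x assume "x \<in> cube o' k0 L i c"
  then show "x \<in> bl c (lev k0 i)" using ctr_close[OF assms, of k0 x o'] by (simp add: cube_def bl_iff)
qed

text \<open>A point of the small ball is within gd/4 of the middle of the lattice cell in every
  coordinate. Its centre of the next finer generation is within another gd/4, so it still rounds to
  c.\<close>

lemma cube_inner:
  assumes i: "i \<le> L" and c: "c \<in> range (snap o' (lev k0 i))"
  shows "bl (c + pw (lev k0 i) half) (lev k0 i - int ga) \<subseteq> cube o' k0 L i c"
proof
  fix x let ?k = "lev k0 i" let ?z = "c + pw ?k half"
  assume "x \<in> bl ?z (?k - int ga)"
  then have "G (- int ga) (pw (- ?k) (x - ?z)) < 1" by (simp add: bl_iff G_pw algebra_simps)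
  from grid(5)[OF this] have w: "\<bar>pw (- ?k) (x - ?z) $ j\<bar> < gd / 4" for j .
  obtain u where u: "c = snap o' ?k u" using c by blast
  show "x \<in> cube o' k0 L i c"
  proof (cases "i = L")
    case True
    have "snap o' ?k x = c" proof (rule snap_eq[OF u])
      fix j show "\<bar>pw (- ?k) (x - ?z) $ j\<bar> < gd / 2" using w[of j] grid(1) by linarith
    qed
    then show ?thesis using True by (simp add: cube_def ctr_top)
  next
    case False
    then have iL: "i < L" using i by simp
    let ?y = "ctr o' k0 L (Suc i) x"
    have "G (lev k0 (Suc i)) (?y - x) \<le> 1/4" using ctr_close[of "Suc i" L k0 x o'] iL by (simp add: G_minus)
    then have "G (- int ga) (pw (- ?k) (?y - x)) < 1" by (simp add: G_pw lev_def algebra_simps)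
    from grid(5)[OF this] have w2: "\<bar>pw (- ?k) (?y - x) $ j\<bar> < gd / 4" for j .
    have "snap o' ?k ?y = c"
    proof (rule snap_eq[OF u])
      fix j
      have "pw (- ?k) (?y - ?z) = pw (- ?k) (?y - x) + pw (- ?k) (x - ?z)" unfolding pw_simps(1)[symmetric] by (simp add: algebra_simps)
      then show "\<bar>pw (- ?k) (?y - ?z) $ j\<bar> < gd / 2" using w[of j] w2[of j] by (simp only: vector_add_component)
    qed
    then show ?thesis using ctr_step[OF iL] by (simp add: cube_def)
  qed
qed

lemma ctr_determined:
  assumes "j \<le> i" "i \<le> L" "ctr o' k0 L i x = ctr o' k0 L i y"
  shows "ctr o' k0 L j x = ctr o' k0 L j y"
  using assms(1)
proof (induction j rule: inc_induct)
  case base then show ?case using assms(3) .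
next
  case (step n) then show ?case using assms(2) by (simp add: ctr_step)
qed

text \<open>Centres are lattice points at bounded distance from S, so only finitely many integer
  vectors occur. This keeps all later sums over cubes finite.\<close>

lemma finite_ctr_image:
  assumes "bounded S" "i \<le> L" shows "finite (ctr o' k0 L i ` S)"
proof -
  let ?k = "lev k0 i"
  let ?h = "\<lambda>m. o' + pw ?k (gd *\<^sub>R ofintvec m)"
  obtain R where R: "\<And>x. x \<in> S \<Longrightarrow> norm x \<le> R" using assms(1) unfolding bounded_iff by blast
  obtain K where K: "K > 0" "\<And>x. norm x \<le> K * norm (Pm *v x)" using norm_le_P by blast
  obtain K2 where K2: "\<And>x. norm (pw (-?k) x) \<le> K2 * norm x" "K2 > 0"
  proof -
    obtain M where M: "\<And>x. pw (-?k) x = M *v x" using pw_matrix by blast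
    obtain K2 where "K2 > 0" "\<And>y. norm (M *v y) \<le> norm y * K2"
      using bounded_linear.pos_bounded[OF matrix_vector_mul_bounded_linear[of M]] by auto
    then show ?thesis using that[of K2] M by (simp add: mult.commute)
  qed
  define W where "W = (K / 4 + K2 * (\<bar>R\<bar> + norm o')) / gd"
  have "ctr o' k0 L i ` S \<subseteq> ?h ` {m. \<forall>j. m $ j \<in> {-\<lceil>W\<rceil>..\<lceil>W\<rceil>}}"
  proof
    fix c assume "c \<in> ctr o' k0 L i ` S"
    then obtain x where x: "x \<in> S" "c = ctr o' k0 L i x" by blast
    obtain m where m: "c = ?h m" using ctr_range[OF assms(2), of o' k0 x] x(2) unfolding snap_def by auto
    have "norm (gd *\<^sub>R ofintvec m) \<le> gd * W"
    proof -
      have "pw (-?k) (c - o') = gd *\<^sub>R ofintvec m" unfolding m by simp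
      moreover have "pw (-?k) (c - o') = pw (-?k) (x - o') - pw (-?k) (x - c)" unfolding pw_simps(2)[symmetric] by simp
      ultimately have "norm (gd *\<^sub>R ofintvec m) \<le> norm (pw (-?k) (x - o')) + norm (pw (-?k) (x - c))"
        by (metis norm_triangle_ineq4)
      also have "norm (pw (-?k) (x - c)) \<le> K * G ?k (x - c)" unfolding G_def by (rule K(2))
      also have "\<dots> \<le> K * (1/4)" using ctr_close[OF assms(2), of k0 x o'] K(1) unfolding x(2) by (intro mult_left_mono) auto
      also have "norm (pw (-?k) (x - o')) \<le> K2 * norm (x - o')" by (rule K2(1))
      also have "\<dots> \<le> K2 * (\<bar>R\<bar> + norm o')"
        using R[OF x(1)] norm_triangle_ineq4[of x o'] K2(2) by (intro mult_left_mono) auto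
      finally show ?thesis using grid(1) by (simp add: W_def)
    qed
    then have "norm (ofintvec m) \<le> W" using grid(1) by simp
    then have "\<bar>real_of_int (m $ j)\<bar> \<le> W" for j
      using component_le_norm_cart[of "ofintvec m" j] by (simp add: ofintvec_def)
    then have "m $ j \<in> {-\<lceil>W\<rceil>..\<lceil>W\<rceil>}" for j
      by (smt (verit) atLeastAtMost_iff ceiling_mono ceiling_of_int le_of_int_ceiling of_int_le_iff of_int_minus)
    then show "c \<in> ?h ` {m. \<forall>j. m $ j \<in> {-\<lceil>W\<rceil>..\<lceil>W\<rceil>}}" using m by blast
  qed
  moreover have "finite {m::int^'n. \<forall>j. m $ j \<in> {-\<lceil>W\<rceil>..\<lceil>W\<rceil>}}"
  proof -
    have "{m::int^'n. \<forall>j. m $ j \<in> {-\<lceil>W\<rceil>..\<lceil>W\<rceil>}} \<subseteq> vec_lambda ` (PiE UNIV (\<lambda>_. {-\<lceil>W\<rceil>..\<lceil>W\<rceil>}))"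
    proof
      fix m :: "int^'n" assume "m \<in> {m. \<forall>j. m $ j \<in> {-\<lceil>W\<rceil>..\<lceil>W\<rceil>}}"
      then have "vec_nth m \<in> PiE UNIV (\<lambda>_. {-\<lceil>W\<rceil>..\<lceil>W\<rceil>})" by auto
      moreover have "m = vec_lambda (vec_nth m)" by simp
      ultimately show "m \<in> vec_lambda ` (PiE UNIV (\<lambda>_. {-\<lceil>W\<rceil>..\<lceil>W\<rceil>}))" by blast
    qed
    then show ?thesis by (rule finite_subset) (intro finite_imageI finite_PiE, auto)
  qed
  ultimately show ?thesis using finite_subset finite_imageI by blast
qed

end


section \<open>Stopping-time selection of sparse cubes\<close>

context aniso_poly begin

definition locint :: "(real^'n \<Rightarrow> real) \<Rightarrow> bool" where
  "locint f \<longleftrightarrow> (\<forall>x k. set_integrable lebesgue (bl x k) f)"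

text \<open>The L^1 mean oscillation over x + B_k about the polynomial projection; the factor b^(-k)
  is the reciprocal of the volume.\<close>

definition osc :: "(real^'n \<Rightarrow> real) \<Rightarrow> real^'n \<Rightarrow> int \<Rightarrow> real" where
  "osc f x k = bdet A powr real_of_int (-k) * (LINT y:bl x k|lebesgue. \<bar>f y - proj x k f y\<bar>)"

definition Cp :: real where "Cp = (SOME C. C\<ge>1 \<and> (\<forall>x0 k j x f Q. set_integrable lebesgue (bl x0 k) f \<longrightarrow> poly_le d Q \<longrightarrow> x \<in> bl x0 (k + int j) \<longrightarrow>
     \<bar>proj x0 k f x - Q x\<bar> \<le> C * lp ^ (d * j) * (bdet A powr real_of_int (-k) * (LINT y:bl x0 k|lebesgue. \<bar>f y - Q y\<bar>))) \<and>
   (\<forall>x0 k j x Q. poly_le d Q \<longrightarrow> x \<in> bl x0 (k + int j) \<longrightarrow>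
     \<bar>Q x\<bar> \<le> C * lp ^ (d * j) * (bdet A powr real_of_int (-k) * (LINT y:bl x0 k|lebesgue. \<bar>Q y\<bar>))))"

lemma Cp1: "Cp \<ge> 1"
  and proj_bound: "\<And>x0 k j x f Q. set_integrable lebesgue (bl x0 k) f \<Longrightarrow> poly_le d Q \<Longrightarrow> x \<in> bl x0 (k + int j) \<Longrightarrow>
     \<bar>proj x0 k f x - Q x\<bar> \<le> Cp * lp ^ (d * j) * (bdet A powr real_of_int (-k) * (LINT y:bl x0 k|lebesgue. \<bar>f y - Q y\<bar>))"
  and poly_bound: "\<And>x0 k j x Q. poly_le d Q \<Longrightarrow> x \<in> bl x0 (k + int j) \<Longrightarrow>
     \<bar>Q x\<bar> \<le> Cp * lp ^ (d * j) * (bdet A powr real_of_int (-k) * (LINT y:bl x0 k|lebesgue. \<bar>Q y\<bar>))"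
proof -
  note s = someI_ex[OF proj_bound_ex[unfolded Bex_def], folded Cp_def]
  from s show "Cp \<ge> 1" by (elim conjE)
  from s show "\<And>x0 k j x f Q. set_integrable lebesgue (bl x0 k) f \<Longrightarrow> poly_le d Q \<Longrightarrow> x \<in> bl x0 (k + int j) \<Longrightarrow>
     \<bar>proj x0 k f x - Q x\<bar> \<le> Cp * lp ^ (d * j) * (bdet A powr real_of_int (-k) * (LINT y:bl x0 k|lebesgue. \<bar>f y - Q y\<bar>))"
    by (elim conjE) (simp only:)
  from s show "\<And>x0 k j x Q. poly_le d Q \<Longrightarrow> x \<in> bl x0 (k + int j) \<Longrightarrow>
     \<bar>Q x\<bar> \<le> Cp * lp ^ (d * j) * (bdet A powr real_of_int (-k) * (LINT y:bl x0 k|lebesgue. \<bar>Q y\<bar>))"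
    by (elim conjE) (simp only:)
qed

lemma abs_integral_nonneg: "0 \<le> (LINT y:S|lebesgue. \<bar>g y :: real\<bar>)"
  unfolding set_lebesgue_integral_def by (intro integral_nonneg_AE) auto

lemma osc_nonneg: "0 \<le> osc f x k" unfolding osc_def by (simp add: abs_integral_nonneg)

lemma abs_integral_subset:
  assumes "set_integrable lebesgue S (g :: real^'n \<Rightarrow> real)" "T \<subseteq> S" "T \<in> sets lebesgue"
  shows "(LINT y:T|lebesgue. \<bar>g y\<bar>) \<le> (LINT y:S|lebesgue. \<bar>g y\<bar>)"
proof -
  have "set_integrable lebesgue S (\<lambda>y. \<bar>g y\<bar>)" using assms(1) by (rule set_integrable_abs)
  moreover from this have "set_integrable lebesgue T (\<lambda>y. \<bar>g y\<bar>)" using assms(2,3) set_integrable_subset by blast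
  ultimately show ?thesis
    unfolding set_integrable_def set_lebesgue_integral_def using assms(2)
    by (intro integral_mono_AE AE_I2) (auto simp: indicator_def)
qed

lemma abs_integral_triangle:
  assumes "set_integrable lebesgue S (g :: real^'n \<Rightarrow> real)" "set_integrable lebesgue S h"
  shows "(LINT y:S|lebesgue. \<bar>g y - h y\<bar>) \<le> (LINT y:S|lebesgue. \<bar>g y\<bar>) + (LINT y:S|lebesgue. \<bar>h y\<bar>)"
proof -
  have "(LINT y:S|lebesgue. \<bar>g y - h y\<bar>) \<le> (LINT y:S|lebesgue. \<bar>g y\<bar> + \<bar>h y\<bar>)"
    by (intro set_integral_mono set_integrable_abs set_integral_diff set_integral_add assms) auto
  also have "\<dots> = (LINT y:S|lebesgue. \<bar>g y\<bar>) + (LINT y:S|lebesgue. \<bar>h y\<bar>)"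
    by (intro set_integral_add set_integrable_abs assms)
  finally show ?thesis .
qed

lemma bb: "bdet A powr real_of_int (j + k) = bdet A powr real_of_int j * bdet A powr real_of_int k"
  "bdet A powr real_of_int (- k) * bdet A powr real_of_int k = 1" "0 < bdet A powr real_of_int k"
  "bdet A powr real_of_int (j - k) = bdet A powr real_of_int j * bdet A powr real_of_int (-k)"
  "bdet A powr real_of_int (int m) = bdet A ^ m"
  using b_gt1 by (simp_all add: powr_add[symmetric] powr_realpow)

end

text \<open>One ball x0 + B_l, one function and a number L of generations. The constants obtained
  inside depend on none of them.\<close>

locale sparse = aniso_poly A D r lp d for A :: "real^'n^'n" and D r lp d +
  fixes x0 :: "real^'n" and l :: int and L :: nat and f :: "real^'n \<Rightarrow> real"
  assumes loc: "locint f"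
begin

definition "k0 = l + int ga"
text \<open>The lattice is placed so that x0 is the middle of its top cell. As the top scale is l +
  ga, \<open>cube_inner\<close> then puts the whole ball x0 + B_l into the top cube.\<close>

definition "org = x0 - pw k0 half"
definition "kk i = lev k0 i"
definition "cc i x = ctr org k0 L i x"
definition "qq i c = cube org k0 L i c"
definition "Pt t = proj (snd t) (kk (fst t)) f"
definition "os t = osc f (snd t) (kk (fst t))"
text \<open>The stopping threshold. The factor b^ga pays for replacing a ball by the cube inside it,
  and the factor 2 makes the cubes selected next fill at most half of their predecessor.\<close>

definition "Kst = 2 * bdet A ^ ga"
definition "Qt t = qq (fst t) (snd t)"

text \<open>The last selected cube, as a pair of generation and centre, on the descending chain of
  cubes through x. A new cube is selected when the mean of |f - P| over it, with P belonging to the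
  previously selected cube, exceeds \<open>Kst\<close> times the oscillation of that cube.\<close>

fun st :: "nat \<Rightarrow> real^'n \<Rightarrow> nat \<times> (real^'n)" where
  "st 0 x = (0, cc 0 x)"
| "st (Suc i) x = (if Kst * os (st i x) * measure lebesgue (qq (Suc i) (cc (Suc i) x))
      < (LINT y:qq (Suc i) (cc (Suc i) x)|lebesgue. \<bar>f y - Pt (st i x) y\<bar>)
      then (Suc i, cc (Suc i) x) else st i x)"

lemma os_nonneg [simp]: "0 \<le> os t" unfolding os_def by (rule osc_nonneg)

lemma cc_qq: "x \<in> qq i c \<longleftrightarrow> cc i x = c" by (simp add: qq_def cube_def cc_def)

lemma cc_det: "j \<le> i \<Longrightarrow> i \<le> L \<Longrightarrow> cc i x = cc i y \<Longrightarrow> cc j x = cc j y"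
  unfolding cc_def by (rule ctr_determined)

lemma qq_mono: "j \<le> i \<Longrightarrow> i \<le> L \<Longrightarrow> qq i (cc i x) \<subseteq> qq j (cc j x)"
  unfolding subset_iff cc_qq by (intro allI impI) (rule cc_det)

text \<open>The selection up to generation i depends only on the generation-i cube, so
  \<open>st i\<close> is constant on cubes. Measurability and finiteness below rest on this.\<close>

lemma st_det: "i \<le> L \<Longrightarrow> cc i x = cc i y \<Longrightarrow> st i x = st i y"
proof (induction i)
  case (Suc i)
  have "cc i x = cc i y" by (rule cc_det[OF _ Suc.prems]) simp
  with Suc.IH Suc.prems(1) have e: "st i x = st i y" by (meson Suc_leD)
  show ?case unfolding st.simps e Suc.prems(2) by (rule refl)
qed simp

lemma st_fst: "fst (st i x) \<le> i" by (induction i) (auto intro: le_SucI)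

lemma st_snd: "snd (st i x) = cc (fst (st i x)) x" by (induction i) auto

lemma st_fst_mono: "j \<le> i \<Longrightarrow> fst (st j x) \<le> fst (st i x)"
proof (induction i rule: dec_induct)
  case (step i)
  then show ?case using st_fst[of i x] by auto
qed simp

lemma st_fst_eq: "st (fst (st i x)) x = st i x"
  by (induction i) auto

declare st.simps(2) [simp del]

lemma kk_diff: "bdet A powr real_of_int (kk i) = bdet A ^ ga * bdet A powr real_of_int (kk (Suc i))"
  using bb(1)[of "int ga" "kk (Suc i)"] bb(5) by (simp add: kk_def lev_def algebra_simps)

lemma Qt_st: "x \<in> Qt (st i x)" unfolding Qt_def cc_qq st_snd ..

lemma qq_bl: "i \<le> L \<Longrightarrow> qq i c \<subseteq> bl c (kk i)"
  unfolding qq_def kk_def by (rule cube_subset_bl)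

lemma qq_sets [simp]: "qq i c \<in> sets lebesgue" unfolding qq_def by simp

lemma qq_lmeas: "i \<le> L \<Longrightarrow> qq i c \<in> lmeasurable"
  by (intro bounded_set_imp_lmeasurable bounded_subset[OF bl_bounded qq_bl]) auto

lemma qq_measure_le: "i \<le> L \<Longrightarrow> measure lebesgue (qq i c) \<le> bdet A powr real_of_int (kk i)"
  using measure_mono_fmeasurable[OF qq_bl qq_sets bl_lmeas, of i c] measure_bl by simp

lemma qq_inner:
  assumes "i \<le> L" shows "bl (cc i x + pw (kk i) half) (kk i - int ga) \<subseteq> qq i (cc i x)"
  unfolding qq_def kk_def cc_def by (rule cube_inner[OF assms ctr_range[OF assms]])

lemma qq_measure_ge: assumes "i \<le> L" shows "bdet A powr real_of_int (kk i) \<le> bdet A ^ ga * measure lebesgue (qq i (cc i x))"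
proof -
  have "bdet A powr real_of_int (kk i - int ga) \<le> measure lebesgue (qq i (cc i x))"
    using measure_mono_fmeasurable[OF qq_inner[OF assms] bl_sets qq_lmeas[OF assms]] by (simp add: measure_bl)
  moreover have "bdet A powr real_of_int (kk i) = bdet A ^ ga * bdet A powr real_of_int (kk i - int ga)"
    using bb(1)[of "int ga" "kk i - int ga"] bb(5) by simp
  ultimately show ?thesis using b_gt1 by (simp add: mult_left_mono)
qed

lemma f_diff_int: "poly_le d R \<Longrightarrow> set_integrable lebesgue (bl x k) (\<lambda>y. f y - R y)"
  using loc bl_integrable[OF poly_le_continuous] unfolding locint_def by (intro set_integral_diff) auto

lemma f_diff_int_qq: "poly_le d R \<Longrightarrow> i \<le> L \<Longrightarrow> set_integrable lebesgue (qq i c) (\<lambda>y. f y - R y)"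
  by (rule set_integrable_subset[OF f_diff_int[of R c "kk i"]]) (auto intro: subsetD[OF qq_bl])

lemma Pt_poly: "poly_le d (Pt t)"
  unfolding Pt_def using loc unfolding locint_def by (intro proj_poly) auto

lemma os_integral: "(LINT y:bl (snd t) (kk (fst t))|lebesgue. \<bar>f y - Pt t y\<bar>) = bdet A powr real_of_int (kk (fst t)) * os t"
  unfolding os_def osc_def Pt_def using bb(2)[of "kk (fst t)"] by (simp add: algebra_simps)

lemma os_integral_qq: "i \<le> L \<Longrightarrow> (LINT y:qq i c|lebesgue. \<bar>f y - Pt (i, c) y\<bar>) \<le> bdet A powr real_of_int (kk i) * os (i, c)"
  using abs_integral_subset[OF f_diff_int[OF Pt_poly] qq_bl qq_sets, of i c "(i, c)"] os_integral[of "(i,c)"] by simp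

lemma b_ge1: "1 \<le> bdet A ^ ga" "1 \<le> Kst"
proof -
  show "1 \<le> bdet A ^ ga" using b_gt1 by (simp add: one_le_power)
  then show "1 \<le> Kst" unfolding Kst_def by simp
qed

text \<open>Either the cube has just been selected, and the bound is the definition of its own
  oscillation, or the stopping test failed on it.\<close>

lemma not_stopped_bound:
  assumes "i \<le> L"
  shows "(LINT y:qq i (cc i x)|lebesgue. \<bar>f y - Pt (st i x) y\<bar>) \<le> Kst * os (st i x) * measure lebesgue (qq i (cc i x))"
proof -
  have own: "(LINT y:qq i (cc i x)|lebesgue. \<bar>f y - Pt (i, cc i x) y\<bar>) \<le> Kst * os (i, cc i x) * measure lebesgue (qq i (cc i x))"
  proof -
    have "(LINT y:qq i (cc i x)|lebesgue. \<bar>f y - Pt (i, cc i x) y\<bar>) \<le> bdet A powr real_of_int (kk i) * os (i, cc i x)"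
      by (rule os_integral_qq[OF assms])
    also have "\<dots> \<le> (bdet A ^ ga * measure lebesgue (qq i (cc i x))) * os (i, cc i x)"
      by (intro mult_right_mono qq_measure_ge assms) simp
    also have "\<dots> \<le> (Kst * measure lebesgue (qq i (cc i x))) * os (i, cc i x)"
      using b_gt1 unfolding Kst_def by (intro mult_right_mono) auto
    finally show ?thesis by (simp add: algebra_simps)
  qed
  show ?thesis
  proof (cases i)
    case 0 then show ?thesis using own by simp
  next
    case (Suc j)
    show ?thesis using own unfolding Suc by (auto simp: st.simps(2) not_less)
  qed
qed

definition "Cg = Cp * lp ^ (d * ga) * bdet A ^ ga"
definition "Cs = Cg * (Kst * bdet A ^ ga)"

lemma Cg1: "1 \<le> Cg"
proof -
  have "1 \<le> Cp * lp ^ (d * ga)" using mult_mono[OF Cp1 one_le_power[of lp "d * ga"]] lp1 Cp1 by simp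
  then show ?thesis unfolding Cg_def using mult_mono[of 1 "Cp * lp ^ (d * ga)" 1 "bdet A ^ ga"] b_ge1 by simp
qed

text \<open>The polynomial is controlled by its mean over the ball inscribed in the cube; enlarging
  that ball by ga scales captures every point of the cube.\<close>

lemma cube_poly_bound:
  assumes "i \<le> L" "poly_le d R"
  shows "\<bar>R x\<bar> \<le> Cg * (bdet A powr real_of_int (- kk i) * (LINT y:qq i (cc i x)|lebesgue. \<bar>R y\<bar>))"
proof -
  let ?z = "cc i x + pw (kk i) half" and ?k = "kk i - int ga"
  have "G (kk i) (x - cc i x) \<le> 1/4" unfolding kk_def cc_def by (rule ctr_close[OF assms(1)])
  moreover have "G (kk i) (cc i x - ?z) \<le> 1/8"
  proof -
    have "G (kk i) (cc i x - ?z) = G 0 half" by (simp add: G_neg G_pw)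
    also have "\<dots> \<le> 1/8" using grid(1) by (intro grid(4)) simp
    finally show ?thesis .
  qed
  ultimately have "G (kk i) (x - ?z) < 1" using G_triangle3[of "kk i" x ?z "cc i x"] by simp
  then have "x \<in> bl ?z (?k + int ga)" by (simp add: bl_iff)
  from poly_bound[OF assms(2) this]
  have "\<bar>R x\<bar> \<le> Cp * lp ^ (d * ga) * (bdet A powr real_of_int (- ?k) * (LINT y:bl ?z ?k|lebesgue. \<bar>R y\<bar>))" .
  also have "\<dots> \<le> Cp * lp ^ (d * ga) * (bdet A powr real_of_int (- ?k) * (LINT y:qq i (cc i x)|lebesgue. \<bar>R y\<bar>))"
  proof (intro mult_left_mono)
    have "set_integrable lebesgue (qq i (cc i x)) R"
      using set_integrable_subset[OF bl_integrable[OF poly_le_continuous[OF assms(2)]] qq_sets qq_bl[OF assms(1)]] .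
    then show "(LINT y:bl ?z ?k|lebesgue. \<bar>R y\<bar>) \<le> (LINT y:qq i (cc i x)|lebesgue. \<bar>R y\<bar>)"
      by (rule abs_integral_subset[OF _ qq_inner[OF assms(1)] bl_sets])
  qed (use Cp1 lp1 in auto)
  also have "bdet A powr real_of_int (- ?k) = bdet A ^ ga * bdet A powr real_of_int (- kk i)"
    using bb(1)[of "int ga" "- kk i"] bb(5) by simp
  finally show ?thesis by (simp add: Cg_def mult.assoc)
qed

text \<open>The polynomials of two consecutively selected cubes are both close to f in mean on the
  new cube, hence close to each other there, and for polynomials a mean bound is a pointwise
  bound.\<close>

lemma chain_step:
  assumes "Suc i \<le> L" "st (Suc i) x = (Suc i, cc (Suc i) x)"
  shows "\<bar>Pt (st i x) x - Pt (st (Suc i) x) x\<bar> \<le> Cs * (os (st i x) + os (st (Suc i) x))"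
proof -
  let ?T = "st i x" and ?U = "st (Suc i) x" and ?q = "qq (Suc i) (cc (Suc i) x)" and ?b = "bdet A powr real_of_int (- kk (Suc i))"
  let ?R = "\<lambda>y. Pt ?T y - Pt ?U y"
  have iT: "set_integrable lebesgue ?q (\<lambda>y. f y - Pt ?T y)" and iU: "set_integrable lebesgue ?q (\<lambda>y. f y - Pt ?U y)"
    by (rule f_diff_int_qq[OF Pt_poly assms(1)])+
  have sub: "?q \<subseteq> qq i (cc i x)"
    by (rule qq_mono[OF _ assms(1)]) simp
  \<comment> \<open>The new cube lies in the cube one generation up, where the bound for the old
    selection still holds; the ratio of their scales costs b^ga.\<close>
  have 1: "(LINT y:?q|lebesgue. \<bar>f y - Pt ?T y\<bar>) \<le> Kst * bdet A ^ ga * os ?T * bdet A powr real_of_int (kk (Suc i))"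
  proof -
    have "(LINT y:?q|lebesgue. \<bar>f y - Pt ?T y\<bar>) \<le> (LINT y:qq i (cc i x)|lebesgue. \<bar>f y - Pt ?T y\<bar>)"
      by (rule abs_integral_subset[OF f_diff_int_qq[OF Pt_poly] sub qq_sets]) (use assms(1) in linarith)
    also have "\<dots> \<le> Kst * os ?T * measure lebesgue (qq i (cc i x))" using assms(1) by (intro not_stopped_bound) linarith
    also have "\<dots> \<le> Kst * os ?T * bdet A powr real_of_int (kk i)"
      by (rule mult_left_mono[OF qq_measure_le]) (use assms(1) b_ge1 in \<open>simp_all del: st.simps\<close>)
    finally show ?thesis unfolding kk_diff[of i] by (simp add: mult_ac)
  qed
  have 2: "(LINT y:?q|lebesgue. \<bar>f y - Pt ?U y\<bar>) \<le> os ?U * bdet A powr real_of_int (kk (Suc i))"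
    using os_integral_qq[OF assms(1), of "cc (Suc i) x"] unfolding assms(2) by (simp only: mult.commute)
  have "\<bar>?R x\<bar> \<le> Cg * (?b * (LINT y:?q|lebesgue. \<bar>?R y\<bar>))"
    by (rule cube_poly_bound[OF assms(1)]) (intro poly_le_diff Pt_poly)
  also have "(LINT y:?q|lebesgue. \<bar>?R y\<bar>) = (LINT y:?q|lebesgue. \<bar>(f y - Pt ?U y) - (f y - Pt ?T y)\<bar>)" by simp
  also have "Cg * (?b * \<dots>) \<le> Cg * (?b * ((LINT y:?q|lebesgue. \<bar>f y - Pt ?U y\<bar>) + (LINT y:?q|lebesgue. \<bar>f y - Pt ?T y\<bar>)))"
    using Cg1 by (intro mult_left_mono abs_integral_triangle iT iU) auto
  also have "\<dots> \<le> Cg * (?b * (os ?U * bdet A powr real_of_int (kk (Suc i)) + Kst * bdet A ^ ga * os ?T * bdet A powr real_of_int (kk (Suc i))))"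
    using Cg1 1 2 by (intro mult_left_mono add_mono) auto
  also have "\<dots> = Cg * (?b * bdet A powr real_of_int (kk (Suc i))) * (os ?U + Kst * bdet A ^ ga * os ?T)"
    by (simp add: algebra_simps)
  also have "\<dots> = Cg * (os ?U + Kst * bdet A ^ ga * os ?T)" by (simp only: bb(2) mult_1_right)
  also have "\<dots> \<le> Cg * (Kst * bdet A ^ ga * os ?U + Kst * bdet A ^ ga * os ?T)"
  proof -
    have "1 \<le> Kst * bdet A ^ ga" using mult_mono[of 1 Kst 1 "bdet A ^ ga"] b_ge1 by simp
    from mult_right_mono[OF this, of "os ?U"] show ?thesis using Cg1 by (intro mult_left_mono add_right_mono) auto
  qed
  finally show ?thesis by (simp add: Cs_def algebra_simps)
qed

definition "chain i x = (\<Sum>j\<in>{j. j \<le> i \<and> fst (st j x) = j}. os (st j x))"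

text \<open>Telescoping over selected cubes counts each oscillation at most twice; the subtracted
  last term is the invariant that leaves room for the next step.\<close>

lemma chain_bound:
  assumes "i \<le> L"
  shows "\<bar>Pt (st 0 x) x - Pt (st i x) x\<bar> \<le> Cs * (2 * chain i x - os (st i x))"
  using assms
proof (induction i)
  case 0
  have "{j. j = 0 \<and> fst (st j x) = j} = {0}" by auto
  moreover have "0 \<le> Cs" unfolding Cs_def using Cg1 b_ge1 by simp
  ultimately show ?case unfolding chain_def by simp
next
  case (Suc i)
  show ?case
  proof (cases "fst (st (Suc i) x) = Suc i")
    case True
    then have eq: "st (Suc i) x = (Suc i, cc (Suc i) x)" using st_snd[of "Suc i" x] by (simp add: prod_eq_iff)
    have "{j. j \<le> Suc i \<and> fst (st j x) = j} = insert (Suc i) {j. j \<le> i \<and> fst (st j x) = j}"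
      using True by (auto simp: le_Suc_eq)
    then have ch: "chain (Suc i) x = os (st (Suc i) x) + chain i x" unfolding chain_def by simp
    have "\<bar>Pt (st 0 x) x - Pt (st (Suc i) x) x\<bar> \<le> Cs * (2 * chain i x - os (st i x)) + Cs * (os (st i x) + os (st (Suc i) x))"
      using Suc chain_step[OF Suc.prems eq] by linarith
    then show ?thesis unfolding ch by (simp add: algebra_simps)
  next
    case False
    then have eq: "st (Suc i) x = st i x" by (auto simp: st.simps(2) split: if_splits)
    have "{j. j \<le> Suc i \<and> fst (st j x) = j} = {j. j \<le> i \<and> fst (st j x) = j}"
      using False by (auto simp: le_Suc_eq)
    then have "chain (Suc i) x = chain i x" unfolding chain_def by simp
    then show ?thesis using Suc eq by simp
  qed
qed

text \<open>After L generations f is compared with a number \<kappa> instead of being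
  differentiated: the remainder consists of |f x - \<kappa>| and the mean of |f - \<kappa>| over the
  finest cell, and is made small in L^1 later by taking \<kappa> from a continuous
  approximation.\<close>

lemma pointwise_bound:
  "\<bar>f x - Pt (st 0 x) x\<bar> \<le> 2 * Cs * chain L x + (\<bar>f x - \<kappa>\<bar> + Cg * (bdet A powr real_of_int (- kk L) * (LINT y:qq L (cc L x)|lebesgue. \<bar>f y - \<kappa>\<bar>)))"
proof -
  let ?T = "st L x" and ?q = "qq L (cc L x)" and ?b = "bdet A powr real_of_int (- kk L)"
  have ch: "\<bar>Pt (st 0 x) x - Pt ?T x\<bar> \<le> Cs * (2 * chain L x - os ?T)" by (rule chain_bound) simp
  have "\<bar>Pt ?T x - \<kappa>\<bar> \<le> Cg * (?b * (LINT y:?q|lebesgue. \<bar>Pt ?T y - \<kappa>\<bar>))"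
    by (rule cube_poly_bound) (auto intro!: poly_le_diff Pt_poly poly_le_const)
  also have "(LINT y:?q|lebesgue. \<bar>Pt ?T y - \<kappa>\<bar>) = (LINT y:?q|lebesgue. \<bar>(f y - \<kappa>) - (f y - Pt ?T y)\<bar>)" by simp
  also have "Cg * (?b * \<dots>) \<le> Cg * (?b * ((LINT y:?q|lebesgue. \<bar>f y - \<kappa>\<bar>) + (LINT y:?q|lebesgue. \<bar>f y - Pt ?T y\<bar>)))"
    using Cg1 by (intro mult_left_mono abs_integral_triangle f_diff_int_qq Pt_poly poly_le_const) auto
  also have "\<dots> \<le> Cg * (?b * ((LINT y:?q|lebesgue. \<bar>f y - \<kappa>\<bar>) + Kst * os ?T * bdet A powr real_of_int (kk L)))"
  proof -
    have "(LINT y:?q|lebesgue. \<bar>f y - Pt ?T y\<bar>) \<le> Kst * os ?T * measure lebesgue ?q" by (rule not_stopped_bound) simp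
    also have "\<dots> \<le> Kst * os ?T * bdet A powr real_of_int (kk L)"
      using b_ge1 by (intro mult_left_mono qq_measure_le) auto
    finally show ?thesis using Cg1 by (intro mult_left_mono add_left_mono) auto
  qed
  also have "\<dots> = Cg * (?b * (LINT y:?q|lebesgue. \<bar>f y - \<kappa>\<bar>)) + Cg * Kst * os ?T * (?b * bdet A powr real_of_int (kk L))"
    by (simp add: algebra_simps)
  also have "Cg * Kst * os ?T * (?b * bdet A powr real_of_int (kk L)) \<le> Cs * os ?T"
  proof -
    have "Cg * Kst * 1 \<le> Cg * Kst * bdet A ^ ga" using b_ge1 Cg1 by (intro mult_left_mono) auto
    then have "Cg * Kst \<le> Cs" by (simp add: Cs_def mult.assoc)
    from mult_right_mono[OF this, of "os ?T"] show ?thesis by (simp only: bb(2)) simp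
  qed
  finally have "\<bar>Pt ?T x - \<kappa>\<bar> \<le> Cg * (?b * (LINT y:?q|lebesgue. \<bar>f y - \<kappa>\<bar>)) + Cs * os ?T" by simp
  with ch show ?thesis by (simp add: algebra_simps)
qed

definition "Q0 = qq 0 (cc 0 x0)"
text \<open>All cubes selected inside the top cube.\<close>

definition "II = (\<Union>j\<le>L. st j ` Q0)"
text \<open>The part of a selected cube where nothing is selected after it. These sets are disjoint
  because each x has a single last selection.\<close>

definition "EE t = {x \<in> Q0. st L x = t}"

lemma Q0_bl: "Q0 \<subseteq> bl x0 (l + int ga)"
proof
  fix x assume "x \<in> Q0"
  then have c: "cc 0 x = cc 0 x0" by (simp add: Q0_def cc_qq)
  have "G (kk 0) (x - cc 0 x) \<le> 1/4" "G (kk 0) (x0 - cc 0 x0) \<le> 1/4"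
    unfolding kk_def cc_def by (intro ctr_close; simp)+
  then have "G (kk 0) (x - x0) < 1" using G_triangle3[of "kk 0" x x0 "cc 0 x"] c by (simp add: G_minus)
  then show "x \<in> bl x0 (l + int ga)" by (simp add: bl_iff kk_def lev_def k0_def)
qed

lemma B_Q0: "bl x0 l \<subseteq> Q0"
proof -
  have sn: "snap org k0 x0 = org"
    using grid(1) by (simp add: snap_def org_def pw_simps ofintvec_def floorvec_def vec_eq_iff)
       (simp add: zero_vec_def[symmetric] pw_simps)
  have "bl (org + pw (lev k0 0) half) (lev k0 0 - int ga) \<subseteq> cube org k0 L 0 org"
    by (rule cube_inner) (auto simp: lev_def intro!: image_eqI[of org _ x0] sn[symmetric])
  then have "bl x0 l \<subseteq> cube org k0 L 0 org" by (simp add: lev_def k0_def org_def)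
  moreover have "x0 \<in> bl x0 l" by simp
  ultimately have "ctr org k0 L 0 x0 = org" unfolding cube_def by blast
  then have "cube org k0 L 0 org = Q0" unfolding Q0_def qq_def cc_def by simp
  with \<open>bl x0 l \<subseteq> cube org k0 L 0 org\<close> show ?thesis by simp
qed

lemma Q0_bounded: "bounded Q0" using Q0_bl bl_bounded bounded_subset by blast

lemma finite_cc: "i \<le> L \<Longrightarrow> finite (cc i ` Q0)"
  unfolding cc_def by (rule finite_ctr_image[OF Q0_bounded])

lemma II_char: "t \<in> II \<longleftrightarrow> (\<exists>x\<in>Q0. fst t \<le> L \<and> st (fst t) x = t \<and> snd t = cc (fst t) x)"
proof
  assume "t \<in> II"
  then obtain j x where "j \<le> L" "x \<in> Q0" "t = st j x" unfolding II_def by blast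
  then show "\<exists>x\<in>Q0. fst t \<le> L \<and> st (fst t) x = t \<and> snd t = cc (fst t) x"
    using st_fst[of j x] st_fst_eq[of j x] st_snd[of j x] by (intro bexI[of _ x]) auto
next
  assume "\<exists>x\<in>Q0. fst t \<le> L \<and> st (fst t) x = t \<and> snd t = cc (fst t) x"
  then obtain x where x: "x \<in> Q0" "fst t \<le> L" "st (fst t) x = t" by blast
  from x(1) have "st (fst t) x \<in> st (fst t) ` Q0" by (rule imageI)
  with x(2,3) show "t \<in> II" unfolding II_def by auto
qed

lemma finite_II: "finite II"
proof -
  have "II \<subseteq> (\<Union>j\<le>L. {j} \<times> cc j ` Q0)"
  proof
    fix t assume "t \<in> II"
    then obtain x where "x \<in> Q0" "fst t \<le> L" "snd t = cc (fst t) x" unfolding II_char by blast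
    then show "t \<in> (\<Union>j\<le>L. {j} \<times> cc j ` Q0)" by (cases t) auto
  qed
  moreover have "finite (\<Union>j\<le>L. {j} \<times> cc j ` Q0)" using finite_cc by auto
  ultimately show ?thesis by (rule finite_subset)
qed

lemma II_st: assumes "t \<in> II" "x \<in> Qt t" shows "st (fst t) x = t" "x \<in> Q0" "fst t \<le> L"
proof -
  obtain y where y: "y \<in> Q0" "fst t \<le> L" "st (fst t) y = t" "snd t = cc (fst t) y" using assms(1) unfolding II_char by blast
  have c: "cc (fst t) x = cc (fst t) y" using assms(2) y(4) by (simp add: Qt_def cc_qq)
  show "st (fst t) x = t" using st_det[OF y(2) c] y(3) by simp
  show "x \<in> Q0" using cc_det[OF _ y(2) c, of 0] y(1) by (simp add: Q0_def cc_qq)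
  show "fst t \<le> L" by (rule y(2))
qed

lemma Qt_subset: assumes "t \<in> II" shows "Qt t \<subseteq> bl (snd t) (kk (fst t))" "Qt t \<subseteq> Q0"
proof -
  have "fst t \<le> L" using assms unfolding II_char by (elim bexE conjE)
  then show "Qt t \<subseteq> bl (snd t) (kk (fst t))" unfolding Qt_def by (rule qq_bl)
  show "Qt t \<subseteq> Q0" using II_st(2)[OF assms] by (rule subsetI)
qed

text \<open>The selected cubes on the chain through x are distinct members of \<open>II\<close> that
  contain x.\<close>

lemma chain_le: assumes "x \<in> Q0" shows "chain L x \<le> (\<Sum>t\<in>II. os t * indicator (Qt t) x)"
proof -
  let ?J = "{j. j \<le> L \<and> fst (st j x) = j}"
  have inj: "inj_on (\<lambda>j. st j x) ?J"
  proof (rule inj_onI)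
    fix i j assume "i \<in> ?J" "j \<in> ?J" "st i x = st j x"
    then have "i = fst (st i x)" "fst (st j x) = j" "fst (st i x) = fst (st j x)" by (auto simp only: mem_Collect_eq)
    then show "i = j" by (simp only:)
  qed
  have "chain L x = (\<Sum>t\<in>(\<lambda>j. st j x) ` ?J. os t)" unfolding chain_def by (simp add: sum.reindex[OF inj])
  also have "\<dots> = (\<Sum>t\<in>(\<lambda>j. st j x) ` ?J. os t * indicator (Qt t) x)"
    by (rule sum.cong) (use Qt_st in auto)
  also have "\<dots> \<le> (\<Sum>t\<in>II. os t * indicator (Qt t) x)"
    using assms by (intro sum_mono2 finite_II) (auto simp: II_def)
  finally show ?thesis .
qed

lemma laminar: assumes "t \<in> II" "u \<in> II" shows "Qt t \<subseteq> Qt u \<or> Qt u \<subseteq> Qt t \<or> Qt t \<inter> Qt u = {}"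
proof -
  have main: "Qt u \<subseteq> Qt t" if "t \<in> II" "u \<in> II" "fst t \<le> fst u" "x \<in> Qt t" "x \<in> Qt u" for t u x
  proof
    fix y assume "y \<in> Qt u"
    then have "cc (fst u) y = cc (fst u) x" using that(5) by (simp add: Qt_def cc_qq)
    then have "cc (fst t) y = cc (fst t) x" using that II_st(3)[OF that(2,5)] by (intro cc_det[of "fst t" "fst u"]) auto
    then show "y \<in> Qt t" using that(4) by (simp add: Qt_def cc_qq)
  qed
  show ?thesis
  proof (cases "Qt t \<inter> Qt u = {}")
    case False
    then obtain x where "x \<in> Qt t" "x \<in> Qt u" by blast
    then show ?thesis using main[of t u x] main[of u t x] assms linear[of "fst t" "fst u"] by blast
  qed simp
qed

lemma EE_sub: "t \<in> II \<Longrightarrow> EE t \<subseteq> Qt t"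
  using Qt_st by (auto simp: EE_def)

lemma EE_disjoint: "t \<noteq> u \<Longrightarrow> EE t \<inter> EE u = {}" by (auto simp: EE_def)

text \<open>The set is a finite union of finest cells, since the last selection is constant on
  them.\<close>

lemma EE_sets: "EE t \<in> sets lebesgue"
proof -
  have "EE t = (\<Union>c\<in>cc L ` EE t. qq L c)"
  proof (intro equalityI subsetI)
    fix x assume "x \<in> (\<Union>c\<in>cc L ` EE t. qq L c)"
    then obtain y where y: "y \<in> EE t" "cc L x = cc L y" by (auto simp: cc_qq)
    then show "x \<in> EE t" using st_det[of L x y] cc_det[of 0 L x y] by (auto simp: EE_def Q0_def cc_qq)
  qed (auto simp: cc_qq)
  moreover have "finite (cc L ` EE t)" using finite_cc[of L] by (rule finite_subset[rotated]) (auto simp: EE_def)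
  ultimately show ?thesis by (metis (no_types, lifting) qq_sets sets.finite_UN)
qed

text \<open>The cubes selected directly after t are disjoint subcubes on which |f - P_t| has mean
  above \<open>Kst * os t\<close>, while its integral over the whole cube is at most |B|
  \<open>os t\<close>. They therefore fill at most half of the cube, and the complementary half is
  \<open>EE t\<close>.\<close>

lemma EE_measure:
  assumes t: "t \<in> II"
  shows "bdet A powr real_of_int (kk (fst t)) \<le> 2 * bdet A ^ ga * measure lebesgue (EE t)"
proof -
  let ?j = "fst t" and ?b = "bdet A powr real_of_int (kk (fst t))"
  obtain z where z: "z \<in> Q0" "?j \<le> L" "st ?j z = t" "snd t = cc ?j z" using t unfolding II_char by blast
  \<comment> \<open>The cubes selected immediately after t: the selection is t one generation
    earlier and has just switched.\<close>
  define J where "J = {(i, c). ?j < i \<and> i \<le> L \<and> (\<exists>x\<in>Qt t. c = cc i x \<and> st (i - 1) x = t \<and> st i x = (i, c))}"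
  have J: "i \<le> L" "?j < i" "y \<in> Qt t" "st (i - 1) y = t" "st i y = (i, c)" if "(i, c) \<in> J" "y \<in> qq i c" for i c y
  proof -
    obtain x where x: "?j < i" "i \<le> L" "x \<in> Qt t" "c = cc i x" "st (i - 1) x = t" "st i x = (i, c)"
      using \<open>(i, c) \<in> J\<close> unfolding J_def by blast
    have c: "cc i y = cc i x" using that(2) x(4) by (simp add: cc_qq)
    show "i \<le> L" "?j < i" using x by auto
    show "st i y = (i, c)" using st_det[OF x(2) c] x(6) by simp
    show "st (i - 1) y = t" using st_det[OF _ cc_det[OF _ x(2) c], of "i - 1"] x(2,5) by simp
    show "y \<in> Qt t" using cc_det[OF _ x(2) c, of ?j] x(1,3) by (simp add: Qt_def cc_qq)
  qed
  have Jfin: "finite J"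
  proof -
    have "J \<subseteq> (\<Union>i\<le>L. {i} \<times> cc i ` Q0)" using Qt_subset(2)[OF t] by (auto simp: J_def)
    moreover have "finite (\<Union>i\<le>L. {i} \<times> cc i ` Q0)" using finite_cc by auto
    ultimately show ?thesis by (rule finite_subset)
  qed
  have Jne: "\<exists>y. y \<in> qq (fst p) (snd p)" if "p \<in> J" for p using that by (auto simp: J_def cc_qq)
  have Jstop: "Kst * os t * measure lebesgue (qq i c) < (LINT y:qq i c|lebesgue. \<bar>f y - Pt t y\<bar>)" if ic: "(i, c) \<in> J" for i c
  proof -
    obtain y where y: "y \<in> qq i c" using Jne[OF ic] by auto
    note Jy = J[OF ic y]
    obtain i' where i': "i = Suc i'" using Jy(2) by (cases i) auto
    have s: "st i' y = t" using Jy(4) i' by simp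
    have c: "c = cc (Suc i') y" using y i' by (simp add: cc_qq)
    have "st (Suc i') y \<noteq> st i' y" using Jy(5,2) s i' by (auto simp: prod_eq_iff)
    then have "Kst * os t * measure lebesgue (qq (Suc i') c) < (LINT y:qq (Suc i') c|lebesgue. \<bar>f y - Pt t y\<bar>)"
      unfolding st.simps s c[symmetric] by (auto split: if_splits)
    then show ?thesis unfolding i' .
  qed
  \<comment> \<open>Were two of them to share a point at different generations, the selection at the
    earlier one would already have left t, and generations of selections never decrease. At equal
    generation the centres agree.\<close>
  have Jdisj: "p = p'" if "p \<in> J" "p' \<in> J" "y \<in> qq (fst p) (snd p)" "y \<in> qq (fst p') (snd p')" for p p' y
  proof -
    have aux: "\<not> fst p < fst p'" if "p \<in> J" "p' \<in> J" "y \<in> qq (fst p) (snd p)" "y \<in> qq (fst p') (snd p')" for p p'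
    proof
      assume lt: "fst p < fst p'"
      have p: "st (fst p) y = p" "?j < fst p" using J[of "fst p" "snd p" y] that by auto
      have p': "st (fst p' - 1) y = t" using J[of "fst p'" "snd p'" y] that by auto
      have "fst (st (fst p) y) \<le> fst (st (fst p' - 1) y)" using lt by (intro st_fst_mono) simp
      then show False using p p' by simp
    qed
    have "fst p = fst p'" using aux[of p p'] aux[of p' p] that by force
    then show ?thesis using that(3,4) by (simp add: cc_qq prod_eq_iff)
  qed
  have sumJ: "(\<Sum>p\<in>J. LINT y:qq (fst p) (snd p)|lebesgue. \<bar>f y - Pt t y\<bar>) \<le> (LINT y:Qt t|lebesgue. \<bar>f y - Pt t y\<bar>)"
  proof -
    let ?u = "\<lambda>y. \<bar>f y - Pt t y\<bar>"
    have iQ: "set_integrable lebesgue (Qt t) ?u" unfolding Qt_def by (intro set_integrable_abs f_diff_int_qq Pt_poly z(2))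
    have ip: "set_integrable lebesgue (qq (fst p) (snd p)) ?u" if "p \<in> J" for p
      using that by (intro set_integrable_abs f_diff_int_qq Pt_poly) (auto simp: J_def)
    have "(\<Sum>p\<in>J. LINT y:qq (fst p) (snd p)|lebesgue. ?u y) = (LINT y|lebesgue. (\<Sum>p\<in>J. indicator (qq (fst p) (snd p)) y *\<^sub>R ?u y))"
      unfolding set_lebesgue_integral_def using ip unfolding set_integrable_def
      by (intro Bochner_Integration.integral_sum[symmetric]) auto
    also have "\<dots> \<le> (LINT y|lebesgue. indicator (Qt t) y *\<^sub>R ?u y)"
    proof (rule integral_mono_AE)
      show "integrable lebesgue (\<lambda>y. \<Sum>p\<in>J. indicator (qq (fst p) (snd p)) y *\<^sub>R ?u y)"
        using ip unfolding set_integrable_def by (intro Bochner_Integration.integrable_sum) auto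
      show "integrable lebesgue (\<lambda>y. indicator (Qt t) y *\<^sub>R ?u y)" using iQ unfolding set_integrable_def .
      show "AE y in lebesgue. (\<Sum>p\<in>J. indicator (qq (fst p) (snd p)) y *\<^sub>R ?u y) \<le> indicator (Qt t) y *\<^sub>R ?u y"
      proof (rule AE_I2)
        fix y
        show "(\<Sum>p\<in>J. indicator (qq (fst p) (snd p)) y *\<^sub>R ?u y) \<le> indicator (Qt t) y *\<^sub>R ?u y"
        proof (cases "\<exists>p\<in>J. y \<in> qq (fst p) (snd p)")
          case True
          then obtain p where p: "p \<in> J" "y \<in> qq (fst p) (snd p)" by blast
          have "(\<Sum>p\<in>J. indicator (qq (fst p) (snd p)) y *\<^sub>R ?u y) = (\<Sum>p'\<in>J. if p' = p then ?u y else 0)"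
          proof (rule sum.cong[OF refl])
            fix p' assume p': "p' \<in> J"
            show "indicator (qq (fst p') (snd p')) y *\<^sub>R ?u y = (if p' = p then ?u y else 0)"
            proof (cases "y \<in> qq (fst p') (snd p')")
              case True
              have "p = p'" by (rule Jdisj[OF p(1) p' p(2) True])
              then show ?thesis using True by simp
            next
              case False
              then have "p' \<noteq> p" using p(2) by blast
              then show ?thesis using False by simp
            qed
          qed
          also have "\<dots> = ?u y" using Jfin p(1) by simp
          finally show ?thesis using J(3)[of "fst p" "snd p" y] p by simp
        next
          case False
          then have "(\<Sum>p\<in>J. indicator (qq (fst p) (snd p)) y *\<^sub>R ?u y) = 0" by (intro sum.neutral) auto
          then show ?thesis by simp
        qed
      qed
    qed
    finally show ?thesis unfolding set_lebesgue_integral_def .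
  qed
  have own: "(LINT y:Qt t|lebesgue. \<bar>f y - Pt t y\<bar>) \<le> ?b * os t"
    using os_integral_qq[OF z(2), of "snd t"] unfolding Qt_def by simp
  \<comment> \<open>The Chebyshev step. Division by \<open>os t\<close> is legitimate, because
    vanishing oscillation is incompatible with the strict stopping inequality.\<close>
  have Jm: "2 * (\<Sum>p\<in>J. measure lebesgue (qq (fst p) (snd p))) \<le> measure lebesgue (Qt t)"
  proof (cases "J = {}")
    case True then show ?thesis by simp
  next
    case False
    then obtain i c where ic: "(i, c) \<in> J" by auto
    have "os t \<noteq> 0"
    proof
      assume "os t = 0"
      then have "(LINT y:qq i c|lebesgue. \<bar>f y - Pt t y\<bar>) > 0" using Jstop[OF ic] by simp
      moreover have "(LINT y:qq i c|lebesgue. \<bar>f y - Pt t y\<bar>) \<le> (LINT y:Qt t|lebesgue. \<bar>f y - Pt t y\<bar>)"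
        using J(3)[OF ic] unfolding Qt_def by (intro abs_integral_subset f_diff_int_qq Pt_poly z(2)) auto
      ultimately show False using own \<open>os t = 0\<close> by simp
    qed
    then have os: "os t > 0" using os_nonneg[of t] by linarith
    have "Kst * os t * (\<Sum>p\<in>J. measure lebesgue (qq (fst p) (snd p))) \<le> (\<Sum>p\<in>J. LINT y:qq (fst p) (snd p)|lebesgue. \<bar>f y - Pt t y\<bar>)"
      unfolding sum_distrib_left using Jstop by (intro sum_mono less_imp_le) auto
    also have "\<dots> \<le> ?b * os t" using sumJ own by simp
    finally have "Kst * (\<Sum>p\<in>J. measure lebesgue (qq (fst p) (snd p))) \<le> ?b" using os by (simp add: mult.commute mult.left_commute)
    also have "\<dots> \<le> bdet A ^ ga * measure lebesgue (Qt t)"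
      using qq_measure_ge[OF z(2), of z] z(4) by (simp add: Qt_def)
    finally have "bdet A ^ ga * (2 * (\<Sum>p\<in>J. measure lebesgue (qq (fst p) (snd p)))) \<le> bdet A ^ ga * measure lebesgue (Qt t)"
      by (simp add: Kst_def algebra_simps)
    then show ?thesis using b_ge1 by (subst (asm) mult_le_cancel_left_pos) auto
  qed
  \<comment> \<open>A point of the cube outside \<open>EE t\<close> leaves t at some first
    generation; the cube of that generation belongs to J.\<close>
  have cover: "Qt t - EE t \<subseteq> (\<Union>p\<in>J. qq (fst p) (snd p))"
  proof
    fix x assume x: "x \<in> Qt t - EE t"
    then have sx: "st ?j x = t" "x \<in> Q0" using II_st[OF t] by auto
    then have ne: "st L x \<noteq> t" using x by (simp add: EE_def)
    define i where "i = (LEAST i. ?j \<le> i \<and> st i x \<noteq> t)"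
    have i: "?j \<le> i" "st i x \<noteq> t" using LeastI[of "\<lambda>i. ?j \<le> i \<and> st i x \<noteq> t" L] ne z(2) unfolding i_def by auto
    have iL: "i \<le> L" unfolding i_def using ne z(2) by (intro Least_le) auto
    have ji: "?j < i" using i sx(1) by (cases "?j = i") auto
    then obtain i' where i': "i = Suc i'" by (cases i) auto
    have s: "st i' x = t" using not_less_Least[of i' "\<lambda>i. ?j \<le> i \<and> st i x \<noteq> t"] ji i' unfolding i_def by auto
    have "st (Suc i') x = (Suc i', cc (Suc i') x)" using i(2) s unfolding i' by (auto simp: st.simps(2) split: if_splits)
    then have "(i, cc i x) \<in> J" using x ji iL s i' unfolding J_def by auto
    moreover have "x \<in> qq (fst (i, cc i x)) (snd (i, cc i x))" by (simp add: cc_qq)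
    ultimately show "x \<in> (\<Union>p\<in>J. qq (fst p) (snd p))" by blast
  qed
  have QtL: "Qt t \<in> lmeasurable" unfolding Qt_def by (rule qq_lmeas[OF z(2)])
  have qJ: "qq (fst p) (snd p) \<in> lmeasurable" if "p \<in> J" for p using that by (intro qq_lmeas) (auto simp: J_def)
  have "measure lebesgue (Qt t) - measure lebesgue (EE t) = measure lebesgue (Qt t - EE t)"
    using EE_sub[OF t] EE_sets QtL by (intro measure_Diff[symmetric]) (auto simp: fmeasurable_def)
  also have "\<dots> \<le> measure lebesgue (\<Union>p\<in>J. qq (fst p) (snd p))"
  proof (rule measure_mono_fmeasurable[OF cover])
    show "Qt t - EE t \<in> sets lebesgue" by (intro sets.Diff EE_sets fmeasurableD QtL)
    show "(\<Union>p\<in>J. qq (fst p) (snd p)) \<in> lmeasurable" using Jfin qJ by (intro fmeasurable.finite_UN) auto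
  qed
  also have "\<dots> \<le> (\<Sum>p\<in>J. measure lebesgue (qq (fst p) (snd p)))"
    using Jfin qJ by (intro measure_UNION_le) (auto simp: fmeasurable_def)
  finally have "measure lebesgue (Qt t) \<le> 2 * measure lebesgue (EE t)" using Jm by simp
  then have "bdet A ^ ga * measure lebesgue (Qt t) \<le> bdet A ^ ga * (2 * measure lebesgue (EE t))"
    using b_ge1 by (intro mult_left_mono) auto
  moreover have "?b \<le> bdet A ^ ga * measure lebesgue (Qt t)"
    using qq_measure_ge[OF z(2), of z] z(4) by (simp add: Qt_def)
  ultimately show ?thesis by (simp add: mult_ac)
qed

end


section \<open>The error term and pointwise sparse domination\<close>

context sparse begin

definition "lc c v = Cg * (bdet A powr real_of_int (- kk L) * (LINT y:qq L c|lebesgue. \<bar>f y - v\<bar>))"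

text \<open>The remainder of \<open>pointwise_bound\<close> with \<kappa> equal to the value of
  \<phi> at the centre of the finest cell of x, written as a finite sum over cells so that it is
  manifestly integrable.\<close>

definition "err \<phi> x = (\<Sum>c\<in>cc L ` Q0. indicator (qq L c) x * (\<bar>f x - \<phi> c\<bar> + lc c (\<phi> c)))"

lemma sum_cells:
  assumes "x \<in> Q0" shows "(\<Sum>c\<in>cc L ` Q0. indicator (qq L c) x * h c) = (h (cc L x) :: real)"
proof -
  have "(\<Sum>c\<in>cc L ` Q0. indicator (qq L c) x * h c) = (\<Sum>c\<in>cc L ` Q0. if c = cc L x then h c else 0)"
    by (rule sum.cong) (auto simp: indicator_def cc_qq)
  also have "\<dots> = h (cc L x)" using assms finite_cc[of L] by simp
  finally show ?thesis .
qed

lemma cell_Q0: assumes "c \<in> cc L ` Q0" shows "qq L c \<subseteq> Q0"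
proof -
  obtain y where y: "y \<in> Q0" "c = cc L y" using assms by blast
  have "qq 0 (cc 0 y) = Q0" using y(1) by (simp add: Q0_def cc_qq)
  then show ?thesis using qq_mono[of 0 L y] y(2) by simp
qed

lemma lc_nonneg: "0 \<le> lc c v"
  unfolding lc_def using Cg1 by (simp add: abs_integral_nonneg)

lemma err_nonneg: "0 \<le> err \<phi> x"
  unfolding err_def by (intro sum_nonneg mult_nonneg_nonneg add_nonneg_nonneg lc_nonneg) auto

lemma cell_int: "integrable lebesgue (\<lambda>x. indicator (qq L c) x * \<bar>f x - v\<bar>)"
  using set_integrable_abs[OF f_diff_int_qq[OF poly_le_const[of d v], of L c]] unfolding set_integrable_def by simp

lemma cell_ind: "integrable lebesgue (\<lambda>x. indicator (qq L c) x * (v::real))"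
  using qq_lmeas[of L c] unfolding fmeasurable_def
  by (intro integrable_mult_left integrable_real_indicator) auto

lemma err_integrable: "integrable lebesgue (err \<phi>)"
  unfolding err_def distrib_left
  by (intro Bochner_Integration.integrable_sum Bochner_Integration.integrable_add cell_int cell_ind)

text \<open>Integrating the cell mean over its own cell returns at most \<open>Cg\<close> times the
  integral of |f - \<phi>(c)|. Replacing \<phi>(c) by \<phi>(x) costs w on each cell, and the cells
  are disjoint within one ball.\<close>

lemma err_integral:
  assumes \<phi>: "continuous_on UNIV \<phi>" and w: "\<And>x. x \<in> Q0 \<Longrightarrow> \<bar>\<phi> x - \<phi> (cc L x)\<bar> \<le> w"
  shows "(LINT x|lebesgue. err \<phi> x) \<le> (1 + Cg) * ((LINT x:bl x0 k0|lebesgue. \<bar>f x - \<phi> x\<bar>) + w * bdet A powr real_of_int k0)"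
proof -
  let ?C = "cc L ` Q0"
  have fin: "finite ?C" by (rule finite_cc) simp
  have fphi: "set_integrable lebesgue (bl x0 k0) (\<lambda>x. f x - \<phi> x)"
    using loc \<phi> bl_integrable unfolding locint_def by (intro set_integral_diff) auto
  have "(LINT x|lebesgue. err \<phi> x) = (\<Sum>c\<in>?C. (LINT x|lebesgue. indicator (qq L c) x * \<bar>f x - \<phi> c\<bar>) + (LINT x|lebesgue. indicator (qq L c) x * lc c (\<phi> c)))"
    unfolding err_def distrib_left
  proof (subst Bochner_Integration.integral_sum)
    show "integrable lebesgue (\<lambda>x. indicator (qq L c) x * \<bar>f x - \<phi> c\<bar> + indicator (qq L c) x * lc c (\<phi> c))" for c
      by (rule Bochner_Integration.integrable_add[OF cell_int cell_ind])
  qed (rule sum.cong[OF refl], rule Bochner_Integration.integral_add[OF cell_int cell_ind])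
  also have "\<dots> \<le> (\<Sum>c\<in>?C. (1 + Cg) * (LINT x|lebesgue. indicator (qq L c) x * \<bar>f x - \<phi> c\<bar>))"
  proof (rule sum_mono)
    fix c assume "c \<in> ?C"
    let ?i = "LINT x|lebesgue. indicator (qq L c) x * \<bar>f x - \<phi> c\<bar>"
    have i: "(LINT y:qq L c|lebesgue. \<bar>f y - \<phi> c\<bar>) = ?i" by (simp add: set_lebesgue_integral_def)
    have i0: "0 \<le> ?i" unfolding i[symmetric] by (rule abs_integral_nonneg)
    have "(LINT x|lebesgue. indicator (qq L c) x * lc c (\<phi> c)) = measure lebesgue (qq L c) * lc c (\<phi> c)"
      by (simp add: qq_lmeas)
    also have "\<dots> \<le> bdet A powr real_of_int (kk L) * lc c (\<phi> c)"
      by (intro mult_right_mono qq_measure_le lc_nonneg) simp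
    also have "\<dots> = Cg * (bdet A powr real_of_int (- kk L) * bdet A powr real_of_int (kk L)) * ?i"
      unfolding lc_def i by simp
    also have "\<dots> = Cg * ?i" by (simp only: bb(2) mult_1_right)
    finally show "?i + (LINT x|lebesgue. indicator (qq L c) x * lc c (\<phi> c)) \<le> (1 + Cg) * ?i"
      by (simp add: algebra_simps)
  qed
  also have "\<dots> = (1 + Cg) * (\<Sum>c\<in>?C. LINT x|lebesgue. indicator (qq L c) x * \<bar>f x - \<phi> c\<bar>)"
    by (simp add: sum_distrib_left)
  also have "(\<Sum>c\<in>?C. LINT x|lebesgue. indicator (qq L c) x * \<bar>f x - \<phi> c\<bar>) = (LINT x|lebesgue. (\<Sum>c\<in>?C. indicator (qq L c) x * \<bar>f x - \<phi> c\<bar>))"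
    by (intro Bochner_Integration.integral_sum[symmetric] cell_int)
  also have "\<dots> \<le> (LINT x|lebesgue. indicator (bl x0 k0) x * \<bar>f x - \<phi> x\<bar> + indicator (bl x0 k0) x * w)"
  proof (rule integral_mono_AE)
    show "integrable lebesgue (\<lambda>x. \<Sum>c\<in>?C. indicator (qq L c) x * \<bar>f x - \<phi> c\<bar>)"
      by (intro Bochner_Integration.integrable_sum cell_int)
    show "integrable lebesgue (\<lambda>x. indicator (bl x0 k0) x * \<bar>f x - \<phi> x\<bar> + indicator (bl x0 k0) x * w)"
    proof (rule Bochner_Integration.integrable_add)
      show "integrable lebesgue (\<lambda>x. indicator (bl x0 k0) x * \<bar>f x - \<phi> x\<bar>)"
        using set_integrable_abs[OF fphi] unfolding set_integrable_def by simp
      show "integrable lebesgue (\<lambda>x. indicator (bl x0 k0) x * w)"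
        using bl_lmeas[of x0 k0] unfolding fmeasurable_def
        by (intro integrable_mult_left integrable_real_indicator) auto
    qed
    show "AE x in lebesgue. (\<Sum>c\<in>?C. indicator (qq L c) x * \<bar>f x - \<phi> c\<bar>) \<le> indicator (bl x0 k0) x * \<bar>f x - \<phi> x\<bar> + indicator (bl x0 k0) x * w"
    proof (rule AE_I2)
      fix x
      show "(\<Sum>c\<in>?C. indicator (qq L c) x * \<bar>f x - \<phi> c\<bar>) \<le> indicator (bl x0 k0) x * \<bar>f x - \<phi> x\<bar> + indicator (bl x0 k0) x * w"
      proof (cases "x \<in> Q0")
        case True
        then have b: "x \<in> bl x0 k0" using Q0_bl unfolding k0_def by blast
        show ?thesis unfolding sum_cells[OF True] using w[OF True] b by simp
      next
        case False
        then have "x \<notin> qq L c" if "c \<in> ?C" for c using cell_Q0[OF that] by blast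
        then have "(\<Sum>c\<in>?C. indicator (qq L c) x * \<bar>f x - \<phi> c\<bar>) = 0" by (intro sum.neutral) auto
        moreover have "0 \<le> w" using w[of x0] B_Q0 by (meson abs_ge_zero bl_center order_trans subsetD)
        ultimately show ?thesis by simp
      qed
    qed
  qed
  also have "\<dots> = (LINT x:bl x0 k0|lebesgue. \<bar>f x - \<phi> x\<bar>) + w * bdet A powr real_of_int k0"
  proof (subst Bochner_Integration.integral_add)
    show "integrable lebesgue (\<lambda>x. indicator (bl x0 k0) x * \<bar>f x - \<phi> x\<bar>)"
      using set_integrable_abs[OF fphi] unfolding set_integrable_def by simp
    show "integrable lebesgue (\<lambda>x. indicator (bl x0 k0) x * w)"
      using bl_lmeas[of x0 k0] unfolding fmeasurable_def
      by (intro integrable_mult_left integrable_real_indicator) auto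
  qed (simp add: set_lebesgue_integral_def measure_bl bl_lmeas mult.commute)
  finally show ?thesis using Cg1 by (simp add: mult_left_mono)
qed

text \<open>The selection runs from the projection of the top cube, so the projection of the given
  ball is first exchanged for it; this costs \<open>Cp * bdet A ^ ga\<close> times the top
  oscillation, itself a term of the sum.\<close>

lemma main_bound:
  assumes x: "x \<in> bl x0 l"
  shows "\<bar>f x - proj x0 l f x\<bar> \<le> (Cp * bdet A ^ ga + 2 * Cs) * (\<Sum>t\<in>II. os t * indicator (Qt t) x) + err \<phi> x"
proof -
  have xQ: "x \<in> Q0" using x B_Q0 by blast
  let ?T = "st 0 x0"
  have T: "st 0 x = ?T" using xQ by (simp add: Q0_def cc_qq)
  have TI: "?T \<in> II" unfolding II_def using B_Q0 bl_center[of x0 l] by blast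
  have xT: "x \<in> Qt ?T" using Qt_st[of x 0] unfolding T .
  have k: "kk (fst ?T) = l + int ga" by (simp add: kk_def lev_def k0_def)
  have "\<bar>proj x0 l f x - Pt ?T x\<bar> \<le> Cp * lp ^ (d * 0) * (bdet A powr real_of_int (-l) * (LINT y:bl x0 l|lebesgue. \<bar>f y - Pt ?T y\<bar>))"
    using loc x unfolding locint_def by (intro proj_bound Pt_poly) auto
  also have "\<dots> \<le> Cp * lp ^ (d * 0) * (bdet A powr real_of_int (-l) * (bdet A powr real_of_int (kk (fst ?T)) * os ?T))"
  proof (intro mult_left_mono)
    have "bl x0 l \<subseteq> bl (snd ?T) (kk (fst ?T))"
    proof -
      have "Q0 = Qt ?T" by (simp add: Q0_def Qt_def)
      then show ?thesis using B_Q0 Qt_subset(1)[OF TI] by blast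
    qed
    then have "(LINT y:bl x0 l|lebesgue. \<bar>f y - Pt ?T y\<bar>) \<le> (LINT y:bl (snd ?T) (kk (fst ?T))|lebesgue. \<bar>f y - Pt ?T y\<bar>)"
      by (intro abs_integral_subset f_diff_int Pt_poly) auto
    then show "(LINT y:bl x0 l|lebesgue. \<bar>f y - Pt ?T y\<bar>) \<le> bdet A powr real_of_int (kk (fst ?T)) * os ?T"
      by (simp only: os_integral)
  qed (use Cp1 in auto)
  also have "\<dots> = Cp * bdet A ^ ga * os ?T"
    unfolding k bb(1) using bb(2)[of l] bb(5)[of ga] by (simp add: algebra_simps)
  also have "\<dots> \<le> Cp * bdet A ^ ga * (\<Sum>t\<in>II. os t * indicator (Qt t) x)"
  proof (rule mult_left_mono)
    have "os ?T * indicator (Qt ?T) x \<le> (\<Sum>t\<in>II. os t * indicator (Qt t) x)"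
      by (rule member_le_sum[OF TI _ finite_II]) simp
    then show "os ?T \<le> (\<Sum>t\<in>II. os t * indicator (Qt t) x)" using xT by simp
  qed (use Cp1 b_gt1 in auto)
  finally have 1: "\<bar>proj x0 l f x - Pt ?T x\<bar> \<le> Cp * bdet A ^ ga * (\<Sum>t\<in>II. os t * indicator (Qt t) x)" .
  have e: "err \<phi> x = \<bar>f x - \<phi> (cc L x)\<bar> + lc (cc L x) (\<phi> (cc L x))"
    unfolding err_def by (rule sum_cells[OF xQ])
  have "0 \<le> Cs" unfolding Cs_def using Cg1 b_ge1 by simp
  then have "2 * Cs * chain L x \<le> 2 * Cs * (\<Sum>t\<in>II. os t * indicator (Qt t) x)"
    using chain_le[OF xQ] by (intro mult_left_mono) auto
  moreover have "\<bar>f x - Pt ?T x\<bar> \<le> 2 * Cs * chain L x + err \<phi> x"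
    using pointwise_bound[of x "\<phi> (cc L x)"] unfolding T e lc_def .
  ultimately have "\<bar>f x - proj x0 l f x\<bar> \<le> Cp * bdet A ^ ga * (\<Sum>t\<in>II. os t * indicator (Qt t) x) + (2 * Cs * (\<Sum>t\<in>II. os t * indicator (Qt t) x) + err \<phi> x)"
    using 1 by linarith
  then show ?thesis by (simp add: algebra_simps)
qed

end

context aniso_poly begin

text \<open>The constant of \<open>main_bound\<close> restated outside the locale, which shows that
  it depends on neither the function, nor the ball, nor the number of generations.\<close>

definition "Csd = Cp * bdet A ^ ga + 2 * (Cp * lp ^ (d * ga) * bdet A ^ ga * (2 * bdet A ^ ga * bdet A ^ ga))"

text \<open>What survives of the construction: balls, laminar cubes in them, disjoint major subsets
  E, and the pointwise bound with an error e of integral below \<epsilon>.\<close>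

definition sparse_family where
  "sparse_family x0 l f \<epsilon> I cen sc Q E e \<longleftrightarrow> finite I \<and>
     (\<forall>t\<in>I. Q t \<subseteq> bl (cen t) (sc t) \<and> Q t \<subseteq> bl x0 (l + int ga) \<and> Q t \<in> sets lebesgue \<and> E t \<in> sets lebesgue \<and>
        E t \<subseteq> Q t \<and> bdet A powr real_of_int (sc t) \<le> 2 * bdet A ^ ga * measure lebesgue (E t)) \<and>
     (\<forall>t\<in>I. \<forall>u\<in>I. t \<noteq> u \<longrightarrow> E t \<inter> E u = {}) \<and>
     (\<forall>t\<in>I. \<forall>u\<in>I. Q t \<subseteq> Q u \<or> Q u \<subseteq> Q t \<or> Q t \<inter> Q u = {}) \<and>
     integrable lebesgue e \<and> (\<forall>x. 0 \<le> e x) \<and> (LINT x|lebesgue. e x) < \<epsilon> \<and>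
     (\<forall>x\<in>bl x0 l. \<bar>f x - proj x0 l f x\<bar> \<le> Csd * (\<Sum>t\<in>I. osc f (cen t) (sc t) * indicator (Q t) x) + e x)"

text \<open>The function f is approximated in L^1 by a continuous \<phi> on the enlarged ball, and
  enough generations are taken that \<phi> hardly varies on the finest cells.\<close>

lemma sparse_domination:
  assumes f: "locint f" and e: "\<epsilon> > 0"
  obtains I :: "(nat \<times> (real^'n)) set" and cen sc Q E e where "sparse_family x0 l f \<epsilon> I cen sc Q E e"
proof -
  define k where "k = l + int ga"
  define C where "C = 1 + Cp * lp ^ (d * ga) * bdet A ^ ga"
  have C: "C > 0" unfolding C_def using Cp1 lp1 b_gt1 by (simp add: add_pos_nonneg)
  define V where "V = bdet A powr real_of_int k"
  have V: "V > 0" unfolding V_def using b_gt1 by simp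
  obtain \<phi> where \<phi>: "continuous_on UNIV \<phi>" "(LINT x:bl x0 k|lebesgue. \<bar>f x - \<phi> x\<bar>) < \<epsilon> / (2 * C)"
  proof (rule L1_continuous_approx[of "bl x0 k" f "\<epsilon> / (2 * C)"])
    show "set_integrable lebesgue (bl x0 k) f" using f unfolding locint_def by blast
  qed (use e C bl_lmeas in auto)
  \<comment> \<open>Half of \<epsilon> is spent on the L^1 error and half on the oscillation of
    \<phi> over a ball of measure V, both after multiplication by the constant C of
    \<open>err_integral\<close>.\<close>
  define w where "w = \<epsilon> / (2 * C * V)"
  have w: "w > 0" using e C V by (simp add: w_def)
  obtain R where R: "\<And>x. x \<in> bl x0 k \<Longrightarrow> norm x \<le> R" using bl_bounded unfolding bounded_iff by blast
  have "uniformly_continuous_on (cball 0 (R + 1)) \<phi>"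
    by (rule compact_uniformly_continuous) (auto intro: continuous_on_subset[OF \<phi>(1)])
  then obtain \<delta> where \<delta>: "\<delta> > 0" "\<And>x y. x \<in> cball 0 (R + 1) \<Longrightarrow> y \<in> cball 0 (R + 1) \<Longrightarrow> dist y x < \<delta> \<Longrightarrow> dist (\<phi> y) (\<phi> x) < w"
    unfolding uniformly_continuous_on_def using w by blast
  obtain K where K: "K > 0" "\<And>x. norm x \<le> K * norm (Pm *v x)" using norm_le_P by blast
  obtain m where m: "K / min \<delta> 1 < r ^ m" using r1 real_arch_pow by blast
  \<comment> \<open>The finest scale is then at most -m, so points are closer than min \<delta> 1 to
    their centres. The bound 1 keeps the centres in the compact ball where \<phi> is uniformly
    continuous.\<close>
  define L where "L = nat k + m"
  interpret sparse A D r lp d x0 l L f by unfold_locales (rule f)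
  have k0: "k0 = k" by (simp add: k0_def k_def)
  have close: "norm (x - cc L x) < min \<delta> 1" for x
  proof -
    have "G (kk L) (x - cc L x) \<le> 1/4" unfolding kk_def cc_def by (rule ctr_close) simp
    moreover have "kk L \<le> - int m"
    proof -
      have "int L * 1 \<le> int L * int ga" using grid(3) by (intro mult_left_mono) auto
      moreover have "k \<le> int (nat k)" by simp
      ultimately show ?thesis unfolding kk_def lev_def k0 L_def by simp
    qed
    ultimately have "G (- int m) (x - cc L x) \<le> 1/4" using G_antimono order_trans by blast
    then have g: "r ^ m * G 0 (x - cc L x) < 1" using G_step[of m "- int m" "x - cc L x"] by simp
    have "K / min \<delta> 1 * G 0 (x - cc L x) \<le> r ^ m * G 0 (x - cc L x)" using m by (intro mult_right_mono) auto
    with g have "K / min \<delta> 1 * G 0 (x - cc L x) < 1" by simp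
    then have "K * G 0 (x - cc L x) < min \<delta> 1" using \<delta>(1) by (simp add: pos_divide_less_eq)
    then show ?thesis using K(2)[of "x - cc L x"] by (simp add: G_def)
  qed
  have osc_w: "\<bar>\<phi> x - \<phi> (cc L x)\<bar> \<le> w" if "x \<in> Q0" for x
  proof -
    have "x \<in> bl x0 k" using that Q0_bl unfolding k_def by blast
    then have "norm x \<le> R" by (rule R)
    moreover have "norm (cc L x) \<le> norm x + norm (x - cc L x)" using norm_triangle_sub[of "cc L x" x] by (simp add: norm_minus_commute)
    ultimately have "dist (\<phi> x) (\<phi> (cc L x)) < w" using close[of x] by (intro \<delta>(2)) (auto simp: dist_norm)
    then show ?thesis by (simp add: dist_real_def)
  qed
  have CgC: "1 + Cg = C" by (simp add: C_def Cg_def)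
  have "(LINT x|lebesgue. err \<phi> x) \<le> C * ((LINT x:bl x0 k|lebesgue. \<bar>f x - \<phi> x\<bar>) + w * V)"
    using err_integral[OF \<phi>(1) osc_w] unfolding CgC k0 V_def .
  also have "\<dots> < C * (\<epsilon> / (2 * C) + w * V)" using C \<phi>(2) by (intro mult_strict_left_mono) auto
  also have "\<dots> = \<epsilon>" using C V by (simp add: w_def field_simps)
  finally have int: "(LINT x|lebesgue. err \<phi> x) < \<epsilon>" .
  have Cc: "Csd = Cp * bdet A ^ ga + 2 * Cs" by (simp add: Csd_def Cs_def Cg_def Kst_def)
  have "sparse_family x0 l f \<epsilon> II snd (\<lambda>t. kk (fst t)) Qt EE (err \<phi>)"
    unfolding sparse_family_def
  proof (intro conjI ballI allI impI)
    fix t assume t: "t \<in> II"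
    show "Qt t \<subseteq> bl (snd t) (kk (fst t))" by (rule Qt_subset(1)[OF t])
    show "Qt t \<subseteq> bl x0 (l + int ga)" using Qt_subset(2)[OF t] Q0_bl by (rule order_trans)
    show "EE t \<subseteq> Qt t" by (rule EE_sub[OF t])
    show "bdet A powr real_of_int (kk (fst t)) \<le> 2 * bdet A ^ ga * measure lebesgue (EE t)" by (rule EE_measure[OF t])
  next
    fix x assume "x \<in> bl x0 l"
    then show "\<bar>f x - proj x0 l f x\<bar> \<le> Csd * (\<Sum>t\<in>II. osc f (snd t) (kk (fst t)) * indicator (Qt t) x) + err \<phi> x"
      unfolding Cc using main_bound unfolding os_def by blast
  next
    show "Qt t \<subseteq> Qt u \<or> Qt u \<subseteq> Qt t \<or> Qt t \<inter> Qt u = {}" if "t \<in> II" "u \<in> II" for t u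
      by (rule laminar[OF that])
    show "EE t \<inter> EE u = {}" if "t \<noteq> u" for t u by (rule EE_disjoint[OF that])
  qed (simp_all add: finite_II EE_sets err_integrable err_nonneg int Qt_def)
  then show thesis by (rule that)
qed

end


section \<open>Recovering a norm from its associate norm\<close>

context aniso begin

lemma ennreal_enn2real_min_of_nat: "ennreal (enn2real (min y (of_nat n))) = min y (of_nat n)"
proof (rule ennreal_enn2real)
  have "min y (of_nat n) \<le> (of_nat n :: ennreal)" by simp
  then show "min y (of_nat n) < top" by (rule order_le_less_trans) (simp add: less_top[symmetric])
qed

lemma bounded_supp_integrable:
  fixes p :: "real^'n \<Rightarrow> real"
  assumes "p \<in> borel_measurable lebesgue" "\<And>x. \<bar>p x\<bar> \<le> c" "\<And>x. x \<notin> bl z k \<Longrightarrow> p x = 0"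
  shows "integrable lebesgue p"
proof (rule Bochner_Integration.integrable_bound[where f = "\<lambda>x. c * indicator (bl z k) x"])
  show "integrable lebesgue (\<lambda>x. c * indicator (bl z k) x)"
    using bl_lmeas[of z k] unfolding fmeasurable_def by (intro integrable_mult_right integrable_real_indicator) auto
  show "AE x in lebesgue. norm (p x) \<le> norm (c * indicator (bl z k) x)"
  proof (rule AE_I2)
    fix x show "norm (p x) \<le> norm (c * indicator (bl z k) x)"
      using assms(2)[of x] assms(3)[of x] by (cases "x \<in> bl z k") auto
  qed
qed (rule assms(1))

context
  fixes Y :: "(real^'n \<Rightarrow> ennreal) \<Rightarrow> ennreal"
  assumes Y: "ball_Bfs A D Y"
begin

lemma Y_scale: "c \<ge> 0 \<Longrightarrow> g \<in> borel_measurable lebesgue \<Longrightarrow> Y (\<lambda>x. ennreal c * g x) = ennreal c * Y g"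
  using Y unfolding ball_Bfs_def ball_qBfs_def by blast

lemma Y_add: "g \<in> borel_measurable lebesgue \<Longrightarrow> h \<in> borel_measurable lebesgue \<Longrightarrow> Y (\<lambda>x. g x + h x) \<le> Y g + Y h"
  using Y unfolding ball_Bfs_def by blast

lemma Y_AE_mono: "g \<in> borel_measurable lebesgue \<Longrightarrow> h \<in> borel_measurable lebesgue \<Longrightarrow> AE x in lebesgue. g x \<le> h x \<Longrightarrow> Y g \<le> Y h"
  using Y unfolding ball_Bfs_def ball_qBfs_def by blast

lemma Y_mono: "g \<in> borel_measurable lebesgue \<Longrightarrow> h \<in> borel_measurable lebesgue \<Longrightarrow> (\<And>x. g x \<le> h x) \<Longrightarrow> Y g \<le> Y h"
  by (rule Y_AE_mono) auto

lemma Y_zero: "Y (\<lambda>x. 0) = 0"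
  using Y_scale[of 0 "\<lambda>x. 0"] by simp

lemma Y_fatou:
  assumes "\<And>m. gs m \<in> borel_measurable lebesgue" "g \<in> borel_measurable lebesgue"
    "\<And>x. incseq (\<lambda>m. gs m x)" "\<And>x. (\<lambda>m. gs m x) \<longlonglongrightarrow> g x"
  shows "(\<lambda>m. Y (gs m)) \<longlonglongrightarrow> Y g"
proof -
  have "\<forall>gs g. (\<forall>m. gs m \<in> borel_measurable lebesgue) \<longrightarrow> g \<in> borel_measurable lebesgue \<longrightarrow>
          (AE x in lebesgue. incseq (\<lambda>m. gs m x) \<and> (\<lambda>m. gs m x) \<longlonglongrightarrow> g x) \<longrightarrow>
          (\<lambda>m. Y (gs m)) \<longlonglongrightarrow> Y g"
    using Y unfolding ball_Bfs_def ball_qBfs_def by (elim conjE)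
  then show ?thesis using assms by auto
qed

text \<open>A separation argument done by hand. If \<open>Y u > M\<close>, let gs minimize the L^2
  distance to u among functions 0 \<le> g \<le> u with Y-norm at most M. Then h = u - gs is nonzero,
  and minimality makes h, suitably scaled, an admissible dual function whose pairing with u exceeds
  M.\<close>

lemma lorentz_luxemburg_bounded:
  fixes u :: "real^'n \<Rightarrow> real"
  assumes um: "u \<in> borel_measurable lebesgue" and ub: "\<And>x. 0 \<le> u x" "\<And>x. u x \<le> b" and us: "\<And>x. x \<notin> bl z k \<Longrightarrow> u x = 0"
    and M: "M > 0"
    and dual: "\<And>h. h \<in> borel_measurable lebesgue \<Longrightarrow> assoc_norm Y h \<le> 1 \<Longrightarrow> (\<integral>\<^sup>+x. ennreal (u x) * h x \<partial>lebesgue) \<le> ennreal M"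
  shows "Y (\<lambda>x. ennreal (u x)) \<le> ennreal M"
proof (rule ccontr)
  assume "\<not> Y (\<lambda>x. ennreal (u x)) \<le> ennreal M"
  then have big: "ennreal M < Y (\<lambda>x. ennreal (u x))" by simp
  define good where "good g \<longleftrightarrow> g \<in> borel_measurable lebesgue \<and> (\<forall>x. 0 \<le> g x) \<and> Y (\<lambda>x. ennreal (g x)) \<le> ennreal M" for g :: "real^'n \<Rightarrow> real"
  define KK where "KK = {g. good g \<and> (\<forall>x. g x \<le> u x)}"
  define J where "J g = (LINT x|lebesgue. (u x - g x)\<^sup>2)" for g
  have b0: "0 \<le> b" using ub[of undefined] by linarith
  have good_conv: "good (\<lambda>x. (1 - t) * g x + t * h x)" if "good g" "good h" "0 \<le> t" "t \<le> 1" for g h t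
  proof -
    note g = that(1)[unfolded good_def] and h = that(2)[unfolded good_def]
    have [measurable]: "g \<in> borel_measurable lebesgue" "h \<in> borel_measurable lebesgue" using g h by auto
    have "Y (\<lambda>x. ennreal ((1 - t) * g x + t * h x)) = Y (\<lambda>x. ennreal (1 - t) * ennreal (g x) + ennreal t * ennreal (h x))"
      using g h that(3,4) by (simp add: ennreal_plus ennreal_mult)
    also have "\<dots> \<le> Y (\<lambda>x. ennreal (1 - t) * ennreal (g x)) + Y (\<lambda>x. ennreal t * ennreal (h x))"
      by (rule Y_add) measurable
    also have "\<dots> = ennreal (1 - t) * Y (\<lambda>x. ennreal (g x)) + ennreal t * Y (\<lambda>x. ennreal (h x))"
      using that(3,4) by (subst (1 2) Y_scale) auto
    also have "\<dots> \<le> ennreal (1 - t) * ennreal M + ennreal t * ennreal M"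
      using g h by (intro add_mono mult_left_mono) auto
    also have "\<dots> = ennreal M" using that(3,4) M by (simp add: ennreal_mult[symmetric] ennreal_plus[symmetric] algebra_simps del: ennreal_plus)
    finally show ?thesis using g h that(3,4) unfolding good_def by auto
  qed
  have KKd: "g \<in> borel_measurable lebesgue" "0 \<le> g x" "g x \<le> u x" "good g" "\<bar>g x\<bar> \<le> b" "x \<notin> bl z k \<Longrightarrow> g x = 0" if "g \<in> KK" for g x
  proof -
    show 1: "g \<in> borel_measurable lebesgue" "0 \<le> g x" "g x \<le> u x" "good g" using that unfolding KK_def good_def by auto
    show "\<bar>g x\<bar> \<le> b" using 1 ub(2)[of x] by simp
    show "x \<notin> bl z k \<Longrightarrow> g x = 0" using 1 us[of x] by simp
  qed
  have uab: "\<bar>u x\<bar> \<le> b" for x using ub[of x] by simp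
  have sqint: "integrable lebesgue (\<lambda>x. (p x - q x) * (p' x - q' x))"
    if "p \<in> borel_measurable lebesgue" "q \<in> borel_measurable lebesgue" "p' \<in> borel_measurable lebesgue" "q' \<in> borel_measurable lebesgue"
      "\<And>x. \<bar>p x\<bar> \<le> c" "\<And>x. \<bar>q x\<bar> \<le> c" "\<And>x. \<bar>p' x\<bar> \<le> c" "\<And>x. \<bar>q' x\<bar> \<le> c"
      "\<And>x. x \<notin> bl z k \<Longrightarrow> p x = 0" "\<And>x. x \<notin> bl z k \<Longrightarrow> q x = 0" for p q p' q' :: "real^'n \<Rightarrow> real" and c :: real
  proof (rule bounded_supp_integrable[where c = "(2 * c) * (2 * c)" and z = z and k = k])
    show "(\<lambda>x. (p x - q x) * (p' x - q' x)) \<in> borel_measurable lebesgue"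
      by (intro borel_measurable_times borel_measurable_diff that)
    show "\<bar>(p x - q x) * (p' x - q' x)\<bar> \<le> (2 * c) * (2 * c)" for x
      unfolding abs_mult using that(5,6,7,8)[of x] by (intro mult_mono) linarith+
    show "x \<notin> bl z k \<Longrightarrow> (p x - q x) * (p' x - q' x) = 0" for x using that(9,10)[of x] by simp
  qed
  have zero: "(\<lambda>x. 0) \<in> KK" using Y_zero ub M unfolding KK_def good_def by auto
  have J0: "0 \<le> J g" for g unfolding J_def by (intro integral_nonneg_AE AE_I2) auto
  define m where "m = Inf (J ` KK)"
  have bdd: "bdd_below (J ` KK)" using J0 by (intro bdd_belowI[of _ 0]) auto
  have m_le: "m \<le> J g" if "g \<in> KK" for g unfolding m_def using bdd that by (intro cInf_lower) auto
  have m0: "0 \<le> m" unfolding m_def using J0 zero by (intro cInf_greatest) auto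
  \<comment> \<open>Near-minimizers at the rate 4^(-n), which makes successive differences summable
    in L^1.\<close>
  have "\<exists>g\<in>KK. J g < m + (1/4) ^ n" for n :: nat
  proof -
    have "Inf (J ` KK) < m + (1/4) ^ n" unfolding m_def by simp
    moreover have "J ` KK \<noteq> {}" using zero by blast
    ultimately have "\<exists>y\<in>J ` KK. y < m + (1/4) ^ n" by (intro cInf_lessD)
    then show ?thesis by (simp only: bex_simps)
  qed
  then obtain gn where gn: "\<And>n. gn n \<in> KK" "\<And>n. J (gn n) < m + (1/4) ^ n" by metis
  have conv: "AE x in lebesgue. convergent (\<lambda>n. gn n x)"
  proof -
    let ?df = "\<lambda>n x. gn (Suc n) x - gn n x"
    have dfm: "?df n \<in> borel_measurable lebesgue" for n using KKd(1)[OF gn(1)] by (intro borel_measurable_diff)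
    \<comment> \<open>Parallelogram law: the midpoint of two near-minimizers is again a
      competitor.\<close>
    have sq: "(LINT x|lebesgue. (?df n x)\<^sup>2) \<le> 4 * (1/4) ^ n" for n
    proof -
      let ?h = "\<lambda>x. (1 - 1/2) * gn n x + (1/2) * gn (Suc n) x"
      have "?h \<in> KK" unfolding KK_def
      proof (intro CollectI conjI allI)
        show "good ?h" by (rule good_conv) (use KKd(4)[OF gn(1)] in auto)
        show "?h x \<le> u x" for x using KKd(3)[OF gn(1), of n x] KKd(3)[OF gn(1), of "Suc n" x] by simp
      qed
      then have "m \<le> J ?h" by (rule m_le)
      have i: "integrable lebesgue (\<lambda>x. (u x - gn j x)\<^sup>2)" for j
        unfolding power2_eq_square by (rule sqint[where c = b]) (use um KKd[OF gn(1)] uab us in auto)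
      have hh: "integrable lebesgue (\<lambda>x. (u x - ?h x)\<^sup>2)"
        unfolding power2_eq_square by (rule sqint[where c = b]) (use um KKd[OF \<open>?h \<in> KK\<close>] uab us in auto)
      have "(?df n x)\<^sup>2 = 2 * (u x - gn n x)\<^sup>2 + 2 * (u x - gn (Suc n) x)\<^sup>2 - 4 * (u x - ?h x)\<^sup>2" for x
        by (simp add: power2_eq_square algebra_simps)
      then have "(LINT x|lebesgue. (?df n x)\<^sup>2) = 2 * J (gn n) + 2 * J (gn (Suc n)) - 4 * J ?h"
        using i hh unfolding J_def by simp
      also have "\<dots> \<le> 2 * (m + (1/4) ^ n) + 2 * (m + (1/4) ^ Suc n) - 4 * m"
        by (intro diff_mono add_mono mult_left_mono less_imp_le[OF gn(2)] \<open>m \<le> J ?h\<close>) auto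
      also have "\<dots> \<le> 4 * (1/4) ^ n" by simp
      finally show ?thesis .
    qed
    define V where "V = measure lebesgue (bl z k)"
    have ab: "(\<integral>\<^sup>+x. ennreal \<bar>?df n x\<bar> \<partial>lebesgue) \<le> ennreal ((V + 4) * (1/2) ^ n)" for n
    proof -
      have i1: "integrable lebesgue (\<lambda>x. (?df n x)\<^sup>2)"
        unfolding power2_eq_square by (rule sqint[where c = b]) (use KKd[OF gn(1)] in auto)
      have i2: "integrable lebesgue (indicator (bl z k) :: _ \<Rightarrow> real)"
        using bl_lmeas[of z k] unfolding fmeasurable_def by (intro integrable_real_indicator) auto
      \<comment> \<open>Splitting at height 2^(-n) turns the L^2 bound into a summable L^1 bound on
        a set of finite measure, and hence into almost everywhere convergence.\<close>
      have pt: "\<bar>?df n x\<bar> \<le> (1/2) ^ n * indicator (bl z k) x + 2 ^ n * (?df n x)\<^sup>2" for x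
      proof (cases "x \<in> bl z k")
        case True
        show ?thesis
        proof (cases "\<bar>?df n x\<bar> \<le> (1/2) ^ n")
          case False
          then have "(1/2) ^ n * \<bar>?df n x\<bar> \<le> \<bar>?df n x\<bar> * \<bar>?df n x\<bar>" by (intro mult_right_mono) auto
          then have "2 ^ n * ((1/2) ^ n * \<bar>?df n x\<bar>) \<le> 2 ^ n * (?df n x)\<^sup>2" by (intro mult_left_mono) (auto simp: power2_eq_square)
          then have "\<bar>?df n x\<bar> \<le> 2 ^ n * (?df n x)\<^sup>2" by (simp add: power_one_over)
          then show ?thesis using True by (simp add: add_increasing)
        qed (use True in \<open>simp add: add_increasing2\<close>)
      qed (use KKd(6)[OF gn(1)] in auto)
      have "(\<integral>\<^sup>+x. ennreal \<bar>?df n x\<bar> \<partial>lebesgue) \<le> (\<integral>\<^sup>+x. ennreal ((1/2) ^ n * indicator (bl z k) x + 2 ^ n * (?df n x)\<^sup>2) \<partial>lebesgue)"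
        by (intro nn_integral_mono ennreal_leI pt)
      also have "\<dots> = ennreal (LINT x|lebesgue. (1/2) ^ n * indicator (bl z k) x + 2 ^ n * (?df n x)\<^sup>2)"
        using i1 i2 by (intro nn_integral_eq_integral) auto
      also have "(LINT x|lebesgue. (1/2) ^ n * indicator (bl z k) x + 2 ^ n * (?df n x)\<^sup>2) = (1/2) ^ n * V + 2 ^ n * (LINT x|lebesgue. (?df n x)\<^sup>2)"
        using i1 i2 by (simp add: V_def bl_lmeas)
      also have "ennreal \<dots> \<le> ennreal ((1/2) ^ n * V + 2 ^ n * (4 * (1/4) ^ n))"
        by (intro ennreal_leI add_left_mono mult_left_mono sq) auto
      also have "(1/2) ^ n * V + 2 ^ n * (4 * (1/4) ^ n) = (V + 4) * (1/2::real) ^ n"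
      proof -
        have "2 ^ n * (1/4::real) ^ n = (1/2) ^ n" by (simp add: power_mult_distrib[symmetric])
        then show ?thesis by (simp add: algebra_simps)
      qed
      finally show ?thesis .
    qed
    have "(\<integral>\<^sup>+x. (\<Sum>n. ennreal \<bar>?df n x\<bar>) \<partial>lebesgue) = (\<Sum>n. \<integral>\<^sup>+x. ennreal \<bar>?df n x\<bar> \<partial>lebesgue)"
      using dfm by (intro nn_integral_suminf) auto
    also have "\<dots> \<le> (\<Sum>n. ennreal ((V + 4) * (1/2) ^ n))" by (intro suminf_le ab) auto
    also have "\<dots> = ennreal (\<Sum>n. (V + 4) * (1/2) ^ n)"
      by (intro suminf_ennreal2 summable_mult summable_geometric) (auto simp: V_def)
    also have "\<dots> < \<infinity>" by simp
    finally have fin: "(\<integral>\<^sup>+x. (\<Sum>n. ennreal \<bar>?df n x\<bar>) \<partial>lebesgue) \<noteq> \<infinity>" by simp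
    have "AE x in lebesgue. (\<Sum>n. ennreal \<bar>?df n x\<bar>) \<noteq> \<infinity>"
      by (rule nn_integral_PInf_AE[OF _ fin]) (use dfm in auto)
    then show ?thesis
    proof eventually_elim
      case (elim x)
      then have "summable (\<lambda>n. \<bar>?df n x\<bar>)" by (intro summable_suminf_not_top) auto
      then have "summable (\<lambda>n. ?df n x)" by (rule summable_rabs_cancel)
      then have "convergent (\<lambda>n. (\<Sum>i<n. ?df i x) + gn 0 x)"
        by (intro convergent_add convergent_const) (simp add: summable_iff_convergent)
      moreover have "(\<Sum>i<n. ?df i x) + gn 0 x = gn n x" for n using sum_lessThan_telescope[of "\<lambda>i. gn i x" n] by simp
      ultimately show ?case by simp
    qed
  qed
  define gs where "gs x = enn2real (liminf (\<lambda>n. ennreal (gn n x)))" for x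
  have lim_le: "liminf (\<lambda>n. ennreal (gn n x)) \<le> ennreal (u x)" for x
    by (rule Liminf_le) (use KKd(3)[OF gn(1)] in \<open>auto intro!: always_eventually ennreal_leI\<close>)
  have gse: "ennreal (gs x) = liminf (\<lambda>n. ennreal (gn n x))" for x
    unfolding gs_def using lim_le[of x] by (intro ennreal_enn2real) (auto simp: le_less_trans)
  have gnm [measurable]: "gn n \<in> borel_measurable lebesgue" for n by (rule KKd(1)[OF gn(1)])
  have gsm: "gs \<in> borel_measurable lebesgue" unfolding gs_def by measurable
  have gs0: "0 \<le> gs x" for x by (simp add: gs_def)
  have gsu: "gs x \<le> u x" for x using lim_le[of x] ub(1)[of x] unfolding gse[symmetric] by simp
  \<comment> \<open>The Fatou property: the infima over tails increase to the lower limit, and each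
    has norm at most M.\<close>
  have YgsM: "Y (\<lambda>x. ennreal (gs x)) \<le> ennreal M"
  proof (rule LIMSEQ_le_const2)
    show "(\<lambda>n. Y (\<lambda>x. INF j\<in>{n..}. ennreal (gn j x))) \<longlonglongrightarrow> Y (\<lambda>x. ennreal (gs x))"
    proof (rule Y_fatou)
      show "(\<lambda>x. INF j\<in>{n..}. ennreal (gn j x)) \<in> borel_measurable lebesgue" for n by measurable
      show "(\<lambda>x. ennreal (gs x)) \<in> borel_measurable lebesgue" using gsm by measurable
      show inc: "incseq (\<lambda>n. INF j\<in>{n..}. ennreal (gn j x))" for x
        by (intro incseq_SucI INF_superset_mono) auto
      show "(\<lambda>n. INF j\<in>{n..}. ennreal (gn j x)) \<longlonglongrightarrow> ennreal (gs x)" for x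
        using LIMSEQ_SUP[OF inc[of x]] unfolding gse liminf_SUP_INF by simp
    qed
    show "\<exists>N. \<forall>n\<ge>N. Y (\<lambda>x. INF j\<in>{n..}. ennreal (gn j x)) \<le> ennreal M"
    proof (intro exI allI impI)
      fix n
      have "Y (\<lambda>x. INF j\<in>{n..}. ennreal (gn j x)) \<le> Y (\<lambda>x. ennreal (gn n x))"
        by (rule Y_mono) (measurable, auto intro: INF_lower)
      also have "\<dots> \<le> ennreal M" using KKd(4)[OF gn(1), of n] unfolding good_def by blast
      finally show "Y (\<lambda>x. INF j\<in>{n..}. ennreal (gn j x)) \<le> ennreal M" .
    qed
  qed
  have gsK: "gs \<in> KK" unfolding KK_def good_def using gsm gs0 gsu YgsM by auto
  have Jgs: "J gs = m"
  proof (rule antisym)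
    have lim: "AE x in lebesgue. (\<lambda>n. (u x - gn n x)\<^sup>2) \<longlonglongrightarrow> (u x - gs x)\<^sup>2"
      using conv
    proof eventually_elim
      case (elim x)
      then obtain l where l: "(\<lambda>n. gn n x) \<longlonglongrightarrow> l" unfolding convergent_def by blast
      have "0 \<le> l" by (rule LIMSEQ_le_const[OF l]) (use KKd(2)[OF gn(1)] in auto)
      have "(\<lambda>n. ennreal (gn n x)) \<longlonglongrightarrow> ennreal l" using l by (rule tendsto_ennrealI)
      then have "ennreal (gs x) = ennreal l" unfolding gse by (intro lim_imp_Liminf) auto
      then have "gs x = l" using gs0 \<open>0 \<le> l\<close> by simp
      then show ?case using l by (intro tendsto_intros) auto
    qed
    have "(\<lambda>n. J (gn n)) \<longlonglongrightarrow> J gs" unfolding J_def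
    proof (rule integral_dominated_convergence[where w = "\<lambda>x. (2 * b)\<^sup>2 * indicator (bl z k) x"])
      show "integrable lebesgue (\<lambda>x. (2 * b)\<^sup>2 * indicator (bl z k) x)"
        using bl_lmeas[of z k] unfolding fmeasurable_def by (intro integrable_mult_right integrable_real_indicator) auto
      show "AE x in lebesgue. norm ((u x - gn n x)\<^sup>2) \<le> (2 * b)\<^sup>2 * indicator (bl z k) x" for n
      proof (rule AE_I2)
        fix x show "norm ((u x - gn n x)\<^sup>2) \<le> (2 * b)\<^sup>2 * indicator (bl z k) x"
        proof (cases "x \<in> bl z k")
          case True
          have "\<bar>u x - gn n x\<bar> \<le> \<bar>2 * b\<bar>" using uab[of x] KKd(5)[OF gn(1), of n x] b0 by linarith
          then show ?thesis using True by (simp add: abs_le_square_iff)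
        next
          case False then show ?thesis using us KKd(6)[OF gn(1)] by simp
        qed
      qed
    qed (use um gsm lim in auto)
    moreover have "(\<lambda>n. m + (1/4) ^ n) \<longlonglongrightarrow> m + 0" by (intro tendsto_intros LIMSEQ_power_zero) auto
    ultimately show "J gs \<le> m" using gn(2) by (intro LIMSEQ_le[of "\<lambda>n. J (gn n)" _ "\<lambda>n. m + (1/4) ^ n"]) (auto intro: less_imp_le)
    show "m \<le> J gs" by (rule m_le[OF gsK])
  qed
  define h where "h x = u x - gs x" for x
  have h0: "0 \<le> h x" and hb: "h x \<le> b" for x using gsu[of x] gs0[of x] ub(2)[of x] by (auto simp: h_def)
  have hs: "x \<notin> bl z k \<Longrightarrow> h x = 0" for x using us[of x] KKd(6)[OF gsK, of x] by (simp add: h_def)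
  have hm [measurable]: "h \<in> borel_measurable lebesgue" unfolding h_def using um gsm by measurable
  define t where "t = (LINT x|lebesgue. h x * gs x)"
  have hgs: "integrable lebesgue (\<lambda>x. h x * gs x)" 
    using sqint[of u gs gs "\<lambda>x. 0" b] um gsm KKd(5,6)[OF gsK] uab us b0 by (simp add: h_def)
  have t0: "0 \<le> t" unfolding t_def using h0 gs0 by (intro integral_nonneg_AE AE_I2) auto
  have mpos: "0 < m"
  proof (rule ccontr)
    assume "\<not> 0 < m"
    then have "(LINT x|lebesgue. (u x - gs x)\<^sup>2) = 0" using m0 Jgs unfolding J_def by simp
    moreover have "integrable lebesgue (\<lambda>x. (u x - gs x)\<^sup>2)"
      unfolding power2_eq_square by (rule sqint[where c = b]) (use um gsm KKd(5,6)[OF gsK] uab us in auto)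
    ultimately have "AE x in lebesgue. (u x - gs x)\<^sup>2 = 0" by (subst (asm) integral_nonneg_eq_0_iff_AE) auto
    then have "AE x in lebesgue. ennreal (u x) \<le> ennreal (gs x)" by eventually_elim simp
    then have "Y (\<lambda>x. ennreal (u x)) \<le> Y (\<lambda>x. ennreal (gs x))"
      using um gsm by (intro Y_AE_mono) auto
    with YgsM big show False by simp
  qed
  \<comment> \<open>First-order condition at the minimizer, tested with functions g of norm at most
    M that need not lie below u.\<close>
  have variation: "(LINT x|lebesgue. h x * g x) \<le> t"
    if g: "good g" and gb: "\<And>x. g x \<le> c" and gsupp: "\<And>x. x \<notin> bl z k \<Longrightarrow> g x = 0" for g c
  proof -
    have gm: "g \<in> borel_measurable lebesgue" and g0: "\<And>x. 0 \<le> g x" using g unfolding good_def by auto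
    define c' where "c' = max b c"
    have gc: "\<bar>g x\<bar> \<le> c'" for x using g0[of x] gb[of x] by (simp add: c'_def)
    have gsc: "\<bar>gs x\<bar> \<le> c'" for x using KKd(5)[OF gsK, of x] by (simp add: c'_def)
    have uc: "\<bar>u x\<bar> \<le> c'" for x using uab[of x] by (simp add: c'_def)
    let ?w = "\<lambda>x. g x - gs x"
    have iw: "integrable lebesgue (\<lambda>x. (?w x)\<^sup>2)"
      unfolding power2_eq_square by (rule sqint[where c = c']) (use gm gsm gc gsc gsupp KKd(6)[OF gsK] in auto)
    have ihw: "integrable lebesgue (\<lambda>x. h x * ?w x)"
      unfolding h_def by (rule sqint[where c = c']) (use um gm gsm gc gsc uc us KKd(6)[OF gsK] in auto)
    have ih: "integrable lebesgue (\<lambda>x. (h x)\<^sup>2)"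
      unfolding h_def power2_eq_square by (rule sqint[where c = c']) (use um gm gsm gc gsc uc us KKd(6)[OF gsK] in auto)
    have key: "2 * (LINT x|lebesgue. h x * ?w x) \<le> e * (LINT x|lebesgue. (?w x)\<^sup>2)" if e: "0 < e" "e \<le> 1" for e
    proof -
      let ?g = "\<lambda>x. (1 - e) * gs x + e * g x"
      have gg: "good ?g" by (rule good_conv) (use KKd(4)[OF gsK] g e in auto)
      \<comment> \<open>The convex combination may exceed u; cutting it at u keeps it admissible and
        does not increase the distance to u.\<close>
      let ?p = "\<lambda>x. min (?g x) (u x)"
      have p: "?p \<in> KK" unfolding KK_def good_def
      proof (intro CollectI conjI allI)
        show pm: "?p \<in> borel_measurable lebesgue" using gm gsm um by measurable
        show "0 \<le> ?p x" for x using gs0 g0 e ub(1) by simp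
        have "Y (\<lambda>x. ennreal (?p x)) \<le> Y (\<lambda>x. ennreal (?g x))"
          using gm gsm um by (intro Y_mono) (auto intro!: ennreal_leI)
        then show "Y (\<lambda>x. ennreal (?p x)) \<le> ennreal M" using gg unfolding good_def by (meson order_trans)
      qed auto
      have "m \<le> J ?p" by (rule m_le[OF p])
      also have "J ?p \<le> (LINT x|lebesgue. (h x)\<^sup>2 - 2 * e * (h x * ?w x) + e\<^sup>2 * (?w x)\<^sup>2)"
        unfolding J_def
      proof (rule integral_mono_AE)
        show "integrable lebesgue (\<lambda>x. (u x - ?p x)\<^sup>2)"
          unfolding power2_eq_square by (rule sqint[where c = b]) (use um KKd[OF p] uab us in auto)
        show "integrable lebesgue (\<lambda>x. (h x)\<^sup>2 - 2 * e * (h x * ?w x) + e\<^sup>2 * (?w x)\<^sup>2)"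
          using ih ihw iw by auto
        show "AE x in lebesgue. (u x - ?p x)\<^sup>2 \<le> (h x)\<^sup>2 - 2 * e * (h x * ?w x) + e\<^sup>2 * (?w x)\<^sup>2"
        proof (rule AE_I2)
          fix x
          have "(u x - ?p x)\<^sup>2 \<le> (u x - ?g x)\<^sup>2" by (subst abs_le_square_iff[symmetric]) (auto simp: min_def)
          also have "\<dots> = (h x)\<^sup>2 - 2 * e * (h x * ?w x) + e\<^sup>2 * (?w x)\<^sup>2"
            by (simp add: h_def power2_eq_square algebra_simps)
          finally show "(u x - ?p x)\<^sup>2 \<le> (h x)\<^sup>2 - 2 * e * (h x * ?w x) + e\<^sup>2 * (?w x)\<^sup>2" .
        qed
      qed
      also have "\<dots> = (LINT x|lebesgue. (h x)\<^sup>2) - 2 * e * (LINT x|lebesgue. h x * ?w x) + e\<^sup>2 * (LINT x|lebesgue. (?w x)\<^sup>2)"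
        using ih ihw iw by simp
      also have "(LINT x|lebesgue. (h x)\<^sup>2) = m" using Jgs unfolding J_def h_def .
      finally have "e * (2 * (LINT x|lebesgue. h x * ?w x)) \<le> e * (e * (LINT x|lebesgue. (?w x)\<^sup>2))"
        by (simp add: power2_eq_square algebra_simps)
      then show ?thesis using e(1) by (simp only: mult_le_cancel_left_pos)
    qed
    have "2 * (LINT x|lebesgue. h x * ?w x) \<le> 0"
    proof (rule LIMSEQ_le_const)
      have "(\<lambda>n. (1 / real (Suc n)) * (LINT x|lebesgue. (?w x)\<^sup>2)) \<longlonglongrightarrow> 0 * (LINT x|lebesgue. (?w x)\<^sup>2)"
        by (intro tendsto_mult tendsto_const lim_1_over_n[THEN LIMSEQ_Suc])
      then show "(\<lambda>n. (1 / real (Suc n)) * (LINT x|lebesgue. (?w x)\<^sup>2)) \<longlonglongrightarrow> 0" by simp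
      show "\<exists>N. \<forall>n\<ge>N. 2 * (LINT x|lebesgue. h x * ?w x) \<le> (1 / real (Suc n)) * (LINT x|lebesgue. (?w x)\<^sup>2)"
        by (intro exI allI impI key) auto
    qed
    moreover have "(LINT x|lebesgue. h x * ?w x) = (LINT x|lebesgue. h x * g x) - t"
    proof -
      have "integrable lebesgue (\<lambda>x. h x * ?w x + h x * gs x)" using ihw hgs by (rule Bochner_Integration.integrable_add)
      then have "integrable lebesgue (\<lambda>x. h x * g x)" by (simp add: algebra_simps)
      then show ?thesis unfolding t_def right_diff_distrib using hgs by (rule Bochner_Integration.integral_diff)
    qed
    ultimately show ?thesis by simp
  qed
  \<comment> \<open>An arbitrary g of norm 1 is scaled by M and truncated to a bounded function on
    the ball, where the first-order condition applies; monotone convergence removes the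
    truncation.\<close>
  have hassoc: "(\<integral>\<^sup>+x. ennreal (h x) * g x \<partial>lebesgue) \<le> ennreal (t / M)"
    if gm: "g \<in> borel_measurable lebesgue" and gY: "Y g = 1" for g
  proof -
    define gk where "gk n x = enn2real (min (ennreal M * g x) (of_nat n)) * indicator (bl z k) x" for n x
    have gke: "ennreal (gk n x) = min (ennreal M * g x) (of_nat n) * indicator (bl z k) x" for n x
      unfolding gk_def by (simp add: indicator_def ennreal_enn2real_min_of_nat)
    have [measurable]: "gk n \<in> borel_measurable lebesgue" for n unfolding gk_def using gm by measurable
    have gkY: "Y (\<lambda>x. ennreal (gk n x)) \<le> ennreal M" for n
    proof -
      have "Y (\<lambda>x. ennreal (gk n x)) \<le> Y (\<lambda>x. ennreal M * g x)"
        using gm unfolding gke by (intro Y_mono) (auto simp: indicator_def)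
      also have "\<dots> = ennreal M" using Y_scale[of M g] gm gY M by simp
      finally show ?thesis .
    qed
    have gk0: "0 \<le> gk n x" for n x by (simp add: gk_def)
    have gkb: "gk n x \<le> real n" for n x
    proof -
      have "ennreal (gk n x) \<le> ennreal (real n)" unfolding gke by (auto simp: indicator_def ennreal_of_nat_eq_real_of_nat)
      then show ?thesis by simp
    qed
    have bnd: "(\<integral>\<^sup>+x. ennreal (h x) * ennreal (gk n x) \<partial>lebesgue) \<le> ennreal t" for n
    proof -
      have "(LINT x|lebesgue. h x * gk n x) \<le> t"
      proof (rule variation[where c = "real n"])
        have "gk n \<in> borel_measurable lebesgue" by measurable
        then show "good (gk n)" using gkY gk0 unfolding good_def by blast
        show "x \<notin> bl z k \<Longrightarrow> gk n x = 0" for x by (simp add: gk_def)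
      qed (rule gkb)
      moreover have "integrable lebesgue (\<lambda>x. h x * gk n x)"
      proof (rule bounded_supp_integrable[where c = "b * real n" and z = z and k = k])
        show "\<bar>h x * gk n x\<bar> \<le> b * real n" for x unfolding abs_mult using h0 hb gk0 gkb b0 by (intro mult_mono) auto
      qed (use hs in auto)
      ultimately show ?thesis
        using nn_integral_eq_integral[of lebesgue "\<lambda>x. h x * gk n x"] h0 gk0 by (simp add: ennreal_mult[symmetric] ennreal_leI)
    qed
    have sup: "(SUP n. ennreal (h x) * ennreal (gk n x)) = ennreal M * (ennreal (h x) * g x)" for x
    proof (cases "x \<in> bl z k")
      case True
      have "(SUP n. min (ennreal M * g x) (of_nat n)) = ennreal M * g x"
      proof -
        have "(SUP n. min (ennreal M * g x) (of_nat n)) = min (ennreal M * g x) (SUP n. of_nat n)"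
          by (simp add: inf_min[symmetric] inf_SUP)
        then show ?thesis by (simp add: ennreal_SUP_of_nat_eq_top)
      qed
      then show ?thesis unfolding gke using True by (simp add: SUP_mult_left_ennreal[symmetric] mult_ac)
    next
      case False then show ?thesis using hs by simp
    qed
    have "ennreal M * (\<integral>\<^sup>+x. ennreal (h x) * g x \<partial>lebesgue) = (\<integral>\<^sup>+x. ennreal M * (ennreal (h x) * g x) \<partial>lebesgue)"
      using gm by (intro nn_integral_cmult[symmetric]) measurable
    also have "\<dots> = (\<integral>\<^sup>+x. (SUP n. ennreal (h x) * ennreal (gk n x)) \<partial>lebesgue)" by (simp only: sup)
    also have "\<dots> = (SUP n. \<integral>\<^sup>+x. ennreal (h x) * ennreal (gk n x) \<partial>lebesgue)"
    proof (rule nn_integral_monotone_convergence_SUP)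
      show "incseq (\<lambda>n x. ennreal (h x) * ennreal (gk n x))"
        unfolding gke by (intro incseq_SucI le_funI mult_left_mono mult_right_mono min.mono) auto
    qed measurable
    also have "\<dots> \<le> ennreal t" by (intro SUP_least bnd)
    finally have "ennreal M * (\<integral>\<^sup>+x. ennreal (h x) * g x \<partial>lebesgue) \<le> ennreal t" .
    then have "ennreal (1 / M) * (ennreal M * (\<integral>\<^sup>+x. ennreal (h x) * g x \<partial>lebesgue)) \<le> ennreal (1 / M) * ennreal t"
      by (intro mult_left_mono) auto
    then show ?thesis using M t0 by (simp add: mult.assoc[symmetric] ennreal_mult[symmetric])
  qed
  \<comment> \<open>The function c h has associate norm at most c t / M, hence at most 1, and it
    pairs with u = h + gs to c (m + t).\<close>
  have contra: "c * (m + t) \<le> M" if c: "0 < c" "c * t \<le> M" for c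
  proof -
    have ch: "(\<lambda>x. ennreal c * ennreal (h x)) \<in> borel_measurable lebesgue" by measurable
    have "assoc_norm Y (\<lambda>x. ennreal c * ennreal (h x)) \<le> 1"
      unfolding assoc_norm_def
    proof (rule SUP_least)
      fix g assume "g \<in> {g \<in> borel_measurable lebesgue. Y g = 1}"
      then have gm: "g \<in> borel_measurable lebesgue" and gY: "Y g = 1" by auto
      have "(\<integral>\<^sup>+x. ennreal c * ennreal (h x) * g x \<partial>lebesgue) = ennreal c * (\<integral>\<^sup>+x. ennreal (h x) * g x \<partial>lebesgue)"
        unfolding mult.assoc using gm by (intro nn_integral_cmult) measurable
      also have "\<dots> \<le> ennreal c * ennreal (t / M)" by (intro mult_left_mono hassoc[OF gm gY]) auto
      also have "\<dots> = ennreal (c * t / M)" using c t0 M by (simp add: ennreal_mult[symmetric])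
      also have "\<dots> \<le> 1" using c M by (simp add: divide_simps)
      finally show "(\<integral>\<^sup>+x. ennreal c * ennreal (h x) * g x \<partial>lebesgue) \<le> 1" .
    qed
    from dual[OF ch this] have "(\<integral>\<^sup>+x. ennreal (u x) * (ennreal c * ennreal (h x)) \<partial>lebesgue) \<le> ennreal M" .
    also have "(\<integral>\<^sup>+x. ennreal (u x) * (ennreal c * ennreal (h x)) \<partial>lebesgue) = (\<integral>\<^sup>+x. ennreal (c * ((h x)\<^sup>2 + h x * gs x)) \<partial>lebesgue)"
      using c ub(1) h0 gs0 by (intro nn_integral_cong) (simp add: ennreal_mult[symmetric] h_def power2_eq_square algebra_simps)
    also have "\<dots> = ennreal (LINT x|lebesgue. c * ((h x)\<^sup>2 + h x * gs x))"
    proof (rule nn_integral_eq_integral)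
      have ih: "integrable lebesgue (\<lambda>x. (h x)\<^sup>2)"
        unfolding h_def power2_eq_square by (rule sqint[where c = b]) (use um gsm uab KKd(5,6)[OF gsK] us in auto)
      show "integrable lebesgue (\<lambda>x. c * ((h x)\<^sup>2 + h x * gs x))"
        using ih hgs by (intro integrable_mult_right Bochner_Integration.integrable_add) auto
    qed (use c h0 gs0 in \<open>auto intro!: AE_I2\<close>)
    also have "(LINT x|lebesgue. c * ((h x)\<^sup>2 + h x * gs x)) = c * (m + t)"
    proof -
      have ih: "integrable lebesgue (\<lambda>x. (h x)\<^sup>2)"
        unfolding h_def power2_eq_square by (rule sqint[where c = b]) (use um gsm uab KKd(5,6)[OF gsK] us in auto)
      have "(LINT x|lebesgue. (h x)\<^sup>2) = m" using Jgs unfolding J_def h_def .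
      then show ?thesis using ih hgs by (simp add: t_def)
    qed
    finally show ?thesis using M by simp
  qed
  \<comment> \<open>For t > 0 the choice c = M/t gives M + M m / t \<le> M. For t = 0 every c is
    admissible, and 2 M / m is large enough.\<close>
  show False
  proof (cases "t = 0")
    case True
    have "2 * M / m * (m + t) \<le> M" using contra[of "2 * M / m"] True M mpos by simp
    then show False using True M mpos by simp
  next
    case False
    then have "t > 0" using t0 by simp
    have "M / t * (m + t) \<le> M" using contra[of "M / t"] \<open>t > 0\<close> M by simp
    moreover have "M / t * (m + t) = M / t * m + M" using \<open>t > 0\<close> by (simp add: distrib_left)
    ultimately have "M / t * m \<le> 0" by linarith
    moreover have "M / t * m > 0" using \<open>t > 0\<close> M mpos by simp
    ultimately show False by simp
  qed
qed

text \<open>Truncations in height and support reduce to the bounded case, and the Fatou property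
  passes to the limit.\<close>

lemma lorentz_luxemburg:
  assumes F: "F \<in> borel_measurable lebesgue"
    and dual: "\<And>h. h \<in> borel_measurable lebesgue \<Longrightarrow> assoc_norm Y h \<le> 1 \<Longrightarrow> (\<integral>\<^sup>+x. F x * h x \<partial>lebesgue) \<le> M"
  shows "Y F \<le> M"
proof (rule ennreal_le_epsilon)
  fix e :: real assume fin: "M < top" and e: "0 < e"
  \<comment> \<open>The bounded case asks for a positive bound, so M is enlarged by e.\<close>
  define M' where "M' = enn2real M + e"
  have M': "M' > 0" "M + ennreal e = ennreal M'"
    using e fin by (auto simp: M'_def add_nonneg_pos ennreal_plus)
  define Fn where "Fn n x = enn2real (min (F x) (of_nat n)) * indicator (bl 0 (int n)) x" for n x
  have Fne: "ennreal (Fn n x) = min (F x) (of_nat n) * indicator (bl 0 (int n)) x" for n x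
    unfolding Fn_def by (simp add: indicator_def ennreal_enn2real_min_of_nat)
  have [measurable]: "Fn n \<in> borel_measurable lebesgue" for n unfolding Fn_def using F by measurable
  have le: "Y (\<lambda>x. ennreal (Fn n x)) \<le> ennreal M'" for n
  proof (rule lorentz_luxemburg_bounded[where b = "real n" and z = 0 and k = "int n"])
    show "Fn n x \<le> real n" for x
    proof -
      have "ennreal (Fn n x) \<le> ennreal (real n)" unfolding Fne by (auto simp: indicator_def ennreal_of_nat_eq_real_of_nat)
      then show ?thesis by simp
    qed
    show "Fn n \<in> borel_measurable lebesgue" by measurable
    show "0 \<le> Fn n x" for x by (simp add: Fn_def)
    show "x \<notin> bl 0 (int n) \<Longrightarrow> Fn n x = 0" for x by (simp add: Fn_def)
    fix h assume h: "h \<in> borel_measurable lebesgue" "assoc_norm Y h \<le> 1"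
    have "(\<integral>\<^sup>+x. ennreal (Fn n x) * h x \<partial>lebesgue) \<le> (\<integral>\<^sup>+x. F x * h x \<partial>lebesgue)"
      unfolding Fne by (intro nn_integral_mono mult_right_mono) (auto simp: indicator_def)
    also have "\<dots> \<le> M" by (rule dual[OF h])
    also have "M \<le> ennreal M'" unfolding M'(2)[symmetric] by simp
    finally show "(\<integral>\<^sup>+x. ennreal (Fn n x) * h x \<partial>lebesgue) \<le> ennreal M'" .
  qed (rule M'(1))
  have "(\<lambda>n. Y (\<lambda>x. ennreal (Fn n x))) \<longlonglongrightarrow> Y F"
  proof (rule Y_fatou)
    show inc: "incseq (\<lambda>n. ennreal (Fn n x))" for x
      unfolding Fne
    proof (intro incseq_SucI mult_mono min.mono)
      fix n show "indicator (bl 0 (int n)) x \<le> (indicator (bl 0 (int (Suc n))) x :: ennreal)"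
        using bl_mono[of "int n" "int (Suc n)" 0] by (auto simp: indicator_def)
    qed auto
    show "(\<lambda>n. ennreal (Fn n x)) \<longlonglongrightarrow> F x" for x
    proof -
      obtain j :: nat where j: "G (0 + int j) x < 1" using G_exhaust by blast
      have "eventually (\<lambda>n. ennreal (Fn n x) = min (F x) (of_nat n)) sequentially"
        using eventually_ge_at_top[of j]
      proof eventually_elim
        case (elim n)
        then have "x \<in> bl 0 (int n)" using j G_antimono[of "int j" "int n" x] by (simp add: bl_iff)
        then show ?case unfolding Fne by simp
      qed
      moreover have "(\<lambda>n. min (F x) (of_nat n)) \<longlonglongrightarrow> min (F x) top"
        by (intro tendsto_min tendsto_const of_nat_tendsto_top_ennreal)
      ultimately show ?thesis by (subst tendsto_cong) auto
    qed
  qed (use F in auto)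
  then show "Y F \<le> M + ennreal e" unfolding M'(2) using le by (intro LIMSEQ_le_const2) auto
qed

end
end


section \<open>Powers of extended reals and the maximal function\<close>

lemma epow_ennreal: "0 \<le> a \<Longrightarrow> epow (ennreal a) p = ennreal (a powr p)"
  by (simp add: epow_def)

lemma epow_top [simp]: "epow \<infinity> p = \<infinity>" by (simp add: epow_def)

lemma epow_zero [simp]: "epow 0 p = 0" by (simp add: epow_def)

lemma epow_mono: assumes "0 \<le> p" "x \<le> y" shows "epow x p \<le> epow y p"
proof (cases y)
  case (real b)
  then obtain a where a: "x = ennreal a" "0 \<le> a" using assms(2) by (cases x) (auto simp: top_unique)
  then have "a \<le> b" using assms(2) real by simp
  then show ?thesis using a real assms(1) by (simp add: epow_ennreal powr_mono2)
qed (simp add: epow_def)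

lemma epow_epow: "epow (epow x a) b = epow x (a * b)"
  by (cases x) (auto simp: epow_def powr_powr)

lemma epow_one [simp]: "epow x 1 = x"
  by (cases x) (auto simp: epow_def)

lemma epow_measurable [measurable]: "f \<in> borel_measurable M \<Longrightarrow> (\<lambda>x. epow (f x) p) \<in> borel_measurable M"
proof -
  assume [measurable]: "f \<in> borel_measurable M"
  show ?thesis unfolding epow_def by measurable
qed

lemma epow_cmult: "0 \<le> c \<Longrightarrow> 0 < p \<Longrightarrow> epow (ennreal c * x) p = ennreal (c powr p) * epow x p"
proof (cases x)
  case (real a)
  assume "0 \<le> c"
  then show ?thesis using real by (simp add: ennreal_mult[symmetric] epow_ennreal powr_mult)
next
  case top
  assume "0 \<le> c" "0 < p"
  then show ?thesis using top by (cases "c = 0") (auto simp: ennreal_mult_top epow_def)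
qed

lemma epow_eq_0: "epow x p = 0 \<longleftrightarrow> x = 0"
  by (cases x) (auto simp: epow_def)

lemma epow_less_top: "epow x p < \<infinity> \<longleftrightarrow> x < \<infinity>"
  by (cases x) (auto simp: epow_def)

text \<open>Young's inequality without the weights 1/s and 1/s': compare y with x^(s-1) and bound
  the product by the dominating term.\<close>

lemma young_simple:
  fixes x y s :: real
  assumes s: "1 < s" and x: "0 \<le> x" and y: "0 \<le> y"
  shows "x * y \<le> x powr s + y powr (s / (s - 1))"
proof (cases "x = 0 \<or> y = 0")
  case False
  then have x: "0 < x" and y: "0 < y" using assms(2,3) by (auto simp: less_le)
  show ?thesis
  proof (cases "y \<le> x powr (s - 1)")
    case True
    have "x * y \<le> x * x powr (s - 1)" using True x by (intro mult_left_mono) auto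
    also have "\<dots> = x powr s" using x by (simp add: powr_mult_base)
    finally show ?thesis by (simp add: add_increasing2)
  next
    case False
    have "x = (x powr (s - 1)) powr (1 / (s - 1))" using x s by (simp add: powr_powr)
    also have "\<dots> \<le> y powr (1 / (s - 1))" using False s by (intro powr_mono2) auto
    finally have "x * y \<le> y powr (1 / (s - 1)) * y" using y by (intro mult_right_mono) auto
    also have "\<dots> = y powr (1 + 1 / (s - 1))" using y by (simp add: powr_add mult.commute)
    also have "1 + 1 / (s - 1) = s / (s - 1)" using s by (simp add: field_simps)
    finally show ?thesis by (simp add: add_increasing)
  qed
qed auto

context aniso begin

lemma maxf_ge: "x \<in> bl z k \<Longrightarrow> (\<integral>\<^sup>+ y. g y * indicator (bl z k) y \<partial>lebesgue) / emeasure lebesgue (bl z k) \<le> maxf A D g x"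
  unfolding maxf_def by (rule SUP_upper) auto

text \<open>Strict superlevel sets are unions of open balls, so the maximal function is measurable
  for every g.\<close>

lemma maxf_measurable: "maxf A D g \<in> borel_measurable lebesgue"
proof -
  have "{x. a < maxf A D g x} \<in> sets lebesgue" for a
  proof -
    have "{x. a < maxf A D g x} = \<Union>{B \<in> dballs A D. a < (\<integral>\<^sup>+ y. g y * indicator B y \<partial>lebesgue) / emeasure lebesgue B}"
      unfolding maxf_def less_SUP_iff by auto
    moreover have "open \<dots>" by (intro open_Union) (auto simp: dballs_eq bl_open)
    ultimately show ?thesis by auto
  qed
  then show ?thesis by (intro borel_measurableI_greater) simp
qed

lemma maxf_cmult: "g \<in> borel_measurable lebesgue \<Longrightarrow> maxf A D (\<lambda>y. c * g y) x = c * maxf A D g x"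
proof -
  assume g: "g \<in> borel_measurable lebesgue"
  have B: "B \<in> sets lebesgue" if "B \<in> {B \<in> dballs A D. x \<in> B}" for B using that by (auto simp: dballs_eq)
  have "maxf A D (\<lambda>y. c * g y) x = (SUP B\<in>{B \<in> dballs A D. x \<in> B}. c * ((\<integral>\<^sup>+ y. g y * indicator B y \<partial>lebesgue) / emeasure lebesgue B))"
    unfolding maxf_def
  proof (rule SUP_cong[OF refl])
    fix B assume B': "B \<in> {B \<in> dballs A D. x \<in> B}"
    have "(\<integral>\<^sup>+ y. c * g y * indicator B y \<partial>lebesgue) = c * (\<integral>\<^sup>+ y. g y * indicator B y \<partial>lebesgue)"
      unfolding mult.assoc using g B[OF B'] by (intro nn_integral_cmult) auto
    then show "(\<integral>\<^sup>+ y. c * g y * indicator B y \<partial>lebesgue) / emeasure lebesgue B = c * ((\<integral>\<^sup>+ y. g y * indicator B y \<partial>lebesgue) / emeasure lebesgue B)"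
      by (simp add: ennreal_times_divide)
  qed
  also have "\<dots> = c * maxf A D g x" unfolding maxf_def by (rule SUP_mult_left_ennreal[symmetric])
  finally show ?thesis .
qed

text \<open>One ball through x already shows it: a set of relative density c in a ball has maximal
  function at least c on that ball.\<close>

lemma maxf_indicator_ge:
  assumes "x \<in> bl z k" "E \<in> sets lebesgue" "E \<subseteq> bl z k" "0 \<le> c" "c * bdet A powr real_of_int k \<le> measure lebesgue E"
  shows "ennreal c \<le> maxf A D (indicator E) x"
proof -
  have fm: "E \<in> lmeasurable" using assms(2) by (intro bounded_set_imp_lmeasurable bounded_subset[OF bl_bounded assms(3)]) auto
  have "(\<integral>\<^sup>+ y. indicator E y * indicator (bl z k) y \<partial>lebesgue) = (\<integral>\<^sup>+ y. indicator E y \<partial>lebesgue)"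
    using assms(3) by (intro nn_integral_cong) (auto simp: indicator_def)
  also have "\<dots> = ennreal (measure lebesgue E)" using assms(2) fm by (simp add: emeasure_eq_measure2)
  finally have "ennreal (measure lebesgue E) / ennreal (bdet A powr real_of_int k) \<le> maxf A D (indicator E) x"
    using maxf_ge[OF assms(1), of "indicator E"] by (simp add: emeasure_bl)
  moreover have "ennreal c \<le> ennreal (measure lebesgue E) / ennreal (bdet A powr real_of_int k)"
    using assms(4,5) b_gt1 by (subst divide_ennreal) (auto intro!: ennreal_leI simp: pos_le_divide_eq)
  ultimately show ?thesis by (rule order_trans[rotated])
qed

end

section \<open>The function space and the exponent-one seminorm\<close>

locale bqbf = aniso_poly A D r lp d for A :: "real^'n^'n" and D r lp d +
  fixes N :: "(real^'n \<Rightarrow> ennreal) \<Rightarrow> ennreal" and th p0 pm :: real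
  assumes X: "ball_qBfs A D N"
    and FS: "assumption_FS A D N pm"
    and th: "0 < th" "th < 1" "th < pm" "th < p0" and AA: "assumption_A A D N th p0"
begin

abbreviation "Y \<equiv> Xpow N (1 / th)"

lemma Y_Bfs: "ball_Bfs A D Y" using AA unfolding assumption_A_def by blast

lemmas Y_scale' = Y_scale[OF Y_Bfs] and Y_add' = Y_add[OF Y_Bfs] and Y_mono' = Y_mono[OF Y_Bfs]

lemma N_scale: "c \<ge> 0 \<Longrightarrow> g \<in> borel_measurable lebesgue \<Longrightarrow> N (\<lambda>x. ennreal c * g x) = ennreal c * N g"
  using X unfolding ball_qBfs_def by blast

lemma N_mono: "g \<in> borel_measurable lebesgue \<Longrightarrow> h \<in> borel_measurable lebesgue \<Longrightarrow> (\<And>x. g x \<le> h x) \<Longrightarrow> N g \<le> N h"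
proof -
  have "\<forall>g h. g \<in> borel_measurable lebesgue \<longrightarrow> h \<in> borel_measurable lebesgue \<longrightarrow>
          (AE x in lebesgue. g x \<le> h x) \<longrightarrow> N g \<le> N h"
    using X unfolding ball_qBfs_def by (elim conjE)
  then show "g \<in> borel_measurable lebesgue \<Longrightarrow> h \<in> borel_measurable lebesgue \<Longrightarrow> (\<And>x. g x \<le> h x) \<Longrightarrow> N g \<le> N h"
    by simp
qed

lemma N_zero_AE: "g \<in> borel_measurable lebesgue \<Longrightarrow> N g = 0 \<Longrightarrow> AE x in lebesgue. g x = 0"
  using X unfolding ball_qBfs_def by blast

lemma N_ball: "N (indicator (bl x k)) < \<infinity>"
  using X bl_in_dballs unfolding ball_qBfs_def by blast

lemma N_ball_pos: "0 < N (indicator (bl x k))"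
proof (rule ccontr)
  assume "\<not> 0 < N (indicator (bl x k))"
  then have "N (indicator (bl x k)) = 0" by (simp add: not_gr_zero)
  from N_zero_AE[OF _ this] have "AE y in lebesgue. y \<notin> bl x k" by (auto elim: eventually_mono simp: indicator_def split: if_splits)
  then have "bl x k \<in> null_sets lebesgue" using AE_iff_null_sets[of "bl x k" lebesgue] by simp
  then show False using emeasure_bl[of x k] b_gt1 by (auto simp: null_sets_def)
qed

lemma ind_norm_bl: "0 < ind_norm N (bl x k)" "N (indicator (bl x k)) = ennreal (ind_norm N (bl x k))"
  using N_ball[of x k] N_ball_pos[of x k] unfolding ind_norm_def by (auto simp: enn2real_positive_iff)

text \<open>The X-norm of F^(1/th), which is the norm of F in X^{1/th} raised to the power 1/th.
  Block norms have this form with F a sum of indicators, so they are treated through F.\<close>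

definition F_norm :: "(real^'n \<Rightarrow> real) \<Rightarrow> ennreal" where
  "F_norm F = N (\<lambda>x. ennreal (F x powr (1 / th)))"

lemma F_norm_Y: assumes "\<And>x. 0 \<le> F x" shows "F_norm F = epow (Y (\<lambda>x. ennreal (F x))) (1 / th)"
  unfolding F_norm_def Xpow_def epow_epow using th assms by (simp add: epow_ennreal)

lemma Y_F_norm: assumes "\<And>x. 0 \<le> F x" shows "Y (\<lambda>x. ennreal (F x)) = epow (F_norm F) th"
  unfolding F_norm_Y[OF assms] epow_epow using th by simp

lemma F_norm_mono:
  assumes "F \<in> borel_measurable lebesgue" "H \<in> borel_measurable lebesgue" "\<And>x. 0 \<le> F x" "\<And>x. F x \<le> H x"
  shows "F_norm F \<le> F_norm H"
  unfolding F_norm_def using assms th by (intro N_mono) (auto intro!: ennreal_leI powr_mono2)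

lemma F_norm_cmult:
  assumes "F \<in> borel_measurable lebesgue" "\<And>x. 0 \<le> F x" "0 \<le> c"
  shows "F_norm (\<lambda>x. c * F x) = ennreal (c powr (1 / th)) * F_norm F"
  unfolding F_norm_def using assms
  by (subst N_scale[symmetric]) (auto simp: powr_mult ennreal_mult)

definition step :: "'i set \<Rightarrow> ('i \<Rightarrow> real) \<Rightarrow> ('i \<Rightarrow> (real^'n) set) \<Rightarrow> real^'n \<Rightarrow> real" where
  "step I a E x = (\<Sum>i\<in>I. a i * indicator (E i) x)"

lemma step_nonneg: "(\<And>i. i \<in> I \<Longrightarrow> 0 \<le> a i) \<Longrightarrow> 0 \<le> step I a E x"
  unfolding step_def by (intro sum_nonneg mult_nonneg_nonneg) auto

lemma step_measurable: "(\<And>i. i \<in> I \<Longrightarrow> E i \<in> sets lebesgue) \<Longrightarrow> step I a E \<in> borel_measurable lebesgue"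
  unfolding step_def[abs_def] by (intro borel_measurable_sum borel_measurable_times) auto

text \<open>The Fefferman-Stein inequality with p = th/2 and u = 2, for the functions sqrt(a_i)
  times the indicator of E_i. It replaces sets H_i by sets E_i whose maximal function is at least
  \<kappa>_i on H_i, and the exponent 2 is what squares \<kappa>_i.\<close>

lemma FS_step:
  "\<exists>C\<ge>0. \<forall>I a \<kappa> E H. finite (I :: 'i set) \<longrightarrow> (\<forall>i\<in>I. 0 \<le> a i \<and> 0 \<le> \<kappa> i \<and> E i \<in> sets lebesgue \<and> H i \<in> sets lebesgue \<and>
      (\<forall>x\<in>H i. ennreal (\<kappa> i) \<le> maxf A D (indicator (E i)) x)) \<longrightarrow>
      F_norm (step I (\<lambda>i. a i * (\<kappa> i)\<^sup>2) H) \<le> ennreal C * F_norm (step I a E)"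
proof -
  have "0 < th / 2" "th / 2 < pm" "1 < (2::real)" using th by auto
  then obtain C where C: "\<And>f :: nat \<Rightarrow> real^'n \<Rightarrow> ennreal. (\<And>k. f k \<in> borel_measurable lebesgue) \<Longrightarrow>
          Xpow N (1 / (th / 2)) (\<lambda>x. epow (\<Sum>k. epow (maxf A D (f k) x) 2) (1 / 2))
            \<le> ennreal C * Xpow N (1 / (th / 2)) (\<lambda>x. epow (\<Sum>k. epow (f k x) 2) (1 / 2))"
    using FS unfolding assumption_FS_def by metis
  show ?thesis
  proof (intro exI[of _ "max C 0 powr (2 / th)"] conjI allI impI)
    fix I :: "'i set" and a \<kappa> :: "'i \<Rightarrow> real" and E H :: "'i \<Rightarrow> (real^'n) set"
    assume fin: "finite I" and as: "\<forall>i\<in>I. 0 \<le> a i \<and> 0 \<le> \<kappa> i \<and> E i \<in> sets lebesgue \<and> H i \<in> sets lebesgue \<and>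
      (\<forall>x\<in>H i. ennreal (\<kappa> i) \<le> maxf A D (indicator (E i)) x)"
    obtain h where h: "bij_betw h {0..<card I} I" using ex_bij_betw_nat_finite[OF fin] by blast
    \<comment> \<open>The square root makes the sum of squares equal to \<open>step I a E\<close>;
      the sequence is padded by zero.\<close>
    define f where "f k = (if k < card I then (\<lambda>x. ennreal (sqrt (a (h k))) * indicator (E (h k)) x) else (\<lambda>x. 0))" for k
    have hI: "h k \<in> I" if "k < card I" for k using h that by (auto simp: bij_betw_def)
    have fm: "f k \<in> borel_measurable lebesgue" for k 
    proof (cases "k < card I")
      case True
      have [measurable]: "E (h k) \<in> sets lebesgue" using as hI[OF True] by blast
      show ?thesis unfolding f_def if_P[OF True] by measurable
    qed (simp add: f_def)
    have m0: "maxf A D (\<lambda>x. 0) x = 0" for x using maxf_cmult[of "\<lambda>x. 0" 0 x] by simp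
    have reidx: "(\<Sum>k. if k < card I then g (h k) else 0) = (\<Sum>i\<in>I. g i)" for g :: "'i \<Rightarrow> ennreal"
    proof -
      have "(\<Sum>k. if k < card I then g (h k) else 0) = (\<Sum>k\<in>{0..<card I}. g (h k))"
        by (subst suminf_finite[of "{0..<card I}"]) auto
      also have "\<dots> = (\<Sum>i\<in>I. g i)" by (rule sum.reindex_bij_betw[OF h])
      finally show ?thesis .
    qed
    have R: "(\<Sum>k. epow (f k x) 2) = ennreal (step I a E x)" for x
    proof -
      have "epow (f k x) 2 = (if k < card I then ennreal (a (h k) * indicator (E (h k)) x) else 0)" for k
        unfolding f_def using as hI[of k] by (auto simp: indicator_def epow_ennreal powr_numeral)
      then have "(\<Sum>k. epow (f k x) 2) = (\<Sum>i\<in>I. ennreal (a i * indicator (E i) x))"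
        using reidx[of "\<lambda>i. ennreal (a i * indicator (E i) x)"] by (simp only:)
      then show ?thesis unfolding step_def using as by (subst (asm) sum_ennreal) auto
    qed
    have L: "ennreal (step I (\<lambda>i. a i * (\<kappa> i)\<^sup>2) H x) \<le> (\<Sum>k. epow (maxf A D (f k) x) 2)" for x
    proof -
      have "ennreal (step I (\<lambda>i. a i * (\<kappa> i)\<^sup>2) H x) = (\<Sum>k. if k < card I then ennreal (a (h k) * (\<kappa> (h k))\<^sup>2 * indicator (H (h k)) x) else 0)"
        unfolding reidx[of "\<lambda>i. ennreal (a i * (\<kappa> i)\<^sup>2 * indicator (H i) x)"] step_def using as by (subst sum_ennreal) auto
      also have "\<dots> \<le> (\<Sum>k. epow (maxf A D (f k) x) 2)"
      proof (intro suminf_le summableI)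
        fix k
        show "(if k < card I then ennreal (a (h k) * (\<kappa> (h k))\<^sup>2 * indicator (H (h k)) x) else 0) \<le> epow (maxf A D (f k) x) 2"
        proof (cases "k < card I \<and> x \<in> H (h k)")
          case True
          then have i: "h k \<in> I" using hI by blast
          have "ennreal (sqrt (a (h k))) * ennreal (\<kappa> (h k)) \<le> ennreal (sqrt (a (h k))) * maxf A D (indicator (E (h k))) x"
            using as i True by (intro mult_left_mono) auto
          also have "\<dots> = maxf A D (f k) x"
          proof -
            have "(indicator (E (h k)) :: real^'n \<Rightarrow> ennreal) \<in> borel_measurable lebesgue" using as i by (intro borel_measurable_indicator) auto
            from maxf_cmult[OF this] show ?thesis using True by (simp add: f_def)
          qed
          finally have "epow (ennreal (sqrt (a (h k)) * \<kappa> (h k))) 2 \<le> epow (maxf A D (f k) x) 2"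
            using as i by (intro epow_mono) (auto simp: ennreal_mult)
          then show ?thesis using True as i by (simp add: epow_ennreal powr_numeral power_mult_distrib)
        qed (auto simp: indicator_def)
      qed
      finally show ?thesis .
    qed
    have e: "epow (epow y (1 / 2)) (1 / (th / 2)) = epow y (1 / th)" for y unfolding epow_epow using th by simp
    have m1: "(\<lambda>x. (\<Sum>k. epow (maxf A D (f k) x) 2)) \<in> borel_measurable lebesgue"
      using maxf_measurable by measurable
    have sm: "step I (\<lambda>i. a i * (\<kappa> i)\<^sup>2) H \<in> borel_measurable lebesgue" using as by (intro step_measurable) auto
    have sn: "0 \<le> step I (\<lambda>i. a i * (\<kappa> i)\<^sup>2) H x" "0 \<le> step I a E x" for x using as by (auto intro!: step_nonneg)
    have "F_norm (step I (\<lambda>i. a i * (\<kappa> i)\<^sup>2) H) = N (\<lambda>x. epow (ennreal (step I (\<lambda>i. a i * (\<kappa> i)\<^sup>2) H x)) (1 / th))"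
      unfolding F_norm_def using sn by (simp add: epow_ennreal)
    also have "\<dots> \<le> N (\<lambda>x. epow (\<Sum>k. epow (maxf A D (f k) x) 2) (1 / th))"
      using m1 sm th by (intro N_mono epow_mono L) auto
    finally have 1: "epow (F_norm (step I (\<lambda>i. a i * (\<kappa> i)\<^sup>2) H)) (th / 2) \<le> epow (N (\<lambda>x. epow (\<Sum>k. epow (maxf A D (f k) x) 2) (1 / th))) (th / 2)"
      using th by (intro epow_mono) auto
    also have "\<dots> = Xpow N (1 / (th / 2)) (\<lambda>x. epow (\<Sum>k. epow (maxf A D (f k) x) 2) (1 / 2))"
      unfolding Xpow_def e by simp
    also have "\<dots> \<le> ennreal C * Xpow N (1 / (th / 2)) (\<lambda>x. epow (\<Sum>k. epow (f k x) 2) (1 / 2))" by (rule C[OF fm])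
    also have "\<dots> = ennreal (max C 0) * epow (F_norm (step I a E)) (th / 2)"
      unfolding Xpow_def e R F_norm_def using sn by (simp add: epow_ennreal max_def ennreal_neg)
    finally have "epow (epow (F_norm (step I (\<lambda>i. a i * (\<kappa> i)\<^sup>2) H)) (th / 2)) (2 / th) \<le> epow (ennreal (max C 0) * epow (F_norm (step I a E)) (th / 2)) (2 / th)"
      using th by (intro epow_mono) auto
    then show "F_norm (step I (\<lambda>i. a i * (\<kappa> i)\<^sup>2) H) \<le> ennreal (max C 0 powr (2 / th)) * F_norm (step I a E)"
      using th by (simp add: epow_cmult epow_epow)
  qed auto
qed

lemma Y_ball_finite: "Y (indicator (bl x k)) < \<infinity>"
proof -
  have "Y (indicator (bl x k)) < \<infinity>" using Y_Bfs bl_in_dballs unfolding ball_Bfs_def ball_qBfs_def by blast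
  then show ?thesis .
qed

text \<open>Finiteness comes from the triangle inequality in X^{1/th}, where each indicator of a
  ball has finite norm.\<close>

lemma F_norm_step_finite:
  assumes "finite I" "\<And>i. i \<in> I \<Longrightarrow> 0 \<le> a i"
  shows "F_norm (step I a (\<lambda>i. bl (x i) (k i))) < \<infinity>"
proof -
  have "Y (\<lambda>y. ennreal (step I a (\<lambda>i. bl (x i) (k i)) y)) < \<infinity>"
    using assms
  proof (induction I rule: finite_induct)
    case empty then show ?case by (simp add: step_def Y_zero[OF Y_Bfs])
  next
    case (insert i I)
    let ?s = "\<lambda>I. step I a (\<lambda>i. bl (x i) (k i))"
    have "Y (\<lambda>y. ennreal (?s (insert i I) y)) = Y (\<lambda>y. ennreal (a i) * indicator (bl (x i) (k i)) y + ennreal (?s I y))"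
    proof (rule arg_cong[of _ _ Y], rule ext)
      fix y
      have "?s (insert i I) y = a i * indicator (bl (x i) (k i)) y + ?s I y" unfolding step_def by (rule sum.insert[OF insert.hyps])
      then show "ennreal (?s (insert i I) y) = ennreal (a i) * indicator (bl (x i) (k i)) y + ennreal (?s I y)"
        using insert.prems step_nonneg[of I a "\<lambda>i. bl (x i) (k i)" y] by (simp add: ennreal_plus indicator_def)
    qed
    also have "\<dots> \<le> Y (\<lambda>y. ennreal (a i) * indicator (bl (x i) (k i)) y) + Y (\<lambda>y. ennreal (?s I y))"
      using step_measurable[of I "\<lambda>i. bl (x i) (k i)" a] by (intro Y_add') auto
    also have "Y (\<lambda>y. ennreal (a i) * indicator (bl (x i) (k i)) y) = ennreal (a i) * Y (indicator (bl (x i) (k i)))"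
      using insert.prems by (intro Y_scale') auto
    also have "\<dots> + Y (\<lambda>y. ennreal (?s I y)) < \<infinity>"
      using insert Y_ball_finite[of "x i" "k i"] by (simp add: ennreal_mult_less_top)
    finally show ?case .
  qed
  then show ?thesis using assms(2) by (subst F_norm_Y) (auto simp: epow_less_top[simplified] intro: step_nonneg)
qed

lemma F_norm_step_pos:
  assumes "finite I" "\<And>i. i \<in> I \<Longrightarrow> 0 \<le> a i" "j \<in> I" "0 < a j"
  shows "0 < F_norm (step I a (\<lambda>i. bl (x i) (k i)))"
proof -
  have "0 < ennreal (a j powr (1 / th)) * N (indicator (bl (x j) (k j)))"
    using assms(4) N_ball_pos[of "x j" "k j"] by (simp add: ennreal_zero_less_mult_iff)
  also have "\<dots> = N (\<lambda>y. ennreal (a j powr (1 / th)) * indicator (bl (x j) (k j)) y)"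
    by (intro N_scale[symmetric]) auto
  also have "\<dots> \<le> F_norm (step I a (\<lambda>i. bl (x i) (k i)))"
    unfolding F_norm_def
  proof (rule N_mono)
    show "(\<lambda>y. ennreal (step I a (\<lambda>i. bl (x i) (k i)) y powr (1 / th))) \<in> borel_measurable lebesgue"
      using step_measurable[of I "\<lambda>i. bl (x i) (k i)" a] by auto
    fix y
    have "a j * indicator (bl (x j) (k j)) y \<le> step I a (\<lambda>i. bl (x i) (k i)) y"
      unfolding step_def using assms by (intro member_le_sum) auto
    then show "ennreal (a j powr (1 / th)) * indicator (bl (x j) (k j)) y \<le> ennreal (step I a (\<lambda>i. bl (x i) (k i)) y powr (1 / th))"
      using assms(4) th by (auto simp: indicator_def intro!: ennreal_leI powr_mono2)
  qed auto
  finally show ?thesis .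
qed

lemma ennreal_mult_inverse: "0 < \<beta> \<Longrightarrow> \<beta> < \<infinity> \<Longrightarrow> \<beta> * inverse \<beta> = (1 :: ennreal)"
  by (cases \<beta>) (auto simp: inverse_ennreal ennreal_mult[symmetric])

lemma ennreal_le_of_inverse_mult:
  fixes \<beta> S c :: ennreal
  assumes "0 < \<beta>" "\<beta> < \<infinity>" "inverse \<beta> * S \<le> c" shows "S \<le> c * \<beta>"
proof -
  have "\<beta> * inverse \<beta> = 1" using assms(1,2) by (rule ennreal_mult_inverse)
  then have "S = \<beta> * (inverse \<beta> * S)" by (simp add: mult.assoc[symmetric])
  also have "\<dots> \<le> \<beta> * c" using assms(3) by (intro mult_left_mono) auto
  finally show ?thesis by (simp add: mult.commute)
qed

lemma ennreal_inverse_mult_le: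
  fixes \<beta> S c :: ennreal
  assumes "0 < \<beta>" "\<beta> < \<infinity>" "S \<le> c * \<beta>" shows "inverse \<beta> * S \<le> c"
proof -
  have "\<beta> * inverse \<beta> = 1" using assms(1,2) by (rule ennreal_mult_inverse)
  moreover have "inverse \<beta> * S \<le> inverse \<beta> * (c * \<beta>)" using assms(3) by (intro mult_left_mono) auto
  moreover have "inverse \<beta> * (c * \<beta>) = c * (\<beta> * inverse \<beta>)" by (simp only: mult_ac)
  ultimately show ?thesis by simp
qed

lemma campanato_term:
  assumes "locint f" "0 \<le> w"
  shows "ennreal (w * measure lebesgue (bl z k)) *
           epow ((\<integral>\<^sup>+ x. ennreal (\<bar>f x - proj z k f x\<bar> powr 1) * indicator (bl z k) x \<partial>lebesgue) / emeasure lebesgue (bl z k)) (1 / 1)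
       = ennreal (w * bdet A powr real_of_int k * osc f z k)"
proof -
  have f: "set_integrable lebesgue (bl z k) f" using assms(1) unfolding locint_def by blast
  have i: "set_integrable lebesgue (bl z k) (\<lambda>x. f x - proj z k f x)"
    by (rule set_integral_diff(1)[OF f bl_integrable[OF poly_le_continuous[OF proj_poly[OF f]]]])
  have "(\<integral>\<^sup>+ x. ennreal (\<bar>f x - proj z k f x\<bar> powr 1) * indicator (bl z k) x \<partial>lebesgue) = ennreal (LINT y:bl z k|lebesgue. \<bar>f y - proj z k f y\<bar>)"
    using nn_integral_lebesgue_on_eq[OF i] by simp
  also have "\<dots> = ennreal (bdet A powr real_of_int k * osc f z k)"
    unfolding osc_def using bb(2)[of k] by (simp add: mult.assoc[symmetric] mult.commute)
  also have "\<dots> / emeasure lebesgue (bl z k) = ennreal (osc f z k)"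
    unfolding emeasure_bl using b_gt1 osc_nonneg[of f z k] by (subst divide_ennreal) auto
  finally show ?thesis using assms(2) osc_nonneg[of f z k] by (simp add: measure_bl ennreal_mult[symmetric])
qed

text \<open>The definition of the exponent-one seminorm cleared of its denominator, for an arbitrary
  finite index set and weights already divided by the norms of the indicators. If all weights vanish
  the supremum does not apply, but the left side is 0.\<close>

lemma campanato_sum:
  assumes f: "locint f" and fin: "finite I" and w: "\<And>i. i \<in> I \<Longrightarrow> 0 \<le> w i"
  shows "(\<Sum>i\<in>I. ennreal (w i * bdet A powr real_of_int (k i) * osc f (x i) (k i)))
     \<le> campanato A D N 1 d th f * F_norm (step I (\<lambda>i. w i powr th) (\<lambda>i. bl (x i) (k i)))"
proof (cases "\<exists>i\<in>I. w i \<noteq> 0")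
  case False
  then have "(\<Sum>i\<in>I. ennreal (w i * bdet A powr real_of_int (k i) * osc f (x i) (k i))) = 0" by (intro sum.neutral) auto
  then show ?thesis by simp
next
  case True
  then obtain i0 where i0: "i0 \<in> I" "0 < w i0" using w by (metis less_eq_real_def)
  obtain h where h: "bij_betw h {..<card I} I" using ex_bij_betw_nat_finite[OF fin] by (auto simp: atLeast0LessThan)
  let ?B = "\<lambda>i. bl (x i) (k i)"
  define Bs where "Bs j = ?B (h j)" for j
  define lam where "lam j = w (h j) * ind_norm N (?B (h j))" for j
  have hI: "h j \<in> I" if "j < card I" for j using h that by (auto simp: bij_betw_def)
  have lw: "lam j / ind_norm N (Bs j) = w (h j)" for j using ind_norm_bl(1)[of "x (h j)" "k (h j)"] by (simp add: lam_def Bs_def)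
  have "i0 \<in> h ` {..<card I}" using h i0(1) by (simp add: bij_betw_def)
  then obtain j0 where j0: "j0 < card I" "h j0 = i0" by blast
  have "lam j0 > 0" using i0(2) j0(2) ind_norm_bl(1) by (simp add: lam_def)
  have lam0: "0 \<le> lam j" if "j < card I" for j using w[OF hI[OF that]] ind_norm_bl(1)[of "x (h j)" "k (h j)"] by (simp add: lam_def)
  have "0 < (\<Sum>j<card I. lam j)" using \<open>lam j0 > 0\<close> lam0 j0(1) by (intro sum_pos2[of _ j0]) auto
  then have mem: "(card I, Bs, lam) \<in> {(m, Bs, lam). (\<forall>j<m. Bs j \<in> dballs A D) \<and> (\<forall>j<m. 0 \<le> lam j) \<and> (\<Sum>j<m. lam j) \<noteq> 0}"
    using lam0 by (auto simp: Bs_def)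
  have bn: "block_norm N th (card I) Bs lam = F_norm (step I (\<lambda>i. w i powr th) ?B)"
  proof -
    have "(\<Sum>j<card I. w (h j) powr th * indicator (?B (h j)) y) = step I (\<lambda>i. w i powr th) ?B y" for y
      unfolding step_def by (rule sum.reindex_bij_betw[OF h])
    then show ?thesis unfolding block_norm_def F_norm_def lw by (simp add: Bs_def)
  qed
  let ?\<beta> = "F_norm (step I (\<lambda>i. w i powr th) ?B)"
  have S: "(\<Sum>j<card I. ennreal (lam j * measure lebesgue (Bs j) / ind_norm N (Bs j)) *
           epow ((\<integral>\<^sup>+ x. ennreal (\<bar>f x - poly_proj d (Bs j) f x\<bar> powr 1) * indicator (Bs j) x \<partial>lebesgue) / emeasure lebesgue (Bs j)) (1 / 1))
       = (\<Sum>i\<in>I. ennreal (w i * bdet A powr real_of_int (k i) * osc f (x i) (k i)))"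
  proof -
    have "ennreal (lam j * measure lebesgue (Bs j) / ind_norm N (Bs j)) *
           epow ((\<integral>\<^sup>+ x. ennreal (\<bar>f x - poly_proj d (Bs j) f x\<bar> powr 1) * indicator (Bs j) x \<partial>lebesgue) / emeasure lebesgue (Bs j)) (1 / 1)
         = ennreal (w (h j) * bdet A powr real_of_int (k (h j)) * osc f (x (h j)) (k (h j)))" if "j \<in> {..<card I}" for j
    proof -
      have "lam j * measure lebesgue (Bs j) / ind_norm N (Bs j) = w (h j) * measure lebesgue (Bs j)"
        using lw[of j] by (metis times_divide_eq_left mult.commute)
      then show ?thesis using campanato_term[OF f w[OF hI], of j "x (h j)" "k (h j)"] that unfolding Bs_def by simp
    qed
    then have "(\<Sum>j<card I. ennreal (lam j * measure lebesgue (Bs j) / ind_norm N (Bs j)) *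
           epow ((\<integral>\<^sup>+ x. ennreal (\<bar>f x - poly_proj d (Bs j) f x\<bar> powr 1) * indicator (Bs j) x \<partial>lebesgue) / emeasure lebesgue (Bs j)) (1 / 1))
       = (\<Sum>j<card I. ennreal (w (h j) * bdet A powr real_of_int (k (h j)) * osc f (x (h j)) (k (h j))))"
      by (rule sum.cong[OF refl])
    also have "\<dots> = (\<Sum>i\<in>I. ennreal (w i * bdet A powr real_of_int (k i) * osc f (x i) (k i)))"
      by (rule sum.reindex_bij_betw[OF h])
    finally show ?thesis .
  qed
  have "inverse ?\<beta> * (\<Sum>i\<in>I. ennreal (w i * bdet A powr real_of_int (k i) * osc f (x i) (k i))) \<le> campanato A D N 1 d th f"
    unfolding campanato_def S[symmetric] bn[symmetric] by (rule SUP_upper2[OF mem]) (simp only: case_prod_conv order_refl)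
  moreover have "0 < ?\<beta>" using i0 w by (intro F_norm_step_pos[OF fin _ i0(1)]) auto
  moreover have "?\<beta> < \<infinity>" using w by (intro F_norm_step_finite[OF fin]) auto
  ultimately show ?thesis using ennreal_le_of_inverse_mult by blast
qed

end


section \<open>Integrals against the decaying kernel\<close>

context aniso_poly begin

definition ker :: "real \<Rightarrow> (real^'n \<Rightarrow> real) \<Rightarrow> real^'n \<Rightarrow> int \<Rightarrow> real^'n \<Rightarrow> real" where
  "ker \<beta> f z l x = bdet A powr (\<beta> * real_of_int l) * \<bar>f x - proj z l f x\<bar> /
      (bdet A powr (real_of_int l * (1 + \<beta>)) + rho A D (x - z) powr (1 + \<beta>))"

lemma ker_factor:
  "bdet A powr (\<beta> * real_of_int l) / bdet A powr (real_of_int (l + int k) * (1 + \<beta>)) = bdet A powr (- real_of_int l - real k * (1 + \<beta>))"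
  by (simp add: powr_diff[symmetric] algebra_simps)

text \<open>In the ball the first summand of the denominator is kept; outside it the second, which
  is constant on each annulus. The exterior case names the outer ball of the annulus, and the factor
  b^(1+\<beta>) absorbs that shift by one scale.\<close>

lemma ker_le:
  assumes "0 \<le> \<beta>"
  shows "\<exists>k. x \<in> bl z (l + int k) \<and> ker \<beta> f z l x \<le> bdet A powr (1 + \<beta>) * bdet A powr (- real_of_int l - real k * (1 + \<beta>)) * \<bar>f x - proj z l f x\<bar>"
proof (cases "G l (x - z) < 1")
  case True
  have pos: "0 < bdet A powr (real_of_int l * (1 + \<beta>))" using b_gt1 by simp
  have "ker \<beta> f z l x \<le> bdet A powr (\<beta> * real_of_int l) * \<bar>f x - proj z l f x\<bar> / bdet A powr (real_of_int l * (1 + \<beta>))"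
    unfolding ker_def by (intro divide_left_mono mult_pos_pos add_pos_nonneg pos powr_ge_zero) auto
  also have "\<dots> = bdet A powr (- real_of_int l - real 0 * (1 + \<beta>)) * \<bar>f x - proj z l f x\<bar>"
    unfolding ker_factor[of \<beta> l 0, symmetric] by simp
  also have "\<dots> \<le> bdet A powr (1 + \<beta>) * (bdet A powr (- real_of_int l - real 0 * (1 + \<beta>)) * \<bar>f x - proj z l f x\<bar>)"
  proof -
    have "1 \<le> bdet A powr (1 + \<beta>)" using b_gt1 assms by (intro ge_one_powr_ge_zero) auto
    then have "1 * v \<le> bdet A powr (1 + \<beta>) * v" if "0 \<le> v" for v using that by (rule mult_right_mono)
    from this[of "bdet A powr (- real_of_int l - real 0 * (1 + \<beta>)) * \<bar>f x - proj z l f x\<bar>"] show ?thesis by simp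
  qed
  finally show ?thesis using True by (intro exI[of _ 0]) (simp add: bl_iff mult.assoc)
next
  case False
  then have "x - z \<noteq> 0" by auto
  then obtain k' where k': "G k' (x - z) \<ge> 1" "G (k' + 1) (x - z) < 1" using rho_cases by blast
  have "l \<le> k'" using False G_antimono[of "k' + 1" l "x - z"] k'(2) by force
  then obtain k where k: "k' = l + int k" using zle_iff_zadd by auto
  have r: "rho A D (x - z) powr (1 + \<beta>) = bdet A powr (real_of_int (l + int k) * (1 + \<beta>))"
    unfolding rho_eq[OF k'] k by (simp add: powr_powr)
  have pos: "0 < bdet A powr (real_of_int (l + int k) * (1 + \<beta>))" using b_gt1 by simp
  have "ker \<beta> f z l x \<le> bdet A powr (\<beta> * real_of_int l) * \<bar>f x - proj z l f x\<bar> / bdet A powr (real_of_int (l + int k) * (1 + \<beta>))"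
    unfolding ker_def r by (intro divide_left_mono mult_pos_pos add_nonneg_pos pos powr_ge_zero) auto
  also have "\<dots> = bdet A powr (- real_of_int l - real k * (1 + \<beta>)) * \<bar>f x - proj z l f x\<bar>"
    unfolding ker_factor[of \<beta> l k, symmetric] by simp
  also have "bdet A powr (- real_of_int l - real k * (1 + \<beta>)) = bdet A powr (1 + \<beta>) * bdet A powr (- real_of_int l - real (Suc k) * (1 + \<beta>))"
    by (simp add: powr_add[symmetric] algebra_simps)
  finally show ?thesis using k'(2) unfolding k by (intro exI[of _ "Suc k"]) (simp add: bl_iff algebra_simps)
qed

text \<open>Consecutive projections differ on the smaller ball by at most b times the oscillation on
  the larger one, and carrying this estimate out to scale l + k costs \<open>lp ^ d\<close> per
  scale.\<close>

lemma proj_diff_telescope: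
  assumes f: "locint f" and x: "x \<in> bl z (l + int k)"
  shows "\<bar>proj z l f x - proj z (l + int k) f x\<bar> \<le> Cp * bdet A * lp ^ d * (\<Sum>j\<in>{1..k}. lp ^ (d * (k - j)) * osc f z (l + int j))"
proof -
  have fi: "set_integrable lebesgue (bl z m) f" for m using f unfolding locint_def by blast
  have step: "\<bar>proj z (l + int i) f x - proj z (l + int (Suc i)) f x\<bar> \<le> Cp * bdet A * lp ^ d * (lp ^ (d * (k - Suc i)) * osc f z (l + int (Suc i)))"
    if i: "i < k" for i
  proof -
    let ?P = "proj z (l + int (Suc i)) f"
    have P: "poly_le d ?P" by (rule proj_poly[OF fi])
    have d: "set_integrable lebesgue (bl z m) (\<lambda>y. f y - ?P y)" for m
      by (rule set_integral_diff(1)[OF fi bl_integrable[OF poly_le_continuous[OF P]]])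
    have "x \<in> bl z ((l + int i) + int (k - i))" using x i by (simp add: of_nat_diff)
    from proj_bound[OF fi P this]
    have "\<bar>proj z (l + int i) f x - ?P x\<bar> \<le> Cp * lp ^ (d * (k - i)) * (bdet A powr real_of_int (- (l + int i)) * (LINT y:bl z (l + int i)|lebesgue. \<bar>f y - ?P y\<bar>))" .
    also have "\<dots> \<le> Cp * lp ^ (d * (k - i)) * (bdet A powr real_of_int (- (l + int i)) * (LINT y:bl z (l + int (Suc i))|lebesgue. \<bar>f y - ?P y\<bar>))"
      using Cp1 lp1 by (intro mult_left_mono abs_integral_subset d bl_mono) auto
    also have "bdet A powr real_of_int (- (l + int i)) = bdet A * bdet A powr real_of_int (- (l + int (Suc i)))"
    proof -
      have e: "- (l + int i) = 1 + - (l + int (Suc i))" by simp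
      have "bdet A powr real_of_int 1 = bdet A" using b_gt1 by simp
      then show ?thesis unfolding e bb(1) by (simp only:)
    qed
    also have "lp ^ (d * (k - i)) = lp ^ d * lp ^ (d * (k - Suc i))"
    proof -
      have "k - i = Suc (k - Suc i)" using i by simp
      then show ?thesis by (simp add: power_add[symmetric])
    qed
    finally show ?thesis unfolding osc_def by (simp add: mult_ac)
  qed
  have "proj z l f x - proj z (l + int k) f x = (\<Sum>i<k. proj z (l + int i) f x - proj z (l + int (Suc i)) f x)"
    using sum_lessThan_telescope'[of "\<lambda>i. proj z (l + int i) f x" k] by simp
  then have "\<bar>proj z l f x - proj z (l + int k) f x\<bar> \<le> (\<Sum>i<k. \<bar>proj z (l + int i) f x - proj z (l + int (Suc i)) f x\<bar>)"
    by (simp only: sum_abs)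
  also have "\<dots> \<le> (\<Sum>i<k. Cp * bdet A * lp ^ d * (lp ^ (d * (k - Suc i)) * osc f z (l + int (Suc i))))"
    by (intro sum_mono step) auto
  also have "\<dots> = Cp * bdet A * lp ^ d * (\<Sum>i<k. lp ^ (d * (k - Suc i)) * osc f z (l + int (Suc i)))"
    by (simp only: sum_distrib_left)
  also have "(\<Sum>i<k. lp ^ (d * (k - Suc i)) * osc f z (l + int (Suc i))) = (\<Sum>j\<in>{1..k}. lp ^ (d * (k - j)) * osc f z (l + int j))"
    by (rule sum.reindex_bij_witness[of _ "\<lambda>j. j - 1" Suc]) auto
  finally show ?thesis .
qed

lemma annulus_integral:
  assumes f: "locint f"
  shows "(LINT y:bl z (l + int k)|lebesgue. \<bar>f y - proj z l f y\<bar>)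
     \<le> bdet A powr real_of_int (l + int k) * ((1 + Cp * bdet A * lp ^ d) * (\<Sum>j\<le>k. lp ^ (d * (k - j)) * osc f z (l + int j)))"
proof -
  let ?B = "bl z (l + int k)" and ?P = "proj z (l + int k) f" and ?C = "Cp * bdet A * lp ^ d"
  let ?S = "\<Sum>j\<in>{1..k}. lp ^ (d * (k - j)) * osc f z (l + int j)" and ?T = "\<Sum>j\<le>k. lp ^ (d * (k - j)) * osc f z (l + int j)"
  have fi: "set_integrable lebesgue (bl z m) f" for m using f unfolding locint_def by blast
  have P: "poly_le d (proj z m f)" for m by (rule proj_poly[OF fi])
  have d: "set_integrable lebesgue ?B (\<lambda>y. f y - proj z m f y)" for m
    by (rule set_integral_diff(1)[OF fi bl_integrable[OF poly_le_continuous[OF P]]])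
  have C0: "0 \<le> ?C" using Cp1 b_gt1 lp1 by simp
  have nn: "0 \<le> lp ^ (d * (k - j)) * osc f z (l + int j)" for j using lp1 osc_nonneg by simp
  have ST: "?S \<le> ?T" using nn by (intro sum_mono2) auto
  have oT: "osc f z (l + int k) \<le> ?T"
    using member_le_sum[of k "{..k}" "\<lambda>j. lp ^ (d * (k - j)) * osc f z (l + int j)"] nn by simp
  have ci: "set_integrable lebesgue ?B (\<lambda>y. c :: real)" for c by (rule bl_integrable) auto
  have "(LINT y:?B|lebesgue. \<bar>f y - proj z l f y\<bar>) \<le> (LINT y:?B|lebesgue. \<bar>f y - ?P y\<bar> + ?C * ?S)"
  proof (rule set_integral_mono)
    show "set_integrable lebesgue ?B (\<lambda>y. \<bar>f y - proj z l f y\<bar>)" by (rule set_integrable_abs[OF d])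
    show "set_integrable lebesgue ?B (\<lambda>y. \<bar>f y - ?P y\<bar> + ?C * ?S)" by (rule set_integral_add(1)[OF set_integrable_abs[OF d] ci])
    show "\<bar>f y - proj z l f y\<bar> \<le> \<bar>f y - ?P y\<bar> + ?C * ?S" if "y \<in> ?B" for y
      using proj_diff_telescope[OF f that] by linarith
  qed
  also have "\<dots> = (LINT y:?B|lebesgue. \<bar>f y - ?P y\<bar>) + (LINT y:?B|lebesgue. ?C * ?S)"
    by (rule set_integral_add(2)[OF set_integrable_abs[OF d] ci])
  also have "(LINT y:?B|lebesgue. \<bar>f y - ?P y\<bar>) = bdet A powr real_of_int (l + int k) * osc f z (l + int k)"
    unfolding osc_def using bb(2)[of "l + int k"] by (simp only: mult.assoc[symmetric] mult.commute[of "bdet A powr real_of_int (l + int k)"] mult_1_left)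
  also have "(LINT y:?B|lebesgue. ?C * ?S) = bdet A powr real_of_int (l + int k) * (?C * ?S)"
    using measure_bl[of z "l + int k"] bl_lmeas[of z "l + int k"] by (simp only: set_lebesgue_integral_def) simp
  also have "bdet A powr real_of_int (l + int k) * osc f z (l + int k) + bdet A powr real_of_int (l + int k) * (?C * ?S)
     \<le> bdet A powr real_of_int (l + int k) * ?T + bdet A powr real_of_int (l + int k) * (?C * ?T)"
    using C0 by (intro add_mono mult_left_mono oT ST) auto
  finally show ?thesis by (simp only: distrib_left distrib_right mult_1_left)
qed

text \<open>Exchange the order of summation: each u j is multiplied by at most a full geometric
  series.\<close>

lemma geometric_convolution:
  fixes u :: "nat \<Rightarrow> real"
  assumes "\<And>j. 0 \<le> u j" "0 \<le> q" "q < 1"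
  shows "(\<Sum>k<K. \<Sum>j\<le>k. u j * q ^ (k - j)) \<le> (\<Sum>j<K. u j) / (1 - q)"
proof -
  have "(\<Sum>k<K. \<Sum>j\<le>k. u j * q ^ (k - j)) = (\<Sum>j<K. \<Sum>k\<in>{j..<K}. u j * q ^ (k - j))"
  proof -
    have "(\<Sum>k<K. \<Sum>j\<le>k. u j * q ^ (k - j)) = (\<Sum>(k,j)\<in>(SIGMA k:{..<K}. {..k}). u j * q ^ (k - j))"
      by (subst sum.Sigma) auto
    also have "\<dots> = (\<Sum>(j,k)\<in>(SIGMA j:{..<K}. {j..<K}). u j * q ^ (k - j))"
      by (rule sum.reindex_bij_witness[of _ "\<lambda>(j,k). (k,j)" "\<lambda>(k,j). (j,k)"]) auto
    also have "\<dots> = (\<Sum>j<K. \<Sum>k\<in>{j..<K}. u j * q ^ (k - j))" by (subst sum.Sigma) auto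
    finally show ?thesis .
  qed
  also have "\<dots> \<le> (\<Sum>j<K. u j * (1 / (1 - q)))"
  proof (rule sum_mono)
    fix j assume "j \<in> {..<K}"
    have "(\<Sum>k\<in>{j..<K}. q ^ (k - j)) = (\<Sum>m<K - j. q ^ m)"
      by (rule sum.reindex_bij_witness[of _ "\<lambda>m. m + j" "\<lambda>k. k - j"]) auto
    also have "\<dots> \<le> 1 / (1 - q)"
      using sum_le_suminf[of "\<lambda>m. q ^ m" "{..<K - j}"] assms(2,3) by (simp add: suminf_geometric summable_geometric)
    finally show "(\<Sum>k\<in>{j..<K}. u j * q ^ (k - j)) \<le> u j * (1 / (1 - q))"
      unfolding sum_distrib_left[symmetric] using assms(1) by (intro mult_left_mono)
  qed
  also have "\<dots> = (\<Sum>j<K. u j) / (1 - q)" by (simp add: sum_divide_distrib)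
  finally show ?thesis .
qed

text \<open>Summing the annuli gives a convolution of the sequence b^(-j \<beta>) osc_j with the
  powers of lp^d / b^\<beta>, whose ratio is below 1. The partial sums over K are kept because only
  finite families can be fed into \<open>campanato_sum\<close>.\<close>

lemma ker_integral_le:
  assumes f: "locint f" and \<beta>: "0 \<le> \<beta>" "lp ^ d < bdet A powr \<beta>"
  shows "(\<integral>\<^sup>+x. ennreal (ker \<beta> f z l x) \<partial>lebesgue) \<le>
    (SUP K. ennreal (bdet A powr (1 + \<beta>) * (1 + Cp * bdet A * lp ^ d) / (1 - lp ^ d / bdet A powr \<beta>) * (\<Sum>j<K. bdet A powr (- real j * \<beta>) * osc f z (l + int j))))"
proof -
  let ?b = "bdet A" and ?C = "1 + Cp * bdet A * lp ^ d" and ?q = "lp ^ d / bdet A powr \<beta>"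
  let ?c = "\<lambda>k. ?b powr (1 + \<beta>) * ?b powr (- real_of_int l - real k * (1 + \<beta>))"
  have fi: "set_integrable lebesgue (bl z m) f" for m using f unfolding locint_def by blast
  have d: "set_integrable lebesgue (bl z m) (\<lambda>y. f y - proj z l f y)" for m
    by (rule set_integral_diff(1)[OF fi bl_integrable[OF poly_le_continuous[OF proj_poly[OF fi]]]])
  let ?t = "\<lambda>k x. ennreal (?c k) * (ennreal \<bar>f x - proj z l f x\<bar> * indicator (bl z (l + int k)) x)"
  have dm: "(\<lambda>x. ennreal \<bar>f x - proj z l f x\<bar> * indicator (bl z m) x) \<in> borel_measurable lebesgue" for m
  proof -
    have "(\<lambda>x. indicator (bl z m) x *\<^sub>R (f x - proj z l f x)) \<in> borel_measurable lebesgue"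
      using d unfolding set_integrable_def by (rule borel_measurable_integrable)
    then have m: "(\<lambda>x. ennreal \<bar>indicator (bl z m) x *\<^sub>R (f x - proj z l f x)\<bar>) \<in> borel_measurable lebesgue" by measurable
    have "(\<lambda>x. ennreal \<bar>indicator (bl z m) x *\<^sub>R (f x - proj z l f x)\<bar>) = (\<lambda>x. ennreal \<bar>f x - proj z l f x\<bar> * indicator (bl z m) x)"
      by (rule ext) (auto simp: indicator_def)
    with m show ?thesis by (simp only:)
  qed
  have tm: "?t k \<in> borel_measurable lebesgue" for k
    by (rule borel_measurable_times_ennreal[OF borel_measurable_const dm])
  have "(\<integral>\<^sup>+x. ennreal (ker \<beta> f z l x) \<partial>lebesgue) \<le> (\<integral>\<^sup>+x. (\<Sum>k. ?t k x) \<partial>lebesgue)"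
  proof (rule nn_integral_mono)
    fix x
    obtain k where k: "x \<in> bl z (l + int k)" "ker \<beta> f z l x \<le> ?c k * \<bar>f x - proj z l f x\<bar>"
      using ker_le[OF \<beta>(1), of x z l f] by blast
    have "ennreal (ker \<beta> f z l x) \<le> ennreal (?c k * \<bar>f x - proj z l f x\<bar>)" by (rule ennreal_leI[OF k(2)])
    also have "\<dots> = ?t k x" using k(1) by (simp add: ennreal_mult)
    also have "\<dots> \<le> (\<Sum>k. ?t k x)" using sum_le_suminf[of "\<lambda>k. ?t k x" "{k}"] by simp
    finally show "ennreal (ker \<beta> f z l x) \<le> (\<Sum>k. ?t k x)" .
  qed
  also have "\<dots> = (\<Sum>k. \<integral>\<^sup>+x. ?t k x \<partial>lebesgue)" using tm by (intro nn_integral_suminf)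
  also have "\<dots> = (SUP K. \<Sum>k<K. \<integral>\<^sup>+x. ?t k x \<partial>lebesgue)" by (rule suminf_eq_SUP)
  also have "\<dots> \<le> (SUP K. ennreal (?b powr (1 + \<beta>) * ?C / (1 - ?q) * (\<Sum>j<K. ?b powr (- real j * \<beta>) * osc f z (l + int j))))"
  proof (rule SUP_mono', goal_cases)
    case (1 K)
    have q: "0 \<le> ?q" "?q < 1" using \<beta>(2) lp1 b_gt1 by (auto simp: divide_simps)
    let ?u = "\<lambda>j. ?b powr (- real j * \<beta>) * osc f z (l + int j)"
    have u0: "0 \<le> ?u j" for j using osc_nonneg by simp
    have each: "(\<integral>\<^sup>+x. ?t k x \<partial>lebesgue) \<le> ennreal (?b powr (1 + \<beta>) * ?C * (\<Sum>j\<le>k. ?u j * ?q ^ (k - j)))" for k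
    proof -
      have "(\<integral>\<^sup>+x. ?t k x \<partial>lebesgue) = ennreal (?c k) * (\<integral>\<^sup>+x. ennreal \<bar>f x - proj z l f x\<bar> * indicator (bl z (l + int k)) x \<partial>lebesgue)"
        by (rule nn_integral_cmult[OF dm])
      also have "\<dots> = ennreal (?c k * (LINT y:bl z (l + int k)|lebesgue. \<bar>f y - proj z l f y\<bar>))"
        unfolding nn_integral_lebesgue_on_eq[OF d] by (simp add: ennreal_mult abs_integral_nonneg)
      also have "\<dots> \<le> ennreal (?c k * (?b powr real_of_int (l + int k) * (?C * (\<Sum>j\<le>k. lp ^ (d * (k - j)) * osc f z (l + int j)))))"
        by (intro ennreal_leI mult_left_mono annulus_integral f) auto
      also have "?c k * (?b powr real_of_int (l + int k) * (?C * (\<Sum>j\<le>k. lp ^ (d * (k - j)) * osc f z (l + int j))))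
          = ?b powr (1 + \<beta>) * ?C * (?b powr (- real k * \<beta>) * (\<Sum>j\<le>k. lp ^ (d * (k - j)) * osc f z (l + int j)))"
      proof -
        have "?b powr (- real_of_int l - real k * (1 + \<beta>)) * ?b powr real_of_int (l + int k) = ?b powr (- real k * \<beta>)"
          by (simp add: powr_add[symmetric] algebra_simps)
        moreover have "v * x * (y * (C * s)) = v * C * ((x * y) * s)" for v x y C s :: real by (simp only: mult_ac)
        ultimately show ?thesis by (simp only:)
      qed
      also have "?b powr (- real k * \<beta>) * (\<Sum>j\<le>k. lp ^ (d * (k - j)) * osc f z (l + int j)) = (\<Sum>j\<le>k. ?u j * ?q ^ (k - j))"
        unfolding sum_distrib_left
      proof (rule sum.cong[OF refl])
        fix j assume "j \<in> {..k}"
        then have kj: "real k = real j + real (k - j)" by (simp add: of_nat_diff)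
        have "?b powr (- real k * \<beta>) = ?b powr (- real j * \<beta>) * ?b powr (- (real (k - j) * \<beta>))"
          unfolding kj by (simp add: powr_add[symmetric] algebra_simps)
        also have "?b powr (- (real (k - j) * \<beta>)) = 1 / (?b powr \<beta>) ^ (k - j)"
          using b_gt1 by (simp add: powr_minus powr_power mult.commute field_simps)
        finally show "?b powr (- real k * \<beta>) * (lp ^ (d * (k - j)) * osc f z (l + int j)) = ?u j * ?q ^ (k - j)"
          by (simp add: power_mult power_divide)
      qed
      finally show ?thesis .
    qed
    have "(\<Sum>k<K. \<integral>\<^sup>+x. ?t k x \<partial>lebesgue) \<le> (\<Sum>k<K. ennreal (?b powr (1 + \<beta>) * ?C * (\<Sum>j\<le>k. ?u j * ?q ^ (k - j))))"
      by (intro sum_mono each)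
    also have "\<dots> = ennreal (?b powr (1 + \<beta>) * ?C * (\<Sum>k<K. \<Sum>j\<le>k. ?u j * ?q ^ (k - j)))"
      using u0 q Cp1 b_gt1 lp1 by (subst sum_ennreal) (auto simp: sum_distrib_left osc_nonneg intro!: mult_nonneg_nonneg sum_nonneg add_nonneg_nonneg)
    also have "\<dots> \<le> ennreal (?b powr (1 + \<beta>) * ?C * ((\<Sum>j<K. ?u j) / (1 - ?q)))"
      using Cp1 b_gt1 lp1 by (intro ennreal_leI mult_left_mono geometric_convolution u0 q) (auto intro!: mult_nonneg_nonneg add_nonneg_nonneg)
    finally show ?case by simp
  qed
  finally show ?thesis .
qed

end


section \<open>The kernel applied to families of balls\<close>

context bqbf begin

text \<open>The family J is enlarged to the balls z_j + B_{l_j + i} for i < K, with weights decaying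
  in i. \<open>FS_step\<close> moves each of them back to z_j + B_{l_j}, and a geometric series in i
  remains.\<close>

lemma eps_family:
  assumes \<beta>: "2 / th < \<beta>" "lp ^ d < bdet A powr \<beta>"
  shows "\<exists>C\<ge>0. \<forall>f J w z l. locint f \<longrightarrow> finite (J :: nat set) \<longrightarrow> (\<forall>j\<in>J. 0 \<le> w j) \<longrightarrow>
     (\<Sum>j\<in>J. ennreal (w j * bdet A powr real_of_int (l j)) * (\<integral>\<^sup>+x. ennreal (ker \<beta> f (z j) (l j) x) \<partial>lebesgue))
     \<le> ennreal C * (campanato A D N 1 d th f * F_norm (step J (\<lambda>j. w j powr th) (\<lambda>j. bl (z j) (l j))))"
proof -
  let ?b = "bdet A"
  define C3 where "C3 = ?b powr (1 + \<beta>) * (1 + Cp * ?b * lp ^ d) / (1 - lp ^ d / ?b powr \<beta>)"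
  have b0: "0 \<le> \<beta>" using \<beta>(1) th by (smt (verit) divide_nonneg_pos)
  have "lp ^ d / ?b powr \<beta> < 1" using \<beta>(2) b_gt1 by (simp add: divide_simps)
  then have C3: "0 \<le> C3" unfolding C3_def using Cp1 b_gt1 lp1 by (intro divide_nonneg_nonneg mult_nonneg_nonneg add_nonneg_nonneg) auto
  obtain CF where CF: "0 \<le> CF"
    and CFall: "\<forall>I a \<kappa> E H. finite (I :: (nat \<times> nat) set) \<longrightarrow> (\<forall>i\<in>I. 0 \<le> a i \<and> 0 \<le> \<kappa> i \<and> E i \<in> sets lebesgue \<and> H i \<in> sets lebesgue \<and>
      (\<forall>x\<in>H i. ennreal (\<kappa> i) \<le> maxf A D (indicator (E i)) x)) \<longrightarrow>
      F_norm (step I (\<lambda>i. a i * (\<kappa> i)\<^sup>2) H) \<le> ennreal CF * F_norm (step I a E)"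
    using FS_step[where 'i = "nat \<times> nat"] by (elim exE conjE)
  \<comment> \<open>The ratio left over: W^th decays like b^(-(1+\<beta>) th) per scale, and b^(-2)
    of it is spent on \<kappa>^2. It is below 1 because \<beta> th > 2.\<close>
  define \<rho> where "\<rho> = ?b powr (2 - (1 + \<beta>) * th)"
  have "2 < \<beta> * th" using \<beta>(1) th by (simp add: pos_divide_less_eq)
  then have "2 - (1 + \<beta>) * th < 0" using th by (simp add: algebra_simps)
  then have \<rho>: "0 \<le> \<rho>" "\<rho> < 1" unfolding \<rho>_def using b_gt1 by (auto simp: powr_less_one)
  define C where "C = C3 * (CF * (1 / (1 - \<rho>)) powr (1 / th))"
  have C0: "0 \<le> C" unfolding C_def using C3 CF by simp
  show ?thesis
  proof (intro exI[of _ C] conjI C0 allI impI)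
    fix f :: "real^'n \<Rightarrow> real" and J :: "nat set" and w :: "nat \<Rightarrow> real" and z :: "nat \<Rightarrow> real^'n" and l :: "nat \<Rightarrow> int"
    assume f: "locint f" and fin: "finite J" and w: "\<forall>j\<in>J. (0::real) \<le> w j"
    let ?F = "F_norm (step J (\<lambda>j. w j powr th) (\<lambda>j. bl (z j) (l j)))"
    let ?camp = "campanato A D N 1 d th f"
    let ?u = "\<lambda>j i. ?b powr (- real i * \<beta>) * osc f (z j) (l j + int i)"
    have u0: "0 \<le> ?u j i" for j i using osc_nonneg by simp
    have part: "(\<Sum>j\<in>J. ennreal (w j * ?b powr real_of_int (l j)) * ennreal (C3 * (\<Sum>i<K. ?u j i))) \<le> ennreal C * (?camp * ?F)" for K
    proof -
      let ?I = "J \<times> {..<K}"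
      \<comment> \<open>Chosen so that W times the volume of the enlarged ball equals w_j b^(l_j)
        b^(-i \<beta>), the coefficient in the kernel bound.\<close>
      define W where "W p = w (fst p) * ?b powr (- real (snd p) * (1 + \<beta>))" for p :: "nat \<times> nat"
      define a where "a p = w (fst p) powr th * \<rho> ^ snd p" for p :: "nat \<times> nat"
      define \<kappa> where "\<kappa> p = ?b powr (- real (snd p))" for p :: "nat \<times> nat"
      let ?x = "\<lambda>p. z (fst p)" and ?k = "\<lambda>p. l (fst p) + int (snd p)"
      have W0: "0 \<le> W p" if "p \<in> ?I" for p using w that by (auto simp: W_def)
      have "(\<Sum>j\<in>J. ennreal (w j * ?b powr real_of_int (l j)) * ennreal (C3 * (\<Sum>i<K. ?u j i)))
          = ennreal C3 * (\<Sum>j\<in>J. \<Sum>i<K. ennreal (w j * ?b powr real_of_int (l j) * ?u j i))"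
      proof (subst sum_distrib_left, rule sum.cong[OF refl])
        fix j assume j: "j \<in> J"
        have "ennreal (w j * ?b powr real_of_int (l j)) * ennreal (C3 * (\<Sum>i<K. ?u j i)) = ennreal (C3 * (\<Sum>i<K. w j * ?b powr real_of_int (l j) * ?u j i))"
          using w j C3 u0 by (subst ennreal_mult[symmetric]) (auto simp: sum_distrib_left sum_nonneg mult_ac)
        also have "\<dots> = ennreal C3 * (\<Sum>i<K. ennreal (w j * ?b powr real_of_int (l j) * ?u j i))"
          using w j C3 u0 by (subst ennreal_mult) (auto intro!: sum_nonneg simp: sum_ennreal)
        finally show "ennreal (w j * ?b powr real_of_int (l j)) * ennreal (C3 * (\<Sum>i<K. ?u j i)) = ennreal C3 * (\<Sum>i<K. ennreal (w j * ?b powr real_of_int (l j) * ?u j i))" .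
      qed
      also have "(\<Sum>j\<in>J. \<Sum>i<K. ennreal (w j * ?b powr real_of_int (l j) * ?u j i)) = (\<Sum>p\<in>?I. ennreal (W p * ?b powr real_of_int (?k p) * osc f (?x p) (?k p)))"
      proof (subst sum.cartesian_product, rule sum.cong[OF refl], clarify)
        fix j i
        have "?b powr (- real i * (1 + \<beta>)) * ?b powr real_of_int (l j + int i) = ?b powr real_of_int (l j) * ?b powr (- real i * \<beta>)"
          by (simp add: powr_add[symmetric] algebra_simps)
        then have "W (j, i) * ?b powr real_of_int (?k (j, i)) = w j * (?b powr real_of_int (l j) * ?b powr (- real i * \<beta>))"
          by (simp only: W_def fst_conv snd_conv mult.assoc)
        then show "ennreal (w j * ?b powr real_of_int (l j) * ?u j i) = ennreal (W (j, i) * ?b powr real_of_int (?k (j, i)) * osc f (?x (j, i)) (?k (j, i)))"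
          by (simp only: fst_conv snd_conv mult.assoc)
      qed
      also have "\<dots> \<le> ?camp * F_norm (step ?I (\<lambda>p. W p powr th) (\<lambda>p. bl (?x p) (?k p)))"
        using fin W0 by (intro campanato_sum f) auto
      also have "step ?I (\<lambda>p. W p powr th) (\<lambda>p. bl (?x p) (?k p)) = step ?I (\<lambda>p. a p * (\<kappa> p)\<^sup>2) (\<lambda>p. bl (?x p) (?k p))"
      proof -
        have "W p powr th = a p * (\<kappa> p)\<^sup>2" if "p \<in> ?I" for p
        proof -
          have "W p powr th = w (fst p) powr th * ?b powr (- real (snd p) * (1 + \<beta>) * th)"
            using w that unfolding W_def by (auto simp: powr_mult powr_powr)
          also have "?b powr (- real (snd p) * (1 + \<beta>) * th) = ?b powr (real (snd p) * (2 - (1 + \<beta>) * th)) * ?b powr (2 * (- real (snd p)))"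
            by (simp add: powr_add[symmetric] algebra_simps)
          also have "?b powr (real (snd p) * (2 - (1 + \<beta>) * th)) = \<rho> ^ snd p"
            unfolding \<rho>_def using b_gt1 by (simp add: powr_power mult.commute)
          also have "?b powr (2 * (- real (snd p))) = (\<kappa> p)\<^sup>2"
            unfolding \<kappa>_def using b_gt1 by (simp add: powr_power mult.commute)
          finally show ?thesis unfolding a_def by (simp only: mult.assoc)
        qed
        then show ?thesis unfolding step_def by (intro ext sum.cong) auto
      qed
      also have "F_norm \<dots> \<le> ennreal CF * F_norm (step ?I a (\<lambda>p. bl (z (fst p)) (l (fst p))))"
      proof (rule CFall[THEN spec, THEN spec, THEN spec, THEN spec, THEN spec, THEN mp, THEN mp])
        show "finite ?I" using fin by simp
        show "\<forall>p\<in>?I. 0 \<le> a p \<and> 0 \<le> \<kappa> p \<and> bl (z (fst p)) (l (fst p)) \<in> sets lebesgue \<and> bl (?x p) (?k p) \<in> sets lebesgue \<and>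
          (\<forall>x\<in>bl (?x p) (?k p). ennreal (\<kappa> p) \<le> maxf A D (indicator (bl (z (fst p)) (l (fst p)))) x)"
        proof (intro ballI conjI)
          fix p y assume p: "p \<in> ?I" and y: "y \<in> bl (?x p) (?k p)"
          show "ennreal (\<kappa> p) \<le> maxf A D (indicator (bl (z (fst p)) (l (fst p)))) y"
          proof (rule maxf_indicator_ge[OF y])
            show "bl (z (fst p)) (l (fst p)) \<subseteq> bl (?x p) (?k p)" by (rule bl_mono) simp
            show "\<kappa> p * ?b powr real_of_int (?k p) \<le> measure lebesgue (bl (z (fst p)) (l (fst p)))"
              unfolding \<kappa>_def measure_bl by (simp add: powr_add[symmetric])
          qed (auto simp: \<kappa>_def)
        qed (use \<rho>(1) in \<open>auto simp: a_def \<kappa>_def\<close>)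
      qed
      also have "F_norm (step ?I a (\<lambda>p. bl (z (fst p)) (l (fst p)))) \<le> F_norm (\<lambda>y. (1 / (1 - \<rho>)) * step J (\<lambda>j. w j powr th) (\<lambda>j. bl (z j) (l j)) y)"
      proof (rule F_norm_mono)
        show "step ?I a (\<lambda>p. bl (z (fst p)) (l (fst p))) \<in> borel_measurable lebesgue" by (rule step_measurable) simp
        show "(\<lambda>y. (1 / (1 - \<rho>)) * step J (\<lambda>j. w j powr th) (\<lambda>j. bl (z j) (l j)) y) \<in> borel_measurable lebesgue"
          by (intro borel_measurable_times borel_measurable_const step_measurable) simp
        fix y
        show "0 \<le> step ?I a (\<lambda>p. bl (z (fst p)) (l (fst p))) y" using \<rho>(1) by (intro step_nonneg) (simp add: a_def)
        have "step ?I a (\<lambda>p. bl (z (fst p)) (l (fst p))) y = (\<Sum>j\<in>J. \<Sum>i<K. w j powr th * indicator (bl (z j) (l j)) y * \<rho> ^ i)"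
          unfolding step_def a_def by (subst sum.cartesian_product) (auto intro!: sum.cong)
        also have "\<dots> \<le> (\<Sum>j\<in>J. w j powr th * indicator (bl (z j) (l j)) y * (1 / (1 - \<rho>)))"
        proof (rule sum_mono)
          fix j
          have "(\<Sum>i<K. \<rho> ^ i) \<le> 1 / (1 - \<rho>)"
            using sum_le_suminf[of "\<lambda>m. \<rho> ^ m" "{..<K}"] \<rho> by (simp add: suminf_geometric summable_geometric)
          then show "(\<Sum>i<K. w j powr th * indicator (bl (z j) (l j)) y * \<rho> ^ i) \<le> w j powr th * indicator (bl (z j) (l j)) y * (1 / (1 - \<rho>))"
            unfolding sum_distrib_left[symmetric] by (intro mult_left_mono) auto
        qed
        also have "\<dots> = (1 / (1 - \<rho>)) * step J (\<lambda>j. w j powr th) (\<lambda>j. bl (z j) (l j)) y"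
          unfolding step_def sum_distrib_left by (intro sum.cong refl) (simp only: mult.commute)
        finally show "step ?I a (\<lambda>p. bl (z (fst p)) (l (fst p))) y \<le> (1 / (1 - \<rho>)) * step J (\<lambda>j. w j powr th) (\<lambda>j. bl (z j) (l j)) y" .
      qed
      also have "\<dots> = ennreal ((1 / (1 - \<rho>)) powr (1 / th)) * ?F"
        using \<rho> by (intro F_norm_cmult step_measurable step_nonneg) auto
      finally have "(\<Sum>j\<in>J. ennreal (w j * ?b powr real_of_int (l j)) * ennreal (C3 * (\<Sum>i<K. ?u j i)))
          \<le> ennreal C3 * (?camp * (ennreal CF * (ennreal ((1 / (1 - \<rho>)) powr (1 / th)) * ?F)))"
        by (simp add: mult_left_mono)
      also have "\<dots> = ennreal C * (?camp * ?F)"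
        unfolding C_def using C3 CF by (simp add: ennreal_mult mult_ac)
      finally show ?thesis .
    qed
    have "(\<Sum>j\<in>J. ennreal (w j * ?b powr real_of_int (l j)) * (\<integral>\<^sup>+x. ennreal (ker \<beta> f (z j) (l j) x) \<partial>lebesgue))
       \<le> (\<Sum>j\<in>J. ennreal (w j * ?b powr real_of_int (l j)) * (SUP K. ennreal (C3 * (\<Sum>i<K. ?u j i))))"
      unfolding C3_def by (intro sum_mono mult_left_mono ker_integral_le f b0 \<beta>(2)) auto
    also have "\<dots> = (SUP K. \<Sum>j\<in>J. ennreal (w j * ?b powr real_of_int (l j)) * ennreal (C3 * (\<Sum>i<K. ?u j i)))"
      unfolding SUP_mult_left_ennreal
    proof (rule ennreal_SUP_sum[symmetric])
      fix j
      show "incseq (\<lambda>K. ennreal (w j * ?b powr real_of_int (l j)) * ennreal (C3 * (\<Sum>i<K. ?u j i)))"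
        using C3 u0 by (intro incseq_SucI mult_left_mono ennreal_leI) auto
    qed
    also have "\<dots> \<le> ennreal C * (?camp * ?F)" by (intro SUP_least part)
    finally show "(\<Sum>j\<in>J. ennreal (w j * ?b powr real_of_int (l j)) * (\<integral>\<^sup>+x. ennreal (ker \<beta> f (z j) (l j) x) \<partial>lebesgue)) \<le> ennreal C * (?camp * ?F)" .
  qed
qed

section \<open>Duality in the associate space\<close>

lemma assoc_norm_pairing:
  assumes H: "H \<in> borel_measurable lebesgue" and g: "g \<in> borel_measurable lebesgue" and fin: "Y g < \<infinity>"
  shows "(\<integral>\<^sup>+x. g x * H x \<partial>lebesgue) \<le> Y g * assoc_norm Y H"
proof (cases "Y g = 0")
  case True
  then have "N (\<lambda>x. epow (g x) (1 / th)) = 0" unfolding Xpow_def by (simp add: epow_eq_0)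
  then have "AE x in lebesgue. epow (g x) (1 / th) = 0" using g by (intro N_zero_AE) auto
  then have "AE x in lebesgue. g x * H x = 0" by (rule eventually_mono) (simp add: epow_eq_0)
  then have "(\<integral>\<^sup>+x. g x * H x \<partial>lebesgue) = (\<integral>\<^sup>+x. (0::ennreal) \<partial>(lebesgue :: (real^'n) measure))" by (intro nn_integral_cong_AE)
  then show ?thesis by simp
next
  case False
  define c where "c = enn2real (Y g)"
  have c: "0 < c" "Y g = ennreal c" using False fin by (auto simp: c_def enn2real_positive_iff less_top zero_less_iff_neq_zero)
  let ?g = "\<lambda>x. ennreal (1 / c) * g x"
  have "Y ?g = ennreal (1 / c) * Y g" using c g by (intro Y_scale') auto
  then have "Y ?g = 1" using c by (simp add: ennreal_mult[symmetric])
  then have "(\<integral>\<^sup>+x. H x * ?g x \<partial>lebesgue) \<le> assoc_norm Y H"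
    unfolding assoc_norm_def using g by (intro SUP_upper) auto
  moreover have "(\<integral>\<^sup>+x. H x * ?g x \<partial>lebesgue) = ennreal (1 / c) * (\<integral>\<^sup>+x. g x * H x \<partial>lebesgue)"
    using g H by (subst nn_integral_cmult[symmetric]) (auto simp: mult_ac)
  ultimately have "ennreal c * (ennreal (1 / c) * (\<integral>\<^sup>+x. g x * H x \<partial>lebesgue)) \<le> ennreal c * assoc_norm Y H"
    by (intro mult_left_mono) auto
  then show ?thesis using c by (simp add: mult.assoc[symmetric] ennreal_mult[symmetric])
qed

text \<open>Hoelder's inequality in the form that avoids L^s norms: Young's inequality is applied to
  \<psi> and h / \<kappa>, where \<kappa> is the L^{s'} average of h, and the second term then
  integrates to the volume of the ball.\<close>

lemma holder_avg:
  assumes s: "1 < s" and K: "0 \<le> K" and \<psi>: "\<psi> \<in> borel_measurable lebesgue" "\<And>x. 0 \<le> \<psi> x"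
    and supp: "\<And>x. x \<notin> bl z m \<Longrightarrow> \<psi> x = 0"
    and int: "(\<integral>\<^sup>+x. ennreal (\<psi> x powr s) \<partial>lebesgue) \<le> ennreal K"
    and h: "h \<in> borel_measurable lebesgue"
    and \<kappa>: "\<kappa> = epow ((\<integral>\<^sup>+ y. epow (h y) (s / (s - 1)) * indicator (bl z m) y \<partial>lebesgue) / emeasure lebesgue (bl z m)) (1 / (s / (s - 1)))"
  shows "(\<integral>\<^sup>+x. ennreal (\<psi> x) * h x \<partial>lebesgue) \<le> ennreal (K + bdet A powr real_of_int m) * \<kappa>"
proof -
  let ?s' = "s / (s - 1)" and ?B = "bl z m" and ?V = "bdet A powr real_of_int m"
  have s': "0 < ?s'" using s by simp
  have V: "0 < ?V" using b_gt1 by simp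
  let ?I = "\<integral>\<^sup>+ y. epow (h y) ?s' * indicator ?B y \<partial>lebesgue"
  have Im: "(\<lambda>y. epow (h y) ?s' * indicator ?B y) \<in> borel_measurable lebesgue" using h by auto
  show ?thesis
  proof (cases \<kappa>)
    case top
    have "0 < K + ?V" by (rule add_nonneg_pos[OF K V])
    then show ?thesis using top by (simp add: ennreal_mult_top ennreal_mult_eq_top_iff)
  next
    case (real c)
    have pw: "epow \<kappa> ?s' = ?I / emeasure lebesgue ?B" unfolding \<kappa> epow_epow using s by simp
    then have I: "?I = ennreal ?V * epow \<kappa> ?s'"
      unfolding pw emeasure_bl using V ennreal_mult_divide_eq[of "ennreal ?V" ?I] by (simp add: ennreal_times_divide mult.commute)
    show ?thesis
    proof (cases "c = 0")
      case True
      then have "?I = 0" using I real by simp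
      then have "AE y in lebesgue. epow (h y) ?s' * indicator ?B y = 0" using Im by (simp add: nn_integral_0_iff_AE)
      then have "AE y in lebesgue. ennreal (\<psi> y) * h y = 0"
      proof eventually_elim
        case (elim y) then show ?case using supp[of y] by (cases "y \<in> ?B") (auto simp: epow_eq_0)
      qed
      then have "(\<integral>\<^sup>+x. ennreal (\<psi> x) * h x \<partial>lebesgue) = (\<integral>\<^sup>+x. (0::ennreal) \<partial>(lebesgue :: (real^'n) measure))" by (intro nn_integral_cong_AE)
      then show ?thesis by simp
    next
      case False
      then have c: "0 < c" using real by simp
      \<comment> \<open>Here c is the real value of \<kappa>; Young's inequality for \<psi> and h/c
        is multiplied by c.\<close>
      have pt: "ennreal (\<psi> x) * h x \<le> ennreal c * (ennreal (\<psi> x powr s) + ennreal (c powr (- ?s')) * (epow (h x) ?s' * indicator ?B x))" for x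
      proof (cases "x \<in> ?B \<and> \<psi> x \<noteq> 0")
        case True
        then have \<psi>0: "0 < \<psi> x" using \<psi>(2)[of x] by simp
        show ?thesis
        proof (cases "h x")
          case top
          have "0 < c powr (- ?s')" using c by simp
          then show ?thesis using top True c by (simp add: ennreal_mult_top epow_def ennreal_mult_eq_top_iff)
        next
          case (real t)
          have "\<psi> x * (t / c) \<le> \<psi> x powr s + (t / c) powr ?s'" using real c by (intro young_simple s \<psi>(2)) auto
          also have "(t / c) powr ?s' = c powr (- ?s') * t powr ?s'" using real c by (simp add: powr_divide powr_minus field_simps)
          finally have "c * (\<psi> x * (t / c)) \<le> c * (\<psi> x powr s + c powr (- ?s') * t powr ?s')" using c by (intro mult_left_mono) auto
          then have "\<psi> x * t \<le> c * (\<psi> x powr s + c powr (- ?s') * t powr ?s')" using c by simp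
          then have "ennreal (\<psi> x * t) \<le> ennreal (c * (\<psi> x powr s + c powr (- ?s') * t powr ?s'))" by (rule ennreal_leI)
          then show ?thesis using True real c \<psi>(2)[of x]
            by (simp add: epow_ennreal ennreal_mult[symmetric] ennreal_plus[symmetric] del: ennreal_plus)
        qed
      next
        case False then show ?thesis using supp[of x] by auto
      qed
      have "(\<integral>\<^sup>+x. ennreal (\<psi> x) * h x \<partial>lebesgue) \<le> (\<integral>\<^sup>+x. ennreal c * (ennreal (\<psi> x powr s) + ennreal (c powr (- ?s')) * (epow (h x) ?s' * indicator ?B x)) \<partial>lebesgue)"
        by (intro nn_integral_mono pt)
      also have "\<dots> = ennreal c * ((\<integral>\<^sup>+x. ennreal (\<psi> x powr s) \<partial>lebesgue) + ennreal (c powr (- ?s')) * ?I)"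
        using \<psi>(1) Im by (simp add: nn_integral_cmult nn_integral_add)
      also have "\<dots> \<le> ennreal c * (ennreal K + ennreal (c powr (- ?s')) * ?I)"
        by (intro mult_left_mono add_right_mono int) auto
      also have "ennreal (c powr (- ?s')) * ?I = ennreal ?V"
      proof -
        have "c powr (- ?s') * (?V * c powr ?s') = ?V" using c by (simp add: powr_minus)
        then show ?thesis unfolding I real using c by (simp add: epow_ennreal ennreal_mult[symmetric])
      qed
      also have "ennreal c * (ennreal K + ennreal ?V) = ennreal (K + ?V) * \<kappa>"
        using K V real by (simp add: ennreal_plus mult.commute)
      finally show ?thesis .
    qed
  qed
qed

text \<open>By \<open>lorentz_luxemburg\<close> it suffices to pair with h of associate norm at most
  1. On each ball the pairing with \<psi>_j is at most a constant times the volume times an L^{s'}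
  average of h, s = p0/th, and that average is dominated on B_j by the powered maximal function of
  h, which is bounded on the associate space.\<close>

lemma dual_step:
  assumes K: "0 \<le> K"
  shows "\<exists>C\<ge>0. \<forall>(J :: nat set) (a :: nat \<Rightarrow> real) (z :: nat \<Rightarrow> real^'n) (l :: nat \<Rightarrow> int) (\<psi> :: nat \<Rightarrow> real^'n \<Rightarrow> real). finite J \<longrightarrow>
      (\<forall>j\<in>J. 0 \<le> a j \<and> \<psi> j \<in> borel_measurable lebesgue \<and> (\<forall>x. 0 \<le> \<psi> j x) \<and> (\<forall>x. x \<notin> bl (z j) (l j + int ga) \<longrightarrow> \<psi> j x = 0) \<and>
         (\<integral>\<^sup>+x. ennreal (\<psi> j x powr (p0 / th)) \<partial>lebesgue) \<le> ennreal (K * bdet A powr real_of_int (l j))) \<longrightarrow>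
      F_norm (\<lambda>x. \<Sum>j\<in>J. a j * \<psi> j x) \<le> ennreal C * F_norm (step J a (\<lambda>j. bl (z j) (l j)))"
proof -
  let ?s = "p0 / th"
  let ?s' = "?s / (?s - 1)"
  have s: "1 < ?s" using th by simp
  then have s': "0 < ?s'" using th by (intro divide_pos_pos) auto
  then have i0: "0 \<le> 1 / ?s'" by (intro divide_nonneg_pos) auto
  obtain CA where CA: "\<And>h. h \<in> borel_measurable lebesgue \<Longrightarrow> assoc_norm Y (maxf_pow A D ?s' h) \<le> ennreal CA * assoc_norm Y h"
    using AA unfolding assumption_A_def by blast
  define K' where "K' = K + bdet A ^ ga"
  have K': "0 \<le> K'" using K b_gt1 by (simp add: K'_def)
  define C where "C = K' * max CA 0"
  have C0: "0 \<le> C" using K' by (simp add: C_def)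
  show ?thesis
  proof (intro exI[of _ "C powr (1 / th)"] conjI allI impI)
    fix J :: "nat set" and a :: "nat \<Rightarrow> real" and z :: "nat \<Rightarrow> real^'n" and l :: "nat \<Rightarrow> int" and \<psi> :: "nat \<Rightarrow> real^'n \<Rightarrow> real"
    assume fin: "finite J" and as: "\<forall>j\<in>J. 0 \<le> a j \<and> \<psi> j \<in> borel_measurable lebesgue \<and> (\<forall>x. 0 \<le> \<psi> j x) \<and> (\<forall>x. x \<notin> bl (z j) (l j + int ga) \<longrightarrow> \<psi> j x = 0) \<and>
         (\<integral>\<^sup>+x. ennreal (\<psi> j x powr ?s) \<partial>lebesgue) \<le> ennreal (K * bdet A powr real_of_int (l j))"
    let ?S = "step J a (\<lambda>j. bl (z j) (l j))"
    let ?F = "\<lambda>x. \<Sum>j\<in>J. a j * \<psi> j x"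
    have Sm: "?S \<in> borel_measurable lebesgue" by (rule step_measurable) simp
    have S0: "0 \<le> ?S x" for x using as by (intro step_nonneg) auto
    have Sfin: "Y (\<lambda>x. ennreal (?S x)) < \<infinity>"
      using F_norm_step_finite[of J a z l] fin as by (simp add: Y_F_norm[OF S0] epow_less_top[simplified])
    have F0: "0 \<le> ?F x" for x using as by (intro sum_nonneg mult_nonneg_nonneg) auto
    have Fm: "?F \<in> borel_measurable lebesgue" using as by (intro borel_measurable_sum borel_measurable_times) auto
    have "Y (\<lambda>x. ennreal (?F x)) \<le> ennreal C * Y (\<lambda>x. ennreal (?S x))"
    proof (rule lorentz_luxemburg[OF Y_Bfs])
      show "(\<lambda>x. ennreal (?F x)) \<in> borel_measurable lebesgue" using Fm by auto
      fix h assume h: "h \<in> borel_measurable lebesgue" "assoc_norm Y h \<le> 1"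
      let ?H = "maxf_pow A D ?s' h"
      have Hm: "?H \<in> borel_measurable lebesgue" unfolding maxf_pow_def[abs_def] using maxf_measurable by auto
      \<comment> \<open>The average is over the enlarged ball that carries \<psi>_j. It also
        competes in the maximal function at every point of the smaller ball.\<close>
      define \<kappa> where "\<kappa> j = epow ((\<integral>\<^sup>+ y. epow (h y) ?s' * indicator (bl (z j) (l j + int ga)) y \<partial>lebesgue) / emeasure lebesgue (bl (z j) (l j + int ga))) (1 / ?s')" for j
      have \<kappa>H: "\<kappa> j \<le> ?H x" if "x \<in> bl (z j) (l j)" for j x
      proof -
        have "x \<in> bl (z j) (l j + int ga)" using that bl_mono[of "l j" "l j + int ga"] by auto
        then show ?thesis unfolding \<kappa>_def maxf_pow_def by (intro epow_mono[OF i0] maxf_ge)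
      qed
      have each: "(\<integral>\<^sup>+x. ennreal (\<psi> j x) * h x \<partial>lebesgue) \<le> ennreal K' * (ennreal (bdet A powr real_of_int (l j)) * \<kappa> j)" if j: "j \<in> J" for j
      proof -
        have "(\<integral>\<^sup>+x. ennreal (\<psi> j x) * h x \<partial>lebesgue) \<le> ennreal (K * bdet A powr real_of_int (l j) + bdet A powr real_of_int (l j + int ga)) * \<kappa> j"
          by (rule holder_avg[OF s _ _ _ _ _ h(1) \<kappa>_def]) (use as j K in auto)
        also have "K * bdet A powr real_of_int (l j) + bdet A powr real_of_int (l j + int ga) = K' * bdet A powr real_of_int (l j)"
          unfolding bb(1) bb(5) K'_def by (simp add: algebra_simps)
        also have "ennreal \<dots> = ennreal K' * ennreal (bdet A powr real_of_int (l j))" using K' by (simp add: ennreal_mult)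
        finally show ?thesis by (simp only: mult.assoc)
      qed
      have "(\<integral>\<^sup>+x. ennreal (?F x) * h x \<partial>lebesgue) = (\<integral>\<^sup>+x. (\<Sum>j\<in>J. ennreal (a j) * (ennreal (\<psi> j x) * h x)) \<partial>lebesgue)"
      proof (rule nn_integral_cong)
        fix x
        have "ennreal (?F x) = (\<Sum>j\<in>J. ennreal (a j) * ennreal (\<psi> j x))" using as by (subst sum_ennreal[symmetric]) (auto simp: ennreal_mult intro!: sum.cong)
        then show "ennreal (?F x) * h x = (\<Sum>j\<in>J. ennreal (a j) * (ennreal (\<psi> j x) * h x))" by (simp add: sum_distrib_right mult.assoc)
      qed
      also have "\<dots> = (\<Sum>j\<in>J. ennreal (a j) * (\<integral>\<^sup>+x. ennreal (\<psi> j x) * h x \<partial>lebesgue))"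
      proof (subst nn_integral_sum)
        show "(\<lambda>x. ennreal (a j) * (ennreal (\<psi> j x) * h x)) \<in> borel_measurable lebesgue" if "j \<in> J" for j
          using as that h(1) by (intro borel_measurable_times_ennreal) auto
        show "(\<Sum>j\<in>J. \<integral>\<^sup>+x. ennreal (a j) * (ennreal (\<psi> j x) * h x) \<partial>lebesgue) = (\<Sum>j\<in>J. ennreal (a j) * (\<integral>\<^sup>+x. ennreal (\<psi> j x) * h x \<partial>lebesgue))"
          using as h(1) by (intro sum.cong refl nn_integral_cmult borel_measurable_times_ennreal) auto
      qed
      also have "\<dots> \<le> (\<Sum>j\<in>J. ennreal (a j) * (ennreal K' * (ennreal (bdet A powr real_of_int (l j)) * \<kappa> j)))"
        by (intro sum_mono mult_left_mono each) auto
      also have "\<dots> = ennreal K' * (\<Sum>j\<in>J. ennreal (a j) * \<kappa> j * ennreal (bdet A powr real_of_int (l j)))"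
        by (simp add: sum_distrib_left mult_ac)
      also have "(\<Sum>j\<in>J. ennreal (a j) * \<kappa> j * ennreal (bdet A powr real_of_int (l j))) = (\<Sum>j\<in>J. \<integral>\<^sup>+x. ennreal (a j) * \<kappa> j * indicator (bl (z j) (l j)) x \<partial>lebesgue)"
        by (intro sum.cong refl) (simp add: nn_integral_cmult_indicator emeasure_bl)
      also have "\<dots> = (\<integral>\<^sup>+x. (\<Sum>j\<in>J. ennreal (a j) * \<kappa> j * indicator (bl (z j) (l j)) x) \<partial>lebesgue)"
        by (intro nn_integral_sum[symmetric]) auto
      also have "\<dots> \<le> (\<integral>\<^sup>+x. ennreal (?S x) * ?H x \<partial>lebesgue)"
      proof (rule nn_integral_mono)
        fix x
        have "(\<Sum>j\<in>J. ennreal (a j) * \<kappa> j * indicator (bl (z j) (l j)) x) \<le> (\<Sum>j\<in>J. ennreal (a j) * indicator (bl (z j) (l j)) x * ?H x)"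
          using \<kappa>H by (intro sum_mono) (auto simp: indicator_def intro: mult_left_mono)
        also have "\<dots> = ennreal (?S x) * ?H x"
        proof -
          have "ennreal (?S x) = (\<Sum>j\<in>J. ennreal (a j) * indicator (bl (z j) (l j)) x)"
          proof -
            have "(\<Sum>j\<in>J. ennreal (a j) * indicator (bl (z j) (l j)) x) = (\<Sum>j\<in>J. ennreal (a j * indicator (bl (z j) (l j)) x))"
              by (intro sum.cong) (auto simp: indicator_def)
            also have "\<dots> = ennreal (?S x)" unfolding step_def using as by (intro sum_ennreal) auto
            finally show ?thesis ..
          qed
          then show ?thesis by (simp add: sum_distrib_right)
        qed
        finally show "(\<Sum>j\<in>J. ennreal (a j) * \<kappa> j * indicator (bl (z j) (l j)) x) \<le> ennreal (?S x) * ?H x" .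
      qed
      also have "\<dots> \<le> Y (\<lambda>x. ennreal (?S x)) * assoc_norm Y ?H"
        using Sm by (intro assoc_norm_pairing Hm Sfin) auto
      also have "\<dots> \<le> Y (\<lambda>x. ennreal (?S x)) * ennreal (max CA 0)"
      proof (rule mult_left_mono)
        have "assoc_norm Y ?H \<le> ennreal CA * assoc_norm Y h" by (rule CA[OF h(1)])
        also have "\<dots> \<le> ennreal (max CA 0) * 1" using h(2) by (intro mult_mono ennreal_leI) auto
        finally show "assoc_norm Y ?H \<le> ennreal (max CA 0)" by simp
      qed simp
      finally have "(\<integral>\<^sup>+x. ennreal (?F x) * h x \<partial>lebesgue) \<le> ennreal K' * (Y (\<lambda>x. ennreal (?S x)) * ennreal (max CA 0))"
        by (simp add: mult_left_mono)
      also have "\<dots> = ennreal C * Y (\<lambda>x. ennreal (?S x))" unfolding C_def using K' by (simp add: ennreal_mult mult_ac)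
      finally show "(\<integral>\<^sup>+x. ennreal (?F x) * h x \<partial>lebesgue) \<le> ennreal C * Y (\<lambda>x. ennreal (?S x))" .
    qed
    then have "epow (Y (\<lambda>x. ennreal (?F x))) (1 / th) \<le> epow (ennreal C * Y (\<lambda>x. ennreal (?S x))) (1 / th)"
      using th by (intro epow_mono) auto
    then show "F_norm ?F \<le> ennreal (C powr (1 / th)) * F_norm ?S"
      unfolding F_norm_Y[OF F0] F_norm_Y[OF S0] using C0 th by (simp add: epow_cmult)
  qed simp
qed

section \<open>Kernel seminorm against exponent one\<close>

lemma block_norm_step:
  "block_norm N th m (\<lambda>j. bl (xs j) (ls j)) lam
     = F_norm (step {..<m} (\<lambda>j. (lam j / ind_norm N (bl (xs j) (ls j))) powr th) (\<lambda>j. bl (xs j) (ls j)))"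
  unfolding block_norm_def F_norm_def step_def ..

lemma block_norm_bounds:
  assumes "\<forall>j<m. 0 \<le> lam j" "(\<Sum>j<m. lam j) \<noteq> 0"
  shows "0 < block_norm N th m (\<lambda>j. bl (xs j) (ls j)) lam" "block_norm N th m (\<lambda>j. bl (xs j) (ls j)) lam < \<infinity>"
proof -
  obtain j where j: "j < m" "lam j \<noteq> 0" using assms(2) by (metis lessThan_iff sum.neutral)
  then have "0 < lam j / ind_norm N (bl (xs j) (ls j))"
    using assms(1) ind_norm_bl(1)[of "xs j" "ls j"] by (simp add: less_le)
  then show "0 < block_norm N th m (\<lambda>j. bl (xs j) (ls j)) lam"
    unfolding block_norm_step using j by (intro F_norm_step_pos[of _ _ j]) auto
  show "block_norm N th m (\<lambda>j. bl (xs j) (ls j)) lam < \<infinity>"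
    unfolding block_norm_step by (intro F_norm_step_finite) auto
qed

lemma campanato_eps_ker:
  "campanato_eps A D N lm eps d th f = (SUP (m, xs, ls, lam) \<in> {(m, xs, ls, lam). (\<forall>j<m. 0 \<le> lam j) \<and> (\<Sum>j<m. lam j) \<noteq> 0}.
     inverse (block_norm N th m (\<lambda>j. bl (xs j) (ls j)) lam) *
     (\<Sum>j<m. ennreal (lam j * measure lebesgue (bl (xs j) (ls j)) / ind_norm N (bl (xs j) (ls j))) *
       (\<integral>\<^sup>+x. ennreal (ker (eps * ln lm / ln (bdet A)) f (xs j) (ls j) x) \<partial>lebesgue)))"
  unfolding campanato_eps_def Let_def ker_def bl_def ..

text \<open>\<open>eps_family\<close> for one test family, divided by its block norm, which is
  positive and finite.\<close>

lemma campanato_eps_le: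
  assumes \<beta>: "2 / th < eps * ln lm / ln (bdet A)" "lp ^ d < bdet A powr (eps * ln lm / ln (bdet A))"
  shows "\<exists>C\<ge>0. \<forall>f. locint f \<longrightarrow> campanato_eps A D N lm eps d th f \<le> ennreal C * campanato A D N 1 d th f"
proof -
  let ?\<beta> = "eps * ln lm / ln (bdet A)"
  obtain C where C0: "0 \<le> C" and C: "\<forall>f J w z l. locint f \<longrightarrow> finite (J :: nat set) \<longrightarrow> (\<forall>j\<in>J. 0 \<le> w j) \<longrightarrow>
     (\<Sum>j\<in>J. ennreal (w j * bdet A powr real_of_int (l j)) * (\<integral>\<^sup>+x. ennreal (ker ?\<beta> f (z j) (l j) x) \<partial>lebesgue))
     \<le> ennreal C * (campanato A D N 1 d th f * F_norm (step J (\<lambda>j. w j powr th) (\<lambda>j. bl (z j) (l j))))"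
    using eps_family[OF \<beta>] by (elim exE conjE)
  show ?thesis
  proof (intro exI[of _ C] conjI C0 allI impI)
    fix f :: "real^'n \<Rightarrow> real" assume f: "locint f"
    show "campanato_eps A D N lm eps d th f \<le> ennreal C * campanato A D N 1 d th f"
      unfolding campanato_eps_ker
    proof (intro SUP_least, clarify)
      fix m :: nat and xs :: "nat \<Rightarrow> real^'n" and ls :: "nat \<Rightarrow> int" and lam :: "nat \<Rightarrow> real"
      assume lam: "\<forall>j<m. 0 \<le> lam j" "(\<Sum>j<m. lam j) \<noteq> 0"
      let ?w = "\<lambda>j. lam j / ind_norm N (bl (xs j) (ls j))"
      have w: "\<forall>j\<in>{..<m}. 0 \<le> ?w j" using lam(1) ind_norm_bl(1) by (auto intro!: divide_nonneg_pos)
      have "(\<Sum>j<m. ennreal (lam j * measure lebesgue (bl (xs j) (ls j)) / ind_norm N (bl (xs j) (ls j))) *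
         (\<integral>\<^sup>+x. ennreal (ker ?\<beta> f (xs j) (ls j) x) \<partial>lebesgue))
        = (\<Sum>j<m. ennreal (?w j * bdet A powr real_of_int (ls j)) * (\<integral>\<^sup>+x. ennreal (ker ?\<beta> f (xs j) (ls j) x) \<partial>lebesgue))"
        by (simp add: measure_bl)
      also have "\<dots> \<le> ennreal C * (campanato A D N 1 d th f * F_norm (step {..<m} (\<lambda>j. ?w j powr th) (\<lambda>j. bl (xs j) (ls j))))"
        by (rule C[THEN spec, THEN spec, THEN spec, THEN spec, THEN spec, THEN mp, THEN mp, THEN mp, OF f finite_lessThan w])
      also have "\<dots> = (ennreal C * campanato A D N 1 d th f) * block_norm N th m (\<lambda>j. bl (xs j) (ls j)) lam"
        unfolding block_norm_step by (simp only: mult.assoc)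
      finally show "inverse (block_norm N th m (\<lambda>j. bl (xs j) (ls j)) lam) * (\<Sum>j<m. ennreal (lam j * measure lebesgue (bl (xs j) (ls j)) / ind_norm N (bl (xs j) (ls j))) *
         (\<integral>\<^sup>+x. ennreal (ker ?\<beta> f (xs j) (ls j) x) \<partial>lebesgue)) \<le> ennreal C * campanato A D N 1 d th f"
        by (rule ennreal_inverse_mult_le[OF block_norm_bounds[OF lam]])
    qed
  qed
qed

text \<open>Inside the ball \<open>rho\<close> is at most b^l, so the two summands of the
  denominator are comparable; hence the factor 2.\<close>

lemma ker_ge:
  assumes "x \<in> bl z l" "0 \<le> \<beta>"
  shows "\<bar>f x - proj z l f x\<bar> / (2 * bdet A powr real_of_int l) \<le> ker \<beta> f z l x"
proof -
  let ?b = "bdet A"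
  have "rho A D (x - z) \<le> ?b powr real_of_int l" using assms(1) by (intro rho_lt) (simp add: bl_iff)
  moreover have "0 \<le> rho A D (x - z)" by (simp add: rho_def)
  ultimately have "rho A D (x - z) powr (1 + \<beta>) \<le> (?b powr real_of_int l) powr (1 + \<beta>)"
    using assms(2) by (intro powr_mono2) auto
  then have r: "rho A D (x - z) powr (1 + \<beta>) \<le> ?b powr (real_of_int l * (1 + \<beta>))" by (simp add: powr_powr)
  have "\<bar>f x - proj z l f x\<bar> / (2 * ?b powr real_of_int l) = ?b powr (\<beta> * real_of_int l) * \<bar>f x - proj z l f x\<bar> / (2 * ?b powr (real_of_int l * (1 + \<beta>)))"
    using b_gt1 by (simp add: algebra_simps powr_add)
  also have "\<dots> \<le> ker \<beta> f z l x"
    unfolding ker_def using r b_gt1 by (intro divide_left_mono mult_pos_pos add_pos_nonneg) auto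
  finally show ?thesis .
qed

lemma avg_le_ker:
  assumes f: "locint f" and fm: "f \<in> borel_measurable lebesgue" and \<beta>: "0 \<le> \<beta>"
  shows "(\<integral>\<^sup>+ x. ennreal (\<bar>f x - proj z l f x\<bar>) * indicator (bl z l) x \<partial>lebesgue) / emeasure lebesgue (bl z l)
     \<le> 2 * (\<integral>\<^sup>+x. ennreal (ker \<beta> f z l x) \<partial>lebesgue)"
proof -
  let ?V = "bdet A powr real_of_int l"
  have V: "0 < ?V" using b_gt1 by simp
  have "set_integrable lebesgue (bl z l) f" using f unfolding locint_def by blast
  then have "continuous_on UNIV (proj z l f)" by (intro poly_le_continuous[OF proj_poly])
  then have pm: "proj z l f \<in> borel_measurable lebesgue" by (intro measurable_completion) (simp add: borel_measurable_continuous_onI)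
  let ?I = "\<integral>\<^sup>+ x. ennreal (\<bar>f x - proj z l f x\<bar>) * indicator (bl z l) x \<partial>lebesgue"
  have "ennreal (1 / (2 * ?V)) * ?I = (\<integral>\<^sup>+ x. ennreal (1 / (2 * ?V)) * (ennreal (\<bar>f x - proj z l f x\<bar>) * indicator (bl z l) x) \<partial>lebesgue)"
    using fm pm by (intro nn_integral_cmult[symmetric]) auto
  also have "\<dots> \<le> (\<integral>\<^sup>+x. ennreal (ker \<beta> f z l x) \<partial>lebesgue)"
  proof (rule nn_integral_mono)
    fix x show "ennreal (1 / (2 * ?V)) * (ennreal (\<bar>f x - proj z l f x\<bar>) * indicator (bl z l) x) \<le> ennreal (ker \<beta> f z l x)"
    proof (cases "x \<in> bl z l")
      case True
      then show ?thesis using ennreal_leI[OF ker_ge[OF True \<beta>, of f]] V by (simp add: ennreal_mult[symmetric])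
    qed simp
  qed
  finally have "2 * (ennreal (1 / (2 * ?V)) * ?I) \<le> 2 * (\<integral>\<^sup>+x. ennreal (ker \<beta> f z l x) \<partial>lebesgue)" by (intro mult_left_mono) auto
  moreover have "2 * (ennreal (1 / (2 * ?V)) * ?I) = ?I / emeasure lebesgue (bl z l)"
  proof -
    have "2 * ennreal (1 / (2 * ?V)) = inverse (ennreal ?V)"
      using V by (subst inverse_ennreal[OF V]) (simp add: ennreal_mult[symmetric] ennreal_numeral[symmetric] inverse_eq_divide del: ennreal_numeral)
    then show ?thesis unfolding emeasure_bl divide_ennreal_def by (simp only: mult.assoc[symmetric] mult.commute)
  qed
  ultimately show ?thesis by simp
qed

lemma campanato_le_eps:
  assumes f: "locint f" and fm: "f \<in> borel_measurable lebesgue" and \<beta>: "0 \<le> eps * ln lm / ln (bdet A)"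
  shows "campanato A D N 1 d th f \<le> 2 * campanato_eps A D N lm eps d th f"
  unfolding campanato_def
proof (intro SUP_least, clarify)
  let ?\<beta> = "eps * ln lm / ln (bdet A)"
  fix m :: nat and Bs :: "nat \<Rightarrow> (real^'n) set" and lam :: "nat \<Rightarrow> real"
  assume Bs: "\<forall>j<m. Bs j \<in> dballs A D" and lam: "\<forall>j<m. 0 \<le> lam j" "(\<Sum>j<m. lam j) \<noteq> 0"
  have "\<forall>j. \<exists>p. j < m \<longrightarrow> Bs j = bl (fst p) (snd p)" using Bs unfolding dballs_eq by auto
  then obtain p where p: "\<And>j. j < m \<Longrightarrow> Bs j = bl (fst (p j)) (snd (p j))" by metis
  let ?xs = "\<lambda>j. fst (p j)" and ?ls = "\<lambda>j. snd (p j)"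
  let ?c = "\<lambda>j. ennreal (lam j * measure lebesgue (bl (?xs j) (?ls j)) / ind_norm N (bl (?xs j) (?ls j)))"
  have bn: "block_norm N th m Bs lam = block_norm N th m (\<lambda>j. bl (?xs j) (?ls j)) lam"
    unfolding block_norm_def by (intro arg_cong[of _ _ N] ext arg_cong[of _ _ ennreal] arg_cong2[of _ _ _ _ "(powr)"] sum.cong) (auto simp: p)
  have "(\<Sum>j<m. ennreal (lam j * measure lebesgue (Bs j) / ind_norm N (Bs j)) *
           epow ((\<integral>\<^sup>+ x. ennreal (\<bar>f x - poly_proj d (Bs j) f x\<bar> powr 1) * indicator (Bs j) x \<partial>lebesgue) / emeasure lebesgue (Bs j)) (1 / 1))
     \<le> (\<Sum>j<m. 2 * (?c j * (\<integral>\<^sup>+x. ennreal (ker ?\<beta> f (?xs j) (?ls j) x) \<partial>lebesgue)))"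
  proof (rule sum_mono)
    fix j assume "j \<in> {..<m}"
    then have j: "j < m" by simp
    have "?c j * ((\<integral>\<^sup>+ x. ennreal (\<bar>f x - proj (?xs j) (?ls j) f x\<bar>) * indicator (bl (?xs j) (?ls j)) x \<partial>lebesgue) / emeasure lebesgue (bl (?xs j) (?ls j)))
       \<le> ?c j * (2 * (\<integral>\<^sup>+x. ennreal (ker ?\<beta> f (?xs j) (?ls j) x) \<partial>lebesgue))"
      by (intro mult_left_mono avg_le_ker f fm \<beta>) auto
    then show "ennreal (lam j * measure lebesgue (Bs j) / ind_norm N (Bs j)) *
           epow ((\<integral>\<^sup>+ x. ennreal (\<bar>f x - poly_proj d (Bs j) f x\<bar> powr 1) * indicator (Bs j) x \<partial>lebesgue) / emeasure lebesgue (Bs j)) (1 / 1)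
       \<le> 2 * (?c j * (\<integral>\<^sup>+x. ennreal (ker ?\<beta> f (?xs j) (?ls j) x) \<partial>lebesgue))"
      unfolding p[OF j] by (simp add: mult.left_commute)
  qed
  also have "\<dots> = 2 * (\<Sum>j<m. ?c j * (\<integral>\<^sup>+x. ennreal (ker ?\<beta> f (?xs j) (?ls j) x) \<partial>lebesgue))" by (simp add: sum_distrib_left)
  finally have "inverse (block_norm N th m Bs lam) * (\<Sum>j<m. ennreal (lam j * measure lebesgue (Bs j) / ind_norm N (Bs j)) *
           epow ((\<integral>\<^sup>+ x. ennreal (\<bar>f x - poly_proj d (Bs j) f x\<bar> powr 1) * indicator (Bs j) x \<partial>lebesgue) / emeasure lebesgue (Bs j)) (1 / 1))
     \<le> inverse (block_norm N th m Bs lam) * (2 * (\<Sum>j<m. ?c j * (\<integral>\<^sup>+x. ennreal (ker ?\<beta> f (?xs j) (?ls j) x) \<partial>lebesgue)))"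
    by (intro mult_left_mono) auto
  also have "\<dots> = 2 * (inverse (block_norm N th m (\<lambda>j. bl (?xs j) (?ls j)) lam) * (\<Sum>j<m. ?c j * (\<integral>\<^sup>+x. ennreal (ker ?\<beta> f (?xs j) (?ls j) x) \<partial>lebesgue)))"
    unfolding bn by (simp only: mult.left_commute)
  also have "\<dots> \<le> 2 * campanato_eps A D N lm eps d th f"
    unfolding campanato_eps_ker
  proof (intro mult_left_mono)
    show "inverse (block_norm N th m (\<lambda>j. bl (?xs j) (?ls j)) lam) * (\<Sum>j<m. ?c j * (\<integral>\<^sup>+x. ennreal (ker ?\<beta> f (?xs j) (?ls j) x) \<partial>lebesgue))
      \<le> (SUP (m, xs, ls, lam) \<in> {(m, xs, ls, lam). (\<forall>j<m. 0 \<le> lam j) \<and> (\<Sum>j<m. lam j) \<noteq> 0}.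
     inverse (block_norm N th m (\<lambda>j. bl (xs j) (ls j)) lam) *
     (\<Sum>j<m. ennreal (lam j * measure lebesgue (bl (xs j) (ls j)) / ind_norm N (bl (xs j) (ls j))) *
       (\<integral>\<^sup>+x. ennreal (ker ?\<beta> f (xs j) (ls j) x) \<partial>lebesgue)))"
      by (rule SUP_upper2[of "(m, ?xs, ?ls, lam)"]) (use lam in auto)
  qed simp
  finally show "inverse (block_norm N th m Bs lam) * (\<Sum>j<m. ennreal (lam j * measure lebesgue (Bs j) / ind_norm N (Bs j)) *
           epow ((\<integral>\<^sup>+ x. ennreal (\<bar>f x - poly_proj d (Bs j) f x\<bar> powr 1) * indicator (Bs j) x \<partial>lebesgue) / emeasure lebesgue (Bs j)) (1 / 1))
     \<le> 2 * campanato_eps A D N lm eps d th f" .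
qed

end


section \<open>Laminar families and the sparse pairing\<close>

text \<open>The maximal members of a laminar family are disjoint and have the same union, so the
  local estimates add up without overlap.\<close>

lemma emeasure_laminar_Union_le:
  assumes fin: "finite \<Q>" and sets: "\<Q> \<subseteq> sets M" and h: "h \<in> borel_measurable M"
    and lam: "\<And>X Y. X \<in> \<Q> \<Longrightarrow> Y \<in> \<Q> \<Longrightarrow> X \<subseteq> Y \<or> Y \<subseteq> X \<or> X \<inter> Y = {}"
    and b: "\<And>X. X \<in> \<Q> \<Longrightarrow> emeasure M X \<le> c * (\<integral>\<^sup>+x. h x * indicator X x \<partial>M)"
  shows "emeasure M (\<Union>\<Q>) \<le> c * (\<integral>\<^sup>+x. h x \<partial>M)"
proof -
  define \<M> where "\<M> = {X \<in> \<Q>. \<forall>Y\<in>\<Q>. X \<subseteq> Y \<longrightarrow> X = Y}"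
  have \<M>: "\<M> \<subseteq> \<Q>" "finite \<M>" using fin by (auto simp: \<M>_def)
  have "\<exists>Y\<in>\<M>. X \<subseteq> Y" if "X \<in> \<Q>" for X
    using finite_has_maximal2[OF fin that] by (auto simp: \<M>_def)
  then have U: "\<Union>\<Q> = (\<Union>X\<in>\<M>. X)" using \<M>(1) by blast
  have disj: "X \<inter> Y = {}" if "X \<in> \<M>" "Y \<in> \<M>" "X \<noteq> Y" for X Y
    using lam[of X Y] that by (auto simp: \<M>_def)
  have pt: "(\<Sum>X\<in>\<M>. h x * indicator X x) \<le> h x" for x
  proof (cases "\<exists>X\<in>\<M>. x \<in> X")
    case True
    then obtain X where X: "X \<in> \<M>" "x \<in> X" by blast
    have "(\<Sum>Y\<in>\<M>. h x * indicator Y x) = (\<Sum>Y\<in>{X}. h x * indicator Y x)"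
      using X disj by (intro sum.mono_neutral_right \<M>) (auto simp: indicator_def)
    then show ?thesis using X by simp
  next
    case False
    then have "(\<Sum>X\<in>\<M>. h x * indicator X x) = 0" by (intro sum.neutral) auto
    then show ?thesis by simp
  qed
  have "emeasure M (\<Union>\<Q>) \<le> (\<Sum>X\<in>\<M>. emeasure M X)"
    unfolding U using \<M> sets by (intro emeasure_subadditive_finite) auto
  also have "\<dots> \<le> (\<Sum>X\<in>\<M>. c * (\<integral>\<^sup>+x. h x * indicator X x \<partial>M))" using \<M>(1) by (intro sum_mono b) auto
  also have "\<dots> = c * (\<integral>\<^sup>+x. (\<Sum>X\<in>\<M>. h x * indicator X x) \<partial>M)"
    using \<M>(1) sets h by (subst nn_integral_sum) (auto simp: sum_distrib_left)
  also have "\<dots> \<le> c * (\<integral>\<^sup>+x. h x \<partial>M)" by (intro mult_left_mono nn_integral_mono pt) auto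
  finally show ?thesis .
qed

lemma le_one_plus_powr:
  fixes y s :: real
  assumes "0 \<le> y" "1 \<le> s"
  shows "y \<le> 1 + y powr s"
proof (cases "y \<le> 1")
  case False
  then have "y powr 1 \<le> y powr s" using assms by (intro powr_mono) auto
  then show ?thesis using False by simp
qed (simp add: add_increasing2)

text \<open>A weak-type bound on one set: at most half of an average above T comes from values of g
  below T/2, and the rest is absorbed by the s-th power.\<close>

lemma emeasure_le_of_large_average:
  assumes Q: "Q \<in> sets M" "emeasure M Q < \<infinity>" and g: "g \<in> borel_measurable M" "\<And>x. 0 \<le> g x"
    and s: "1 \<le> s" and T: "0 < T" "T < \<gamma>"
    and avg: "ennreal \<gamma> * emeasure M Q \<le> (\<integral>\<^sup>+x. ennreal (g x) * indicator Q x \<partial>M)"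
  shows "emeasure M Q \<le> ennreal ((2 / T) powr s) * (\<integral>\<^sup>+x. ennreal (g x powr s) * indicator Q x \<partial>M)"
proof -
  let ?c = "(2 / T) powr s" and ?H = "\<integral>\<^sup>+x. ennreal (g x powr s) * indicator Q x \<partial>M"
  obtain v where v: "emeasure M Q = ennreal v" "0 \<le> v" using Q(2) by (cases "emeasure M Q") auto
  \<comment> \<open>The inequality y \<le> 1 + y^s at y = 2 g / T, multiplied by T/2.\<close>
  have pt: "g x \<le> T / 2 + T / 2 * (?c * g x powr s)" for x
  proof -
    have "2 / T * g x \<le> 1 + (2 / T * g x) powr s" using T g by (intro le_one_plus_powr s) auto
    then have "T / 2 * (2 / T * g x) \<le> T / 2 * (1 + (2 / T * g x) powr s)" using T by (intro mult_left_mono) auto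
    moreover have "(2 / T * g x) powr s = ?c * g x powr s" using T g by (simp add: powr_mult del: times_divide_eq_left)
    moreover have "T / 2 * (2 / T * g x) = g x" using T by simp
    ultimately show ?thesis by (simp only: distrib_left mult_1_right)
  qed
  show ?thesis
  proof (cases ?H)
    case top
    have "0 < ?c" using T by simp
    then show ?thesis using top by (simp add: ennreal_mult_top)
  next
    case (real \<eta>)
    have "ennreal T * ennreal v \<le> ennreal \<gamma> * emeasure M Q" unfolding v using T by (intro mult_right_mono ennreal_leI) auto
    also note avg
    also have "(\<integral>\<^sup>+x. ennreal (g x) * indicator Q x \<partial>M)
        \<le> (\<integral>\<^sup>+x. ennreal (T / 2) * indicator Q x + ennreal (T / 2 * ?c) * (ennreal (g x powr s) * indicator Q x) \<partial>M)"
    proof (rule nn_integral_mono)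
      fix x show "ennreal (g x) * indicator Q x \<le> ennreal (T / 2) * indicator Q x + ennreal (T / 2 * ?c) * (ennreal (g x powr s) * indicator Q x)"
        using ennreal_leI[OF pt[of x]] T by (auto simp: indicator_def ennreal_mult[symmetric] mult.assoc)
    qed
    also have "\<dots> = ennreal (T / 2) * ennreal v + ennreal (T / 2 * ?c) * ennreal \<eta>"
      using g Q by (subst nn_integral_add) (auto simp: nn_integral_cmult nn_integral_cmult_indicator v real)
    finally have "T * v \<le> T / 2 * v + T / 2 * ?c * \<eta>"
      using T v real by (simp add: ennreal_mult[symmetric] ennreal_plus[symmetric] del: ennreal_plus)
    then have "T / 2 * v \<le> T / 2 * (?c * \<eta>)" by (simp add: algebra_simps)
    then have "v \<le> ?c * \<eta>" using T by (subst (asm) mult_le_cancel_left_pos) auto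
    then show ?thesis unfolding v real using real by (simp add: ennreal_mult[symmetric] ennreal_leI)
  qed
qed

lemma powr_le_dyadic_sum:
  fixes \<gamma> p :: real
  assumes \<gamma>: "0 \<le> \<gamma>" "\<gamma> < 2 ^ M" and p: "0 < p"
  shows "\<gamma> powr p \<le> 1 + (\<Sum>n<M. 2 powr (real (Suc n) * p) * of_bool (2 ^ n < \<gamma>))"
proof (cases "\<gamma> \<le> 1")
  case True
  then have "\<gamma> powr p \<le> 1" using powr_mono2[of p \<gamma> 1] \<gamma>(1) p by simp
  moreover have "0 \<le> (\<Sum>n<M. 2 powr (real (Suc n) * p) * of_bool (2 ^ n < \<gamma>))" by (intro sum_nonneg) auto
  ultimately show ?thesis by linarith
next
  case False
  define k where "k = (LEAST k. \<gamma> \<le> 2 ^ k)"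
  have k: "\<gamma> \<le> 2 ^ k" unfolding k_def by (rule LeastI[of _ M]) (use \<gamma> in simp)
  have kM: "k \<le> M" unfolding k_def by (rule Least_le) (use \<gamma> in simp)
  obtain n where n: "k = Suc n" using k False by (cases k) auto
  have "\<not> \<gamma> \<le> 2 ^ n" using not_less_Least[of n "\<lambda>k. \<gamma> \<le> 2 ^ k"] n k_def by auto
  have "\<gamma> powr p \<le> (2 ^ Suc n) powr p" using k n \<gamma> p by (intro powr_mono2) auto
  also have "\<dots> = 2 powr (real (Suc n) * p)" by (simp add: powr_realpow[symmetric] powr_powr del: power_Suc)
  also have "\<dots> = 2 powr (real (Suc n) * p) * of_bool (2 ^ n < \<gamma>)" using \<open>\<not> \<gamma> \<le> 2 ^ n\<close> by simp
  also have "\<dots> \<le> (\<Sum>n<M. 2 powr (real (Suc n) * p) * of_bool (2 ^ n < \<gamma>))"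
    using n kM by (intro member_le_sum) auto
  finally show ?thesis by simp
qed

text \<open>A Carleson embedding. For each dyadic level the sets with average above 2^n have union
  of measure at most (2 / 2^n)^s times the integral of g^s; layer-cake summation converges because p
  < s. The indices with average at most 1 contribute just the measure of the union of the
  E_t.\<close>

lemma laminar_averages_bound:
  assumes fin: "finite I" and Q: "\<And>t. t \<in> I \<Longrightarrow> Q t \<in> sets M \<and> emeasure M (Q t) < \<infinity> \<and> E t \<in> sets M \<and> E t \<subseteq> Q t"
    and disj: "\<And>t u. t \<in> I \<Longrightarrow> u \<in> I \<Longrightarrow> t \<noteq> u \<Longrightarrow> E t \<inter> E u = {}"
    and lam: "\<And>t u. t \<in> I \<Longrightarrow> u \<in> I \<Longrightarrow> Q t \<subseteq> Q u \<or> Q u \<subseteq> Q t \<or> Q t \<inter> Q u = {}"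
    and g: "g \<in> borel_measurable M" "\<And>x. 0 \<le> g x" and s: "1 \<le> s" and p: "0 < p" "p < s"
    and avg: "\<And>t. t \<in> I \<Longrightarrow> 0 \<le> \<gamma> t \<and> ennreal (\<gamma> t) * emeasure M (Q t) \<le> (\<integral>\<^sup>+x. ennreal (g x) * indicator (Q t) x \<partial>M)"
  shows "(\<Sum>t\<in>I. ennreal (\<gamma> t powr p) * emeasure M (E t)) \<le>
    emeasure M (\<Union>t\<in>I. E t) + ennreal (2 powr (p + s) / (1 - 2 powr (p - s))) * (\<integral>\<^sup>+x. ennreal (g x powr s) \<partial>M)"
proof -
  let ?H = "\<integral>\<^sup>+x. ennreal (g x powr s) \<partial>M"
  have union: "(\<Sum>t\<in>S. emeasure M (E t)) = emeasure M (\<Union>t\<in>S. E t)" if "S \<subseteq> I" for S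
  proof (rule sum_emeasure)
    show "disjoint_family_on E S" unfolding disjoint_family_on_def using disj that by (meson subsetD)
  qed (use that Q finite_subset[OF that fin] in auto)
  have level: "(\<Sum>t\<in>{t\<in>I. 2 ^ n < \<gamma> t}. emeasure M (E t)) \<le> ennreal ((2 / 2 ^ n) powr s) * ?H" for n
  proof -
    let ?S = "{t\<in>I. 2 ^ n < \<gamma> t}"
    have "(\<Sum>t\<in>?S. emeasure M (E t)) \<le> emeasure M (\<Union>(Q ` ?S))"
      unfolding union[of ?S, simplified] using Q fin by (intro emeasure_mono) (auto intro!: sets.finite_UN)
    also have "\<dots> \<le> ennreal ((2 / 2 ^ n) powr s) * ?H"
    proof (rule emeasure_laminar_Union_le)
      fix X assume "X \<in> Q ` ?S"
      then obtain t where t: "t \<in> I" "2 ^ n < \<gamma> t" "X = Q t" by blast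
      show "emeasure M X \<le> ennreal ((2 / 2 ^ n) powr s) * (\<integral>\<^sup>+x. ennreal (g x powr s) * indicator X x \<partial>M)"
        unfolding t(3) by (rule emeasure_le_of_large_average[OF _ _ g s _ t(2)]) (use Q[OF t(1)] avg[OF t(1)] in auto)
    next
      fix X Y assume "X \<in> Q ` ?S" "Y \<in> Q ` ?S"
      then obtain t u where "t \<in> I" "u \<in> I" "X = Q t" "Y = Q u" by blast
      then show "X \<subseteq> Y \<or> Y \<subseteq> X \<or> X \<inter> Y = {}" using lam[of t u] by simp
    qed (use fin Q g(1) in auto)
    finally show ?thesis .
  qed
  obtain m where m: "(\<Sum>t\<in>I. \<gamma> t) < 2 ^ m" using real_arch_pow[of 2 "\<Sum>t\<in>I. \<gamma> t"] by auto
  have \<gamma>m: "\<gamma> t < 2 ^ m" if "t \<in> I" for t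
    using member_le_sum[of t I \<gamma>] that avg fin m by fastforce
  let ?c = "\<lambda>n. 2 powr (real (Suc n) * p)"
  define \<rho> where "\<rho> = (2::real) powr (p - s)"
  have \<rho>: "0 < \<rho>" "\<rho> < 1" using p by (auto simp: \<rho>_def powr_less_one)
  have cn: "?c n * (2 / 2 ^ n) powr s = 2 powr (p + s) * \<rho> ^ n" for n
    unfolding \<rho>_def by (simp add: powr_divide powr_realpow[symmetric] powr_powr powr_add[symmetric] powr_diff[symmetric] algebra_simps)
  have "(\<Sum>t\<in>I. ennreal (\<gamma> t powr p) * emeasure M (E t))
      \<le> (\<Sum>t\<in>I. (1 + (\<Sum>n<m. ennreal (?c n) * of_bool (2 ^ n < \<gamma> t))) * emeasure M (E t))"
  proof (intro sum_mono mult_right_mono)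
    fix t assume t: "t \<in> I"
    have "ennreal (\<gamma> t powr p) \<le> ennreal (1 + (\<Sum>n<m. ?c n * of_bool (2 ^ n < \<gamma> t)))"
      using avg[OF t] \<gamma>m[OF t] p(1) by (intro ennreal_leI powr_le_dyadic_sum) auto
    also have "\<dots> = 1 + (\<Sum>n<m. ennreal (?c n * of_bool (2 ^ n < \<gamma> t)))"
      by (subst ennreal_plus) (auto intro!: sum_nonneg simp: sum_ennreal)
    also have "\<dots> = 1 + (\<Sum>n<m. ennreal (?c n) * of_bool (2 ^ n < \<gamma> t))"
      by (intro arg_cong2[of _ _ _ _ "(+)"] sum.cong) auto
    finally show "ennreal (\<gamma> t powr p) \<le> 1 + (\<Sum>n<m. ennreal (?c n) * of_bool (2 ^ n < \<gamma> t))" .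
  qed simp
  also have "\<dots> = (\<Sum>t\<in>I. emeasure M (E t)) + (\<Sum>t\<in>I. \<Sum>n<m. ennreal (?c n) * (of_bool (2 ^ n < \<gamma> t) * emeasure M (E t)))"
    by (simp only: distrib_right mult_1_left sum.distrib sum_distrib_right mult.assoc)
  also have "(\<Sum>t\<in>I. \<Sum>n<m. ennreal (?c n) * (of_bool (2 ^ n < \<gamma> t) * emeasure M (E t)))
      = (\<Sum>n<m. ennreal (?c n) * (\<Sum>t\<in>{t\<in>I. 2 ^ n < \<gamma> t}. emeasure M (E t)))"
  proof (subst sum.swap, intro sum.cong refl)
    fix n
    have "(\<Sum>t\<in>I. of_bool (2 ^ n < \<gamma> t) * emeasure M (E t)) = (\<Sum>t\<in>{t\<in>I. 2 ^ n < \<gamma> t}. emeasure M (E t))"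
      using fin by (simp add: sum.inter_filter of_bool_def if_distrib[of "\<lambda>x. x * _"] cong: if_cong)
    then show "(\<Sum>t\<in>I. ennreal (?c n) * (of_bool (2 ^ n < \<gamma> t) * emeasure M (E t))) = ennreal (?c n) * (\<Sum>t\<in>{t\<in>I. 2 ^ n < \<gamma> t}. emeasure M (E t))"
      by (simp add: sum_distrib_left[symmetric])
  qed
  also have "\<dots> \<le> (\<Sum>n<m. ennreal (?c n) * (ennreal ((2 / 2 ^ n) powr s) * ?H))"
    by (intro sum_mono mult_left_mono level) auto
  also have "\<dots> = (\<Sum>n<m. ennreal (2 powr (p + s) * \<rho> ^ n)) * ?H"
    by (simp only: mult.assoc[symmetric] ennreal_mult[symmetric] powr_ge_zero cn sum_distrib_right)
  also have "(\<Sum>n<m. ennreal (2 powr (p + s) * \<rho> ^ n)) = ennreal (2 powr (p + s) * (\<Sum>n<m. \<rho> ^ n))"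
    using \<rho> by (simp add: sum_distrib_left)
  also have "\<dots> \<le> ennreal (2 powr (p + s) * (1 / (1 - \<rho>)))"
    using sum_le_suminf[of "\<lambda>n. \<rho> ^ n" "{..<m}"] \<rho>
    by (intro ennreal_leI mult_left_mono) (auto simp: suminf_geometric summable_geometric)
  also have "(\<Sum>t\<in>I. emeasure M (E t)) = emeasure M (\<Union>t\<in>I. E t)" by (rule union) simp
  finally show ?thesis unfolding \<rho>_def by (simp add: add_left_mono mult_right_mono)
qed

lemma (in aniso) integrable_bounded_support:
  fixes h :: "real^'n \<Rightarrow> real"
  assumes "h \<in> borel_measurable lebesgue" "\<And>x. \<bar>h x\<bar> \<le> c" "\<And>x. x \<notin> bl z k \<Longrightarrow> h x = 0"
  shows "integrable lebesgue h"
proof (rule integrableI_bounded_set[of "bl z k"])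
  show "emeasure lebesgue (bl z k) < \<infinity>" by (simp add: emeasure_bl)
qed (use assms in \<open>auto intro!: AE_I2\<close>)

context bqbf begin

text \<open>What remains of a sparse family after pairing: the disjoint sets E_t filling a fixed
  proportion of their balls, and coefficients \<gamma>_t with the Carleson-type bound in the power
  p. The cubes themselves are no longer recorded.\<close>

definition sparse_weights where
  "sparse_weights p K z l I cen sc E \<gamma> \<longleftrightarrow> finite I \<and>
     (\<forall>t\<in>I. 0 \<le> \<gamma> t \<and> E t \<in> sets lebesgue \<and> E t \<subseteq> bl (cen t) (sc t) \<and> E t \<subseteq> bl z (l + int ga) \<and>
        bdet A powr real_of_int (sc t) \<le> 2 * bdet A ^ ga * measure lebesgue (E t)) \<and>
     (\<forall>t\<in>I. \<forall>u\<in>I. t \<noteq> u \<longrightarrow> E t \<inter> E u = {}) \<and>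
     (\<Sum>t\<in>I. ennreal (\<gamma> t powr p) * emeasure lebesgue (E t)) \<le> ennreal (K * bdet A powr real_of_int l)"

lemma Csd_nonneg: "0 \<le> Csd"
  unfolding Csd_def using Cp1 b_gt1 lp1 by (intro add_nonneg_nonneg mult_nonneg_nonneg) auto

text \<open>The L^q average is linearized by the extremal function of Hoelder's inequality, and
  sparse domination is inserted into the pairing. The coefficients are the averages of that function
  over the cubes.\<close>

lemma sparse_pairing:
  assumes f: "locint f" and q: "1 < q" and p: "0 < p" "p < q / (q - 1)" and e: "0 < \<epsilon>"
    and v: "v \<in> borel_measurable lebesgue" "\<And>x. 0 \<le> v x" "\<And>x. v x \<le> c" "\<And>x. x \<notin> bl z l \<Longrightarrow> v x = 0"
      "\<And>x. x \<in> bl z l \<Longrightarrow> v x \<le> \<bar>f x - proj z l f x\<bar>"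
  shows "\<exists>(I :: (nat \<times> (real^'n)) set) cen sc E \<gamma>.
     sparse_weights p (bdet A ^ ga + 2 powr (p + q / (q - 1)) / (1 - 2 powr (p - q / (q - 1)))) z l I cen sc E \<gamma> \<and>
     bdet A powr real_of_int l * ((LINT x|lebesgue. v x powr q) / bdet A powr real_of_int l) powr (1 / q)
       \<le> Csd * (\<Sum>t\<in>I. osc f (cen t) (sc t) * \<gamma> t * bdet A powr real_of_int (sc t)) + \<epsilon>"
proof -
  let ?b = "bdet A"
  define s where "s = q / (q - 1)"
  have s: "1 \<le> s" "0 < s" "(q - 1) * s = q" "1 - 1 / s = 1 / q" using q by (auto simp: s_def field_simps)
  define V where "V = ?b powr real_of_int l"
  have V: "0 < V" using b_gt1 by (simp add: V_def)
  let ?K = "?b ^ ga + 2 powr (p + s) / (1 - 2 powr (p - s))"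
  have K0: "0 \<le> 2 powr (p + s) / (1 - 2 powr (p - s))" using p by (intro divide_nonneg_nonneg) (auto simp: s_def intro!: less_imp_le[OF powr_less_one])
  have K: "0 \<le> ?K" using K0 b_gt1 by (intro add_nonneg_nonneg) auto
  define a where "a = (LINT x|lebesgue. v x powr q) / V"
  have a0: "0 \<le> a" unfolding a_def using V by (intro divide_nonneg_pos integral_nonneg_AE) auto
  have c0: "0 \<le> c" using v(2,3) order_trans by blast
  show ?thesis
  proof (cases "a = 0")
    case True
    have "sparse_weights p ?K z l ({} :: (nat \<times> (real^'n)) set) cen sc E \<gamma>" for cen sc E \<gamma>
      unfolding sparse_weights_def using K by simp
    then show ?thesis unfolding s_def[symmetric] V_def[symmetric] a_def[symmetric] True
      using e by (intro exI[of _ "{}"] exI conjI) auto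
  next
    case False
    then have a: "0 < a" using a0 by simp
    have LI: "(LINT x|lebesgue. v x powr q) = a * V" using V by (simp add: a_def)
    have vq: "integrable lebesgue (\<lambda>x. v x powr q)"
      using v q c0 by (intro integrable_bounded_support[of _ "c powr q" z l]) (auto intro!: powr_mono2)
    \<comment> \<open>The dual extremizer, normalized so that the integral of g^s is V and the
      pairing with v equals V a^(1/q).\<close>
    define g where "g x = v x powr (q - 1) / a powr (1 / s)" for x
    define m where "m = c powr (q - 1) / a powr (1 / s)"
    have g0: "0 \<le> g x" for x by (simp add: g_def)
    have gm: "g x \<le> m" for x unfolding g_def m_def using v q by (intro divide_right_mono powr_mono2) auto
    have m0: "0 \<le> m" by (simp add: m_def)
    have gM: "g \<in> borel_measurable lebesgue" unfolding g_def[abs_def] using v(1) by auto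
    have gB: "g x = 0" if "x \<notin> bl z l" for x using v(4)[OF that] by (simp add: g_def)
    have gs: "g x powr s = v x powr q / a" for x
      unfolding g_def using s a by (simp add: powr_divide powr_powr)
    have gnn: "(\<integral>\<^sup>+x. ennreal (g x powr s) \<partial>lebesgue) = ennreal V"
    proof -
      have "(\<integral>\<^sup>+x. ennreal (g x powr s) \<partial>lebesgue) = ennreal (LINT x|lebesgue. v x powr q / a)"
        unfolding gs using vq a by (intro nn_integral_eq_integral) auto
      also have "(LINT x|lebesgue. v x powr q / a) = V" using a LI by simp
      finally show ?thesis .
    qed
    \<comment> \<open>Since g \<le> m, this budget makes the paired error at most \<epsilon>.
      Boundedness of g is the reason for working with truncations v.\<close>
    have "0 < \<epsilon> / (m + 1)" using e m0 by simp
    from sparse_domination[OF f this, of z l] obtain I :: "(nat \<times> (real^'n)) set" and cen sc Q E er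
      where sf: "sparse_family z l f (\<epsilon> / (m + 1)) I cen sc Q E er" .
    note fin = sf[unfolded sparse_family_def, THEN conjunct1]
      and I = sf[unfolded sparse_family_def, THEN conjunct2, THEN conjunct1, rule_format]
      and disj = sf[unfolded sparse_family_def, THEN conjunct2, THEN conjunct2, THEN conjunct1, rule_format]
      and lam = sf[unfolded sparse_family_def, THEN conjunct2, THEN conjunct2, THEN conjunct2, THEN conjunct1, rule_format]
      and er = sf[unfolded sparse_family_def, THEN conjunct2, THEN conjunct2, THEN conjunct2, THEN conjunct2, THEN conjunct1] sf[unfolded sparse_family_def, THEN conjunct2, THEN conjunct2, THEN conjunct2, THEN conjunct2, THEN conjunct2, THEN conjunct1, rule_format] sf[unfolded sparse_family_def, THEN conjunct2, THEN conjunct2, THEN conjunct2, THEN conjunct2, THEN conjunct2, THEN conjunct2, THEN conjunct1]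
      and dom = sf[unfolded sparse_family_def, THEN conjunct2, THEN conjunct2, THEN conjunct2, THEN conjunct2, THEN conjunct2, THEN conjunct2, THEN conjunct2, rule_format]
    have Qm: "Q t \<in> lmeasurable" if "t \<in> I" for t
      using I[OF that] by (intro bounded_set_imp_lmeasurable bounded_subset[OF bl_bounded, of "Q t"]) auto
    have Qpos: "0 < measure lebesgue (Q t)" if "t \<in> I" for t
    proof -
      have "0 < ?b powr real_of_int (sc t)" using b_gt1 by simp
      then have "0 < 2 * ?b ^ ga * measure lebesgue (E t)" using I[OF that] by linarith
      then have "0 < measure lebesgue (E t)" using b_gt1 by (simp add: zero_less_mult_iff)
      also have "\<dots> \<le> measure lebesgue (Q t)" using I[OF that] Qm[OF that] by (intro measure_mono_fmeasurable) auto
      finally show ?thesis .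
    qed
    have Qle: "measure lebesgue (Q t) \<le> ?b powr real_of_int (sc t)" if "t \<in> I" for t
      unfolding measure_bl[of "cen t", symmetric] using I[OF that] bl_lmeas by (intro measure_mono_fmeasurable) auto
    have gQ: "integrable lebesgue (\<lambda>x. g x * indicator (Q t) x)" if "t \<in> I" for t
      using gM g0 gm gB m0 I[OF that]
      by (intro integrable_bounded_support[of _ m z l] borel_measurable_times borel_measurable_indicator) (auto simp: indicator_def)
    define \<gamma> where "\<gamma> t = (LINT x|lebesgue. g x * indicator (Q t) x) / measure lebesgue (Q t)" for t
    have \<gamma>0: "0 \<le> \<gamma> t" for t unfolding \<gamma>_def using g0 by (intro divide_nonneg_nonneg integral_nonneg_AE) auto
    have \<gamma>Q: "(LINT x|lebesgue. g x * indicator (Q t) x) = \<gamma> t * measure lebesgue (Q t)" if "t \<in> I" for t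
      using Qpos[OF that] by (simp add: \<gamma>_def)
    have "(\<Sum>t\<in>I. ennreal (\<gamma> t powr p) * emeasure lebesgue (E t)) \<le>
      emeasure lebesgue (\<Union>t\<in>I. E t) + ennreal (2 powr (p + s) / (1 - 2 powr (p - s))) * (\<integral>\<^sup>+x. ennreal (g x powr s) \<partial>lebesgue)"
    proof (rule laminar_averages_bound[OF fin _ disj lam gM g0 s(1) p(1)])
      fix t assume t: "t \<in> I"
      show "Q t \<in> sets lebesgue \<and> emeasure lebesgue (Q t) < \<infinity> \<and> E t \<in> sets lebesgue \<and> E t \<subseteq> Q t"
        using I[OF t] fmeasurableD2[OF Qm[OF t]] by (simp add: less_top)
      have "ennreal (\<gamma> t) * emeasure lebesgue (Q t) = ennreal (\<gamma> t * measure lebesgue (Q t))"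
        using Qm[OF t] \<gamma>0 by (simp add: emeasure_eq_measure2 ennreal_mult)
      also have "\<dots> = (\<integral>\<^sup>+x. ennreal (g x * indicator (Q t) x) \<partial>lebesgue)"
        unfolding \<gamma>Q[OF t, symmetric] using gQ[OF t] g0 by (intro nn_integral_eq_integral[symmetric]) auto
      also have "\<dots> = (\<integral>\<^sup>+x. ennreal (g x) * indicator (Q t) x \<partial>lebesgue)"
        by (intro nn_integral_cong) (auto simp: indicator_def)
      finally show "0 \<le> \<gamma> t \<and> ennreal (\<gamma> t) * emeasure lebesgue (Q t) \<le> (\<integral>\<^sup>+x. ennreal (g x) * indicator (Q t) x \<partial>lebesgue)"
        using \<gamma>0 by simp
    qed (use p(2) s_def in auto)
    also have "\<dots> \<le> emeasure lebesgue (bl z (l + int ga)) + ennreal (2 powr (p + s) / (1 - 2 powr (p - s))) * ennreal V"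
      unfolding gnn using I by (intro add_right_mono emeasure_mono) auto
    also have "\<dots> = ennreal (?K * V)"
    proof -
      have "emeasure lebesgue (bl z (l + int ga)) = ennreal (V * ?b ^ ga)"
        unfolding emeasure_bl bb(1) bb(5) V_def ..
      moreover have "ennreal (2 powr (p + s) / (1 - 2 powr (p - s))) * ennreal V = ennreal (2 powr (p + s) / (1 - 2 powr (p - s)) * V)"
        using K0 V by (intro ennreal_mult[symmetric]) auto
      moreover have "ennreal (V * ?b ^ ga) + ennreal (2 powr (p + s) / (1 - 2 powr (p - s)) * V) = ennreal (V * ?b ^ ga + 2 powr (p + s) / (1 - 2 powr (p - s)) * V)"
        using V b_gt1 mult_nonneg_nonneg[OF K0, of V] by (intro ennreal_plus[symmetric]) auto
      ultimately show ?thesis by (simp only: distrib_right mult.commute[of V])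
    qed
    finally have sw: "sparse_weights p ?K z l I cen sc E \<gamma>"
      unfolding sparse_weights_def V_def
    proof (intro conjI ballI impI fin disj)
      fix t assume t: "t \<in> I"
      show "E t \<subseteq> bl (cen t) (sc t)" "E t \<subseteq> bl z (l + int ga)" using I[OF t] by blast+
    qed (use I \<gamma>0 in simp_all)
    have "V * a powr (1 / q) = (LINT x|lebesgue. v x * g x)"
    proof -
      have "v x * g x = v x powr q / a powr (1 / s)" for x
        unfolding g_def using v(2)[of x] powr_mult_base[of "v x" "q - 1"] by simp
      then have "(LINT x|lebesgue. v x * g x) = V * a / a powr (1 / s)" using LI by simp
      also have "\<dots> = V * a powr (1 / q)" using a unfolding s(4)[symmetric] by (simp add: powr_diff)
      finally show ?thesis ..
    qed
    also have "\<dots> \<le> (LINT x|lebesgue. Csd * (\<Sum>t\<in>I. osc f (cen t) (sc t) * (g x * indicator (Q t) x)) + m * er x)"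
    proof (rule integral_mono)
      show "integrable lebesgue (\<lambda>x. v x * g x)"
        using v gM g0 gm c0 m0 gB by (intro integrable_bounded_support[of _ "c * m" z l]) (auto simp: abs_mult intro!: mult_mono)
      show "integrable lebesgue (\<lambda>x. Csd * (\<Sum>t\<in>I. osc f (cen t) (sc t) * (g x * indicator (Q t) x)) + m * er x)"
        using gQ er(1) by (intro Bochner_Integration.integrable_add Bochner_Integration.integrable_sum integrable_mult_right) auto
      fix x
      show "v x * g x \<le> Csd * (\<Sum>t\<in>I. osc f (cen t) (sc t) * (g x * indicator (Q t) x)) + m * er x"
      proof (cases "x \<in> bl z l")
        case True
        have "v x * g x \<le> (Csd * (\<Sum>t\<in>I. osc f (cen t) (sc t) * indicator (Q t) x) + er x) * g x"
          using v(5)[OF True] dom[OF True] g0 by (intro mult_right_mono) auto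
        also have "\<dots> = Csd * (\<Sum>t\<in>I. osc f (cen t) (sc t) * (g x * indicator (Q t) x)) + g x * er x"
          by (simp add: distrib_left sum_distrib_left mult_ac)
        also have "\<dots> \<le> Csd * (\<Sum>t\<in>I. osc f (cen t) (sc t) * (g x * indicator (Q t) x)) + m * er x"
          using gm er(2) by (intro add_left_mono mult_right_mono) auto
        finally show ?thesis .
      next
        case False
        then show ?thesis using gB[OF False] m0 er(2) by simp
      qed
    qed
    also have "\<dots> = Csd * (\<Sum>t\<in>I. osc f (cen t) (sc t) * (\<gamma> t * measure lebesgue (Q t))) + m * (LINT x|lebesgue. er x)"
      using gQ er(1) \<gamma>Q by (subst Bochner_Integration.integral_add) (auto simp: Bochner_Integration.integral_sum)
    also have "\<dots> \<le> Csd * (\<Sum>t\<in>I. osc f (cen t) (sc t) * \<gamma> t * ?b powr real_of_int (sc t)) + \<epsilon>"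
    proof (intro add_mono mult_left_mono sum_mono)
      show "0 \<le> Csd" by (rule Csd_nonneg)
      fix t assume t: "t \<in> I"
      show "osc f (cen t) (sc t) * (\<gamma> t * measure lebesgue (Q t)) \<le> osc f (cen t) (sc t) * \<gamma> t * ?b powr real_of_int (sc t)"
        unfolding mult.assoc using Qle[OF t] \<gamma>0 osc_nonneg by (intro mult_left_mono) auto
    next
      have "m * (LINT x|lebesgue. er x) \<le> m * (\<epsilon> / (m + 1))" using er(3) m0 by (intro mult_left_mono) auto
      also have "\<dots> \<le> \<epsilon>" using m0 e by (simp add: field_simps)
      finally show "m * (LINT x|lebesgue. er x) \<le> \<epsilon>" .
    qed
    finally show ?thesis using sw unfolding s_def V_def a_def by blast
  qed
qed

end


section \<open>Self-improvement from exponent one to exponent q\<close>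

context bqbf begin

text \<open>\<open>sparse_pairing\<close> is applied on each ball of the family, and the union of
  all the sparse families is tested in \<open>campanato_sum\<close>. \<open>FS_step\<close> passes
  from the sparse balls to the sets E, and \<open>dual_step\<close> from there to the original
  balls.\<close>

lemma truncated_family_bound:
  assumes q: "1 < q" "p0 < q / (q - 1)"
  shows "\<exists>C\<ge>0. \<forall>(f :: real^'n \<Rightarrow> real) (J :: nat set) (w :: nat \<Rightarrow> real) (z :: nat \<Rightarrow> real^'n) (l :: nat \<Rightarrow> int) (v :: nat \<Rightarrow> real^'n \<Rightarrow> real) (c :: real).
     locint f \<longrightarrow> finite J \<longrightarrow> (\<forall>j\<in>J. 0 \<le> w j \<and> v j \<in> borel_measurable lebesgue \<and> (\<forall>x. 0 \<le> v j x \<and> v j x \<le> c) \<and> (\<forall>x. x \<notin> bl (z j) (l j) \<longrightarrow> v j x = 0) \<and>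
        (\<forall>x\<in>bl (z j) (l j). v j x \<le> \<bar>f x - proj (z j) (l j) f x\<bar>)) \<longrightarrow>
     (\<Sum>j\<in>J. ennreal (w j * (bdet A powr real_of_int (l j) * ((LINT x|lebesgue. v j x powr q) / bdet A powr real_of_int (l j)) powr (1 / q))))
       \<le> ennreal C * (campanato A D N 1 d th f * F_norm (step J (\<lambda>j. w j powr th) (\<lambda>j. bl (z j) (l j))))"
proof -
  let ?b = "bdet A"
  define K where "K = ?b ^ ga + 2 powr (p0 + q / (q - 1)) / (1 - 2 powr (p0 - q / (q - 1)))"
  have p0: "0 < p0" using th by simp
  have "0 \<le> 2 powr (p0 + q / (q - 1)) / (1 - 2 powr (p0 - q / (q - 1)))"
    using q by (intro divide_nonneg_nonneg) (auto intro!: less_imp_le[OF powr_less_one])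
  then have K0: "0 \<le> K" unfolding K_def using b_gt1 by (intro add_nonneg_nonneg) auto
  obtain CF where CF: "0 \<le> CF"
    and CFall: "\<forall>I a \<kappa> E H. finite (I :: (nat \<times> (nat \<times> (real^'n))) set) \<longrightarrow> (\<forall>i\<in>I. 0 \<le> a i \<and> 0 \<le> \<kappa> i \<and> E i \<in> sets lebesgue \<and> H i \<in> sets lebesgue \<and>
      (\<forall>x\<in>H i. ennreal (\<kappa> i) \<le> maxf A D (indicator (E i)) x)) \<longrightarrow>
      F_norm (step I (\<lambda>i. a i * (\<kappa> i)\<^sup>2) H) \<le> ennreal CF * F_norm (step I a E)"
    using FS_step[where 'i = "nat \<times> (nat \<times> (real^'n))"] by (elim exE conjE)
  obtain CD where CD: "0 \<le> CD"
    and CDall: "\<forall>(J :: nat set) (a :: nat \<Rightarrow> real) (z :: nat \<Rightarrow> real^'n) (l :: nat \<Rightarrow> int) (\<psi> :: nat \<Rightarrow> real^'n \<Rightarrow> real). finite J \<longrightarrow>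
      (\<forall>j\<in>J. 0 \<le> a j \<and> \<psi> j \<in> borel_measurable lebesgue \<and> (\<forall>x. 0 \<le> \<psi> j x) \<and> (\<forall>x. x \<notin> bl (z j) (l j + int ga) \<longrightarrow> \<psi> j x = 0) \<and>
         (\<integral>\<^sup>+x. ennreal (\<psi> j x powr (p0 / th)) \<partial>lebesgue) \<le> ennreal (K * bdet A powr real_of_int (l j))) \<longrightarrow>
      F_norm (\<lambda>x. \<Sum>j\<in>J. a j * \<psi> j x) \<le> ennreal CD * F_norm (step J a (\<lambda>j. bl (z j) (l j)))"
    using dual_step[OF K0] by (elim exE conjE)
  \<comment> \<open>A lower bound for the proportion of each ball occupied by its set E, hence for
    the maximal function of that set on the ball.\<close>
  define \<kappa> where "\<kappa> = 1 / (2 * ?b ^ ga)"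
  have \<kappa>: "0 < \<kappa>" using b_gt1 by (simp add: \<kappa>_def)
  define R where "R = (1 / \<kappa>\<^sup>2) powr (1 / th)"
  define C where "C = Csd * (CF * (CD * R))"
  have C0: "0 \<le> C" unfolding C_def R_def using Csd_nonneg CF CD by simp
  show ?thesis
  proof (intro exI[of _ C] conjI C0 allI impI)
    fix f :: "real^'n \<Rightarrow> real" and J :: "nat set" and w :: "nat \<Rightarrow> real" and z :: "nat \<Rightarrow> real^'n" and l :: "nat \<Rightarrow> int"
      and v :: "nat \<Rightarrow> real^'n \<Rightarrow> real" and c :: real
    assume f: "locint f" and fin: "finite J"
      and vv: "\<forall>j\<in>J. 0 \<le> w j \<and> v j \<in> borel_measurable lebesgue \<and> (\<forall>x. 0 \<le> v j x \<and> v j x \<le> c) \<and> (\<forall>x. x \<notin> bl (z j) (l j) \<longrightarrow> v j x = 0) \<and>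
        (\<forall>x\<in>bl (z j) (l j). v j x \<le> \<bar>f x - proj (z j) (l j) f x\<bar>)"
    let ?camp = "campanato A D N 1 d th f" and ?F = "F_norm (step J (\<lambda>j. w j powr th) (\<lambda>j. bl (z j) (l j)))"
    define X where "X j = ?b powr real_of_int (l j) * ((LINT x|lebesgue. v j x powr q) / ?b powr real_of_int (l j)) powr (1 / q)" for j
    have X0: "0 \<le> X j" for j by (simp add: X_def)
    have w0: "0 \<le> w j" if "j \<in> J" for j using vv that by blast
    have W0: "0 \<le> (\<Sum>j\<in>J. w j)" by (intro sum_nonneg w0)
    have "(\<Sum>j\<in>J. ennreal (w j * X j)) \<le> ennreal C * (?camp * ?F)"
    proof (rule ennreal_le_epsilon)
      fix e :: real assume e: "0 < e"
      \<comment> \<open>The errors of the individual balls, weighted by w_j, must add up to at most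
        e.\<close>
      define \<epsilon> where "\<epsilon> = e / ((\<Sum>j\<in>J. w j) + 1)"
      have \<epsilon>: "0 < \<epsilon>" unfolding \<epsilon>_def using e W0 by (intro divide_pos_pos) auto
      define P where "P j I cen sc E \<gamma> \<longleftrightarrow> sparse_weights p0 K (z j) (l j) I cen sc E \<gamma> \<and>
         X j \<le> Csd * (\<Sum>t\<in>I. osc f (cen t) (sc t) * \<gamma> t * ?b powr real_of_int (sc t)) + \<epsilon>"
        for j and I :: "(nat \<times> (real^'n)) set" and cen sc E \<gamma>
      have ex: "\<forall>j\<in>J. \<exists>I cen sc E \<gamma>. P j I cen sc E \<gamma>"
      proof
        fix j assume j: "j \<in> J"
        show "\<exists>I cen sc E \<gamma>. P j I cen sc E \<gamma>"
          unfolding P_def X_def K_def using sparse_pairing[OF f q(1) p0 q(2) \<epsilon>, of "v j" c "z j" "l j"] vv j by simp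
      qed
      obtain I cen sc E \<gamma> where P: "\<forall>j\<in>J. P j (I j) (cen j) (sc j) (E j) (\<gamma> j)"
        using ex by metis
      have sw: "sparse_weights p0 K (z j) (l j) (I j) (cen j) (sc j) (E j) (\<gamma> j)" if "j \<in> J" for j
        using P that unfolding P_def by simp
      have Xle: "X j \<le> Csd * (\<Sum>t\<in>I j. osc f (cen j t) (sc j t) * \<gamma> j t * ?b powr real_of_int (sc j t)) + \<epsilon>" if "j \<in> J" for j
        using P that unfolding P_def by simp
      have finI: "finite (I j)" if "j \<in> J" for j using sw[OF that] unfolding sparse_weights_def by (elim conjE)
      have It: "0 \<le> \<gamma> j t \<and> E j t \<in> sets lebesgue \<and> E j t \<subseteq> bl (cen j t) (sc j t) \<and> E j t \<subseteq> bl (z j) (l j + int ga) \<and>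
        ?b powr real_of_int (sc j t) \<le> 2 * ?b ^ ga * measure lebesgue (E j t)" if "j \<in> J" "t \<in> I j" for j t
        using sw[OF that(1), unfolded sparse_weights_def, THEN conjunct2, THEN conjunct1, rule_format, OF that(2)] .
      have disj: "E j t \<inter> E j u = {}" if "j \<in> J" "t \<in> I j" "u \<in> I j" "t \<noteq> u" for j t u
        using sw[OF that(1), unfolded sparse_weights_def, THEN conjunct2, THEN conjunct2, THEN conjunct1, rule_format, OF that(2-4)] .
      have tot: "(\<Sum>t\<in>I j. ennreal (\<gamma> j t powr p0) * emeasure lebesgue (E j t)) \<le> ennreal (K * ?b powr real_of_int (l j))" if "j \<in> J" for j
        using sw[OF that(1), unfolded sparse_weights_def, THEN conjunct2, THEN conjunct2, THEN conjunct2] .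
      let ?S = "Sigma J I"
      have finS: "finite ?S" using fin finI by (rule finite_SigmaI)
      define W where "W p = w (fst p) * \<gamma> (fst p) (snd p)" for p
      define xx where "xx p = cen (fst p) (snd p)" for p
      define kk where "kk p = sc (fst p) (snd p)" for p
      define EE where "EE p = E (fst p) (snd p)" for p
      have W0': "0 \<le> W p" if "p \<in> ?S" for p
      proof -
        have "fst p \<in> J" "snd p \<in> I (fst p)" using that by auto
        then show ?thesis unfolding W_def using It w0 by (intro mult_nonneg_nonneg) blast+
      qed
      \<comment> \<open>The weights enter the block norm in the power th, so this is the
        contribution of ball j after its weight is factored out.\<close>
      define \<psi> where "\<psi> j x = (\<Sum>t\<in>I j. \<gamma> j t powr th * indicator (E j t) x)" for j x
      have real_bound: "(\<Sum>j\<in>J. w j * X j) \<le> Csd * (\<Sum>p\<in>?S. W p * ?b powr real_of_int (kk p) * osc f (xx p) (kk p)) + e"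
      proof -
        have "(\<Sum>j\<in>J. w j * X j) \<le> (\<Sum>j\<in>J. w j * (Csd * (\<Sum>t\<in>I j. osc f (cen j t) (sc j t) * \<gamma> j t * ?b powr real_of_int (sc j t)) + \<epsilon>))"
          by (intro sum_mono mult_left_mono Xle w0)
        also have "\<dots> = Csd * (\<Sum>j\<in>J. \<Sum>t\<in>I j. w j * \<gamma> j t * ?b powr real_of_int (sc j t) * osc f (cen j t) (sc j t)) + (\<Sum>j\<in>J. w j) * \<epsilon>"
          by (simp add: distrib_left sum.distrib sum_distrib_left sum_distrib_right mult_ac)
        also have "(\<Sum>j\<in>J. \<Sum>t\<in>I j. w j * \<gamma> j t * ?b powr real_of_int (sc j t) * osc f (cen j t) (sc j t))
           = (\<Sum>p\<in>?S. W p * ?b powr real_of_int (kk p) * osc f (xx p) (kk p))"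
          using fin finI by (subst sum.Sigma) (auto simp: W_def kk_def xx_def intro!: sum.cong)
        also have "(\<Sum>j\<in>J. w j) * \<epsilon> \<le> e"
          unfolding \<epsilon>_def using e W0 by (simp add: field_simps)
        finally show ?thesis by simp
      qed
      have "(\<Sum>j\<in>J. ennreal (w j * X j)) = ennreal (\<Sum>j\<in>J. w j * X j)"
        using w0 X0 by (intro sum_ennreal) simp
      also have "\<dots> \<le> ennreal (Csd * (\<Sum>p\<in>?S. W p * ?b powr real_of_int (kk p) * osc f (xx p) (kk p)) + e)"
        by (intro ennreal_leI real_bound)
      also have "\<dots> = ennreal Csd * ennreal (\<Sum>p\<in>?S. W p * ?b powr real_of_int (kk p) * osc f (xx p) (kk p)) + ennreal e"
      proof -
        have "0 \<le> (\<Sum>p\<in>?S. W p * ?b powr real_of_int (kk p) * osc f (xx p) (kk p))"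
          by (intro sum_nonneg mult_nonneg_nonneg W0' osc_nonneg) auto
        then show ?thesis using Csd_nonneg e by (simp add: ennreal_mult)
      qed
      also have "ennreal (\<Sum>p\<in>?S. W p * ?b powr real_of_int (kk p) * osc f (xx p) (kk p))
          = (\<Sum>p\<in>?S. ennreal (W p * ?b powr real_of_int (kk p) * osc f (xx p) (kk p)))"
        by (intro sum_ennreal[symmetric] mult_nonneg_nonneg W0' osc_nonneg) auto
      also have "\<dots> \<le> ?camp * F_norm (step ?S (\<lambda>p. W p powr th) (\<lambda>p. bl (xx p) (kk p)))"
        by (rule campanato_sum[OF f finS W0'])
      \<comment> \<open>A factor \<kappa>^2 is split off to match the form of
        \<open>FS_step\<close>; it is a constant and is repaid in R.\<close>
      also have "(\<lambda>p. W p powr th) = (\<lambda>p. W p powr th / \<kappa>\<^sup>2 * \<kappa>\<^sup>2)" using \<kappa> by simp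
      also have "F_norm (step ?S \<dots> (\<lambda>p. bl (xx p) (kk p))) \<le> ennreal CF * F_norm (step ?S (\<lambda>p. W p powr th / \<kappa>\<^sup>2) EE)"
      proof (rule CFall[THEN spec, THEN spec, THEN spec, THEN spec, THEN spec, THEN mp, THEN mp, OF finS, of _ "\<lambda>_. \<kappa>"], intro ballI conjI)
        fix p assume p: "p \<in> ?S"
        then have j: "fst p \<in> J" "snd p \<in> I (fst p)" by auto
        note I = It[OF j]
        show "0 \<le> W p powr th / \<kappa>\<^sup>2" "0 \<le> \<kappa>" using \<kappa> by auto
        show "EE p \<in> sets lebesgue" "bl (xx p) (kk p) \<in> sets lebesgue" using I by (auto simp: EE_def)
        fix y assume y: "y \<in> bl (xx p) (kk p)"
        show "ennreal \<kappa> \<le> maxf A D (indicator (EE p)) y"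
        proof (rule maxf_indicator_ge[OF y])
          show "\<kappa> * ?b powr real_of_int (kk p) \<le> measure lebesgue (EE p)"
            unfolding \<kappa>_def kk_def EE_def using I b_gt1 by (simp add: field_simps)
        qed (use I \<kappa> in \<open>auto simp: EE_def xx_def kk_def\<close>)
      qed
      also have "F_norm (step ?S (\<lambda>p. W p powr th / \<kappa>\<^sup>2) EE) = F_norm (\<lambda>x. \<Sum>j\<in>J. (w j powr th / \<kappa>\<^sup>2) * \<psi> j x)"
      proof (rule arg_cong[of _ _ F_norm], rule ext)
        fix x
        have "(\<Sum>j\<in>J. (w j powr th / \<kappa>\<^sup>2) * \<psi> j x) = (\<Sum>j\<in>J. \<Sum>t\<in>I j. W (j, t) powr th / \<kappa>\<^sup>2 * indicator (EE (j, t)) x)"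
          unfolding \<psi>_def sum_distrib_left using w0 It by (intro sum.cong refl) (simp add: W_def EE_def powr_mult)
        also have "\<dots> = step ?S (\<lambda>p. W p powr th / \<kappa>\<^sup>2) EE x"
          unfolding step_def using fin finI by (subst sum.Sigma) (auto intro!: sum.cong)
        finally show "step ?S (\<lambda>p. W p powr th / \<kappa>\<^sup>2) EE x = (\<Sum>j\<in>J. (w j powr th / \<kappa>\<^sup>2) * \<psi> j x)" ..
      qed
      also have "\<dots> \<le> ennreal CD * F_norm (step J (\<lambda>j. w j powr th / \<kappa>\<^sup>2) (\<lambda>j. bl (z j) (l j)))"
      proof (rule CDall[THEN spec, THEN spec, THEN spec, THEN spec, THEN spec, THEN mp, THEN mp, OF fin], intro ballI conjI allI impI)
        fix j assume j: "j \<in> J"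
        show "0 \<le> w j powr th / \<kappa>\<^sup>2" by simp
        show "\<psi> j \<in> borel_measurable lebesgue"
          unfolding \<psi>_def[abs_def] using It[OF j] by (intro borel_measurable_sum borel_measurable_times borel_measurable_indicator) auto
        show "0 \<le> \<psi> j x" for x unfolding \<psi>_def by (intro sum_nonneg) auto
        show "\<psi> j x = 0" if "x \<notin> bl (z j) (l j + int ga)" for x
          unfolding \<psi>_def
        proof (rule sum.neutral, rule ballI)
          fix t assume "t \<in> I j"
          then have "x \<notin> E j t" using It[OF j] that by blast
          then show "\<gamma> j t powr th * indicator (E j t) x = 0" by simp
        qed
        \<comment> \<open>At most one E contains x, so powers pass through the sum and the exponents
          th and p0/th combine to p0, the power controlled by \<open>sparse_weights\<close>.\<close>
        have pt: "ennreal (\<psi> j x powr (p0 / th)) = (\<Sum>t\<in>I j. ennreal (\<gamma> j t powr p0) * indicator (E j t) x)" for x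
        proof (cases "\<exists>t\<in>I j. x \<in> E j t")
          case True
          then obtain t where t: "t \<in> I j" "x \<in> E j t" by blast
          have no: "x \<notin> E j u" if "u \<in> I j - {t}" for u using disj[OF j t(1), of u] t(2) that by blast
          have "\<psi> j x = (\<Sum>u\<in>{t}. \<gamma> j u powr th * indicator (E j u) x)"
            unfolding \<psi>_def using t no finI[OF j] by (intro sum.mono_neutral_right) auto
          then have 1: "\<psi> j x = \<gamma> j t powr th" using t by simp
          have "(\<Sum>u\<in>I j. ennreal (\<gamma> j u powr p0) * indicator (E j u) x) = (\<Sum>u\<in>{t}. ennreal (\<gamma> j u powr p0) * indicator (E j u) x)"
            using t no finI[OF j] by (intro sum.mono_neutral_right) auto
          then show ?thesis unfolding 1 using t th by (simp add: powr_powr)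
        next
          case False
          then have "\<psi> j x = 0" unfolding \<psi>_def by (intro sum.neutral) auto
          moreover have "(\<Sum>t\<in>I j. ennreal (\<gamma> j t powr p0) * indicator (E j t) x) = 0" using False by (intro sum.neutral) auto
          ultimately show ?thesis by simp
        qed
        have "(\<integral>\<^sup>+x. ennreal (\<psi> j x powr (p0 / th)) \<partial>lebesgue) = (\<Sum>t\<in>I j. ennreal (\<gamma> j t powr p0) * emeasure lebesgue (E j t))"
        proof -
          have E: "E j t \<in> sets lebesgue" if "t \<in> I j" for t using It[OF j that] by (elim conjE)
          have "(\<integral>\<^sup>+x. ennreal (\<psi> j x powr (p0 / th)) \<partial>lebesgue) = (\<Sum>t\<in>I j. \<integral>\<^sup>+x. ennreal (\<gamma> j t powr p0) * indicator (E j t) x \<partial>lebesgue)"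
            unfolding pt
            by (rule nn_integral_sum, rule borel_measurable_times_ennreal, rule borel_measurable_const, rule borel_measurable_indicator, erule E)
          also have "\<dots> = (\<Sum>t\<in>I j. ennreal (\<gamma> j t powr p0) * emeasure lebesgue (E j t))"
            by (rule sum.cong[OF refl], rule nn_integral_cmult_indicator, erule E)
          finally show ?thesis .
        qed
        then show "(\<integral>\<^sup>+x. ennreal (\<psi> j x powr (p0 / th)) \<partial>lebesgue) \<le> ennreal (K * ?b powr real_of_int (l j))"
          using tot[OF j] by simp
      qed
      also have "F_norm (step J (\<lambda>j. w j powr th / \<kappa>\<^sup>2) (\<lambda>j. bl (z j) (l j))) = F_norm (\<lambda>x. (1 / \<kappa>\<^sup>2) * step J (\<lambda>j. w j powr th) (\<lambda>j. bl (z j) (l j)) x)"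
        unfolding step_def[abs_def] by (simp add: sum_divide_distrib)
      also have "\<dots> = ennreal R * ?F"
        unfolding R_def by (intro F_norm_cmult step_measurable step_nonneg) auto
      finally have "(\<Sum>j\<in>J. ennreal (w j * X j)) \<le> ennreal Csd * (?camp * (ennreal CF * (ennreal CD * (ennreal R * ?F)))) + ennreal e"
        by (simp add: mult_left_mono add_right_mono)
      also have "ennreal Csd * (?camp * (ennreal CF * (ennreal CD * (ennreal R * ?F)))) = ennreal C * (?camp * ?F)"
        unfolding C_def using Csd_nonneg CF CD by (simp add: ennreal_mult R_def mult_ac)
      finally show "(\<Sum>j\<in>J. ennreal (w j * X j)) \<le> ennreal C * (?camp * ?F) + ennreal e" .
    qed
    then show "(\<Sum>j\<in>J. ennreal (w j * (?b powr real_of_int (l j) * ((LINT x|lebesgue. v j x powr q) / ?b powr real_of_int (l j)) powr (1 / q))))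
       \<le> ennreal C * (?camp * ?F)" unfolding X_def .
  qed
qed

end


context bqbf begin

text \<open>Monotone convergence in the truncation height, so that bounds for truncations uniform in
  the height pass to a function whose q-th power may fail to be integrable.\<close>

lemma average_powr_le_truncated:
  assumes u: "u \<in> borel_measurable lebesgue" "\<And>x. 0 \<le> u x" and q: "0 < q"
  shows "epow ((\<integral>\<^sup>+x. ennreal (u x powr q) * indicator (bl z l) x \<partial>lebesgue) / emeasure lebesgue (bl z l)) (1 / q)
    \<le> (SUP n. ennreal (((LINT x|lebesgue. (min (u x) (real n) * indicator (bl z l) x) powr q) / bdet A powr real_of_int l) powr (1 / q)))"
    (is "_ \<le> ?c")
proof -
  let ?v = "\<lambda>n x. (min (u x) (real n) * indicator (bl z l) x) powr q"
  let ?V = "bdet A powr real_of_int l"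
  have V: "0 < ?V" using b_gt1 by simp
  have int: "integrable lebesgue (?v n)" for n
    using u q by (intro integrable_bounded_support[of _ "real n powr q" z l] powr_real_measurable borel_measurable_times borel_measurable_min)
      (auto simp: indicator_def intro!: powr_mono2)
  have nn: "(\<integral>\<^sup>+x. ennreal (?v n x) \<partial>lebesgue) = ennreal (LINT x|lebesgue. ?v n x)" for n
    by (intro nn_integral_eq_integral int) auto
  have each: "(\<integral>\<^sup>+x. ennreal (?v n x) \<partial>lebesgue) / ennreal ?V \<le> epow ?c q" for n
  proof -
    let ?a = "(LINT x|lebesgue. ?v n x) / ?V"
    have a: "0 \<le> ?a" using V by (intro divide_nonneg_pos integral_nonneg_AE) auto
    have "(\<integral>\<^sup>+x. ennreal (?v n x) \<partial>lebesgue) / ennreal ?V = ennreal ?a"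
      unfolding nn using V by (intro divide_ennreal integral_nonneg_AE) auto
    also have "\<dots> = epow (ennreal (?a powr (1 / q))) q" using a q by (simp add: epow_ennreal powr_powr)
    also have "\<dots> \<le> epow ?c q" using q by (intro epow_mono SUP_upper) auto
    finally show ?thesis .
  qed
  have "(\<integral>\<^sup>+x. ennreal (u x powr q) * indicator (bl z l) x \<partial>lebesgue) \<le> (\<integral>\<^sup>+x. (SUP n. ennreal (?v n x)) \<partial>lebesgue)"
  proof (rule nn_integral_mono)
    fix x
    have "ennreal (u x powr q) * indicator (bl z l) x \<le> ennreal (?v (nat \<lceil>u x\<rceil>) x)"
    proof -
      have "u x \<le> real (nat \<lceil>u x\<rceil>)" by linarith
      then show ?thesis by (auto simp: indicator_def min_def)
    qed
    also have "\<dots> \<le> (SUP n. ennreal (?v n x))" by (rule SUP_upper) simp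
    finally show "ennreal (u x powr q) * indicator (bl z l) x \<le> (SUP n. ennreal (?v n x))" .
  qed
  also have "\<dots> = (SUP n. \<integral>\<^sup>+x. ennreal (?v n x) \<partial>lebesgue)"
  proof (rule nn_integral_monotone_convergence_SUP)
    show "incseq (\<lambda>n x. ennreal (?v n x))"
      using u q by (intro incseq_SucI le_funI ennreal_leI powr_mono2) (auto simp: indicator_def)
    show "(\<lambda>x. ennreal (?v n x)) \<in> borel_measurable lebesgue" for n using int[of n] by auto
  qed
  finally have "(\<integral>\<^sup>+x. ennreal (u x powr q) * indicator (bl z l) x \<partial>lebesgue) / ennreal ?V
     \<le> (SUP n. \<integral>\<^sup>+x. ennreal (?v n x) \<partial>lebesgue) / ennreal ?V" by (rule divide_right_mono_ennreal)
  also have "\<dots> = (SUP n. (\<integral>\<^sup>+x. ennreal (?v n x) \<partial>lebesgue) / ennreal ?V)"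
    unfolding divide_ennreal_def by (rule SUP_mult_right_ennreal)
  also have "\<dots> \<le> epow ?c q" by (intro SUP_least each)
  finally have "epow ((\<integral>\<^sup>+x. ennreal (u x powr q) * indicator (bl z l) x \<partial>lebesgue) / ennreal ?V) (1 / q) \<le> epow (epow ?c q) (1 / q)"
    using q by (intro epow_mono) auto
  then show ?thesis unfolding emeasure_bl epow_epow using q by simp
qed

lemma campanato_leI:
  assumes "\<And>m xs ls lam. (\<forall>j<m. 0 \<le> lam j) \<Longrightarrow> (\<Sum>j<m. lam j) \<noteq> 0 \<Longrightarrow>
     inverse (block_norm N th m (\<lambda>j. bl (xs j) (ls j)) lam) *
     (\<Sum>j<m. ennreal (lam j * bdet A powr real_of_int (ls j) / ind_norm N (bl (xs j) (ls j))) *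
        epow ((\<integral>\<^sup>+ x. ennreal (\<bar>f x - proj (xs j) (ls j) f x\<bar> powr t) * indicator (bl (xs j) (ls j)) x \<partial>lebesgue)
                / emeasure lebesgue (bl (xs j) (ls j))) (1 / t)) \<le> c"
  shows "campanato A D N t d th f \<le> c"
  unfolding campanato_def
proof (intro SUP_least, clarify)
  fix m :: nat and Bs :: "nat \<Rightarrow> (real^'n) set" and lam :: "nat \<Rightarrow> real"
  assume Bs: "\<forall>j<m. Bs j \<in> dballs A D" and lam: "\<forall>j<m. 0 \<le> lam j" "(\<Sum>j<m. lam j) \<noteq> 0"
  have "\<forall>j. \<exists>p. j < m \<longrightarrow> Bs j = bl (fst p) (snd p)" using Bs unfolding dballs_eq by auto
  then obtain p where p: "\<And>j. j < m \<Longrightarrow> Bs j = bl (fst (p j)) (snd (p j))" by metis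
  let ?B = "\<lambda>j. bl (fst (p j)) (snd (p j))"
  have bn: "block_norm N th m Bs lam = block_norm N th m ?B lam"
    unfolding block_norm_def by (intro arg_cong[of _ _ N] ext arg_cong[of _ _ ennreal] arg_cong2[of _ _ _ _ "(powr)"] sum.cong) (auto simp: p)
  have "(\<Sum>j<m. ennreal (lam j * measure lebesgue (Bs j) / ind_norm N (Bs j)) *
           epow ((\<integral>\<^sup>+ x. ennreal (\<bar>f x - poly_proj d (Bs j) f x\<bar> powr t) * indicator (Bs j) x \<partial>lebesgue) / emeasure lebesgue (Bs j)) (1 / t))
      = (\<Sum>j<m. ennreal (lam j * bdet A powr real_of_int (snd (p j)) / ind_norm N (?B j)) *
           epow ((\<integral>\<^sup>+ x. ennreal (\<bar>f x - poly_proj d (?B j) f x\<bar> powr t) * indicator (?B j) x \<partial>lebesgue) / emeasure lebesgue (?B j)) (1 / t))"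
    by (intro sum.cong refl) (simp add: p measure_bl)
  then show "inverse (block_norm N th m Bs lam) * (\<Sum>j<m. ennreal (lam j * measure lebesgue (Bs j) / ind_norm N (Bs j)) *
           epow ((\<integral>\<^sup>+ x. ennreal (\<bar>f x - poly_proj d (Bs j) f x\<bar> powr t) * indicator (Bs j) x \<partial>lebesgue) / emeasure lebesgue (Bs j)) (1 / t)) \<le> c"
    unfolding bn using assms[OF lam, of "\<lambda>j. fst (p j)" "\<lambda>j. snd (p j)"] by simp
qed

lemma campanato_upper:
  assumes "\<forall>j<m. 0 \<le> lam j" "(\<Sum>j<m. lam j) \<noteq> 0"
  shows "inverse (block_norm N th m (\<lambda>j. bl (xs j) (ls j)) lam) *
     (\<Sum>j<m. ennreal (lam j * bdet A powr real_of_int (ls j) / ind_norm N (bl (xs j) (ls j))) *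
        epow ((\<integral>\<^sup>+ x. ennreal (\<bar>f x - proj (xs j) (ls j) f x\<bar> powr t) * indicator (bl (xs j) (ls j)) x \<partial>lebesgue)
                / emeasure lebesgue (bl (xs j) (ls j))) (1 / t)) \<le> campanato A D N t d th f"
  unfolding campanato_def measure_bl[symmetric]
  by (rule SUP_upper2[of "(m, \<lambda>j. bl (xs j) (ls j), lam)"]) (use assms in \<open>auto simp: measure_bl\<close>)

lemma proj_measurable: "locint f \<Longrightarrow> proj z l f \<in> borel_measurable lebesgue"
  by (intro measurable_completion) (simp add: borel_measurable_continuous_onI poly_le_continuous[OF proj_poly] locint_def)

text \<open>\<open>holder_avg\<close> with \<psi> the indicator of the ball; the constant 2 is the
  price of Young's inequality without weights.\<close>

lemma average_le_powr_average:
  assumes u: "u \<in> borel_measurable lebesgue" "\<And>x. 0 \<le> u x" and q: "1 \<le> q"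
  shows "(\<integral>\<^sup>+x. ennreal (u x) * indicator (bl z l) x \<partial>lebesgue) / emeasure lebesgue (bl z l)
    \<le> 2 * epow ((\<integral>\<^sup>+x. ennreal (u x powr q) * indicator (bl z l) x \<partial>lebesgue) / emeasure lebesgue (bl z l)) (1 / q)"
proof (cases "q = 1")
  case True
  have "x \<le> 2 * x" for x :: ennreal using mult_right_mono[of 1 2 x] by simp
  then show ?thesis using True u(2) by simp
next
  case False
  then have q1: "1 < q" using q by simp
  let ?B = "bl z l" and ?V = "bdet A powr real_of_int l"
  define s where "s = q / (q - 1)"
  have s: "1 < s" "s / (s - 1) = q" using q1 by (auto simp: s_def field_simps)
  have V: "0 < ?V" using b_gt1 by simp
  let ?k = "epow ((\<integral>\<^sup>+ y. epow (ennreal (u y)) (s / (s - 1)) * indicator ?B y \<partial>lebesgue) / emeasure lebesgue ?B) (1 / (s / (s - 1)))"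
  have "(\<integral>\<^sup>+x. ennreal (indicator ?B x) * ennreal (u x) \<partial>lebesgue) \<le> ennreal (?V + ?V) * ?k"
  proof (rule holder_avg[OF s(1), where \<psi> = "indicator ?B" and z = z])
    have "(\<integral>\<^sup>+x. ennreal (indicator ?B x powr s) \<partial>lebesgue) = (\<integral>\<^sup>+x. indicator ?B x \<partial>lebesgue)"
      by (intro nn_integral_cong) (auto simp: indicator_def)
    then show "(\<integral>\<^sup>+x. ennreal (indicator ?B x powr s) \<partial>lebesgue) \<le> ennreal ?V" by (simp add: emeasure_bl)
  qed (use u V in auto)
  moreover have "(\<integral>\<^sup>+x. ennreal (indicator ?B x) * ennreal (u x) \<partial>lebesgue) = (\<integral>\<^sup>+x. ennreal (u x) * indicator ?B x \<partial>lebesgue)"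
    by (intro nn_integral_cong) (auto simp: indicator_def)
  moreover have "?k = epow ((\<integral>\<^sup>+x. ennreal (u x powr q) * indicator ?B x \<partial>lebesgue) / emeasure lebesgue ?B) (1 / q)" (is "_ = ?r")
    unfolding s(2) using u(2) by (simp add: epow_ennreal)
  ultimately have "(\<integral>\<^sup>+x. ennreal (u x) * indicator ?B x \<partial>lebesgue) / ennreal ?V \<le> (ennreal (?V + ?V) * ?r) / ennreal ?V"
    by (intro divide_right_mono_ennreal) simp
  also have "\<dots> = 2 * ?r"
  proof -
    have "ennreal (?V + ?V) / ennreal ?V = 2" using V by (subst divide_ennreal) auto
    then show ?thesis by (simp only: ennreal_divide_times ennreal_times_divide[symmetric] mult.commute[of _ ?r])
  qed
  finally show ?thesis by (simp only: emeasure_bl)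
qed

lemma campanato_one_le:
  assumes f: "locint f" and fm: "f \<in> borel_measurable lebesgue" and q: "1 \<le> q"
  shows "campanato A D N 1 d th f \<le> 2 * campanato A D N q d th f"
proof (rule campanato_leI)
  fix m :: nat and xs :: "nat \<Rightarrow> real^'n" and ls :: "nat \<Rightarrow> int" and lam :: "nat \<Rightarrow> real"
  assume lam: "\<forall>j<m. 0 \<le> lam j" "(\<Sum>j<m. lam j) \<noteq> 0"
  let ?c = "\<lambda>j. ennreal (lam j * bdet A powr real_of_int (ls j) / ind_norm N (bl (xs j) (ls j)))"
  let ?a = "\<lambda>t j. epow ((\<integral>\<^sup>+ x. ennreal (\<bar>f x - proj (xs j) (ls j) f x\<bar> powr t) * indicator (bl (xs j) (ls j)) x \<partial>lebesgue)
                / emeasure lebesgue (bl (xs j) (ls j))) (1 / t)"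
  let ?i = "inverse (block_norm N th m (\<lambda>j. bl (xs j) (ls j)) lam)"
  have "?a 1 j \<le> 2 * ?a q j" for j
    using average_le_powr_average[of "\<lambda>x. \<bar>f x - proj (xs j) (ls j) f x\<bar>" q "xs j" "ls j"] fm proj_measurable[OF f] q by simp
  then have "?i * (\<Sum>j<m. ?c j * ?a 1 j) \<le> ?i * (\<Sum>j<m. ?c j * (2 * ?a q j))"
    by (intro mult_left_mono sum_mono) auto
  also have "\<dots> = 2 * (?i * (\<Sum>j<m. ?c j * ?a q j))" by (simp only: sum_distrib_left mult_ac)
  also have "\<dots> \<le> 2 * campanato A D N q d th f" by (intro mult_left_mono campanato_upper lam) auto
  finally show "?i * (\<Sum>j<m. ?c j * ?a 1 j) \<le> 2 * campanato A D N q d th f" .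
qed

text \<open>The John-Nirenberg phenomenon for this scale: \<open>truncated_family_bound\<close> at
  height n, then n tends to infinity in the whole finite sum.\<close>

lemma campanato_le_one:
  assumes q: "1 \<le> q" "p0 \<le> 1 \<or> q < p0 / (p0 - 1)"
  shows "\<exists>C\<ge>0. \<forall>f. locint f \<longrightarrow> f \<in> borel_measurable lebesgue \<longrightarrow> campanato A D N q d th f \<le> ennreal C * campanato A D N 1 d th f"
proof (cases "q = 1")
  case True then show ?thesis by (intro exI[of _ 1]) simp
next
  case False
  then have q1: "1 < q" using q by simp
  \<comment> \<open>The condition q < p0' is turned into p0 < q', the form required by the Carleson
    embedding.\<close>
  have p0q: "p0 < q / (q - 1)"
  proof (cases "p0 \<le> 1")
    case True
    also have "1 < q / (q - 1)" using q1 by simp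
    finally show ?thesis .
  next
    case False
    then show ?thesis using q q1 by (simp add: field_simps)
  qed
  obtain C where C0: "0 \<le> C" and C: "\<forall>(f :: real^'n \<Rightarrow> real) (J :: nat set) (w :: nat \<Rightarrow> real) (z :: nat \<Rightarrow> real^'n) (l :: nat \<Rightarrow> int) (v :: nat \<Rightarrow> real^'n \<Rightarrow> real) (c :: real).
     locint f \<longrightarrow> finite J \<longrightarrow> (\<forall>j\<in>J. 0 \<le> w j \<and> v j \<in> borel_measurable lebesgue \<and> (\<forall>x. 0 \<le> v j x \<and> v j x \<le> c) \<and> (\<forall>x. x \<notin> bl (z j) (l j) \<longrightarrow> v j x = 0) \<and>
        (\<forall>x\<in>bl (z j) (l j). v j x \<le> \<bar>f x - proj (z j) (l j) f x\<bar>)) \<longrightarrow>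
     (\<Sum>j\<in>J. ennreal (w j * (bdet A powr real_of_int (l j) * ((LINT x|lebesgue. v j x powr q) / bdet A powr real_of_int (l j)) powr (1 / q))))
       \<le> ennreal C * (campanato A D N 1 d th f * F_norm (step J (\<lambda>j. w j powr th) (\<lambda>j. bl (z j) (l j))))"
    using truncated_family_bound[OF q1 p0q] by (elim exE conjE)
  show ?thesis
  proof (intro exI[of _ C] conjI C0 allI impI, rule campanato_leI)
    fix f :: "real^'n \<Rightarrow> real" and m :: nat and xs :: "nat \<Rightarrow> real^'n" and ls :: "nat \<Rightarrow> int" and lam :: "nat \<Rightarrow> real"
    assume f: "locint f" and fm: "f \<in> borel_measurable lebesgue" and lam: "\<forall>j<m. 0 \<le> lam j" "(\<Sum>j<m. lam j) \<noteq> 0"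
    let ?b = "bdet A"
    let ?w = "\<lambda>j. lam j / ind_norm N (bl (xs j) (ls j))"
    let ?u = "\<lambda>j x. \<bar>f x - proj (xs j) (ls j) f x\<bar>"
    let ?v = "\<lambda>n j x. min (?u j x) (real n) * indicator (bl (xs j) (ls j)) x"
    let ?a = "\<lambda>n j. ((LINT x|lebesgue. ?v n j x powr q) / ?b powr real_of_int (ls j)) powr (1 / q)"
    let ?q = "\<lambda>j. epow ((\<integral>\<^sup>+ x. ennreal (?u j x powr q) * indicator (bl (xs j) (ls j)) x \<partial>lebesgue)
                / emeasure lebesgue (bl (xs j) (ls j))) (1 / q)"
    let ?c = "\<lambda>j. ennreal (lam j * ?b powr real_of_int (ls j) / ind_norm N (bl (xs j) (ls j)))"
    let ?F = "F_norm (step {..<m} (\<lambda>j. ?w j powr th) (\<lambda>j. bl (xs j) (ls j)))"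
    have um: "?u j \<in> borel_measurable lebesgue" for j using fm proj_measurable[OF f] by auto
    have vm: "?v n j \<in> borel_measurable lebesgue" for n j
      using um by (intro borel_measurable_times borel_measurable_min) auto
    have w: "0 \<le> ?w j" if "j < m" for j using lam(1) ind_norm_bl(1) that by (intro divide_nonneg_pos) auto
    have int: "integrable lebesgue (\<lambda>x. ?v n j x powr q)" for n j
      using vm q1 by (intro integrable_bounded_support[of _ "real n powr q" "xs j" "ls j"] powr_real_measurable)
        (auto simp: indicator_def intro!: powr_mono2)
    have part: "(\<Sum>j<m. ?c j * ennreal (?a n j)) \<le> ennreal C * (campanato A D N 1 d th f * ?F)" for n
    proof -
      have "(\<Sum>j<m. ?c j * ennreal (?a n j)) = (\<Sum>j<m. ennreal (?w j * (?b powr real_of_int (ls j) * ?a n j)))"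
        using w ind_norm_bl(1) lam(1) by (intro sum.cong refl) (simp add: ennreal_mult[symmetric] divide_nonneg_pos mult_ac)
      also have "\<dots> \<le> ennreal C * (campanato A D N 1 d th f * ?F)"
        by (rule C[THEN spec, THEN spec, THEN spec, THEN spec, THEN spec, THEN spec, THEN spec[where x = "real n"], THEN mp, THEN mp, THEN mp, OF f finite_lessThan])
          (use w vm in \<open>auto simp: indicator_def\<close>)
      finally show ?thesis .
    qed
    have "(\<Sum>j<m. ?c j * ?q j) \<le> (\<Sum>j<m. ?c j * (SUP n. ennreal (?a n j)))"
      using um q1 by (intro sum_mono mult_left_mono average_powr_le_truncated) auto
    also have "\<dots> = (SUP n. \<Sum>j<m. ?c j * ennreal (?a n j))"
      unfolding SUP_mult_left_ennreal
    proof (rule ennreal_SUP_sum[symmetric])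
      fix j
      have "?a n j \<le> ?a (Suc n) j" for n
      proof -
        have "?v n j x powr q \<le> ?v (Suc n) j x powr q" for x
          using q1 by (intro powr_mono2) (auto simp: indicator_def)
        then have "(LINT x|lebesgue. ?v n j x powr q) \<le> (LINT x|lebesgue. ?v (Suc n) j x powr q)"
          by (intro integral_mono int)
        moreover have "0 \<le> (LINT x|lebesgue. ?v n j x powr q)" by (intro integral_nonneg_AE) auto
        ultimately show ?thesis using q1 by (intro powr_mono2 divide_right_mono divide_nonneg_nonneg) auto
      qed
      then show "incseq (\<lambda>n. ?c j * ennreal (?a n j))" by (intro incseq_SucI mult_left_mono ennreal_leI) auto
    qed
    also have "\<dots> \<le> ennreal C * (campanato A D N 1 d th f * ?F)" by (intro SUP_least part)
    also have "\<dots> = (ennreal C * campanato A D N 1 d th f) * block_norm N th m (\<lambda>j. bl (xs j) (ls j)) lam"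
      unfolding block_norm_step by (simp only: mult.assoc)
    finally show "inverse (block_norm N th m (\<lambda>j. bl (xs j) (ls j)) lam) * (\<Sum>j<m. ?c j * ?q j) \<le> ennreal C * campanato A D N 1 d th f"
      by (rule ennreal_inverse_mult_le[OF block_norm_bounds[OF lam]])
  qed
qed

end


section \<open>Translation of the parameters and the equivalence\<close>

lemma (in aniso_poly) Lloc_locint:
  assumes "Lloc q f" "1 \<le> q" shows "locint f"
  unfolding locint_def
proof (intro allI)
  fix x k
  let ?K = "closure (bl x k)"
  have fm: "f \<in> borel_measurable lebesgue" using assms(1) by (simp add: Lloc_def)
  have K: "compact ?K" using bl_bounded by (simp add: compact_closure)
  have [measurable]: "?K \<in> sets lebesgue" by (rule fmeasurableD[OF lmeasurable_compact[OF K]])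
  have [measurable]: "(\<lambda>y. ennreal (\<bar>f y\<bar> powr q) * indicator ?K y) \<in> borel_measurable lebesgue" using fm by measurable
  from K have fin: "(\<integral>\<^sup>+ y. ennreal (\<bar>f y\<bar> powr q) * indicator ?K y \<partial>lebesgue) < \<infinity>" using assms(1) by (simp add: Lloc_def)
  have "(\<integral>\<^sup>+ y. ennreal (norm (indicator (bl x k) y *\<^sub>R f y)) \<partial>lebesgue)
      \<le> (\<integral>\<^sup>+ y. indicator (bl x k) y + ennreal (\<bar>f y\<bar> powr q) * indicator ?K y \<partial>lebesgue)"
  proof (rule nn_integral_mono)
    fix y
    have "y \<in> ?K" if "y \<in> bl x k" using that closure_subset by blast
    then show "ennreal (norm (indicator (bl x k) y *\<^sub>R f y)) \<le> indicator (bl x k) y + ennreal (\<bar>f y\<bar> powr q) * indicator ?K y"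
      using ennreal_leI[OF le_one_plus_powr[of "\<bar>f y\<bar>" q]] assms(2) by (auto simp: indicator_def)
  qed
  also have "\<dots> = emeasure lebesgue (bl x k) + (\<integral>\<^sup>+ y. ennreal (\<bar>f y\<bar> powr q) * indicator ?K y \<partial>lebesgue)"
    by (subst nn_integral_add) auto
  also have "\<dots> < \<infinity>" using fin by (simp add: emeasure_bl)
  finally show "set_integrable lebesgue (bl x k) f"
    unfolding set_integrable_def using fm by (intro integrableI_bounded borel_measurable_scaleR) auto
qed

theorem theorem4p1:
  fixes A :: "real^'n^'n" and D :: "(real^'n) set"
    and lm lp r :: real
    and N :: "(real^'n \<Rightarrow> ennreal) \<Rightarrow> ennreal"
    and pm th p0 q s eps :: real and d :: nat
  assumes dil: "dilation A"
    and lam_minus: "1 < lm" and lam_bounds: "\<And>z. eigenvalue_of A z \<Longrightarrow> lm < cmod z \<and> cmod z < lp"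
    and ell: "origin_ellipsoid D" and vol: "emeasure lebesgue D = 1"
    and r: "1 < r" "D \<subseteq> (\<lambda>x. r *\<^sub>R x) ` D" "(\<lambda>x. r *\<^sub>R x) ` D \<subseteq> (\<lambda>x. A *v x) ` D"
    and X: "ball_qBfs A D N" and ac: "abs_cont_qnorm N"
    and FS: "0 < pm" "assumption_FS A D N pm"
    and AA: "0 < th" "th < min pm 1" "th < p0" "assumption_A A D N th p0"
    and d: "real_of_int \<lfloor>(1 / th - 1) * ln (bdet A) / ln lm\<rfloor> \<le> real d"
    and q: "1 \<le> q" "p0 \<le> 1 \<or> q < p0 / (p0 - 1)"
    and s: "0 < s" "s < th"
    and eps: "ln (bdet A) / ln lm * (2 / s + real d * ln lp / ln (bdet A)) < eps"
  shows "\<exists>C1 C2 :: real. 0 < C1 \<and> 0 < C2 \<and>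
     (\<forall>f. Lloc q f \<longrightarrow>
        (campanato A D N q d th f < \<infinity> \<longleftrightarrow> campanato_eps A D N lm eps d th f < \<infinity>) \<and>
        campanato A D N q d th f \<le> ennreal C1 * campanato_eps A D N lm eps d th f \<and>
        campanato_eps A D N lm eps d th f \<le> ennreal C2 * campanato A D N q d th f)"
proof -
  obtain z where "eigenvalue_of A z" using eigenvalue_exists by blast
  then have lp1: "1 < lp" using lam_bounds[of z] lam_minus by linarith
  interpret bqbf A D r lp d N th p0 pm
  proof unfold_locales
    show "\<And>z. eigenvalue_of A z \<Longrightarrow> cmod z < lp" using lam_bounds by blast
  qed (use ell vol r lp1 X FS AA in auto)
  define \<beta> where "\<beta> = eps * ln lm / ln (bdet A)"
  have lb: "0 < ln (bdet A)" "0 < ln lm" using b_gt1 lam_minus by auto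
  \<comment> \<open>The lower bound on eps becomes a lower bound on \<beta>. Both summands are
    nonnegative and s < th, so \<beta> exceeds 2/th, which serves the geometric series in
    \<open>eps_family\<close>, and also exceeds d ln lp / ln b.\<close>
  have "2 / s + real d * ln lp / ln (bdet A) < \<beta>"
    using eps lb unfolding \<beta>_def by (simp add: field_simps)
  moreover have "2 / th < 2 / s" using s by (intro divide_strict_left_mono) auto
  moreover have dl: "0 \<le> real d * ln lp / ln (bdet A)" using lb lp1 by (intro divide_nonneg_pos mult_nonneg_nonneg) auto
  moreover have s2: "0 < 2 / s" using s by simp
  ultimately have \<beta>1: "2 / th < \<beta>" and \<beta>2: "real d * ln lp / ln (bdet A) < \<beta>" by linarith+
  have "real d * ln lp < \<beta> * ln (bdet A)" using \<beta>2 lb by (simp add: pos_divide_less_eq)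
  then have "exp (real d * ln lp) < exp (\<beta> * ln (bdet A))" by simp
  \<comment> \<open>The second bound exponentiated: the kernel decays faster than polynomials of
    degree d grow.\<close>
  then have \<beta>3: "lp ^ d < bdet A powr \<beta>" using lp1 b_gt1 by (simp add: powr_def exp_of_nat_mult)
  obtain Ce where Ce: "0 \<le> Ce" "\<forall>f. locint f \<longrightarrow> campanato_eps A D N lm eps d th f \<le> ennreal Ce * campanato A D N 1 d th f"
    using campanato_eps_le[OF \<beta>1[unfolded \<beta>_def] \<beta>3[unfolded \<beta>_def]] by (elim exE conjE)
  obtain Cq where Cq: "0 \<le> Cq"
    "\<forall>f. locint f \<longrightarrow> f \<in> borel_measurable lebesgue \<longrightarrow> campanato A D N q d th f \<le> ennreal Cq * campanato A D N 1 d th f"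
    using campanato_le_one[OF q] by (elim exE conjE)
  have "0 < 2 / th" using th(1) by simp
  then have \<beta>0: "0 \<le> eps * ln lm / ln (bdet A)" using \<beta>1 unfolding \<beta>_def by linarith
  \<comment> \<open>Each direction passes through exponent one; the added 1 only makes the constants
    positive.\<close>
  have main: "campanato A D N q d th f \<le> ennreal (2 * Cq + 1) * campanato_eps A D N lm eps d th f \<and>
        campanato_eps A D N lm eps d th f \<le> ennreal (2 * Ce + 1) * campanato A D N q d th f" if "Lloc q f" for f
  proof
    have f: "locint f" "f \<in> borel_measurable lebesgue" using Lloc_locint[OF that q(1)] that by (auto simp: Lloc_def)
    have "campanato A D N q d th f \<le> ennreal Cq * campanato A D N 1 d th f" by (rule Cq(2)[rule_format, OF f])
    also have "\<dots> \<le> ennreal Cq * (2 * campanato_eps A D N lm eps d th f)"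
      by (intro mult_left_mono campanato_le_eps f \<beta>0) simp
    also have "\<dots> = ennreal (2 * Cq) * campanato_eps A D N lm eps d th f" using Cq(1) by (simp add: ennreal_mult mult_ac)
    also have "\<dots> \<le> ennreal (2 * Cq + 1) * campanato_eps A D N lm eps d th f" by (intro mult_right_mono ennreal_leI) auto
    finally show "campanato A D N q d th f \<le> ennreal (2 * Cq + 1) * campanato_eps A D N lm eps d th f" .
    have "campanato_eps A D N lm eps d th f \<le> ennreal Ce * campanato A D N 1 d th f" by (rule Ce(2)[rule_format, OF f(1)])
    also have "\<dots> \<le> ennreal Ce * (2 * campanato A D N q d th f)"
      by (intro mult_left_mono campanato_one_le f q) simp
    also have "\<dots> = ennreal (2 * Ce) * campanato A D N q d th f" using Ce(1) by (simp add: ennreal_mult mult_ac)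
    also have "\<dots> \<le> ennreal (2 * Ce + 1) * campanato A D N q d th f" by (intro mult_right_mono ennreal_leI) auto
    finally show "campanato_eps A D N lm eps d th f \<le> ennreal (2 * Ce + 1) * campanato A D N q d th f" .
  qed
  show ?thesis
  proof (rule exI[of _ "2 * Cq + 1"], rule exI[of _ "2 * Ce + 1"], intro conjI allI impI)
    show "0 < 2 * Cq + 1" "0 < 2 * Ce + 1" using Cq(1) Ce(1) by auto
    fix f :: "real^'n \<Rightarrow> real" assume f: "Lloc q f"
    note m = main[OF f]
    show "campanato A D N q d th f \<le> ennreal (2 * Cq + 1) * campanato_eps A D N lm eps d th f" using m ..
    show "campanato_eps A D N lm eps d th f \<le> ennreal (2 * Ce + 1) * campanato A D N q d th f" using m ..
    have lt: "ennreal c * y < \<infinity>" if "y < \<infinity>" for c y using that by (simp add: ennreal_mult_less_top)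
    show "campanato A D N q d th f < \<infinity> \<longleftrightarrow> campanato_eps A D N lm eps d th f < \<infinity>"
      using m lt le_less_trans by blast
  qed
qed

end
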